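(* For $m\ge0$, let $$D=\left\{z\in\mathbb{C}:|\mathrm{Im}\,z|<\tfrac32,\ |\mathrm{Re}\,z|<\tfrac52m\right\}.$$ There exists a constant $0<C(m)\le1$ such that, if $V\in L^1(\mathbb{R},\mathbb{C}^{2\times2})$ satisfies $\|V\|_{L^1}<C(m)$, then $$\mathrm{Spec}_\varepsilon(\mathscr{L}_{m,V})\subseteq\overline{D}\cup\left\{z\in\mathbb{C}:|\mathrm{Im}\,z|\le1+\varepsilon\left(1+\frac{\|V\|_{L^1}}{4C(m)\big(C(m)-\|V\|_{L^1}\big)}\right)\right\}$$ for all $\varepsilon\ge0$. Moreover, for $m=0$ this statement is valid with $C(0)=1$.
   Context: $\mathscr{L}_m:H^1(\mathbb{R},\mathbb{C}^2)\to L^2(\mathbb{R},\mathbb{C}^2)$ is $(\mathscr{L}_m f)(x)=\begin{pmatrix} m & -\partial_x\\ \partial_x & -m\end{pmatrix}f(x)+i\,\mathrm{sgn}(x)f(x)$. $\|V\|_{L^1}=\int_{\mathbb{R}}|V(x)|_{\mathbb{C}^{2\times2}}\,dx$, with $|\cdot|_{\mathbb{C}^{2\times2}}$ the operator norm induced by the Euclidean norm. For $\|V\|_{L^1}<1$, $\mathscr{L}_{m,V}$ is the following closed densely defined extension of $\mathscr{L}_m+V$ (defined on $H^1(\mathbb{R},\mathbb{C}^2)\cap\mathrm{Dom}(V)$): write $V(x)=U(x)|V(x)|$ (polar decomposition), $A(x)=|V(x)|^{1/2}$, $B(x)=U(x)|V(x)|^{1/2}$ (maximal multiplication operators), $R_0(z)=(\mathscr{L}_m-z)^{-1}$,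 $Q(z)=\overline{AR_0(z)B}$ for $z\in\rho(\mathscr{L}_m)$; $\mathscr{L}_{m,V}$ is the closed operator whose resolvent is $R_0(z)-\overline{R_0(z)B}\,(I+Q(z))^{-1}AR_0(z)$ for every $z\in\rho(\mathscr{L}_m)$ with $-1\in\rho(Q(z))$ (a non-empty set). For a closed operator $\mathscr{L}$ and $\varepsilon>0$, $\mathrm{Spec}_\varepsilon(\mathscr{L})=\mathrm{Spec}(\mathscr{L})\cup\{z\in\rho(\mathscr{L}):\|(\mathscr{L}-z)^{-1}\|>\varepsilon^{-1}\}$, and $\mathrm{Spec}_0(\mathscr{L})=\mathrm{Spec}(\mathscr{L})$. *)

theory Defs
  imports "HOL-Analysis.Analysis"
begin

definition square_integrable :: "(real \<Rightarrow> complex^2) \<Rightarrow> bool" where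
  "square_integrable f \<longleftrightarrow>
     f \<in> borel_measurable lebesgue \<and> integrable lebesgue (\<lambda>x. (norm (f x))\<^sup>2)"

lemma square_integrable_zero: "square_integrable (\<lambda>_. 0)"
  by (simp add: square_integrable_def)

lemma square_integrable_add:
  assumes "square_integrable f" "square_integrable g"
  shows "square_integrable (\<lambda>x. f x + g x)"
proof -
  have [measurable]: "f \<in> borel_measurable lebesgue" "g \<in> borel_measurable lebesgue"
    using assms by (auto simp: square_integrable_def)
  have "integrable lebesgue (\<lambda>x. 2 * (norm (f x))\<^sup>2 + 2 * (norm (g x))\<^sup>2)"
    using assms by (auto simp: square_integrable_def)
  then have "integrable lebesgue (\<lambda>x. (norm (f x + g x))\<^sup>2)"
  proof (rule Bochner_Integration.integrable_bound)
    show "AE x in lebesgue. norm ((norm (f x + g x))\<^sup>2)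
            \<le> norm (2 * (norm (f x))\<^sup>2 + 2 * (norm (g x))\<^sup>2)"
    proof (rule AE_I2)
      fix x
      have "(norm (f x + g x))\<^sup>2 + (norm (f x - g x))\<^sup>2 = 2 * (norm (f x))\<^sup>2 + 2 * (norm (g x))\<^sup>2"
        by (simp add: power2_norm_eq_inner algebra_simps inner_commute)
      then show "norm ((norm (f x + g x))\<^sup>2) \<le> norm (2 * (norm (f x))\<^sup>2 + 2 * (norm (g x))\<^sup>2)"
        using zero_le_power2[of "norm (f x - g x)"] zero_le_power2[of "norm (f x + g x)"]
        unfolding real_norm_def by linarith
    qed
  qed measurable
  then show ?thesis
    by (simp add: square_integrable_def)
qed

lemma square_integrable_scaleR:
  assumes "square_integrable f" shows "square_integrable (\<lambda>x. r *\<^sub>R f x)"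
  using assms by (auto simp: square_integrable_def power_mult_distrib)

lemma square_integrable_uminus:
  assumes "square_integrable f" shows "square_integrable (\<lambda>x. - f x)"
  using assms by (auto simp: square_integrable_def)

lemma square_integrable_diff:
  assumes "square_integrable f" "square_integrable g"
  shows "square_integrable (\<lambda>x. f x - g x)"
  using square_integrable_add[OF assms(1) square_integrable_uminus[OF assms(2)]] by simp

lemma norm_vector_scalar_mult: "norm (c *s v) = cmod c * norm (v :: complex^'n)"
  by (simp add: norm_vec_def L2_set_right_distrib norm_mult)

lemma square_integrable_scaleC:
  assumes "square_integrable f" shows "square_integrable (\<lambda>x. c *s f x)"
proof -
  have "linear (\<lambda>v::complex^2. c *s v)"
    by (auto intro!: linearI simp: vec_eq_iff algebra_simps)
  then have "continuous_on UNIV (\<lambda>v::complex^2. c *s v)"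
    by (simp add: linear_continuous_on linear_linear)
  then have "(\<lambda>v::complex^2. c *s v) \<in> borel_measurable borel"
    by (rule borel_measurable_continuous_onI)
  then show ?thesis
    using assms measurable_compose[of f lebesgue borel "\<lambda>v. c *s v" borel]
    by (auto simp: square_integrable_def norm_vector_scalar_mult power_mult_distrib)
qed

lemma square_integrable_inner:
  assumes "square_integrable f" "square_integrable g"
  shows "integrable lebesgue (\<lambda>x. f x \<bullet> g x)"
proof -
  have "integrable lebesgue
          (\<lambda>x. ((norm (f x + g x))\<^sup>2 - (norm (f x))\<^sup>2 - (norm (g x))\<^sup>2) / 2)"
    using assms square_integrable_add[OF assms] by (auto simp: square_integrable_def)
  also have "(\<lambda>x. ((norm (f x + g x))\<^sup>2 - (norm (f x))\<^sup>2 - (norm (g x))\<^sup>2) / 2) = (\<lambda>x. f x \<bullet> g x)"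
    by (simp add: power2_norm_eq_inner algebra_simps inner_commute fun_eq_iff)
  finally show ?thesis .
qed

quotient_type l2 = "real \<Rightarrow> complex^2" / partial:
  "\<lambda>f g. square_integrable f \<and> square_integrable g \<and> (AE x in lebesgue. f x = g x)"
proof (rule part_equivpI)
  show "\<exists>f. square_integrable f \<and> square_integrable f \<and> (AE x in lebesgue. f x = f x)"
    using square_integrable_zero by auto
qed (auto intro!: sympI transpI)

instantiation l2 :: real_vector
begin

lift_definition zero_l2 :: l2 is "\<lambda>_. 0"
  by (simp add: square_integrable_zero)

lift_definition plus_l2 :: "l2 \<Rightarrow> l2 \<Rightarrow> l2" is "\<lambda>f g x. f x + g x"
  by (auto intro: square_integrable_add)

lift_definition minus_l2 :: "l2 \<Rightarrow> l2 \<Rightarrow> l2" is "\<lambda>f g x. f x - g x"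
  by (auto intro: square_integrable_diff)

lift_definition uminus_l2 :: "l2 \<Rightarrow> l2" is "\<lambda>f x. - f x"
  by (auto intro: square_integrable_uminus)

lift_definition scaleR_l2 :: "real \<Rightarrow> l2 \<Rightarrow> l2" is "\<lambda>r f x. r *\<^sub>R f x"
  by (auto intro: square_integrable_scaleR)

instance
  by standard
    (transfer; auto simp: algebra_simps square_integrable_zero
       intro: square_integrable_add square_integrable_diff square_integrable_uminus
         square_integrable_scaleR)+

end

lift_definition scaleC :: "complex \<Rightarrow> l2 \<Rightarrow> l2" is "\<lambda>c f x. c *s f x"
  by (auto intro: square_integrable_scaleC)

instantiation l2 :: real_inner
begin

text \<open>This is the real inner product; its complex counterpart has this as its real part,
  so both induce the same norm.\<close>

lift_definition inner_l2 :: "l2 \<Rightarrow> l2 \<Rightarrow> real" is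
  "\<lambda>f g. LINT x|lebesgue. f x \<bullet> g x"
proof -
  fix f f' g g' :: "real \<Rightarrow> complex^2"
  assume f: "square_integrable f \<and> square_integrable f' \<and> (AE x in lebesgue. f x = f' x)"
    and g: "square_integrable g \<and> square_integrable g' \<and> (AE x in lebesgue. g x = g' x)"
  show "(LINT x|lebesgue. f x \<bullet> g x) = (LINT x|lebesgue. f' x \<bullet> g' x)"
  proof (rule integral_cong_AE)
    show "AE x in lebesgue. f x \<bullet> g x = f' x \<bullet> g' x"
      using f g by auto
  qed (use f g in \<open>auto intro!: borel_measurable_integrable square_integrable_inner\<close>)
qed

definition norm_l2 :: "l2 \<Rightarrow> real" where "norm_l2 f = sqrt (f \<bullet> f)"
definition dist_l2 :: "l2 \<Rightarrow> l2 \<Rightarrow> real" where "dist_l2 f g = norm (f - g)"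
definition sgn_l2 :: "l2 \<Rightarrow> l2" where "sgn_l2 f = f /\<^sub>R norm f"
definition uniformity_l2 :: "(l2 \<times> l2) filter" where
  "uniformity_l2 = (INF e\<in>{0<..}. principal {(f, g). dist f g < e})"
definition open_l2 :: "l2 set \<Rightarrow> bool" where
  "open_l2 S = (\<forall>f\<in>S. \<forall>\<^sub>F (f', g) in uniformity. f' = f \<longrightarrow> g \<in> S)"

instance
proof
  fix f g h :: l2 and r :: real and S :: "l2 set"
  show "dist f g = norm (f - g)" by (rule dist_l2_def)
  show "sgn f = f /\<^sub>R norm f" by (rule sgn_l2_def)
  show "uniformity = (INF e\<in>{0<..}. principal {(f :: l2, g). dist f g < e})"
    by (rule uniformity_l2_def)
  show "open S = (\<forall>f\<in>S. \<forall>\<^sub>F (f', g) in uniformity. f' = f \<longrightarrow> g \<in> S)"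
    by (rule open_l2_def)
  show "norm f = sqrt (f \<bullet> f)" by (rule norm_l2_def)
  show "f \<bullet> g = g \<bullet> f"
    by transfer (simp add: inner_commute)
  show "(f + g) \<bullet> h = f \<bullet> h + g \<bullet> h"
    by transfer (simp add: inner_add_left square_integrable_inner)
  show "(r *\<^sub>R f) \<bullet> g = r * (f \<bullet> g)"
    by transfer simp
  show "0 \<le> f \<bullet> f"
    by transfer (simp add: integral_nonneg_AE)
  show "(f \<bullet> f = 0) = (f = 0)"
  proof transfer
    fix f :: "real \<Rightarrow> complex^2"
    assume "square_integrable f \<and> square_integrable f \<and> (AE x in lebesgue. f x = f x)"
    then have "integrable lebesgue (\<lambda>x. f x \<bullet> f x)" "square_integrable f"
      by (auto intro: square_integrable_inner)
    then show "((LINT x|lebesgue. f x \<bullet> f x) = 0) \<longleftrightarrow>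
      square_integrable f \<and> square_integrable (\<lambda>_. 0) \<and> (AE x in lebesgue. f x = 0)"
      by (simp add: integral_nonneg_eq_0_iff_AE square_integrable_zero)
  qed
qed

end

text \<open>An operator is represented by its graph. Closures of graphs refer to the product topology on
  \<^typ>\<open>l2 \<times> l2\<close>; the graph of the closure of a closable operator is the closure of
  its graph.\<close>

type_synonym operator = "(l2 \<times> l2) set"

definition linear_operator :: "operator \<Rightarrow> bool" where
  "linear_operator T \<longleftrightarrow> single_valued T \<and> subspace T \<and>
     (\<forall>c f g. (f, g) \<in> T \<longrightarrow> (scaleC c f, scaleC c g) \<in> T)"

definition closed_operator :: "operator \<Rightarrow> bool" where
  "closed_operator T \<longleftrightarrow> linear_operator T \<and> closed T"

definition op_comp :: "operator \<Rightarrow> operator \<Rightarrow> operator"  (infixr "\<circ>\<^sub>o" 75) where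
  "T \<circ>\<^sub>o S = S O T"

definition op_diff :: "operator \<Rightarrow> operator \<Rightarrow> operator"  (infixl "-\<^sub>o" 65) where
  "T -\<^sub>o S = {(f, g - h) | f g h. (f, g) \<in> T \<and> (f, h) \<in> S}"

definition op_scalar :: "complex \<Rightarrow> operator" where
  "op_scalar z = {(f, scaleC z f) | f. True}"

definition op_apply :: "operator \<Rightarrow> l2 \<Rightarrow> l2" where
  "op_apply T f = (THE g. (f, g) \<in> T)"

definition everywhere_bounded :: "operator \<Rightarrow> bool" where
  "everywhere_bounded T \<longleftrightarrow> (\<exists>F. bounded_linear F \<and> T = {(f, F f) | f. True})"

definition op_norm :: "operator \<Rightarrow> real" where
  "op_norm T = onorm (op_apply T)"

definition resolvent :: "operator \<Rightarrow> complex \<Rightarrow> operator" where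
  "resolvent T z = (T -\<^sub>o op_scalar z)\<inverse>"

definition resolvent_set :: "operator \<Rightarrow> complex set" where
  "resolvent_set T = {z. everywhere_bounded (resolvent T z)}"

definition spectrum :: "operator \<Rightarrow> complex set" where
  "spectrum T = - resolvent_set T"

definition pseudospectrum :: "real \<Rightarrow> operator \<Rightarrow> complex set" where
  "pseudospectrum \<epsilon> T =
     (if \<epsilon> = 0 then spectrum T
      else spectrum T \<union> {z \<in> resolvent_set T. op_norm (resolvent T z) > inverse \<epsilon>})"

definition test_function :: "(real \<Rightarrow> real) \<Rightarrow> bool" where
  "test_function \<phi> \<longleftrightarrow>
     (\<forall>k x. ((deriv ^^ k) \<phi>) differentiable (at x)) \<and> compact (closure {x. \<phi> x \<noteq> 0})"

definition weak_deriv :: "l2 \<Rightarrow> l2 \<Rightarrow> bool" where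
  "weak_deriv f f' \<longleftrightarrow> (\<forall>\<phi>. test_function \<phi> \<longrightarrow>
     (LINT x|lebesgue. deriv \<phi> x *\<^sub>R rep_l2 f x) = - (LINT x|lebesgue. \<phi> x *\<^sub>R rep_l2 f' x))"

text \<open>The domain is the Sobolev space of the \<open>f\<close> in \<open>L\<^sup>2\<close> that have a weak derivative
  \<open>f'\<close> in \<open>L\<^sup>2\<close>.\<close>

definition dirac :: "real \<Rightarrow> operator" where
  "dirac m = {(f, g). \<exists>f'. weak_deriv f f' \<and>
     (AE x in lebesgue. rep_l2 g x =
        vector [of_real m * rep_l2 f x $ 1 - rep_l2 f' x $ 2,
                rep_l2 f' x $ 1 - of_real m * rep_l2 f x $ 2]
        + (\<i> * of_real (sgn x)) *s rep_l2 f x)}"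

definition matrix_adjoint :: "complex^2^2 \<Rightarrow> complex^2^2" where
  "matrix_adjoint M = (\<chi> i j. cnj (M $ j $ i))"

text \<open>Over the complex numbers, nonnegativity of the quadratic form includes Hermitian symmetry.\<close>

definition matrix_nonneg :: "complex^2^2 \<Rightarrow> bool" where
  "matrix_nonneg M \<longleftrightarrow> (\<forall>v. (\<Sum>i\<in>UNIV. cnj (v $ i) * (M *v v) $ i) \<in> \<real>\<^sub>\<ge>\<^sub>0)"

definition matrix_sqrt :: "complex^2^2 \<Rightarrow> complex^2^2" where
  "matrix_sqrt M = (THE S. matrix_nonneg S \<and> S ** S = M)"

definition matrix_abs :: "complex^2^2 \<Rightarrow> complex^2^2" where
  "matrix_abs M = matrix_sqrt (matrix_adjoint M ** M)"

text \<open>The partial isometry of the polar decomposition: the first condition fixes it on the range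
  of \<open>\<bar>M\<bar>\<close>, the second on the orthogonal complement, which is the kernel of \<open>M\<close>.\<close>

definition matrix_polar :: "complex^2^2 \<Rightarrow> complex^2^2" where
  "matrix_polar M = (THE U. M = U ** matrix_abs M \<and> (\<forall>v. M *v v = 0 \<longrightarrow> U *v v = 0))"

definition matrix_opnorm :: "complex^2^2 \<Rightarrow> real" where
  "matrix_opnorm M = onorm (\<lambda>v. M *v v)"

definition L1_norm :: "(real \<Rightarrow> complex^2^2) \<Rightarrow> real" where
  "L1_norm V = (LINT x|lebesgue. matrix_opnorm (V x))"

text \<open>The maximal multiplication operator: its domain consists of all \<open>f\<close> in \<open>L\<^sup>2\<close> whose
  product with \<open>M\<close> is again in \<open>L\<^sup>2\<close>.\<close>

definition mult_operator :: "(real \<Rightarrow> complex^2^2) \<Rightarrow> operator" where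
  "mult_operator M = {(f, g). AE x in lebesgue. rep_l2 g x = M x *v rep_l2 f x}"

definition factor_A :: "(real \<Rightarrow> complex^2^2) \<Rightarrow> operator" where
  "factor_A V = mult_operator (\<lambda>x. matrix_sqrt (matrix_abs (V x)))"

definition factor_B :: "(real \<Rightarrow> complex^2^2) \<Rightarrow> operator" where
  "factor_B V = mult_operator (\<lambda>x. matrix_polar (V x) ** matrix_sqrt (matrix_abs (V x)))"

definition birman_schwinger :: "real \<Rightarrow> (real \<Rightarrow> complex^2^2) \<Rightarrow> complex \<Rightarrow> operator" where
  "birman_schwinger m V z = closure (factor_A V \<circ>\<^sub>o resolvent (dirac m) z \<circ>\<^sub>o factor_B V)"

text \<open>\<open>(I + Q)\<^sup>-\<^sup>1\<close> is the resolvent of \<open>Q\<close> at \<open>-1\<close>. For \<open>L1_norm V < 1\<close> some \<open>z\<close> is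
  admissible in the quantifier, and the value of the resolvent at a single point already determines
  the operator. If no \<open>z\<close> were admissible, the description would be void.\<close>

definition perturbed_dirac :: "real \<Rightarrow> (real \<Rightarrow> complex^2^2) \<Rightarrow> operator" where
  "perturbed_dirac m V = (THE L. closed_operator L \<and>
     (\<forall>z \<in> resolvent_set (dirac m). -1 \<in> resolvent_set (birman_schwinger m V z) \<longrightarrow>
        z \<in> resolvent_set L \<and>
        resolvent L z =
          resolvent (dirac m) z -\<^sub>o
            closure (resolvent (dirac m) z \<circ>\<^sub>o factor_B V) \<circ>\<^sub>o
            resolvent (birman_schwinger m V z) (-1) \<circ>\<^sub>o
            factor_A V \<circ>\<^sub>o resolvent (dirac m) z))"

end

theory Submission
  imports Defs
begin

text \<open>Throughout, write \<open>\<delta> = \<bar>Im z\<bar> - 1\<close> and \<open>v\<close> for the \<open>L\<^sup>1\<close> norm of the potential.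
The enclosure is a resolvent bound: if \<open>1 < \<bar>Im z\<bar>\<close> and \<open>z\<close> lies outside the closed box, then
\<open>\<parallel>(L - z)\<^sup>-\<^sup>1\<parallel> \<le> K / \<delta>\<close> with \<open>K = 1 + v / (4 C (C - v))\<close>, and so \<open>z\<close> can lie in the
\<open>\<epsilon>\<close>-pseudospectrum only if \<open>\<delta> < \<epsilon> K\<close> (\<open>pseudospectrum_subset_of_resolvent_bound\<close>).

For the free operator, the Dirac part is symmetric and \<open>\<i> sgn\<close> is bounded by one. Hence the quantity
\<open>Im (u\<^sub>1 cnj u\<^sub>2)\<close> has a derivative of size at least \<open>\<delta> \<bar>u\<bar>\<^sup>2\<close> up to the source term, and
integration gives \<open>\<parallel>R\<^sub>0(z)\<parallel> \<le> 1 / \<delta>\<close> (\<open>dirac_sol_energy\<close>). Furthermore \<open>R\<^sub>0(z)\<close> is an integral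
operator. Its kernel is made of two solutions of the homogeneous system that decay at the two ends, both
pieced together from exponentials at the origin, and it is bounded by \<open>M exp (- \<delta> \<bar>x - y\<bar>)\<close>. The
factor \<open>M\<close> measures the reflection at the origin, where \<open>sgn\<close> jumps. Outside the box it is
bounded by a number depending on \<open>m\<close> only (\<open>green_exists_massive\<close>). For \<open>m = 0\<close> the exponential
solutions have the same direction on both half lines, nothing is reflected, and \<open>M = 1\<close>
(\<open>green_exists_massless\<close>).

If \<open>M v < 1\<close>, then \<open>u \<mapsto> G (g - V u)\<close> is a contraction in the supremum norm. This inverts
\<open>I + Q(z)\<close> (\<open>one_plus_Q_invertible\<close>), so that such \<open>z\<close> are admissible in the definition of the
perturbed operator. The resolvent formula at any admissible point yields exactly the bounded weak solutions of
\<open>(L\<^sub>m + V - z) u = g\<close> (\<open>resolvent_formula\<close>). As one value of the resolvent determines an operator,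
the perturbed operator is this differential operator (\<open>perturbed_dirac_eq\<close>).

The constants differ in the two cases. For \<open>m > 0\<close> take \<open>C = 1 / (2 M)\<close>. From
\<open>u = R\<^sub>0 g - G (V u)\<close>, the supremum bound for \<open>u\<close> and the mapping of \<open>L\<^sup>1\<close> into \<open>L\<^sup>2\<close>
by \<open>G\<close> one obtains the factor \<open>1 + M sqrt M v / (1 - M v)\<close>, which is at most \<open>K\<close>.
For \<open>m = 0\<close> and \<open>C = 1\<close> this argument is too lossy: it gives \<open>1 + v / (1 - v)\<close>, where
\<open>1 + v / (4 (1 - v))\<close> is wanted. Instead the energy is refined. The combinations
\<open>u\<^sub>1 \<plusminus> \<i> u\<^sub>2\<close> decouple when \<open>m = 0\<close>, and multiplying their squared moduli by weights that vary
along with \<open>\<integral> \<bar>V\<bar>\<close> absorbs the potential completely. The outcome is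
\<open>\<parallel>(L - z)\<^sup>-\<^sup>1\<parallel> \<le> 1 / (\<delta> sqrt (1 - v\<^sup>2))\<close> (\<open>massless_resolvent_bound\<close>), and
\<open>1 / sqrt (1 - v\<^sup>2) \<le> 1 + v / (4 (1 - v))\<close> holds for all \<open>0 \<le> v < 1\<close>.\<close>

section \<open>Primitives of locally integrable functions\<close>

text \<open>Local absolute continuity with derivative \<open>f\<close>: the derivative is part of the data and is
determined only almost everywhere.\<close>

definition primitive :: "(real \<Rightarrow> 'a::euclidean_space) \<Rightarrow> (real \<Rightarrow> 'a) \<Rightarrow> bool" where
  "primitive F f \<longleftrightarrow> (\<forall>a b. a \<le> b \<longrightarrow>
     f absolutely_integrable_on {a..b} \<and> F b - F a = integral {a..b} f)"

lemma primitiveD: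
  assumes "primitive F f" "a \<le> b"
  shows "f absolutely_integrable_on {a..b}" "F b - F a = integral {a..b} f"
    "f integrable_on {a..b}"
  using assms by (auto simp: primitive_def set_lebesgue_integral_eq_integral)

text \<open>Increments that are quadratically small add up to nothing: on a partition
of mesh \<open>e\<close> (measured by \<open>T\<close>) the sum of the squares is at most \<open>e (T b - T a)\<close>. Bolzano's
bisection principle performs the refinement of the partition.\<close>

lemma quadratic_increments_imp_constant:
  fixes \<Psi> :: "real \<Rightarrow> 'a::real_normed_vector"
  assumes ab: "a \<le> b" and T: "continuous_on {a..b} T"
    and incr: "\<And>x y. a \<le> x \<Longrightarrow> x \<le> y \<Longrightarrow> y \<le> b \<Longrightarrow> norm (\<Psi> y - \<Psi> x) \<le> K * (T y - T x)\<^sup>2"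
    and mono: "\<And>x y. a \<le> x \<Longrightarrow> x \<le> y \<Longrightarrow> y \<le> b \<Longrightarrow> T x \<le> T y" and K: "0 \<le> K"
  shows "\<Psi> b = \<Psi> a"
proof -
  have *: "norm (\<Psi> b - \<Psi> a) \<le> K * e * (T b - T a)" if e: "0 < e" for e
  proof -
    let ?P = "\<lambda>x y. a \<le> x \<and> x \<le> y \<and> y \<le> b \<longrightarrow> norm (\<Psi> y - \<Psi> x) \<le> K * e * (T y - T x)"
    have "?P a b"
    proof (rule Bolzano[OF ab, of ?P])
      fix x y z assume P: "?P x y" "?P y z" and le: "x \<le> y" "y \<le> z"
      show "?P x z"
      proof
        assume H: "a \<le> x \<and> x \<le> z \<and> z \<le> b"
        have "norm (\<Psi> z - \<Psi> x) \<le> norm (\<Psi> z - \<Psi> y) + norm (\<Psi> y - \<Psi> x)"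
          using norm_triangle_ineq[of "\<Psi> z - \<Psi> y" "\<Psi> y - \<Psi> x"] by simp
        also have "\<dots> \<le> K * e * (T z - T y) + K * e * (T y - T x)"
          using P le H by (intro add_mono) auto
        finally show "norm (\<Psi> z - \<Psi> x) \<le> K * e * (T z - T x)"
          by (simp add: algebra_simps)
      qed
    next
      fix x assume x: "a \<le> x" "x \<le> b"
      then obtain d where d: "d > 0" "\<And>y. y \<in> {a..b} \<Longrightarrow> \<bar>y - x\<bar> < d \<Longrightarrow> \<bar>T y - T x\<bar> < e / 2"
        using T[unfolded continuous_on_iff dist_real_def, rule_format, of x "e / 2"] e by auto
      show "\<exists>d>0. \<forall>u v. u \<le> x \<and> x \<le> v \<and> v - u < d \<longrightarrow> ?P u v"
      proof (intro exI[of _ d] conjI allI impI)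
        fix u v assume uv: "u \<le> x \<and> x \<le> v \<and> v - u < d" "a \<le> u \<and> u \<le> v \<and> v \<le> b"
        have "\<bar>T u - T x\<bar> < e / 2" "\<bar>T v - T x\<bar> < e / 2" by (rule d(2); use uv x in auto)+
        then have "T v - T u \<le> e" by linarith
        moreover have "0 \<le> T v - T u" using mono uv by auto
        ultimately have "(T v - T u)\<^sup>2 \<le> e * (T v - T u)"
          unfolding power2_eq_square by (rule mult_right_mono)
        then have "K * (T v - T u)\<^sup>2 \<le> K * (e * (T v - T u))"
          using K by (rule mult_left_mono)
        moreover have "norm (\<Psi> v - \<Psi> u) \<le> K * (T v - T u)\<^sup>2"
          by (rule incr) (use uv in blast)+
        ultimately show "norm (\<Psi> v - \<Psi> u) \<le> K * e * (T v - T u)"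
          unfolding mult.assoc by (rule order.trans[rotated])
      qed (use d in auto)
    qed
    then show ?thesis using ab by simp
  qed
  have "norm (\<Psi> b - \<Psi> a) \<le> 0"
  proof (rule field_le_epsilon)
    fix e :: real assume e: "0 < e"
    define c where "c = K * (T b - T a) + 1"
    have c: "c > 0" using K mono[of a b] ab by (simp add: c_def add_nonneg_pos)
    have "norm (\<Psi> b - \<Psi> a) \<le> K * (e / c) * (T b - T a)" by (rule *) (use e c in simp)
    also have "\<dots> = (e / c) * (c - 1)" by (simp add: c_def)
    also have "\<dots> \<le> e" using c e by (simp add: field_simps)
    finally show "norm (\<Psi> b - \<Psi> a) \<le> 0 + e" by simp
  qed
  then show ?thesis by simp
qed

lemma primitive_continuous_on:
  assumes "primitive F f" shows "continuous_on S F"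
proof -
  have "isCont F x" for x
  proof -
    have eq: "F (x-1) + integral {x-1..y} f = F y" if "y \<in> {x-1..x+1}" for y
      using primitiveD(2)[OF assms, of "x-1" y, symmetric] that by simp
    have "continuous_on {x-1..x+1} (\<lambda>y. F (x-1) + integral {x-1..y} f)"
      using primitiveD(3)[OF assms, of "x-1" "x+1"]
      by (intro continuous_on_add continuous_on_const indefinite_integral_continuous_1) auto
    then have "continuous_on {x-1..x+1} F"
      by (rule continuous_on_eq) (rule eq)
    then show ?thesis
      by (rule continuous_on_interior) simp
  qed
  then show ?thesis by (simp add: continuous_at_imp_continuous_on)
qed

lemma absint_mult_continuous:
  fixes f g :: "real \<Rightarrow> 'a::{real_normed_field,euclidean_space}"
  assumes "f absolutely_integrable_on {a..b}" "continuous_on {a..b} g"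
  shows "(\<lambda>x. g x * f x) absolutely_integrable_on {a..b}" "(\<lambda>x. f x * g x) absolutely_integrable_on {a..b}"
proof -
  show "(\<lambda>x. g x * f x) absolutely_integrable_on {a..b}"
    using assms
    by (intro absolutely_integrable_bounded_measurable_product[where h = "(*)"])
       (auto intro!: continuous_imp_measurable_on_sets_lebesgue compact_imp_bounded
         compact_continuous_image simp: bilinear_conv_bounded_bilinear bounded_bilinear_mult)
  then show "(\<lambda>x. f x * g x) absolutely_integrable_on {a..b}" by (simp add: mult.commute)
qed

lemma primitive_norm_increment:
  assumes F: "primitive F f" and \<tau>: "\<And>x. norm (f x) \<le> \<tau> x" "\<And>a b. \<tau> integrable_on {a..b}"
    and uv: "x \<le> u" "u \<le> v" "v \<le> y"
  shows "norm (F v - F u) \<le> integral {x..y} \<tau>"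
proof -
  have "norm (F v - F u) \<le> integral {u..v} \<tau>"
    using primitiveD[OF F uv(2)] \<tau> by (simp add: integral_norm_bound_integral)
  also have "\<dots> \<le> integral {x..y} \<tau>"
    using uv \<tau>(2) order.trans[OF norm_ge_zero \<tau>(1)] by (intro integral_subset_le) auto
  finally show ?thesis .
qed

text \<open>The route to the product and reciprocal rules for absolutely continuous functions. It
is enough to verify the fundamental theorem on an interval up to an error quadratic in the
integral of a dominating function \<open>\<tau>\<close>, and an error of this size appears when the continuous factors in
the formula for the derivative are frozen at the end points.\<close>

lemma primitive_if_quadratic_defect:
  assumes f: "\<And>a b. a \<le> b \<Longrightarrow> f absolutely_integrable_on {a..b}"
    and \<tau>: "\<And>a b. \<tau> integrable_on {a..b}" "\<And>x. 0 \<le> \<tau> x" and K: "0 \<le> K"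
    and defect: "\<And>x y. x \<le> y \<Longrightarrow> norm (F y - F x - integral {x..y} f) \<le> K * (integral {x..y} \<tau>)\<^sup>2"
  shows "primitive F f"
  unfolding primitive_def
proof (intro allI impI conjI)
  fix a b :: real assume ab: "a \<le> b"
  show "f absolutely_integrable_on {a..b}" by (rule f[OF ab])
  have fi: "f integrable_on {x..y}" if "x \<le> y" for x y
    using f[OF that] by (simp add: absolutely_integrable_on_def)
  define T where "T x = integral {a..x} \<tau>" for x
  define \<Psi> where "\<Psi> x = F x - integral {a..x} f" for x
  have "\<Psi> b = \<Psi> a"
  proof (rule quadratic_increments_imp_constant[OF ab, of T _ K])
    show "continuous_on {a..b} T"
      unfolding T_def by (rule indefinite_integral_continuous_1[OF \<tau>(1)])
    fix x y assume xy: "a \<le> x" "x \<le> y" "y \<le> b"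
    have T: "integral {x..y} \<tau> = T y - T x"
      using Henstock_Kurzweil_Integration.integral_combine[OF xy(1,2) \<tau>(1)] by (simp add: T_def)
    have "0 \<le> integral {x..y} \<tau>"
      by (rule Henstock_Kurzweil_Integration.integral_nonneg[OF \<tau>(1)]) (rule \<tau>(2))
    then show "T x \<le> T y" using T by simp
    have split: "integral {a..x} f + integral {x..y} f = integral {a..y} f"
      by (rule Henstock_Kurzweil_Integration.integral_combine[OF xy(1,2) fi]) (use xy in simp)
    have "\<Psi> y - \<Psi> x = F y - F x - integral {x..y} f"
      unfolding \<Psi>_def split[symmetric] by simp
    then show "norm (\<Psi> y - \<Psi> x) \<le> K * (T y - T x)\<^sup>2"
      using defect[OF xy(2)] T by simp
  qed (rule K)
  then have "F b - integral {a..b} f = F a" by (simp add: \<Psi>_def)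
  then have "F b = F a + integral {a..b} f" by (simp only: diff_eq_eq)
  then show "F b - F a = integral {a..b} f" by simp
qed

lemma primitive_mult:
  fixes F G :: "real \<Rightarrow> 'a::{real_normed_field,euclidean_space}"
  assumes F: "primitive F f" and G: "primitive G g"
  shows "primitive (\<lambda>x. F x * G x) (\<lambda>x. f x * G x + F x * g x)"
proof -
  define \<tau> where "\<tau> x = norm (f x) + norm (g x)" for x
  have ai: "(\<lambda>x. f x * G x + F x * g x) absolutely_integrable_on {x..y}" if "x \<le> y" for x y
    by (intro set_integral_add absint_mult_continuous primitiveD(1)[OF F that] primitiveD(1)[OF G that]
        primitive_continuous_on[OF F] primitive_continuous_on[OF G])
  have \<tau>: "\<tau> integrable_on {x..y}" for x y
  proof (cases "x \<le> y")
    case True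
    then show ?thesis unfolding \<tau>_def using primitiveD(1)[OF F True] primitiveD(1)[OF G True]
      by (intro integrable_add) (auto simp: absolutely_integrable_on_def)
  qed auto
  show ?thesis
  proof (rule primitive_if_quadratic_defect[OF ai \<tau>, of 1])
    fix x y :: real assume xy: "x \<le> y"
    let ?D = "integral {x..y} \<tau>"
    have Fi: "norm (F v - F u) \<le> ?D" "norm (G v - G u) \<le> ?D" if "x \<le> u" "u \<le> v" "v \<le> y" for u v
      by (rule primitive_norm_increment[OF F _ \<tau> that] primitive_norm_increment[OF G _ \<tau> that]; simp add: \<tau>_def)+
    have i1: "(\<lambda>t. f t * G y + F x * g t) integrable_on {x..y}"
      using primitiveD(3)[OF F xy] primitiveD(3)[OF G xy]
      by (intro integrable_add integrable_on_mult_left integrable_on_mult_right)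
    have i2: "(\<lambda>x. f x * G x + F x * g x) integrable_on {x..y}"
      using ai[OF xy] by (rule absolutely_integrable_on_def[THEN iffD1, THEN conjunct1])
    \<comment> \<open>Freezing \<open>G\<close> at \<open>y\<close> and \<open>F\<close> at \<open>x\<close> makes the fundamental theorem exact.\<close>
    have "F y * G y - F x * G x = (F y - F x) * G y + F x * (G y - G x)" by (simp add: algebra_simps)
    also have "\<dots> = integral {x..y} (\<lambda>t. f t * G y + F x * g t)"
      using primitiveD[OF F xy] primitiveD[OF G xy]
      by (simp add: Henstock_Kurzweil_Integration.integral_add integrable_on_mult_left integrable_on_mult_right)
    finally have "F y * G y - F x * G x - integral {x..y} (\<lambda>x. f x * G x + F x * g x)
        = integral {x..y} (\<lambda>t. (f t * G y + F x * g t) - (f t * G t + F t * g t))"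
      unfolding Henstock_Kurzweil_Integration.integral_diff[OF i1 i2] by simp
    also have "norm \<dots> \<le> integral {x..y} (\<lambda>t. ?D * \<tau> t)"
    proof (rule integral_norm_bound_integral[OF integrable_diff[OF i1 i2] integrable_on_mult_right[OF \<tau>]])
      fix t assume t: "t \<in> {x..y}"
      have "norm ((f t * G y + F x * g t) - (f t * G t + F t * g t))
          = norm (f t * (G y - G t) + (F x - F t) * g t)" by (simp add: algebra_simps)
      also have "\<dots> \<le> norm (f t) * ?D + ?D * norm (g t)"
        by (rule order.trans[OF norm_triangle_ineq])
           (use Fi[of t y] Fi[of x t] Fi[of t t] t in \<open>auto simp: norm_mult norm_minus_commute intro!: add_mono mult_mono\<close>)
      finally show "norm ((f t * G y + F x * g t) - (f t * G t + F t * g t)) \<le> ?D * \<tau> t"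
        by (simp add: \<tau>_def algebra_simps)
    qed
    finally show "norm (F y * G y - F x * G x - integral {x..y} (\<lambda>x. f x * G x + F x * g x)) \<le> 1 * ?D\<^sup>2"
      by (simp add: power2_eq_square)
  qed (simp_all add: \<tau>_def)
qed

lemma primitive_add:
  assumes "primitive F f" "primitive G g" shows "primitive (\<lambda>x. F x + G x) (\<lambda>x. f x + g x)"
  unfolding primitive_def
proof (intro allI impI conjI)
  fix a b :: real assume ab: "a \<le> b"
  note f = primitiveD[OF assms(1) ab] and g = primitiveD[OF assms(2) ab]
  show "(\<lambda>x. f x + g x) absolutely_integrable_on {a..b}" using f g by (intro set_integral_add)
  show "F b + G b - (F a + G a) = integral {a..b} (\<lambda>x. f x + g x)"
    using f g by (simp add: Henstock_Kurzweil_Integration.integral_add algebra_simps)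
qed

lemma primitive_const: "primitive (\<lambda>x. c) (\<lambda>x. 0)"
  by (auto simp: primitive_def set_integrable_def)

lemma primitive_linear:
  assumes "bounded_linear L" "primitive F f" shows "primitive (\<lambda>x. L (F x)) (\<lambda>x. L (f x))"
  unfolding primitive_def
proof (intro allI impI conjI)
  fix a b :: real assume ab: "a \<le> b"
  note f = primitiveD[OF assms(2) ab]
  show "(\<lambda>x. L (f x)) absolutely_integrable_on {a..b}"
    using absolutely_integrable_linear[OF f(1) assms(1)] by (simp add: o_def)
  show "L (F b) - L (F a) = integral {a..b} (\<lambda>x. L (f x))"
    using integral_linear[OF f(3) assms(1)] f(2) bounded_linear.linear[OF assms(1)]
    by (simp add: o_def linear_diff[symmetric])
qed

lemma primitive_cmult:
  fixes c :: "'a::{real_normed_field,euclidean_space}"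
  shows "primitive F f \<Longrightarrow> primitive (\<lambda>x. c * F x) (\<lambda>x. c * f x)"
  by (rule primitive_linear[OF bounded_linear_mult_right])

lemma primitive_diff:
  fixes F :: "real \<Rightarrow> 'a::{real_normed_field,euclidean_space}"
  assumes "primitive F f" "primitive G g" shows "primitive (\<lambda>x. F x - G x) (\<lambda>x. f x - g x)"
  using primitive_add[OF assms(1) primitive_cmult[OF assms(2), of "-1"]] by simp

lemma primitive_cong_AE:
  assumes "primitive F f" and "AE x in lebesgue. f x = g x"
  shows "primitive F g"
proof -
  have neg: "negligible {x. g x \<noteq> f x}"
  proof -
    obtain N where "negligible N" "{x. f x \<noteq> g x} \<subseteq> N"
      using assms(2) by (auto simp: negligible_iff_null_sets eventually_ae_filter)
    then show ?thesis by (rule negligible_subset[OF _ order.trans[rotated]]) auto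
  qed
  show ?thesis
    unfolding primitive_def
  proof (intro allI impI conjI)
    fix a b :: real assume ab: "a \<le> b"
    note f = primitiveD[OF assms(1) ab]
    show "g absolutely_integrable_on {a..b}"
      by (rule absolutely_integrable_spike[OF f(1) neg]) auto
    show "F b - F a = integral {a..b} g"
      unfolding f(2) by (rule integral_spike[OF neg]) auto
  qed
qed

lemma primitive_cong:
  assumes "primitive F f" and "\<And>x. F x = G x" and "\<And>x. f x = g x"
  shows "primitive G g"
proof -
  have "F = G" "f = g" using assms by auto
  then show ?thesis using assms by simp
qed

lemma primitive_of_deriv:
  assumes "\<And>x. (F has_vector_derivative f x) (at x)" "continuous_on UNIV f"
  shows "primitive F f"
  unfolding primitive_def
proof (intro allI impI conjI)
  fix a b :: real assume ab: "a \<le> b"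
  show "f absolutely_integrable_on {a..b}"
    by (intro absolutely_integrable_continuous_real continuous_on_subset[OF assms(2)]) auto
  have "(f has_integral F b - F a) {a..b}"
    by (rule fundamental_theorem_of_calculus[OF ab])
       (use assms(1) in \<open>auto intro: has_vector_derivative_at_within\<close>)
  then show "F b - F a = integral {a..b} f" by (simp add: integral_unique)
qed

text \<open>The coefficients of the Dirac system jump at the origin; solutions on the half lines that agree there
form one solution.\<close>

lemma primitive_glue:
  assumes "\<And>x. x \<ge> 0 \<Longrightarrow> F x = F1 x" "\<And>x. x \<le> 0 \<Longrightarrow> F x = F2 x"
    and "\<And>x. x > 0 \<Longrightarrow> f x = f1 x" "\<And>x. x < 0 \<Longrightarrow> f x = f2 x"
    and P: "primitive F1 f1" "primitive F2 f2"
  shows "primitive F f"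
proof -
  have right: "f absolutely_integrable_on {a..b} \<and> F b - F a = integral {a..b} f"
    if "0 \<le> a" "a \<le> b" for a b
  proof
    show "f absolutely_integrable_on {a..b}"
      by (rule absolutely_integrable_spike[OF primitiveD(1)[OF P(1) that(2)], of "{0}"])
         (use assms that in auto)
    have "integral {a..b} f1 = integral {a..b} f"
      by (rule integral_spike[of "{0}"]) (use assms that in auto)
    then show "F b - F a = integral {a..b} f"
      using primitiveD(2)[OF P(1) that(2)] assms(1) that by simp
  qed
  have left: "f absolutely_integrable_on {a..b} \<and> F b - F a = integral {a..b} f"
    if "b \<le> 0" "a \<le> b" for a b
  proof
    show "f absolutely_integrable_on {a..b}"
      by (rule absolutely_integrable_spike[OF primitiveD(1)[OF P(2) that(2)], of "{0}"])
         (use assms that in auto)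
    have "integral {a..b} f2 = integral {a..b} f"
      by (rule integral_spike[of "{0}"]) (use assms that in auto)
    then show "F b - F a = integral {a..b} f"
      using primitiveD(2)[OF P(2) that(2)] assms(2) that by simp
  qed
  show ?thesis
    unfolding primitive_def
  proof (intro allI impI)
    fix a b :: real assume ab: "a \<le> b"
    consider "0 \<le> a" | "b \<le> 0" | "a < 0" "0 < b" by linarith
    then show "f absolutely_integrable_on {a..b} \<and> F b - F a = integral {a..b} f"
    proof cases
      case 3
      have "f absolutely_integrable_on {a..b}"
        by (rule absolutely_integrable_on_combine[where c = 0]) (use left[of 0 a] right[of 0 b] 3 in auto)
      moreover have "integral {a..0} f + integral {0..b} f = integral {a..b} f"
        by (rule Henstock_Kurzweil_Integration.integral_combine)
           (use 3 calculation in \<open>auto simp: absolutely_integrable_on_def\<close>)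
      ultimately show ?thesis using left[of 0 a] right[of 0 b] 3 by (auto simp: algebra_simps)
    qed (use left right ab in auto)
  qed
qed

lemma primitive_inverse:
  fixes D :: "real \<Rightarrow> real"
  assumes D: "primitive D d" and c: "0 < c" "\<And>x. c \<le> D x" "\<And>x. D x \<le> R"
  shows "primitive (\<lambda>x. 1 / D x) (\<lambda>x. - d x / (D x)\<^sup>2)"
proof -
  have pos: "0 < D x" for x using c(1) c(2)[of x] by linarith
  have R: "0 < R" using pos[of 0] c(3)[of 0] by linarith
  have cont: "continuous_on A (\<lambda>x. - 1 / (D x)\<^sup>2)" for A
  proof -
    have "D x \<noteq> 0" for x using pos[of x] by simp
    then show ?thesis by (intro continuous_intros primitive_continuous_on[OF D]) simp
  qed
  have ai: "(\<lambda>x. - d x / (D x)\<^sup>2) absolutely_integrable_on {x..y}" if "x \<le> y" for x y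
    using absint_mult_continuous(1)[OF primitiveD(1)[OF D that] cont] by simp
  define \<tau> where "\<tau> x = \<bar>d x\<bar>" for x
  have \<tau>: "\<tau> integrable_on {x..y}" for x y
    unfolding \<tau>_def using primitiveD(1)[OF D, of x y] by (cases "x \<le> y") (auto simp: absolutely_integrable_on_def)
  \<comment> \<open>The bound \<open>2 R ?D\<close> of the numerator \<open>D x D y - (D t)\<^sup>2\<close> over the lower bound \<open>c ^ 4\<close> of the denominator.\<close>
  define K where "K = 2 * R / c ^ 4"
  have K: "0 \<le> K" using R c by (simp add: K_def)
  show ?thesis
  proof (rule primitive_if_quadratic_defect[OF ai \<tau> _ K])
    show "0 \<le> \<tau> x" for x by (simp add: \<tau>_def)
    fix x y :: real assume xy: "x \<le> y"
    let ?D = "integral {x..y} \<tau>"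
    have Fi: "\<bar>D v - D u\<bar> \<le> ?D" if "x \<le> u" "u \<le> v" "v \<le> y" for u v
      using primitive_norm_increment[OF D _ \<tau> that] by (simp add: \<tau>_def)
    have i1: "(\<lambda>t. - d t / (D x * D y)) integrable_on {x..y}"
      using integrable_on_mult_left[OF primitiveD(3)[OF D xy], of "- 1 / (D x * D y)"] by simp
    have i2: "(\<lambda>x. - d x / (D x)\<^sup>2) integrable_on {x..y}"
      using ai[OF xy] by (rule absolutely_integrable_on_def[THEN iffD1, THEN conjunct1])
    have "1 / D y - 1 / D x = - (D y - D x) / (D x * D y)"
      using pos[of x] pos[of y] by (simp add: field_simps)
    also have "\<dots> = integral {x..y} (\<lambda>t. - d t / (D x * D y))"
      using primitiveD[OF D xy] by simp
    finally have "1 / D y - 1 / D x - integral {x..y} (\<lambda>x. - d x / (D x)\<^sup>2)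
        = integral {x..y} (\<lambda>t. - d t / (D x * D y) - (- d t / (D t)\<^sup>2))"
      unfolding Henstock_Kurzweil_Integration.integral_diff[OF i1 i2] by simp
    also have "norm \<dots> \<le> integral {x..y} (\<lambda>t. (K * ?D) * \<tau> t)"
    proof (rule integral_norm_bound_integral[OF integrable_diff[OF i1 i2] integrable_on_mult_right[OF \<tau>]])
      fix t assume t: "t \<in> {x..y}"
      have "\<bar>D x * D y - (D t)\<^sup>2\<bar> = \<bar>D x * (D y - D t) + D t * (D x - D t)\<bar>"
        by (simp add: algebra_simps power2_eq_square)
      also have "\<dots> \<le> D x * \<bar>D y - D t\<bar> + D t * \<bar>D x - D t\<bar>"
        using abs_triangle_ineq[of "D x * (D y - D t)" "D t * (D x - D t)"] pos[of x] pos[of t]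
        by (simp add: abs_mult)
      also have "\<dots> \<le> R * ?D + R * ?D"
        using Fi[of t y] Fi[of x t] t R c(3)[of x] c(3)[of t]
        by (intro add_mono mult_mono) (auto simp: abs_minus_commute)
      finally have e1: "\<bar>D x * D y - (D t)\<^sup>2\<bar> \<le> 2 * R * ?D" by simp
      have e2: "c ^ 4 \<le> (D x * D y) * (D t)\<^sup>2"
      proof -
        have "(c * c) * (c * c) \<le> (D x * D y) * (D t * D t)"
          using c by (intro mult_mono) (auto intro!: mult_nonneg_nonneg less_imp_le[OF pos])
        then show ?thesis by (simp add: power2_eq_square power4_eq_xxxx algebra_simps)
      qed
      have "- d t / (D x * D y) - (- d t / (D t)\<^sup>2) = d t * ((D x * D y - (D t)\<^sup>2) / ((D x * D y) * (D t)\<^sup>2))"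
        using pos[of x] pos[of y] pos[of t] by (simp add: field_simps)
      then have "norm (- d t / (D x * D y) - (- d t / (D t)\<^sup>2))
          = \<tau> t * (\<bar>D x * D y - (D t)\<^sup>2\<bar> / ((D x * D y) * (D t)\<^sup>2))"
        using pos[of x] pos[of y] pos[of t] by (simp add: \<tau>_def abs_mult abs_div)
      also have "\<dots> \<le> \<tau> t * ((2 * R * ?D) / c ^ 4)"
        using e1 e2 c(1) by (intro mult_left_mono frac_le) (auto simp: \<tau>_def intro: order.trans[OF abs_ge_zero])
      finally show "norm (- d t / (D x * D y) - (- d t / (D t)\<^sup>2)) \<le> (K * ?D) * \<tau> t"
        by (simp add: K_def algebra_simps)
    qed
    finally show "norm (1 / D y - 1 / D x - integral {x..y} (\<lambda>x. - d x / (D x)\<^sup>2)) \<le> K * ?D\<^sup>2"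
      by (simp add: power2_eq_square)
  qed
qed

lemma primitive_integral_left:
  fixes c :: "real \<Rightarrow> 'a::euclidean_space"
  assumes "\<And>x. c absolutely_integrable_on {..x}"
  shows "primitive (\<lambda>x. integral {..x} c) c"
  unfolding primitive_def
proof (intro allI impI conjI)
  fix a b :: real assume ab: "a \<le> b"
  show ai: "c absolutely_integrable_on {a..b}"
    by (rule set_integrable_subset[OF assms[of b]]) auto
  have "integral ({..a} \<union> {a..b}) c = integral {..a} c + integral {a..b} c"
    by (rule integral_Un)
       (use ai assms[of a] ab in \<open>auto simp: absolutely_integrable_on_def intro: negligible_subset[of "{a}"]\<close>)
  moreover have "{..a} \<union> {a..b} = {..b}" using ab by auto
  ultimately show "integral {..b} c - integral {..a} c = integral {a..b} c" by simp
qed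

lemma primitive_integral_right:
  fixes c :: "real \<Rightarrow> 'a::euclidean_space"
  assumes "\<And>x. c absolutely_integrable_on {x..}"
  shows "primitive (\<lambda>x. - integral {x..} c) c"
  unfolding primitive_def
proof (intro allI impI conjI)
  fix a b :: real assume ab: "a \<le> b"
  show ai: "c absolutely_integrable_on {a..b}"
    by (rule set_integrable_subset[OF assms[of a]]) auto
  have "integral ({a..b} \<union> {b..}) c = integral {a..b} c + integral {b..} c"
    by (rule integral_Un)
       (use ai assms[of b] ab in \<open>auto simp: absolutely_integrable_on_def intro: negligible_subset[of "{b}"]\<close>)
  moreover have "{a..b} \<union> {b..} = {a..}" using ab by auto
  ultimately show "- integral {b..} c - - integral {a..} c = integral {a..b} c" by simp
qed

section \<open>Test functions and weak derivatives on the line\<close>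

primrec smooth_n :: "nat \<Rightarrow> (real \<Rightarrow> real) \<Rightarrow> bool" where
  "smooth_n 0 f \<longleftrightarrow> True"
| "smooth_n (Suc n) f \<longleftrightarrow> (\<forall>x. f differentiable (at x)) \<and> smooth_n n (deriv f)"

lemma smooth_n_Suc_D: "smooth_n (Suc n) f \<Longrightarrow> smooth_n n f"
  by (induction n arbitrary: f) auto

lemma smooth_n_imp_higher_deriv:
  "smooth_n (Suc k) f \<Longrightarrow> ((deriv ^^ k) f) differentiable (at x)"
  by (induction k arbitrary: f) (auto simp: funpow_swap1)

lemma smooth_n_SucI:
  assumes "\<And>x. (f has_real_derivative f' x) (at x)" "smooth_n n f'"
  shows "smooth_n (Suc n) f"
proof -
  have "deriv f = f'" using assms(1) by (intro ext DERIV_imp_deriv)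
  moreover have "f differentiable (at x)" for x
    using assms(1) real_differentiable_def by blast
  ultimately show ?thesis using assms(2) by simp
qed

lemma smooth_n_SucE:
  assumes "smooth_n (Suc n) f"
  obtains f' where "\<And>x. (f has_real_derivative f' x) (at x)" "smooth_n n f'"
  using assms that[of "deriv f"] by (auto simp: DERIV_deriv_iff_real_differentiable)

lemma smooth_n_add: "smooth_n n f \<Longrightarrow> smooth_n n g \<Longrightarrow> smooth_n n (\<lambda>x. f x + g x)"
proof (induction n arbitrary: f g)
  case (Suc n)
  from Suc.prems(1) obtain f' where f: "\<And>x. (f has_real_derivative f' x) (at x)" "smooth_n n f'"
    by (erule smooth_n_SucE)
  from Suc.prems(2) obtain g' where g: "\<And>x. (g has_real_derivative g' x) (at x)" "smooth_n n g'"
    by (erule smooth_n_SucE)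
  show ?case by (rule smooth_n_SucI[OF DERIV_add[OF f(1) g(1)] Suc.IH[OF f(2) g(2)]])
qed auto

lemma smooth_n_const: "smooth_n n (\<lambda>x. c)"
  by (induction n arbitrary: c) (auto intro!: smooth_n_SucI derivative_eq_intros)

lemma smooth_n_mult: "smooth_n n f \<Longrightarrow> smooth_n n g \<Longrightarrow> smooth_n n (\<lambda>x. f x * g x)"
proof (induction n arbitrary: f g)
  case (Suc n)
  note lower = smooth_n_Suc_D[OF Suc.prems(1)] smooth_n_Suc_D[OF Suc.prems(2)]
  from Suc.prems(1) obtain f' where f: "\<And>x. (f has_real_derivative f' x) (at x)" "smooth_n n f'"
    by (erule smooth_n_SucE)
  from Suc.prems(2) obtain g' where g: "\<And>x. (g has_real_derivative g' x) (at x)" "smooth_n n g'"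
    by (erule smooth_n_SucE)
  show ?case
    by (rule smooth_n_SucI[OF DERIV_mult[OF f(1) g(1)]
          smooth_n_add[OF Suc.IH[OF f(2) lower(2)] Suc.IH[OF g(2) lower(1)]]])
qed auto

lemma smooth_n_affine: "smooth_n n f \<Longrightarrow> smooth_n n (\<lambda>x. f (a * x + b))"
proof (induction n arbitrary: f)
  case (Suc n)
  from Suc.prems(1) obtain f' where f: "\<And>x. (f has_real_derivative f' x) (at x)" "smooth_n n f'"
    by (erule smooth_n_SucE)
  have "((\<lambda>x. f (a * x + b)) has_real_derivative f' (a * x + b) * a) (at x)" for x
    by (rule DERIV_chain2[OF f(1)]) (auto intro!: derivative_eq_intros)
  then show ?case
    by (rule smooth_n_SucI[OF _ smooth_n_mult[OF Suc.IH[OF f(2)] smooth_n_const]])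
qed auto

text \<open>The functions \<open>exp (- 1 / x) / x ^ p\<close>, extended by zero, are closed under differentiation up to linear
combinations, which makes smoothness an induction. The case \<open>p = 0\<close> is the standard flat function.\<close>

definition flat_exp :: "nat \<Rightarrow> real \<Rightarrow> real" where
  "flat_exp p x = (if 0 < x then exp (- 1 / x) / x ^ p else 0)"

lemma flat_exp_div_tendsto_0: "((\<lambda>x. flat_exp p x / x) \<longlongrightarrow> 0) (at 0)"
proof (rule filterlim_split_at)
  show "((\<lambda>x. flat_exp p x / x) \<longlongrightarrow> 0) (at_left 0)"
    by (rule tendsto_eventually) (auto simp: eventually_at_left_field flat_exp_def intro!: exI[of _ "-1"])
  have "((\<lambda>x. inverse x ^ Suc p / exp (inverse x)) \<longlongrightarrow> (0::real)) (at_right 0)"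
    by (rule filterlim_compose[OF tendsto_power_div_exp_0 filterlim_inverse_at_top_right])
  then show "((\<lambda>x. flat_exp p x / x) \<longlongrightarrow> 0) (at_right 0)"
  proof (rule tendsto_cong[THEN iffD1, rotated])
    show "\<forall>\<^sub>F x in at_right 0. inverse x ^ Suc p / exp (inverse x) = flat_exp p x / (x::real)"
      by (auto simp: eventually_at_right_field flat_exp_def exp_minus field_simps power_inverse intro!: exI[of _ 1])
  qed
qed

lemma flat_exp_deriv: "(flat_exp p has_real_derivative flat_exp (p + 2) x - real p * flat_exp (p + 1) x) (at x)"
proof -
  consider "x > 0" | "x < 0" | "x = 0" by linarith
  then show ?thesis
  proof cases
    case 1
    have d1: "((\<lambda>x. exp (- 1 / x)) has_real_derivative exp (- 1 / x) * (1 / x\<^sup>2)) (at x)"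
      by (rule DERIV_fun_exp)
         (use 1 in \<open>auto intro!: derivative_eq_intros simp: power2_eq_square\<close>)
    have d2: "((\<lambda>x. x ^ p) has_real_derivative real p * x ^ (p - Suc 0)) (at x)"
      by (rule DERIV_pow)
    have "((\<lambda>x. exp (- 1 / x) / x ^ p) has_real_derivative
        (exp (- 1 / x) * (1 / x\<^sup>2) * x ^ p - exp (- 1 / x) * (real p * x ^ (p - Suc 0))) / (x ^ p * x ^ p)) (at x)"
      by (rule DERIV_divide[OF d1 d2]) (use 1 in simp)
    moreover have "(exp (- 1 / x) * (1 / x\<^sup>2) * x ^ p - exp (- 1 / x) * (real p * x ^ (p - Suc 0))) / (x ^ p * x ^ p)
        = flat_exp (p + 2) x - real p * flat_exp (p + 1) x"
      using 1 by (cases p) (simp_all add: flat_exp_def field_simps power2_eq_square)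
    ultimately have "((\<lambda>x. exp (- 1 / x) / x ^ p) has_real_derivative flat_exp (p + 2) x - real p * flat_exp (p + 1) x) (at x)"
      by simp
    then show ?thesis
      by (rule DERIV_cong_ev[THEN iffD1, rotated -1])
         (use 1 in \<open>auto simp: flat_exp_def eventually_nhds intro!: exI[of _ "{0<..}"]\<close>)
  next
    case 2
    have "((\<lambda>x. 0) has_real_derivative flat_exp (p + 2) x - real p * flat_exp (p + 1) x) (at x)"
      using 2 by (simp add: flat_exp_def)
    then show ?thesis
      by (rule DERIV_cong_ev[THEN iffD1, rotated -1])
         (use 2 in \<open>auto simp: flat_exp_def eventually_nhds intro!: exI[of _ "{..<0}"]\<close>)
  next
    case 3
    then show ?thesis
      using flat_exp_div_tendsto_0[of p] by (simp add: DERIV_def flat_exp_def)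
  qed
qed

lemma smooth_n_flat_exp: "smooth_n n (flat_exp p)"
proof (induction n arbitrary: p)
  case (Suc n)
  have "smooth_n n (\<lambda>x. flat_exp (p + 2) x + (- real p) * flat_exp (p + 1) x)"
    by (intro smooth_n_add smooth_n_mult smooth_n_const Suc)
  then show ?case
    by (intro smooth_n_SucI[OF flat_exp_deriv]) simp
qed auto

text \<open>The parameter \<open>n\<close> steepens the flanks, so that these functions increase to the indicator of the
open interval.\<close>

definition bump :: "real \<Rightarrow> real \<Rightarrow> nat \<Rightarrow> real \<Rightarrow> real" where
  "bump a b n x = flat_exp 0 (real n * (x - a)) * flat_exp 0 (real n * (b - x))"

lemma smooth_n_bump: "smooth_n k (bump a b n)"
proof -
  have "bump a b n = (\<lambda>x. flat_exp 0 (real n * x + (- real n * a)) * flat_exp 0 ((- real n) * x + real n * b))"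
    by (auto simp: bump_def algebra_simps)
  then show ?thesis
    by (simp only: smooth_n_mult[OF smooth_n_affine[OF smooth_n_flat_exp] smooth_n_affine[OF smooth_n_flat_exp]])
qed

lemma bump_bounds: "0 \<le> bump a b n x" "bump a b n x \<le> 1"
proof -
  have "0 \<le> flat_exp 0 y \<and> flat_exp 0 y \<le> 1" for y
    by (auto simp: flat_exp_def)
  then show "0 \<le> bump a b n x" "bump a b n x \<le> 1"
    unfolding bump_def by (auto intro!: mult_nonneg_nonneg mult_le_one)
qed

lemma bump_outside: "x \<notin> {a<..<b} \<Longrightarrow> bump a b n x = 0"
  by (auto simp: bump_def flat_exp_def zero_less_mult_iff)

lemma bump_outside_closed: "x \<notin> {a..b} \<Longrightarrow> bump a b n x = 0"
  by (rule bump_outside) auto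

lemma bump_tendsto_indicator: "(\<lambda>n. bump a b n x) \<longlonglongrightarrow> indicat_real {a<..<b} x"
proof (cases "x \<in> {a<..<b}")
  case True
  have "(\<lambda>n. flat_exp 0 (real n * c)) \<longlonglongrightarrow> 1" if "c > 0" for c
  proof -
    have "(\<lambda>n. exp (- ((1 / c) / real n))) \<longlonglongrightarrow> exp (- 0)"
      by (intro tendsto_exp tendsto_minus lim_const_over_n)
    moreover have "\<forall>\<^sub>F n in sequentially. exp (- ((1 / c) / real n)) = flat_exp 0 (real n * c)"
      using that by (intro eventually_sequentiallyI[of 1]) (simp add: flat_exp_def field_simps)
    ultimately show ?thesis
      by (simp add: Lim_transform_eventually)
  qed
  from tendsto_mult[OF this this, of "x - a" "b - x"] True show ?thesis
    by (simp add: bump_def)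
qed (simp add: bump_outside)

lemma bump_continuous: "continuous_on S (bump a b n)"
proof -
  have "\<forall>x. bump a b n differentiable (at x)"
    using smooth_n_bump[of "Suc 0" a b n] by simp
  then show ?thesis
    by (simp add: continuous_at_imp_continuous_on differentiable_imp_continuous_within)
qed

lemma lebesgue_integral_support:
  fixes g :: "real \<Rightarrow> 'a::euclidean_space"
  assumes "g absolutely_integrable_on {a..b}" "\<And>x. x \<notin> {a..b} \<Longrightarrow> g x = 0"
  shows "integrable lebesgue g" "(LINT x|lebesgue. g x) = integral {a..b} g"
proof -
  have eq: "(\<lambda>x. indicat_real {a..b} x *\<^sub>R g x) = g"
    using assms(2) by (auto simp: indicator_def)
  show "integrable lebesgue g" using assms(1) by (simp add: set_integrable_def eq)
  show "(LINT x|lebesgue. g x) = integral {a..b} g"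
    using set_lebesgue_integral_eq_integral(2)[OF assms(1)] by (simp add: set_lebesgue_integral_def eq)
qed

lemma test_function_props:
  assumes "test_function \<phi>"
  shows "primitive \<phi> (deriv \<phi>)" "continuous_on UNIV (deriv \<phi>)"
    "\<exists>R>0. \<phi> R = 0 \<and> \<phi> (-R) = 0 \<and> (\<forall>x. x \<notin> {-R..R} \<longrightarrow> \<phi> x = 0 \<and> deriv \<phi> x = 0)"
proof -
  have "bounded {x. \<phi> x \<noteq> 0}"
    using assms closure_subset[of "{x. \<phi> x \<noteq> 0}"] by (auto simp: test_function_def intro: bounded_subset dest!: compact_imp_bounded)
  then obtain R0 where R0: "\<And>x. \<phi> x \<noteq> 0 \<Longrightarrow> \<bar>x\<bar> \<le> R0"
    by (auto simp: bounded_iff)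
  define R where "R = \<bar>R0\<bar> + 1"
  have z: "\<phi> x = 0" if "x \<notin> {-R<..<R}" for x
    using R0[of x] that by (cases "\<phi> x = 0") (auto simp: R_def)
  have d0: "\<phi> differentiable (at x)" "deriv \<phi> differentiable (at x)" for x
  proof -
    have *: "\<forall>k x. ((deriv ^^ k) \<phi>) differentiable (at x)"
      using assms by (simp add: test_function_def)
    show "\<phi> differentiable (at x)" using *[rule_format, of 0 x] by simp
    show "deriv \<phi> differentiable (at x)" using *[rule_format, of 1 x] by simp
  qed
  have dz: "deriv \<phi> x = 0" if "x \<notin> {-R..R}" for x
  proof -
    have "((\<lambda>x. 0) has_real_derivative 0) (at x)" by simp
    then have "(\<phi> has_real_derivative 0) (at x)"
      by (rule DERIV_cong_ev[THEN iffD1, rotated -1])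
         (use that z in \<open>auto simp: eventually_nhds intro!: exI[of _ "- {-R..R}"]\<close>)
    then show ?thesis by (rule DERIV_imp_deriv)
  qed
  show c: "continuous_on UNIV (deriv \<phi>)"
    using d0 by (simp add: continuous_at_imp_continuous_on differentiable_imp_continuous_within)
  show "primitive \<phi> (deriv \<phi>)"
    by (rule primitive_of_deriv[OF _ c])
       (use d0 in \<open>simp add: DERIV_deriv_iff_real_differentiable has_real_derivative_iff_has_vector_derivative[symmetric]\<close>)
  show "\<exists>R>0. \<phi> R = 0 \<and> \<phi> (-R) = 0 \<and> (\<forall>x. x \<notin> {-R..R} \<longrightarrow> \<phi> x = 0 \<and> deriv \<phi> x = 0)"
    by (intro exI[of _ R] conjI allI impI) (use z dz in \<open>auto simp: R_def\<close>)
qed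

lemma test_function_by_parts:
  fixes F :: "real \<Rightarrow> complex"
  assumes "test_function \<phi>" "primitive F f"
  shows "(LINT x|lebesgue. deriv \<phi> x *\<^sub>R F x) = - (LINT x|lebesgue. \<phi> x *\<^sub>R f x)"
    "integrable lebesgue (\<lambda>x. deriv \<phi> x *\<^sub>R F x)" "integrable lebesgue (\<lambda>x. \<phi> x *\<^sub>R f x)"
proof -
  obtain R where R: "\<And>x. x \<notin> {-R..R} \<Longrightarrow> \<phi> x = 0" "\<And>x. x \<notin> {-R..R} \<Longrightarrow> deriv \<phi> x = 0"
    "\<phi> R = 0" "\<phi> (-R) = 0" "0 < R"
    using test_function_props(3)[OF assms(1)] by blast
  have P: "primitive (\<lambda>x. complex_of_real (\<phi> x)) (\<lambda>x. complex_of_real (deriv \<phi> x))"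
    by (rule primitive_linear[OF bounded_linear_of_real test_function_props(1)[OF assms(1)]])
  have le: "-R \<le> R" using R(5) by simp
  have a1: "(\<lambda>x. deriv \<phi> x *\<^sub>R F x) absolutely_integrable_on {-R..R}"
    unfolding scaleR_conv_of_real
    by (intro absint_mult_continuous primitiveD(1)[OF P le] primitive_continuous_on[OF assms(2)])
  have a2: "(\<lambda>x. \<phi> x *\<^sub>R f x) absolutely_integrable_on {-R..R}"
    unfolding scaleR_conv_of_real
    by (intro absint_mult_continuous primitiveD(1)[OF assms(2) le] primitive_continuous_on[OF P])
  show "integrable lebesgue (\<lambda>x. deriv \<phi> x *\<^sub>R F x)" "integrable lebesgue (\<lambda>x. \<phi> x *\<^sub>R f x)"
    by (rule lebesgue_integral_support(1)[OF a1] lebesgue_integral_support(1)[OF a2]; simp add: R)+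
  have "integral {-R..R} (\<lambda>x. deriv \<phi> x *\<^sub>R F x + \<phi> x *\<^sub>R f x) = 0"
    using primitiveD(2)[OF primitive_mult[OF P assms(2)] le] R(3,4) by (simp add: scaleR_conv_of_real)
  then have "integral {-R..R} (\<lambda>x. deriv \<phi> x *\<^sub>R F x) + integral {-R..R} (\<lambda>x. \<phi> x *\<^sub>R f x) = 0"
    using a1 a2 by (simp add: Henstock_Kurzweil_Integration.integral_add absolutely_integrable_on_def)
  moreover have "(LINT x|lebesgue. deriv \<phi> x *\<^sub>R F x) = integral {-R..R} (\<lambda>x. deriv \<phi> x *\<^sub>R F x)"
    by (rule lebesgue_integral_support(2)[OF a1]) (simp add: R)
  moreover have "(LINT x|lebesgue. \<phi> x *\<^sub>R f x) = integral {-R..R} (\<lambda>x. \<phi> x *\<^sub>R f x)"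
    by (rule lebesgue_integral_support(2)[OF a2]) (simp add: R)
  ultimately show "(LINT x|lebesgue. deriv \<phi> x *\<^sub>R F x) = - (LINT x|lebesgue. \<phi> x *\<^sub>R f x)"
    by (simp add: eq_neg_iff_add_eq_0)
qed

text \<open>Half open intervals are stable under intersection and generate the Borel sets; the sets
on which the integral of \<open>g\<close> vanishes form a Dynkin system.\<close>

lemma AE_zero_if_interval_integrals_zero:
  fixes g :: "real \<Rightarrow> complex"
  assumes g: "integrable lebesgue g"
    and I: "\<And>a b. a \<le> b \<Longrightarrow> (LINT x:{a<..b}|lebesgue. g x) = 0" and U: "(LINT x|lebesgue. g x) = 0"
  shows "AE x in lebesgue. g x = 0"
proof -
  have si: "set_integrable lebesgue A g" if "A \<in> sets lebesgue" for A
    unfolding set_integrable_def using g that by (rule integrable_mult_indicator[rotated])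
  have borel: "(LINT x:A|lebesgue. g x) = 0" if "A \<in> sets borel" for A
  proof -
    let ?G = "range (\<lambda>(a, b). {a<..b::real})"
    have sb: "sets borel = sigma_sets UNIV ?G"
      by (subst borel_sigma_sets_Ioc) (simp add: sets_measure_of)
    have "Int_stable ?G"
    proof (rule Int_stableI)
      fix A B assume "A \<in> ?G" "B \<in> ?G"
      then obtain a b c d where "A = {a<..b}" "B = {c<..d}" by auto
      then have "A \<inter> B = (\<lambda>(a, b). {a<..b}) (max a c, min b d)" by auto
      then show "A \<inter> B \<in> ?G" by blast
    qed
    moreover have "?G \<subseteq> Pow UNIV" by simp
    moreover have "A \<in> sigma_sets UNIV ?G"
      using that sb by simp
    ultimately show ?thesis
    proof (induction rule: sigma_sets_induct_disjoint)
      case (basic A)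
      then obtain a b where A: "A = {a<..b}" by auto
      show ?case using I[of a b] A by (cases "a \<le> b") (auto simp: set_lebesgue_integral_def)
    next
      case (compl A)
      have A: "A \<in> sets lebesgue" using compl(1) sb
        by (metis sets_completionI_sets sets_lborel)
      have "(LINT x:A \<union> (UNIV - A)|lebesgue. g x) = (LINT x:A|lebesgue. g x) + (LINT x:UNIV - A|lebesgue. g x)"
        using si[OF A] si[of "UNIV - A"] sets.Diff[OF sets.top[of lebesgue] A]
        by (intro set_integral_Un) auto
      then show ?case using compl(2) U by (simp add: set_lebesgue_integral_def)
    next
      case (union A)
      have A: "A i \<in> sets lebesgue" for i using union(2) sb
        by (metis range_subsetD sets_completionI_sets sets_lborel)
      have "(LINT x:\<Union>(range A)|lebesgue. g x) = (\<Sum>i. LINT x:A i|lebesgue. g x)"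
        by (rule lebesgue_integral_countable_add) (use A union(1) si in \<open>auto simp: disjoint_family_on_def\<close>)
      then show ?case using union(3) by simp
    qed (simp add: set_lebesgue_integral_def)
  qed
  interpret sigma_finite_measure "lebesgue :: real measure" 
  proof
    obtain A :: "real set set" where A: "countable A" "A \<subseteq> sets lborel" "\<Union>A = space lborel"
      "\<forall>a\<in>A. emeasure lborel a \<noteq> \<infinity>"
      using lborel.sigma_finite_countable by blast
    then show "\<exists>A. countable A \<and> A \<subseteq> sets lebesgue \<and> \<Union>A = space lebesgue \<and> (\<forall>a\<in>A. emeasure lebesgue (a::real set) \<noteq> \<infinity>)"
      by (intro exI[of _ A]) auto
  qed
  show ?thesis
  proof (rule density_zero[OF g])
    fix A :: "real set" assume "A \<in> sets lebesgue"
    then obtain S N N' where A: "A = S \<union> N" "N \<subseteq> N'" "N' \<in> null_sets lborel" "S \<in> sets lborel"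
      by (rule sets_completionE)
    have "AE x in lebesgue. x \<notin> N'"
      using A(3) by (intro AE_not_in) (rule null_sets_completionI)
    then have "AE x in lebesgue. indicat_real A x *\<^sub>R g x = indicat_real S x *\<^sub>R g x"
      by eventually_elim (use A in \<open>auto simp: indicator_def\<close>)
    then have "(LINT x:A|lebesgue. g x) = (LINT x:S|lebesgue. g x)"
      unfolding set_lebesgue_integral_def
      by (intro integral_cong_AE) (use si[OF \<open>A \<in> sets lebesgue\<close>] si[of S] A(4)
          in \<open>auto simp: set_integrable_def intro: borel_measurable_integrable\<close>)
    then show "(LINT x:A|lebesgue. g x) = 0" using borel[of S] A(4) by simp
  qed
qed

text \<open>A smooth function with compact support is the derivative of a test function as soon as its
integral vanishes.\<close>

lemma test_function_primitive:
  assumes \<eta>: "\<And>n. smooth_n n \<eta>" and supp: "\<And>x. x \<notin> {A<..<B} \<Longrightarrow> \<eta> x = 0"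
    and zero: "integral {A..B} \<eta> = 0" and AB: "A \<le> B"
  shows "\<exists>\<phi>. test_function \<phi> \<and> deriv \<phi> = \<eta>"
proof -
  define \<phi> where "\<phi> x = integral {A - 1..x} \<eta>" for x
  have "\<forall>x. \<eta> differentiable (at x)" using \<eta>[of "Suc 0"] by simp
  then have cont: "continuous_on S \<eta>" for S
    by (simp add: continuous_at_imp_continuous_on differentiable_imp_continuous_within)
  have int: "\<eta> integrable_on {a..b}" for a b
    by (intro integrable_continuous_real cont)
  have left: "\<phi> x = 0" if "x \<le> A" for x
    unfolding \<phi>_def by (rule integral_unique, rule has_integral_is_0) (use that supp in auto)
  have right: "\<phi> x = 0" if "B \<le> x" for x
  proof -
    have "\<phi> x = integral {A - 1..A} \<eta> + integral {A..B} \<eta> + integral {B..x} \<eta>"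
      using that AB int by (simp add: \<phi>_def Henstock_Kurzweil_Integration.integral_combine)
    moreover have "integral {B..x} \<eta> = 0"
      by (rule integral_unique, rule has_integral_is_0) (use supp in auto)
    ultimately show ?thesis using zero left[of A] by (simp add: \<phi>_def)
  qed
  have der: "(\<phi> has_real_derivative \<eta> x) (at x)" for x
  proof (cases "x < A")
    case True
    have "((\<lambda>x. 0) has_real_derivative \<eta> x) (at x)" using supp True by simp
    then show ?thesis
      by (rule DERIV_cong_ev[THEN iffD1, rotated -1])
         (use True left in \<open>auto simp: eventually_nhds intro!: exI[of _ "{..<A}"]\<close>)
  next
    case False
    have "(\<phi> has_vector_derivative \<eta> x) (at x within {A - 1..x + 1})"
      unfolding \<phi>_def by (rule integral_has_vector_derivative[OF cont]) (use False in auto)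
    then have "(\<phi> has_vector_derivative \<eta> x) (at x)"
      using False by (subst (asm) at_within_interior) auto
    then show ?thesis by (simp add: has_real_derivative_iff_has_vector_derivative)
  qed
  have "smooth_n n \<phi>" for n
    by (cases n) (use smooth_n_SucI[OF der \<eta>] in auto)
  then have "((deriv ^^ k) \<phi>) differentiable (at x)" for k x
    by (rule smooth_n_imp_higher_deriv)
  moreover have "compact (closure {x. \<phi> x \<noteq> 0})"
  proof -
    have "{x. \<phi> x \<noteq> 0} \<subseteq> {A..B}"
    proof
      fix x assume "x \<in> {x. \<phi> x \<noteq> 0}"
      then show "x \<in> {A..B}" using left[of x] right[of x] by (cases "x \<le> A"; cases "B \<le> x") auto
    qed
    then show ?thesis
      by (meson bounded_closed_interval bounded_subset compact_closure)
  qed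
  moreover have "deriv \<phi> = \<eta>" using der by (intro ext DERIV_imp_deriv)
  ultimately show ?thesis unfolding test_function_def by blast
qed

text \<open>Subtracting from a bump the right multiple of a fixed bump \<open>\<rho>\<close> makes its integral zero, so that it
is the derivative of a test function. Hence \<open>k\<close> minus its mean against \<open>\<rho>\<close> integrates to zero against
every bump, in the limit over every interval, and so vanishes almost everywhere.\<close>

lemma du_Bois_Reymond:
  fixes k :: "real \<Rightarrow> complex"
  assumes k: "\<And>a b. k absolutely_integrable_on {a..b}"
    and weak: "\<And>\<phi>. test_function \<phi> \<Longrightarrow> (LINT x|lebesgue. deriv \<phi> x *\<^sub>R k x) = 0"
  shows "\<exists>c. AE x in lebesgue. k x = c"
proof -
  define \<rho> where "\<rho> = bump 0 1 1"
  define I where "I = integral {0..1} \<rho>"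
  have bint: "bump a b n integrable_on {c..d}" for a b n c d
    by (intro integrable_continuous_real bump_continuous)
  have I: "I \<noteq> 0"
  proof
    assume "I = 0"
    then have "\<rho> (1/2) = 0"
      using has_integral_0_cbox_imp_0[of 0 1 \<rho> "1/2"] bint[of 0 1 1 0 1] bump_continuous bump_bounds
      by (auto simp: \<rho>_def I_def has_integral_integral)
    then show False by (simp add: \<rho>_def bump_def flat_exp_def)
  qed
  have bk: "(\<lambda>x. bump a b n x *\<^sub>R k x) absolutely_integrable_on {c..d}" for a b n c d
    unfolding scaleR_conv_of_real
    by (intro absint_mult_continuous k continuous_on_of_real bump_continuous)
  \<comment> \<open>The only constant that \<open>k\<close> can be: its mean against \<open>\<rho>\<close>.\<close>
  define c where "c = (LINT x|lebesgue. \<rho> x *\<^sub>R k x) /\<^sub>R I"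
  have bL: "integrable lebesgue (\<lambda>x. bump a b n x *\<^sub>R k x)" for a b n
    by (rule lebesgue_integral_support(1)[OF bk[of a b a b n]]) (simp add: bump_outside_closed)
  have bb: "(\<lambda>x. bump a b n x) absolutely_integrable_on {c..d}" for a b n c d
    by (intro absolutely_integrable_continuous_real bump_continuous)
  have bL1: "integrable lebesgue (\<lambda>x. bump a b n x)" "(LINT x|lebesgue. bump a b n x) = integral {a..b} (bump a b n)" for a b n
    by (rule lebesgue_integral_support[OF bb[of a b a b n]]; simp add: bump_outside_closed)+
  have main: "(LINT x|lebesgue. bump a b n x *\<^sub>R (k x - c)) = 0" if ab: "a \<le> b" for a b n
  proof -
    define J where "J = integral {a..b} (bump a b n)"
    define \<eta> where "\<eta> x = bump a b n x + (- (J / I)) * \<rho> x" for x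
    define A where "A = min a 0" define B where "B = max b 1"
    have "\<exists>\<phi>. test_function \<phi> \<and> deriv \<phi> = \<eta>"
    proof (rule test_function_primitive[of \<eta> A B])
      show "smooth_n n \<eta>" for n
        unfolding \<eta>_def \<rho>_def by (intro smooth_n_add smooth_n_mult smooth_n_const smooth_n_bump)
      show "\<eta> x = 0" if "x \<notin> {A<..<B}" for x
      proof -
        have "x \<notin> {a<..<b}" "x \<notin> {0<..<1}" using that by (auto simp: A_def B_def)
        from this[THEN bump_outside] have "bump a b n x = 0" "\<rho> x = 0" unfolding \<rho>_def by blast+
        then show ?thesis by (simp add: \<eta>_def)
      qed
      have sub: "integral {A..B} (bump a' b' n') = integral {a'..b'} (bump a' b' n')" if "A \<le> a'" "b' \<le> B" for a' b' n'
      proof -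
        have "bump a' b' n' x = 0" if "x \<notin> {A..B}" for x
          using that \<open>A \<le> a'\<close> \<open>b' \<le> B\<close> by (intro bump_outside_closed) auto
        then show ?thesis
          using lebesgue_integral_support(2)[OF bb[of A B a' b' n']] bL1(2)[of a' b' n'] by simp
      qed
      have r: "(\<lambda>x. (- (J / I)) * \<rho> x) integrable_on {A..B}"
        unfolding \<rho>_def by (intro integrable_on_mult_right bint)
      have "integral {A..B} \<eta> = integral {A..B} (bump a b n) + (- (J / I)) * integral {A..B} \<rho>"
        unfolding \<eta>_def Henstock_Kurzweil_Integration.integral_add[OF bint r] by (simp only: integral_mult_right)
      also have "\<dots> = J + (- (J / I)) * I"
        using sub[of a b n] sub[of 0 1 1] by (simp add: J_def I_def \<rho>_def A_def B_def)
      finally have "integral {A..B} \<eta> = J + (- (J / I)) * I" .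
      then show "integral {A..B} \<eta> = 0" using I by simp
      show "A \<le> B" using ab by (auto simp: A_def B_def)
    qed
    then have zero: "(LINT x|lebesgue. \<eta> x *\<^sub>R k x) = 0" using weak by metis
    have "(LINT x|lebesgue. \<eta> x *\<^sub>R k x) = (LINT x|lebesgue. bump a b n x *\<^sub>R k x + (- (J / I)) *\<^sub>R (\<rho> x *\<^sub>R k x))"
      by (simp add: \<eta>_def algebra_simps)
    also have "\<dots> = (LINT x|lebesgue. bump a b n x *\<^sub>R k x) - J *\<^sub>R c"
    proof -
      have i2: "integrable lebesgue (\<lambda>x. (- (J / I)) *\<^sub>R (\<rho> x *\<^sub>R k x))"
        unfolding \<rho>_def by (rule integrable_scaleR_right[OF bL])
      show ?thesis
        unfolding Bochner_Integration.integral_add[OF bL i2] integral_scaleR_right c_def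
        by (simp add: divide_inverse)
    qed
    finally have e: "(LINT x|lebesgue. bump a b n x *\<^sub>R k x) = J *\<^sub>R c" using zero by simp
    have "(LINT x|lebesgue. bump a b n x *\<^sub>R (k x - c)) = (LINT x|lebesgue. bump a b n x *\<^sub>R k x - bump a b n x *\<^sub>R c)"
      by (simp add: algebra_simps)
    also have "\<dots> = (LINT x|lebesgue. bump a b n x *\<^sub>R k x) - J *\<^sub>R c"
      using bL[of a b n] bL1[of a b n] by (subst Bochner_Integration.integral_diff) (auto simp: J_def)
    finally show ?thesis using e by simp
  qed
  define h where "h x = k x - c" for x
  have h: "h absolutely_integrable_on {a..b}" for a b
    unfolding h_def by (intro set_integral_diff k absolutely_integrable_continuous_real) auto
  have hz: "(LINT x:{a<..<b}|lebesgue. h x) = 0" if "a \<le> b" for a b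
  proof -
    have "(\<lambda>n. LINT x|lebesgue. bump a b n x *\<^sub>R h x) \<longlonglongrightarrow> (LINT x|lebesgue. indicat_real {a<..<b} x *\<^sub>R h x)"
    proof (rule integral_dominated_convergence[where w = "\<lambda>x. indicat_real {a..b} x *\<^sub>R norm (h x)"])
      have "set_integrable lebesgue {a<..<b} h"
        by (rule set_integrable_subset[OF h[of a b]]) auto
      then show "(\<lambda>x. indicat_real {a<..<b} x *\<^sub>R h x) \<in> borel_measurable lebesgue"
        by (auto simp: set_integrable_def)
      show "integrable lebesgue (\<lambda>x. indicat_real {a..b} x *\<^sub>R norm (h x))"
        using absolutely_integrable_norm[OF h[of a b]] by (simp add: set_integrable_def o_def)
      show "AE x in lebesgue. (\<lambda>n. bump a b n x *\<^sub>R h x) \<longlonglongrightarrow> indicat_real {a<..<b} x *\<^sub>R h x"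
        by (intro AE_I2 tendsto_intros bump_tendsto_indicator)
      show "(\<lambda>x. bump a b n x *\<^sub>R h x) \<in> borel_measurable lebesgue" for n
      proof -
        have eq: "(\<lambda>x. bump a b n x *\<^sub>R h x) = (\<lambda>x. bump a b n x *\<^sub>R (indicat_real {a..b} x *\<^sub>R h x))"
        proof
          fix x show "bump a b n x *\<^sub>R h x = bump a b n x *\<^sub>R (indicat_real {a..b} x *\<^sub>R h x)"
            by (cases "x \<in> {a..b}") (simp_all add: bump_outside_closed)
        qed
        have "(\<lambda>x. indicat_real {a..b} x *\<^sub>R h x) \<in> borel_measurable lebesgue"
          using h[of a b] by (auto simp: set_integrable_def)
        then show ?thesis
          by (subst eq) (rule borel_measurable_scaleR[OF borel_measurable_integrable[OF bL1(1)]])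
      qed
      show "AE x in lebesgue. norm (bump a b n x *\<^sub>R h x) \<le> indicat_real {a..b} x *\<^sub>R norm (h x)" for n
      proof (intro AE_I2)
        fix x show "norm (bump a b n x *\<^sub>R h x) \<le> indicat_real {a..b} x *\<^sub>R norm (h x)"
          by (cases "x \<in> {a..b}") (simp_all add: bump_outside_closed bump_bounds abs_of_nonneg mult_left_le_one_le)
      qed
    qed
    moreover have "(\<lambda>n. LINT x|lebesgue. bump a b n x *\<^sub>R h x) = (\<lambda>n. 0)"
      using main[OF that] by (simp add: h_def)
    ultimately show ?thesis
      by (simp add: set_lebesgue_integral_def LIMSEQ_const_iff)
  qed
  have hz': "(LINT x:{a<..b}|lebesgue. h x) = 0" if "a \<le> b" for a b
  proof -
    have "AE x in lebesgue. x \<noteq> b"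
      by (rule AE_completion) (rule AE_lborel_singleton)
    then have ae: "AE x in lebesgue. indicat_real {a<..b} x *\<^sub>R h x = indicat_real {a<..<b} x *\<^sub>R h x"
      by eventually_elim (auto simp: indicator_def)
    have "set_integrable lebesgue {a<..<b} h" "set_integrable lebesgue {a<..b} h"
      by (rule set_integrable_subset[OF h[of a b]]; auto)+
    then have "(LINT x:{a<..b}|lebesgue. h x) = (LINT x:{a<..<b}|lebesgue. h x)"
      unfolding set_lebesgue_integral_def
      by (intro integral_cong_AE ae) (auto simp: set_integrable_def)
    then show ?thesis using hz[OF that] by simp
  qed
  have "AE x in lebesgue. \<forall>N::nat. indicat_real {- real N<..real N} x *\<^sub>R h x = 0"
  proof (rule AE_all_countable[THEN iffD2], rule allI)
    fix N :: nat
    let ?g = "\<lambda>x. indicat_real {- real N<..real N} x *\<^sub>R h x"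
    show "AE x in lebesgue. ?g x = 0"
    proof (rule AE_zero_if_interval_integrals_zero)
      have "set_integrable lebesgue {- real N<..real N} h"
        by (rule set_integrable_subset[OF h[of "- real N" "real N"]]) auto
      then show "integrable lebesgue ?g" by (simp add: set_integrable_def)
      show "(LINT x|lebesgue. ?g x) = 0"
        using hz'[of "- real N" "real N"] by (simp add: set_lebesgue_integral_def)
      fix a b :: real assume "a \<le> b"
      have "(\<lambda>x. indicat_real {a<..b} x *\<^sub>R ?g x) = (\<lambda>x. indicat_real {max a (- real N)<..min b (real N)} x *\<^sub>R h x)"
        by (auto simp: indicator_def)
      then show "(LINT x:{a<..b}|lebesgue. ?g x) = 0"
        using hz'[of "max a (- real N)" "min b (real N)"]
        by (cases "max a (- real N) \<le> min b (real N)") (auto simp: set_lebesgue_integral_def)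
    qed
  qed
  then have "AE x in lebesgue. k x = c"
  proof eventually_elim
    case (elim x)
    obtain N :: nat where "\<bar>x\<bar> < real N" using reals_Archimedean2 by blast
    then show ?case using elim[rule_format, of N] by (auto simp: h_def indicator_def abs_less_iff split: if_splits)
  qed
  then show ?thesis by blast
qed

lemma primitive_exists:
  fixes f :: "real \<Rightarrow> 'a::euclidean_space"
  assumes f: "\<And>a b. f absolutely_integrable_on {a..b}"
  shows "\<exists>F. primitive F f"
proof -
  define F where "F x = (if 0 \<le> x then integral {0..x} f else - integral {x..0} f)" for x
  have int: "f integrable_on {a..b}" for a b using f by (simp add: absolutely_integrable_on_def)
  have "F b - F a = integral {a..b} f" if "a \<le> b" for a b
  proof -
    consider "0 \<le> a" | "b < 0" | "a < 0" "0 \<le> b" by linarith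
    then show ?thesis
    proof cases
      case 1
      have "integral {0..a} f + integral {a..b} f = integral {0..b} f"
        by (rule Henstock_Kurzweil_Integration.integral_combine) (use 1 that int in auto)
      then show ?thesis using 1 that by (simp add: F_def) (metis add_diff_cancel_left')
    next
      case 2
      have "integral {a..b} f + integral {b..0} f = integral {a..0} f"
        by (rule Henstock_Kurzweil_Integration.integral_combine) (use 2 that int in auto)
      then show ?thesis using 2 that by (simp add: F_def) (metis add_diff_cancel_right')
    next
      case 3
      have "integral {a..0} f + integral {0..b} f = integral {a..b} f"
        by (rule Henstock_Kurzweil_Integration.integral_combine) (use 3 that int in auto)
      then show ?thesis using 3 that by (simp add: F_def add.commute)
    qed
  qed
  then show ?thesis using f unfolding primitive_def by blast
qed

text \<open>Both \<open>f\<close> and any primitive of \<open>f'\<close> have the weak derivative \<open>f'\<close>; their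
difference is constant by the lemma of du Bois-Reymond.\<close>

lemma weak_derivative_has_primitive:
  fixes f f' :: "real \<Rightarrow> complex"
  assumes f: "\<And>a b. f absolutely_integrable_on {a..b}" and f': "\<And>a b. f' absolutely_integrable_on {a..b}"
    and weak: "\<And>\<phi>. test_function \<phi> \<Longrightarrow>
      (LINT x|lebesgue. deriv \<phi> x *\<^sub>R f x) = - (LINT x|lebesgue. \<phi> x *\<^sub>R f' x)"
  shows "\<exists>F. (AE x in lebesgue. f x = F x) \<and> primitive F f'"
proof -
  obtain F where F: "primitive F f'" using primitive_exists[OF f'] by blast
  have "\<exists>c. AE x in lebesgue. f x - F x = c"
  proof (rule du_Bois_Reymond)
    have "F absolutely_integrable_on {a..b}" for a b
      by (intro absolutely_integrable_continuous_real primitive_continuous_on[OF F])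
    then show "(\<lambda>x. f x - F x) absolutely_integrable_on {a..b}" for a b
      by (intro set_integral_diff f)
    fix \<phi> assume \<phi>: "test_function \<phi>"
    note bp = test_function_by_parts[OF \<phi> F]
    obtain R where R: "\<And>x. x \<notin> {-R..R} \<Longrightarrow> deriv \<phi> x = 0"
      using test_function_props(3)[OF \<phi>] by blast
    have "integrable lebesgue (\<lambda>x. deriv \<phi> x *\<^sub>R f x)"
    proof (rule lebesgue_integral_support(1))
      show "(\<lambda>x. deriv \<phi> x *\<^sub>R f x) absolutely_integrable_on {-R..R}"
        unfolding scaleR_conv_of_real
        by (intro absint_mult_continuous f continuous_on_of_real continuous_on_subset[OF test_function_props(2)[OF \<phi>]]) simp
    qed (simp add: R)
    with bp(2) have "(LINT x|lebesgue. deriv \<phi> x *\<^sub>R (f x - F x))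
        = (LINT x|lebesgue. deriv \<phi> x *\<^sub>R f x) - (LINT x|lebesgue. deriv \<phi> x *\<^sub>R F x)"
      by (simp add: scaleR_diff_right)
    then show "(LINT x|lebesgue. deriv \<phi> x *\<^sub>R (f x - F x)) = 0"
      using weak[OF \<phi>] bp(1) by simp
  qed
  then obtain c where c: "AE x in lebesgue. f x - F x = c" by blast
  have "primitive (\<lambda>x. F x + c) f'"
    using primitive_add[OF F primitive_const[of c]] by simp
  moreover have "AE x in lebesgue. f x = F x + c"
    using c
  proof eventually_elim
    case (elim x)
    have "f x = F x + (f x - F x)" by simp
    then show ?case unfolding elim .
  qed
  ultimately show ?thesis by (intro exI[of _ "\<lambda>x. F x + c"] conjI)
qed

section \<open>Weak solutions of the Dirac system and their energy\<close>

text \<open>The equation \<open>(L\<^sub>m - z) u = h\<close> solved for the derivatives, with no integrability of \<open>u\<close> or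
\<open>h\<close> at infinity.\<close>

definition dirac_sol :: "real \<Rightarrow> complex \<Rightarrow> (real \<Rightarrow> complex^2) \<Rightarrow> (real \<Rightarrow> complex^2) \<Rightarrow> bool" where
  "dirac_sol m z h u \<longleftrightarrow>
     primitive (\<lambda>x. u x $ 1) (\<lambda>x. (of_real m + z - \<i> * of_real (sgn x)) * u x $ 2 + h x $ 2) \<and>
     primitive (\<lambda>x. u x $ 2) (\<lambda>x. (of_real m - z + \<i> * of_real (sgn x)) * u x $ 1 - h x $ 1)"

lemma dirac_solD:
  assumes "dirac_sol m z h u"
  shows "primitive (\<lambda>x. u x $ 1) (\<lambda>x. (of_real m + z - \<i> * of_real (sgn x)) * u x $ 2 + h x $ 2)"
    "primitive (\<lambda>x. u x $ 2) (\<lambda>x. (of_real m - z + \<i> * of_real (sgn x)) * u x $ 1 - h x $ 1)"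
  using assms by (auto simp: dirac_sol_def)

lemma dirac_sol_add:
  assumes "dirac_sol m z h u" "dirac_sol m z h' u'"
  shows "dirac_sol m z (\<lambda>x. h x + h' x) (\<lambda>x. u x + u' x)"
  unfolding dirac_sol_def
  by (intro conjI primitive_cong[OF primitive_add[OF dirac_solD(1)[OF assms(1)] dirac_solD(1)[OF assms(2)]]]
      primitive_cong[OF primitive_add[OF dirac_solD(2)[OF assms(1)] dirac_solD(2)[OF assms(2)]]])
     (simp_all add: algebra_simps)

lemma dirac_sol_cmult:
  assumes "dirac_sol m z h u" shows "dirac_sol m z (\<lambda>x. c *s h x) (\<lambda>x. c *s u x)"
  unfolding dirac_sol_def
  by (intro conjI primitive_cong[OF primitive_cmult[OF dirac_solD(1)[OF assms], of c]]
      primitive_cong[OF primitive_cmult[OF dirac_solD(2)[OF assms], of c]])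
     (simp_all add: algebra_simps)

lemma dirac_sol_diff: "dirac_sol m z h u \<Longrightarrow> dirac_sol m z h' u' \<Longrightarrow> dirac_sol m z (\<lambda>x. h x - h' x) (\<lambda>x. u x - u' x)"
  using dirac_sol_add[OF _ dirac_sol_cmult[of m z h' u' "-1"], of h u]
  by (simp add: vector_sneg_minus1[symmetric])

lemma dirac_sol_cong_AE:
  assumes "dirac_sol m z h u" "AE x in lebesgue. h x = h' x" shows "dirac_sol m z h' u"
  using assms unfolding dirac_sol_def
  by (auto elim!: primitive_cong_AE)

text \<open>Changing the spectral parameter only changes the source.\<close>

lemma dirac_sol_shift: "dirac_sol m z h u \<longleftrightarrow> dirac_sol m z0 (\<lambda>x. h x + (z - z0) *s u x) u"
proof -
  have "(\<lambda>x. (of_real m + z - \<i> * of_real (sgn x)) * u x $ 2 + h x $ 2)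
    = (\<lambda>x. (of_real m + z0 - \<i> * of_real (sgn x)) * u x $ 2 + (h x + (z - z0) *s u x) $ 2)"
    "(\<lambda>x. (of_real m - z + \<i> * of_real (sgn x)) * u x $ 1 - h x $ 1)
    = (\<lambda>x. (of_real m - z0 + \<i> * of_real (sgn x)) * u x $ 1 - (h x + (z - z0) *s u x) $ 1)"
    by (auto simp: algebra_simps)
  then show ?thesis unfolding dirac_sol_def by simp
qed

lemma vec2_eq_vector: "(v :: complex^2) = vector [v $ 1, v $ 2]"
  by (simp add: vec_eq_iff forall_2)

lemma bounded_linear_vec2: "bounded_linear (\<lambda>a::complex. vector [a, 0] :: complex^2)"
  "bounded_linear (\<lambda>a::complex. vector [0, a] :: complex^2)"
  by (auto intro!: linear_conv_bounded_linear[THEN iffD1] linearI simp: vec_eq_iff forall_2)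

lemma vec2_decomp: "(vector [a, b] :: complex^2) = vector [a, 0] + vector [0, b]"
  by (simp add: vec_eq_iff forall_2)

lemma vec2_measurable:
  fixes f :: "'a \<Rightarrow> complex^2"
  shows "f \<in> borel_measurable M \<longleftrightarrow> (\<lambda>x. f x $ 1) \<in> borel_measurable M \<and> (\<lambda>x. f x $ 2) \<in> borel_measurable M"
proof safe
  have lin: "(\<lambda>x. L (g x)) \<in> borel_measurable M" if "bounded_linear L" "g \<in> borel_measurable M"
    for L :: "'b::real_normed_vector \<Rightarrow> 'c::real_normed_vector" and g
    using measurable_compose[OF that(2) borel_measurable_continuous_onI[OF linear_continuous_on[OF that(1)]]] .
  show "(\<lambda>x. f x $ 1) \<in> borel_measurable M" "(\<lambda>x. f x $ 2) \<in> borel_measurable M" if "f \<in> borel_measurable M"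
    using lin[OF bounded_linear_vec_nth that] by auto
  assume m: "(\<lambda>x. f x $ 1) \<in> borel_measurable M" "(\<lambda>x. f x $ 2) \<in> borel_measurable M"
  have "f = (\<lambda>x. vector [f x $ 1, 0] + vector [0, f x $ 2])"
    by (rule ext) (metis vec2_decomp vec2_eq_vector)
  then show "f \<in> borel_measurable M"
    using borel_measurable_add[OF lin[OF bounded_linear_vec2(1) m(1)] lin[OF bounded_linear_vec2(2) m(2)]] by simp
qed

lemma vec2_continuous:
  fixes f :: "real \<Rightarrow> complex^2"
  assumes "continuous_on S (\<lambda>x. f x $ 1)" "continuous_on S (\<lambda>x. f x $ 2)"
  shows "continuous_on S f"
proof -
  have "continuous_on S (\<lambda>x. vector [f x $ 1, 0] + vector [0, f x $ 2] :: complex^2)"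
    by (intro continuous_on_add bounded_linear.continuous_on[OF bounded_linear_vec2(1)]
        bounded_linear.continuous_on[OF bounded_linear_vec2(2)] assms)
  then show ?thesis by (simp add: vec2_decomp[symmetric] vec2_eq_vector[symmetric])
qed

lemma norm_vec2_sq: "(norm (v :: complex^2))\<^sup>2 = (cmod (v $ 1))\<^sup>2 + (cmod (v $ 2))\<^sup>2"
  by (simp add: norm_vec_def L2_set_def sum_2)

lemma sum_prod_le_norms:
  fixes v w :: "complex^2"
  shows "cmod (v $ 1) * cmod (w $ 1) + cmod (v $ 2) * cmod (w $ 2) \<le> norm v * norm w"
proof -
  have "(cmod (v $ 1) * cmod (w $ 1) + cmod (v $ 2) * cmod (w $ 2))\<^sup>2 \<le> (norm v * norm w)\<^sup>2"
    unfolding power_mult_distrib norm_vec2_sq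
    using zero_le_power2[of "cmod (v $ 1) * cmod (w $ 2) - cmod (v $ 2) * cmod (w $ 1)"]
    by (simp add: power2_eq_square algebra_simps)
  then show ?thesis by (rule power2_le_imp_le) simp
qed

lemma dirac_sol_continuous: "dirac_sol m z h u \<Longrightarrow> continuous_on S u"
  unfolding dirac_sol_def by (intro vec2_continuous) (auto intro: primitive_continuous_on)

text \<open>The real mass drops out of the imaginary part. This is why no bound below depends on \<open>m\<close>
as long as only the energy is used.\<close>

lemma dirac_sol_energy_primitive:
  assumes "dirac_sol m z h u"
  shows "primitive (\<lambda>x. Im (u x $ 1 * cnj (u x $ 2)))
    (\<lambda>x. (Im z - sgn x) * (norm (u x))\<^sup>2 + Im (h x $ 2 * cnj (u x $ 2) - u x $ 1 * cnj (h x $ 1)))"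
proof -
  have P: "primitive (\<lambda>x. u x $ 1) (\<lambda>x. (of_real m + z - \<i> * of_real (sgn x)) * u x $ 2 + h x $ 2)"
    "primitive (\<lambda>x. u x $ 2) (\<lambda>x. (of_real m - z + \<i> * of_real (sgn x)) * u x $ 1 - h x $ 1)"
    using assms by (auto simp: dirac_sol_def)
  show ?thesis
  proof (rule primitive_cong[OF primitive_linear[OF bounded_linear_Im primitive_mult[OF P(1) primitive_linear[OF bounded_linear_cnj P(2)]]] refl])
    fix x
    show "Im (((of_real m + z - \<i> * of_real (sgn x)) * u x $ 2 + h x $ 2) * cnj (u x $ 2)
        + u x $ 1 * cnj ((of_real m - z + \<i> * of_real (sgn x)) * u x $ 1 - h x $ 1))
      = (Im z - sgn x) * (norm (u x))\<^sup>2 + Im (h x $ 2 * cnj (u x $ 2) - u x $ 1 * cnj (h x $ 1))"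
      unfolding norm_vec2_sq cmod_power2
      by (simp add: algebra_simps power2_eq_square)
  qed
qed

text \<open>The energy identity, multiplied by the sign of \<open>Im z\<close> and integrated. The function \<open>G\<close> majorises the
source term, and the boundary term is at most half of \<open>\<bar>u\<bar>\<^sup>2\<close> at the two ends.\<close>

lemma dirac_sol_energy:
  assumes s: "dirac_sol m z h u" and z: "1 < \<bar>Im z\<bar>" and ab: "a \<le> b"
    and G: "G integrable_on {a..b}" "\<And>x. norm (h x) * norm (u x) \<le> G x"
  shows "(\<bar>Im z\<bar> - 1) * integral {a..b} (\<lambda>x. (norm (u x))\<^sup>2)
    \<le> integral {a..b} G + ((norm (u a))\<^sup>2 + (norm (u b))\<^sup>2) / 2"
proof -
  let ?J = "\<lambda>x. Im (u x $ 1 * cnj (u x $ 2))"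
  let ?j = "\<lambda>x. (Im z - sgn x) * (norm (u x))\<^sup>2 + Im (h x $ 2 * cnj (u x $ 2) - u x $ 1 * cnj (h x $ 1))"
  note P = primitiveD[OF dirac_sol_energy_primitive[OF s] ab]
  have J: "\<bar>?J x\<bar> \<le> (norm (u x))\<^sup>2 / 2" for x
  proof -
    have "\<bar>?J x\<bar> \<le> cmod (u x $ 1) * cmod (u x $ 2)"
      using abs_Im_le_cmod[of "u x $ 1 * cnj (u x $ 2)"] by (simp add: norm_mult)
    also have "\<dots> \<le> (norm (u x))\<^sup>2 / 2"
      using sum_squares_bound[of "cmod (u x $ 1)" "cmod (u x $ 2)"] by (simp add: norm_vec2_sq)
    finally show ?thesis .
  qed
  have iu: "(\<lambda>x. (\<bar>Im z\<bar> - 1) * (norm (u x))\<^sup>2) integrable_on {a..b}"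
    by (intro integrable_continuous_real continuous_intros dirac_sol_continuous[OF s])
  have "integral {a..b} (\<lambda>x. (\<bar>Im z\<bar> - 1) * (norm (u x))\<^sup>2) \<le> integral {a..b} (\<lambda>x. sgn (Im z) * ?j x + G x)"
  proof (rule integral_le[OF iu])
    show "(\<lambda>x. sgn (Im z) * ?j x + G x) integrable_on {a..b}"
      by (intro integrable_add integrable_on_mult_right P(3) G(1))
    fix x
    have 1: "(\<bar>Im z\<bar> - 1) * (norm (u x))\<^sup>2 \<le> sgn (Im z) * ((Im z - sgn x) * (norm (u x))\<^sup>2)"
    proof -
      have "\<bar>Im z\<bar> - 1 \<le> sgn (Im z) * (Im z - sgn x)" using z by (auto simp: sgn_if)
      from mult_right_mono[OF this zero_le_power2[of "norm (u x)"]] show ?thesis by (simp only: mult.assoc)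
    qed
    have "cmod (h x $ 2 * cnj (u x $ 2) - u x $ 1 * cnj (h x $ 1))
        \<le> cmod (h x $ 1) * cmod (u x $ 1) + cmod (h x $ 2) * cmod (u x $ 2)"
      by (rule order.trans[OF norm_triangle_ineq4]) (simp add: norm_mult)
    then have "\<bar>Im (h x $ 2 * cnj (u x $ 2) - u x $ 1 * cnj (h x $ 1))\<bar> \<le> G x"
      using abs_Im_le_cmod[of "h x $ 2 * cnj (u x $ 2) - u x $ 1 * cnj (h x $ 1)"]
        sum_prod_le_norms[of "h x" "u x"] G(2)[of x] by linarith
    then have 2: "0 \<le> sgn (Im z) * Im (h x $ 2 * cnj (u x $ 2) - u x $ 1 * cnj (h x $ 1)) + G x"
      by (auto simp: sgn_if abs_le_iff)
    show "(\<bar>Im z\<bar> - 1) * (norm (u x))\<^sup>2 \<le> sgn (Im z) * ?j x + G x"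
      using 1 2 unfolding distrib_left by linarith
  qed
  also have "\<dots> = sgn (Im z) * (?J b - ?J a) + integral {a..b} G"
    using P G(1) by (simp add: Henstock_Kurzweil_Integration.integral_add integrable_on_mult_right)
  also have "sgn (Im z) * (?J b - ?J a) \<le> ((norm (u a))\<^sup>2 + (norm (u b))\<^sup>2) / 2"
  proof -
    have "sgn (Im z) * (?J b - ?J a) \<le> \<bar>?J b\<bar> + \<bar>?J a\<bar>"
    proof (cases "0 < Im z")
      case True then have "sgn (Im z) = 1" by simp
      then show ?thesis by (simp only: mult_1)
    next
      case False then have "sgn (Im z) = - 1" using z by simp
      then show ?thesis by (simp only: mult_minus1)
    qed
    then show ?thesis using J[of a] J[of b] unfolding add_divide_distrib by linarith
  qed
  finally show ?thesis by simp
qed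

lemma integrable_if_energy_bounded:
  fixes \<phi> :: "real \<Rightarrow> real"
  assumes \<phi>: "continuous_on UNIV \<phi>" "\<And>x. 0 \<le> \<phi> x" and B: "\<And>n::nat. integral {- real n..real n} \<phi> \<le> c"
  shows "integrable lebesgue \<phi>"
proof -
  define f where "f n x = indicat_real {- real n..real n} x * \<phi> x" for n x
  have ai: "\<phi> absolutely_integrable_on {a..b}" for a b
    by (intro absolutely_integrable_continuous_real continuous_on_subset[OF \<phi>(1)]) auto
  have int: "integrable lebesgue (f n)" "(LINT x|lebesgue. f n x) = integral {- real n..real n} \<phi>" for n
    using ai[of "- real n" "real n"] set_lebesgue_integral_eq_integral(2)[OF ai[of "- real n" "real n"]]
    by (simp_all add: set_integrable_def set_lebesgue_integral_def f_def[abs_def])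
  have mono: "f n x \<le> f k x" if "n \<le> k" for n k x
    using that \<phi>(2)[of x] by (auto simp: f_def indicator_def)
  have "incseq (\<lambda>n. LINT x|lebesgue. f n x)"
    by (intro incseq_SucI integral_mono int mono) auto
  then obtain L where L: "(\<lambda>n. LINT x|lebesgue. f n x) \<longlonglongrightarrow> L"
    using B int(2) by (metis incseq_convergent)
  show ?thesis
  proof (rule integrable_monotone_convergence[OF int(1) _ _ L])
    show "AE x in lebesgue. mono (\<lambda>n. f n x)" by (auto simp: mono_def mono)
    show "AE x in lebesgue. (\<lambda>n. f n x) \<longlonglongrightarrow> \<phi> x"
    proof (intro AE_I2 tendsto_eventually)
      fix x :: real
      obtain N :: nat where "\<bar>x\<bar> \<le> real N" using real_arch_simple by blast
      then show "\<forall>\<^sub>F n in sequentially. f n x = \<phi> x"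
        by (intro eventually_sequentiallyI[of N]) (auto simp: f_def indicator_def abs_le_iff)
    qed
    show "\<phi> \<in> borel_measurable lebesgue"
      using borel_measurable_continuous_onI[OF \<phi>(1)] by (simp add: measurable_completion)
  qed
qed

text \<open>In each of the intervals \<open>[n, n + 1]\<close> and \<open>[- n - 1, - n]\<close> there is a point at which \<open>\<phi>\<close> is
at most its integral over the interval, which tends to zero by integrability. Along these points the boundary
terms disappear, although \<open>\<phi>\<close> itself need not tend to zero.\<close>

lemma integral_bound_if_energy:
  fixes \<phi> :: "real \<Rightarrow> real"
  assumes \<phi>: "continuous_on UNIV \<phi>" "\<And>x. 0 \<le> \<phi> x" "integrable lebesgue \<phi>"
    and E: "\<And>a b. a \<le> b \<Longrightarrow> \<kappa> * integral {a..b} \<phi> \<le> c + d * (\<phi> a + \<phi> b)"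
    and \<kappa>: "0 \<le> \<kappa>" and d: "0 \<le> d"
  shows "\<kappa> * (LINT x|lebesgue. \<phi> x) \<le> c"
proof -
  have ai: "\<phi> absolutely_integrable_on {a..b}" for a b
    by (intro absolutely_integrable_continuous_real continuous_on_subset[OF \<phi>(1)]) auto
  have hk: "(LINT x|lebesgue. indicat_real {a..b} x * \<phi> x) = integral {a..b} \<phi>" for a b
    using set_lebesgue_integral_eq_integral(2)[OF ai[of a b]] by (simp add: set_lebesgue_integral_def)
  have meas[measurable]: "\<phi> \<in> borel_measurable lebesgue" using \<phi>(3) by auto
  have conv: "(\<lambda>n. integral {p n..q n} \<phi>) \<longlonglongrightarrow> (LINT x|lebesgue. l x * \<phi> x)"
    if l: "\<And>x. (\<lambda>n. indicat_real {p n..q n} x) \<longlonglongrightarrow> l x" "l \<in> borel_measurable lebesgue" for p q :: "nat \<Rightarrow> real" and l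
    unfolding hk[symmetric]
  proof (rule integral_dominated_convergence[OF _ _ \<phi>(3)])
    show "AE x in lebesgue. (\<lambda>n. indicat_real {p n..q n} x * \<phi> x) \<longlonglongrightarrow> l x * \<phi> x"
      by (intro AE_I2 tendsto_intros l)
    show "AE x in lebesgue. norm (indicat_real {p n..q n} x * \<phi> x) \<le> \<phi> x" for n
      using \<phi>(2) by (auto simp: indicator_def)
    show "(\<lambda>x. indicat_real {p n..q n} x * \<phi> x) \<in> borel_measurable lebesgue" for n
      by (intro borel_measurable_times meas borel_measurable_indicator) simp
    show "(\<lambda>x. l x * \<phi> x) \<in> borel_measurable lebesgue"
      by (intro borel_measurable_times meas l(2))
  qed
  have lim1: "(\<lambda>n. integral {- real n..real n} \<phi>) \<longlonglongrightarrow> (LINT x|lebesgue. 1 * \<phi> x)"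
  proof (rule conv)
    fix x :: real
    obtain N :: nat where "\<bar>x\<bar> \<le> real N" using real_arch_simple by blast
    then show "(\<lambda>n. indicat_real {- real n..real n} x) \<longlonglongrightarrow> 1"
      by (intro tendsto_eventually eventually_sequentiallyI[of N]) (auto simp: indicator_def abs_le_iff)
  qed auto
  have lim2: "(\<lambda>n. integral {real n..real n + 1} \<phi>) \<longlonglongrightarrow> (LINT x|lebesgue. 0 * \<phi> x)"
    and lim3: "(\<lambda>n. integral {- real n - 1..- real n} \<phi>) \<longlonglongrightarrow> (LINT x|lebesgue. 0 * \<phi> x)"
  proof (rule_tac[!] conv)
    fix x :: real
    obtain N :: nat where N: "\<bar>x\<bar> < real N" using reals_Archimedean2 by blast
    show "(\<lambda>n. indicat_real {real n..real n + 1} x) \<longlonglongrightarrow> 0"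
      using N by (intro tendsto_eventually eventually_sequentiallyI[of N]) (auto simp: indicator_def)
    show "(\<lambda>n. indicat_real {- real n - 1..- real n} x) \<longlonglongrightarrow> 0"
      using N by (intro tendsto_eventually eventually_sequentiallyI[of N]) (auto simp: indicator_def)
  qed auto
  \<comment> \<open>A minimum over an interval of length one is at most the integral.\<close>
  have pick: "\<exists>x\<in>{a..a+1}. \<phi> x \<le> integral {a..a+1} \<phi>" for a
  proof -
    obtain x where x: "x \<in> {a..a+1}" "\<And>y. y \<in> {a..a+1} \<Longrightarrow> \<phi> x \<le> \<phi> y"
      using continuous_attains_inf[of "{a..a+1}" \<phi>] continuous_on_subset[OF \<phi>(1)] by force
    have "integral {a..a+1} (\<lambda>_. \<phi> x) \<le> integral {a..a+1} \<phi>"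
      by (rule integral_le) (use x ai in \<open>auto simp: absolutely_integrable_on_def\<close>)
    then show ?thesis using x by auto
  qed
  have "\<kappa> * integral {- real n..real n} \<phi> \<le> c + d * (integral {- real n - 1..- real n} \<phi> + integral {real n..real n + 1} \<phi>)" for n
  proof -
    obtain b where b: "b \<in> {real n..real n + 1}" "\<phi> b \<le> integral {real n..real n + 1} \<phi>" using pick by blast
    obtain a where a: "a \<in> {- real n - 1..- real n}" "\<phi> a \<le> integral {- real n - 1..- real n} \<phi>"
      using pick[of "- real n - 1"] by auto
    have "integral {- real n..real n} \<phi> \<le> integral {a..b} \<phi>"
      by (rule integral_subset_le) (use a b ai \<phi>(2) in \<open>auto simp: absolutely_integrable_on_def\<close>)
    then have "\<kappa> * integral {- real n..real n} \<phi> \<le> \<kappa> * integral {a..b} \<phi>"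
      using \<kappa> by (rule mult_left_mono)
    also have "\<dots> \<le> c + d * (\<phi> a + \<phi> b)" using a b by (intro E) auto
    also have "\<dots> \<le> c + d * (integral {- real n - 1..- real n} \<phi> + integral {real n..real n + 1} \<phi>)"
      using a b d by (intro add_mono mult_left_mono) auto
    finally show ?thesis .
  qed
  then have "\<kappa> * (LINT x|lebesgue. 1 * \<phi> x) \<le> c + d * ((LINT x|lebesgue. 0 * \<phi> x) + (LINT x|lebesgue. 0 * \<phi> x))"
    by (intro LIMSEQ_le[OF tendsto_mult[OF tendsto_const lim1]
          tendsto_add[OF tendsto_const tendsto_mult[OF tendsto_const tendsto_add[OF lim3 lim2]]]]) auto
  then show ?thesis by simp
qed

lemma square_integrable_continuous:
  fixes u :: "real \<Rightarrow> complex^2"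
  assumes "continuous_on UNIV u"
  shows "square_integrable u \<longleftrightarrow> integrable lebesgue (\<lambda>x. (norm (u x))\<^sup>2)"
  using borel_measurable_continuous_onI[OF assms]
  by (auto simp: square_integrable_def measurable_completion)

text \<open>A bounded solution is square integrable: first the boundary terms are merely bounded, which
gives integrability, and then they disappear, which gives the sharp constant. The part \<open>r \<bar>u\<bar>\<^sup>2\<close> of the
source term is absorbed on the left.\<close>

lemma dirac_sol_square_integrable_bounded:
  assumes s: "dirac_sol m z h u" and z: "1 < \<bar>Im z\<bar>" and S: "\<And>x. norm (u x) \<le> S"
    and G: "\<And>a b. G integrable_on {a..b}" "\<And>a b. integral {a..b} G \<le> c" 
      "\<And>x. norm (h x) * norm (u x) \<le> r * (norm (u x))\<^sup>2 + G x" and r: "r < \<bar>Im z\<bar> - 1" "0 \<le> r"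
  shows "square_integrable u" "(\<bar>Im z\<bar> - 1 - r) * (LINT x|lebesgue. (norm (u x))\<^sup>2) \<le> c"
proof -
  note cu = dirac_sol_continuous[OF s]
  have E: "(\<bar>Im z\<bar> - 1 - r) * integral {a..b} (\<lambda>x. (norm (u x))\<^sup>2)
      \<le> c + (1/2) * ((norm (u a))\<^sup>2 + (norm (u b))\<^sup>2)" if ab: "a \<le> b" for a b
  proof -
    have iu: "(\<lambda>x. r * (norm (u x))\<^sup>2) integrable_on {a..b}"
      by (intro integrable_continuous_real continuous_intros cu)
    have "(\<bar>Im z\<bar> - 1) * integral {a..b} (\<lambda>x. (norm (u x))\<^sup>2)
        \<le> integral {a..b} (\<lambda>x. r * (norm (u x))\<^sup>2 + G x) + ((norm (u a))\<^sup>2 + (norm (u b))\<^sup>2) / 2"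
      by (rule dirac_sol_energy[OF s z ab integrable_add[OF iu G(1)] G(3)])
    also have "integral {a..b} (\<lambda>x. r * (norm (u x))\<^sup>2 + G x)
        = r * integral {a..b} (\<lambda>x. (norm (u x))\<^sup>2) + integral {a..b} G"
      using iu G(1) by (simp add: Henstock_Kurzweil_Integration.integral_add)
    finally show ?thesis using G(2)[of a b] unfolding left_diff_distrib by (simp add: add_divide_distrib)
  qed
  have cphi: "continuous_on UNIV (\<lambda>x. (norm (u x))\<^sup>2)" by (intro continuous_intros cu)
  have bu: "(norm (u x))\<^sup>2 \<le> S\<^sup>2" for x using S[of x] by (intro power_mono) auto
  have int: "integrable lebesgue (\<lambda>x. (norm (u x))\<^sup>2)"
  proof (rule integrable_if_energy_bounded[OF cphi, where c = "(c + S\<^sup>2) / (\<bar>Im z\<bar> - 1 - r)"])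
    fix n :: nat
    have "(\<bar>Im z\<bar> - 1 - r) * integral {- real n..real n} (\<lambda>x. (norm (u x))\<^sup>2) \<le> c + S\<^sup>2"
      using E[of "- real n" "real n"] bu[of "- real n"] bu[of "real n"] by (simp add: field_simps)
    then show "integral {- real n..real n} (\<lambda>x. (norm (u x))\<^sup>2) \<le> (c + S\<^sup>2) / (\<bar>Im z\<bar> - 1 - r)"
      using r by (simp add: pos_le_divide_eq mult.commute)
  qed simp
  then show "square_integrable u" by (simp add: square_integrable_continuous[OF cu])
  show "(\<bar>Im z\<bar> - 1 - r) * (LINT x|lebesgue. (norm (u x))\<^sup>2) \<le> c"
    by (rule integral_bound_if_energy[OF cphi _ int E]) (use r in auto)
qed

lemma dirac_sol_homogeneous_zero:
  assumes s: "dirac_sol m z (\<lambda>_. 0) u" and z: "1 < \<bar>Im z\<bar>" and u: "square_integrable u"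
  shows "u x = 0"
proof -
  note cu = dirac_sol_continuous[OF s]
  have cphi: "continuous_on UNIV (\<lambda>x. (norm (u x))\<^sup>2)" by (intro continuous_intros cu)
  have "(\<bar>Im z\<bar> - 1) * (LINT x|lebesgue. (norm (u x))\<^sup>2) \<le> 0"
  proof (rule integral_bound_if_energy[OF cphi])
    show "integrable lebesgue (\<lambda>x. (norm (u x))\<^sup>2)" using u by (simp add: square_integrable_def)
    show "(\<bar>Im z\<bar> - 1) * integral {a..b} (\<lambda>x. (norm (u x))\<^sup>2) \<le> 0 + (1/2) * ((norm (u a))\<^sup>2 + (norm (u b))\<^sup>2)"
      if "a \<le> b" for a b
      using dirac_sol_energy[OF s z that, of "\<lambda>_. 0"] integrable_0[of "{a..b}"] by simp
  qed (use z in auto)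
  then have "(LINT x|lebesgue. (norm (u x))\<^sup>2) \<le> 0"
    using z by (simp add: mult_le_0_iff)
  moreover have "0 \<le> (LINT x|lebesgue. (norm (u x))\<^sup>2)" by simp
  ultimately have "AE x in lebesgue. (norm (u x))\<^sup>2 = 0"
    using integral_nonneg_eq_0_iff_AE[of lebesgue "\<lambda>x. (norm (u x))\<^sup>2"] u by (simp add: square_integrable_def)
  then have "AE x in lebesgue. x \<in> {x. u x = 0}" by simp
  moreover have "closed {x. u x = 0}"
    by (intro closed_Collect_eq cu continuous_on_const)
  ultimately show ?thesis using mem_closed_if_AE_lebesgue by blast
qed

section \<open>The Green operator outside the strip\<close>

text \<open>The pairing is not conjugated, because the Dirac expression is symmetric with respect to the bilinear
form; this makes \<open>G\<close> below the variation of constants formula.\<close>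

definition dot :: "complex^2 \<Rightarrow> complex^2 \<Rightarrow> complex" where
  "dot v w = v $ 1 * w $ 1 + v $ 2 * w $ 2"

lemma norm_dot: "cmod (dot v w) \<le> norm v * norm w"
  using sum_prod_le_norms[of v w] norm_triangle_ineq[of "v $ 1 * w $ 1" "v $ 2 * w $ 2"]
  by (simp add: dot_def norm_mult)

text \<open>A Green function of \<open>L\<^sub>m - z\<close> off the strip: \<open>up\<close> and \<open>um\<close> decay at \<open>+\<infinity>\<close> and
\<open>-\<infinity>\<close>, \<open>W\<close> is their Wronskian, and \<open>decay\<close> bounds the norm of the kernel by
\<open>M exp (- \<delta> \<bar>x - y\<bar>)\<close>.\<close>

locale green =
  fixes m :: real and z :: complex and up um :: "real \<Rightarrow> complex^2" and W :: complex and M \<delta> :: real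
  assumes dirac_sol_up: "dirac_sol m z (\<lambda>_. 0) up" and dirac_sol_um: "dirac_sol m z (\<lambda>_. 0) um"
    and wronskian: "\<And>x. up x $ 1 * um x $ 2 - up x $ 2 * um x $ 1 = W" and W: "W \<noteq> 0"
    and decay: "\<And>x y. y \<le> x \<Longrightarrow> norm (up x) * norm (um y) \<le> M * cmod W * exp (- \<delta> * (x - y))"
    and \<delta>: "\<delta> = \<bar>Im z\<bar> - 1" "0 < \<delta>" and M: "1 \<le> M"
begin

text \<open>The common ground of \<open>L\<^sup>1\<close> and \<open>L\<^sup>2\<close> sources: the weakest condition under which the
exponential kernel can be integrated against \<open>h\<close>.\<close>

definition admissible_source :: "(real \<Rightarrow> complex^2) \<Rightarrow> bool" where
  "admissible_source h \<longleftrightarrow> h \<in> borel_measurable lebesgue \<and> integrable lebesgue (\<lambda>y. exp (- \<delta> * \<bar>y\<bar>) * norm (h y))"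

definition G :: "(real \<Rightarrow> complex^2) \<Rightarrow> real \<Rightarrow> complex^2" where
  "G h x = (1 / W) *s (integral {..x} (\<lambda>y. dot (um y) (h y)) *s up x
      + integral {x..} (\<lambda>y. dot (up y) (h y)) *s um x)"

lemma dot_measurable:
  assumes "continuous_on UNIV u" "h \<in> borel_measurable lebesgue"
  shows "(\<lambda>y. dot (u y) (h y)) \<in> borel_measurable lebesgue"
proof -
  have "u \<in> borel_measurable lebesgue"
    using borel_measurable_continuous_onI[OF assms(1)] by (simp add: measurable_completion)
  then have [measurable]: "(\<lambda>x. u x $ i) \<in> borel_measurable lebesgue" "(\<lambda>x. h x $ i) \<in> borel_measurable lebesgue" for i
    using assms(2) exhaust_2[of i] by (auto simp: vec2_measurable)
  show ?thesis unfolding dot_def by measurable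
qed

lemma exp_kernel_integrable:
  assumes "admissible_source h"
  shows "integrable lebesgue (\<lambda>y. exp (- \<delta> * \<bar>x - y\<bar>) * norm (h y))"
proof (rule Bochner_Integration.integrable_bound)
  show "integrable lebesgue (\<lambda>y. exp (\<delta> * \<bar>x\<bar>) * (exp (- \<delta> * \<bar>y\<bar>) * norm (h y)))"
    using assms by (intro integrable_mult_right) (simp add: admissible_source_def)
  have [measurable]: "h \<in> borel_measurable lebesgue" using assms by (simp add: admissible_source_def)
  have [measurable]: "(\<lambda>y::real. y) \<in> borel_measurable lebesgue" by (simp add: measurable_completion)
  show "(\<lambda>y. exp (- \<delta> * \<bar>x - y\<bar>) * norm (h y)) \<in> borel_measurable lebesgue" by measurable
  show "AE y in lebesgue. norm (exp (- \<delta> * \<bar>x - y\<bar>) * norm (h y)) \<le> norm (exp (\<delta> * \<bar>x\<bar>) * (exp (- \<delta> * \<bar>y\<bar>) * norm (h y)))"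
  proof (intro AE_I2)
    fix y
    have "\<delta> * \<bar>y\<bar> \<le> \<delta> * (\<bar>x\<bar> + \<bar>x - y\<bar>)" using \<delta> by (intro mult_left_mono) auto
    then have "exp (- \<delta> * \<bar>x - y\<bar>) \<le> exp (\<delta> * \<bar>x\<bar>) * exp (- \<delta> * \<bar>y\<bar>)"
      unfolding exp_add[symmetric] by (simp add: algebra_simps)
    then have "exp (- \<delta> * \<bar>x - y\<bar>) * norm (h y) \<le> exp (\<delta> * \<bar>x\<bar>) * exp (- \<delta> * \<bar>y\<bar>) * norm (h y)"
      by (rule mult_right_mono) simp
    then show "norm (exp (- \<delta> * \<bar>x - y\<bar>) * norm (h y)) \<le> norm (exp (\<delta> * \<bar>x\<bar>) * (exp (- \<delta> * \<bar>y\<bar>) * norm (h y)))"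
      by simp
  qed
qed

lemma up_nz: "up x \<noteq> 0" and um_nz: "um x \<noteq> 0"
  using wronskian[of x] W by auto

text \<open>Only the product of the two solutions is controlled. Here \<open>p\<close> is the value at \<open>x\<close> of one of them, and
dividing by it shows that the integral of the other one against \<open>h\<close> exists.\<close>

lemma half_line_kernel:
  assumes h: "admissible_source h" and A: "A \<in> sets lebesgue" and k: "continuous_on UNIV k" and p: "p \<noteq> 0"
    and b: "\<And>y. y \<in> A \<Longrightarrow> norm p * norm (k y) \<le> M * cmod W * exp (- \<delta> * \<bar>x - y\<bar>)"
  shows "(\<lambda>y. dot (k y) (h y)) absolutely_integrable_on A"
    and "norm p * cmod (integral A (\<lambda>y. dot (k y) (h y)))
      \<le> M * cmod W * (LINT y:A|lebesgue. exp (- \<delta> * \<bar>x - y\<bar>) * norm (h y))"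
proof -
  have c: "norm p * cmod (dot (k y) (h y)) \<le> M * cmod W * (exp (- \<delta> * \<bar>x - y\<bar>) * norm (h y))" if "y \<in> A" for y
  proof -
    have "norm p * cmod (dot (k y) (h y)) \<le> norm p * norm (k y) * norm (h y)"
      using norm_dot[of "k y" "h y"] by (simp add: mult.assoc mult_left_mono)
    also have "\<dots> \<le> M * cmod W * exp (- \<delta> * \<bar>x - y\<bar>) * norm (h y)"
      by (intro mult_right_mono b that) simp
    finally show ?thesis by (simp add: mult.assoc)
  qed
  have e: "set_integrable lebesgue A (\<lambda>y. exp (- \<delta> * \<bar>x - y\<bar>) * norm (h y))"
    unfolding set_integrable_def using exp_kernel_integrable[OF h, of x] A by (intro integrable_mult_indicator) auto
  have m: "(\<lambda>y. dot (k y) (h y)) \<in> borel_measurable lebesgue"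
    using h by (intro dot_measurable k) (simp add: admissible_source_def)
  have i: "set_integrable lebesgue A (\<lambda>y. norm p *\<^sub>R dot (k y) (h y))"
  proof (rule set_integrable_bound)
    show "set_integrable lebesgue A (\<lambda>y. M * cmod W * (exp (- \<delta> * \<bar>x - y\<bar>) * norm (h y)))"
      using e by (intro set_integrable_mult_right) auto
    show "set_borel_measurable lebesgue A (\<lambda>y. norm p *\<^sub>R dot (k y) (h y))"
      unfolding set_borel_measurable_def using m A by (intro borel_measurable_scaleR borel_measurable_indicator) auto
    show "AE y in lebesgue. y \<in> A \<longrightarrow> norm (norm p *\<^sub>R dot (k y) (h y)) \<le> norm (M * cmod W * (exp (- \<delta> * \<bar>x - y\<bar>) * norm (h y)))"
      using c M by (auto simp: abs_mult)
  qed
  show ai: "(\<lambda>y. dot (k y) (h y)) absolutely_integrable_on A"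
    using i p by (simp only: absolutely_integrable_on_scaleR_iff norm_eq_zero simp_thms)
  have "norm p * cmod (integral A (\<lambda>y. dot (k y) (h y)))
      = norm (LINT y:A|lebesgue. norm p *\<^sub>R dot (k y) (h y))"
    using set_lebesgue_integral_eq_integral(2)[OF ai] by simp
  also have "\<dots> \<le> (LINT y:A|lebesgue. norm (norm p *\<^sub>R dot (k y) (h y)))"
    using set_integral_norm_bound[OF i] by simp
  also have "\<dots> \<le> (LINT y:A|lebesgue. M * cmod W * (exp (- \<delta> * \<bar>x - y\<bar>) * norm (h y)))"
    by (rule set_integral_mono[OF set_integrable_norm[OF i] set_integrable_mult_right])
       (use e c in auto)
  finally show "norm p * cmod (integral A (\<lambda>y. dot (k y) (h y)))
      \<le> M * cmod W * (LINT y:A|lebesgue. exp (- \<delta> * \<bar>x - y\<bar>) * norm (h y))" by simp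
qed

lemma kernel_left:
  assumes "admissible_source h"
  shows "(\<lambda>y. dot (um y) (h y)) absolutely_integrable_on {..x}"
    and "norm (up x) * cmod (integral {..x} (\<lambda>y. dot (um y) (h y)))
      \<le> M * cmod W * (LINT y:{..x}|lebesgue. exp (- \<delta> * \<bar>x - y\<bar>) * norm (h y))"
proof -
  have "norm (up x) * norm (um y) \<le> M * cmod W * exp (- \<delta> * \<bar>x - y\<bar>)" if "y \<in> {..x}" for y
    using decay[of y x] that by simp
  note * = half_line_kernel[OF assms _ dirac_sol_continuous[OF dirac_sol_um] up_nz this]
  show "(\<lambda>y. dot (um y) (h y)) absolutely_integrable_on {..x}"
    "norm (up x) * cmod (integral {..x} (\<lambda>y. dot (um y) (h y)))
      \<le> M * cmod W * (LINT y:{..x}|lebesgue. exp (- \<delta> * \<bar>x - y\<bar>) * norm (h y))"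
    by (rule *; simp)+
qed

lemma kernel_right:
  assumes "admissible_source h"
  shows "(\<lambda>y. dot (up y) (h y)) absolutely_integrable_on {x..}"
    and "norm (um x) * cmod (integral {x..} (\<lambda>y. dot (up y) (h y)))
      \<le> M * cmod W * (LINT y:{x..}|lebesgue. exp (- \<delta> * \<bar>x - y\<bar>) * norm (h y))"
proof -
  have "norm (um x) * norm (up y) \<le> M * cmod W * exp (- \<delta> * \<bar>x - y\<bar>)" if "y \<in> {x..}" for y
    using decay[of x y] that by (simp add: mult.commute)
  note * = half_line_kernel[OF assms _ dirac_sol_continuous[OF dirac_sol_up] um_nz this]
  show "(\<lambda>y. dot (up y) (h y)) absolutely_integrable_on {x..}"
    "norm (um x) * cmod (integral {x..} (\<lambda>y. dot (up y) (h y)))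
      \<le> M * cmod W * (LINT y:{x..}|lebesgue. exp (- \<delta> * \<bar>x - y\<bar>) * norm (h y))"
    by (rule *; simp)+
qed

text \<open>In the derivative of \<open>G h\<close> the terms coming from the limits of integration combine, by the Wronskian, to the
source \<open>h\<close>.\<close>

lemma G_sol:
  assumes "admissible_source h" shows "dirac_sol m z h (G h)"
proof -
  note l = primitive_integral_left[OF kernel_left(1)[OF assms]]
  note r = primitive_cmult[OF primitive_integral_right[OF kernel_right(1)[OF assms]], of "-1"]
  have p: "\<And>x. up x $ 1 * um x $ 2 = W + up x $ 2 * um x $ 1"
    using wronskian by (metis diff_add_cancel add.commute)
  show ?thesis
    unfolding dirac_sol_def
  proof
    show "primitive (\<lambda>x. G h x $ 1) (\<lambda>x. (of_real m + z - \<i> * of_real (sgn x)) * G h x $ 2 + h x $ 2)"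
    proof (rule primitive_cong[OF primitive_cmult[OF primitive_add[OF primitive_mult[OF l dirac_solD(1)[OF dirac_sol_up]] primitive_mult[OF r dirac_solD(1)[OF dirac_sol_um]]], of "1 / W"]])
      fix x
      show "1 / W * (integral {..x} (\<lambda>y. dot (um y) (h y)) * up x $ 1 + - 1 * - integral {x..} (\<lambda>y. dot (up y) (h y)) * um x $ 1) = G h x $ 1"
        by (simp add: G_def add_divide_distrib)
      have "dot (um x) (h x) * up x $ 1 + - 1 * dot (up x) (h x) * um x $ 1 = W * h x $ 2"
        unfolding dot_def by (simp add: algebra_simps wronskian[of x, symmetric])
      then show "1 / W * (dot (um x) (h x) * up x $ 1 + integral {..x} (\<lambda>y. dot (um y) (h y)) *
             ((of_real m + z - \<i> * of_real (sgn x)) * up x $ 2 + 0 $ 2) +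
           (- 1 * dot (up x) (h x) * um x $ 1 + - 1 * - integral {x..} (\<lambda>y. dot (up y) (h y)) *
             ((of_real m + z - \<i> * of_real (sgn x)) * um x $ 2 + 0 $ 2)))
         = (of_real m + z - \<i> * of_real (sgn x)) * G h x $ 2 + h x $ 2"
        using W by (simp add: G_def field_simps)
    qed
    show "primitive (\<lambda>x. G h x $ 2) (\<lambda>x. (of_real m - z + \<i> * of_real (sgn x)) * G h x $ 1 - h x $ 1)"
    proof (rule primitive_cong[OF primitive_cmult[OF primitive_add[OF primitive_mult[OF l dirac_solD(2)[OF dirac_sol_up]] primitive_mult[OF r dirac_solD(2)[OF dirac_sol_um]]], of "1 / W"]])
      fix x
      show "1 / W * (integral {..x} (\<lambda>y. dot (um y) (h y)) * up x $ 2 + - 1 * - integral {x..} (\<lambda>y. dot (up y) (h y)) * um x $ 2) = G h x $ 2"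
        by (simp add: G_def add_divide_distrib)
      have "dot (um x) (h x) * up x $ 2 + - 1 * dot (up x) (h x) * um x $ 2 = - (W * h x $ 1)"
        unfolding dot_def by (simp add: algebra_simps wronskian[of x, symmetric])
      then show "1 / W * (dot (um x) (h x) * up x $ 2 + integral {..x} (\<lambda>y. dot (um y) (h y)) *
             ((of_real m - z + \<i> * of_real (sgn x)) * up x $ 1 - 0 $ 1) +
           (- 1 * dot (up x) (h x) * um x $ 2 + - 1 * - integral {x..} (\<lambda>y. dot (up y) (h y)) *
             ((of_real m - z + \<i> * of_real (sgn x)) * um x $ 1 - 0 $ 1)))
         = (of_real m - z + \<i> * of_real (sgn x)) * G h x $ 1 - h x $ 1"
        using W by (simp add: G_def field_simps)
    qed
  qed
qed

lemma G_bound: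
  assumes "admissible_source h"
  shows "norm (G h x) \<le> M * (LINT y|lebesgue. exp (- \<delta> * \<bar>x - y\<bar>) * norm (h y))"
proof -
  let ?k = "\<lambda>y. exp (- \<delta> * \<bar>x - y\<bar>) * norm (h y)"
  have si: "set_integrable lebesgue A ?k" if "A \<in> sets lebesgue" for A
    unfolding set_integrable_def using exp_kernel_integrable[OF assms] that by (intro integrable_mult_indicator) auto
  have "AE y in lebesgue. y \<noteq> x"
    by (rule AE_completion) (rule AE_lborel_singleton)
  then have sum: "(LINT y:{..x}|lebesgue. ?k y) + (LINT y:{x..}|lebesgue. ?k y) = (LINT y|lebesgue. ?k y)"
  proof -
    assume ae: "AE y in lebesgue. y \<noteq> x"
    have "(LINT y:{..x}|lebesgue. ?k y) + (LINT y:{x..}|lebesgue. ?k y)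
        = (LINT y|lebesgue. indicat_real {..x} y *\<^sub>R ?k y + indicat_real {x..} y *\<^sub>R ?k y)"
      unfolding set_lebesgue_integral_def
      by (rule Bochner_Integration.integral_add[symmetric])
         (use si[of "{..x}"] si[of "{x..}"] in \<open>auto simp: set_integrable_def\<close>)
    also have "\<dots> = (LINT y|lebesgue. ?k y)"
    proof (rule integral_cong_AE)
      show "AE y in lebesgue. indicat_real {..x} y *\<^sub>R ?k y + indicat_real {x..} y *\<^sub>R ?k y = ?k y"
        using ae by eventually_elim (auto simp: indicator_def)
      show "(\<lambda>y. indicat_real {..x} y *\<^sub>R ?k y + indicat_real {x..} y *\<^sub>R ?k y) \<in> borel_measurable lebesgue"
        by (intro borel_measurable_add)
           (use si[of "{..x}"] si[of "{x..}"] in \<open>auto simp: set_integrable_def intro: borel_measurable_integrable\<close>)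
      show "?k \<in> borel_measurable lebesgue"
        using exp_kernel_integrable[OF assms] by (rule borel_measurable_integrable)
    qed
    finally show ?thesis .
  qed
  have "cmod W * norm (G h x) = norm (W *s G h x)" by (simp add: norm_vector_scalar_mult)
  also have "W *s G h x = integral {..x} (\<lambda>y. dot (um y) (h y)) *s up x + integral {x..} (\<lambda>y. dot (up y) (h y)) *s um x"
    using W by (simp add: G_def)
  also have "norm \<dots> \<le> norm (up x) * cmod (integral {..x} (\<lambda>y. dot (um y) (h y)))
      + norm (um x) * cmod (integral {x..} (\<lambda>y. dot (up y) (h y)))"
    by (rule order.trans[OF norm_triangle_ineq]) (simp add: norm_vector_scalar_mult mult.commute)
  also have "\<dots> \<le> M * cmod W * (LINT y:{..x}|lebesgue. ?k y) + M * cmod W * (LINT y:{x..}|lebesgue. ?k y)"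
    by (intro add_mono kernel_left(2)[OF assms] kernel_right(2)[OF assms])
  also have "\<dots> = cmod W * (M * (LINT y|lebesgue. ?k y))"
    unfolding sum[symmetric] by (simp add: algebra_simps)
  finally show ?thesis using W by simp
qed

lemma exp_square_integral: "integrable lebesgue (\<lambda>y. exp (- \<delta> * \<bar>x - y\<bar>) ^ 2)"
  "(LINT y|lebesgue. exp (- \<delta> * \<bar>x - y\<bar>) ^ 2) = 1 / \<delta>"
proof -
  let ?f = "\<lambda>y. exp (- \<delta> * \<bar>y\<bar>) ^ 2"
  have hi: "((\<lambda>y. exp (- (2 * \<delta>) * y)) has_integral 1 / (2 * \<delta>)) {0..}"
    using has_integral_exp_minus_to_infinity[of "2 * \<delta>" 0] \<delta> by simp
  have 1: "(?f has_integral 1 / (2 * \<delta>)) {0..}"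
    by (rule has_integral_eq[OF _ hi]) (simp add: power2_eq_square exp_add[symmetric])
  then have ai: "?f absolutely_integrable_on {0..}"
    by (intro nonnegative_absolutely_integrable_1) auto
  have meas: "(\<lambda>y. indicat_real {0..} y *\<^sub>R ?f y) \<in> borel_measurable lborel"
    by measurable
  have "has_bochner_integral lborel (\<lambda>y. indicat_real {0..} y *\<^sub>R ?f y) (1 / (2 * \<delta>))"
    using ai set_lebesgue_integral_eq_integral(2)[OF ai] 1
    by (simp only: has_bochner_integral_iff set_integrable_def set_lebesgue_integral_def
        integrable_completion[OF meas] integral_completion[OF meas] integral_unique)
  then have "has_bochner_integral lborel ?f (2 *\<^sub>R (1 / (2 * \<delta>)))"
    by (rule has_bochner_integral_even_function) simp
  then have "has_bochner_integral lborel (\<lambda>y. ?f (x + (-1) * y)) ((2 *\<^sub>R (1 / (2 * \<delta>))) /\<^sub>R \<bar>-1\<bar>)"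
    by (subst (asm) lborel_has_bochner_integral_real_affine_iff[where c = "-1" and t = x]) auto
  moreover have m2: "(\<lambda>y. exp (- \<delta> * \<bar>x - y\<bar>) ^ 2) \<in> borel_measurable lborel"
    by measurable
  ultimately show "integrable lebesgue (\<lambda>y. exp (- \<delta> * \<bar>x - y\<bar>) ^ 2)"
   "(LINT y|lebesgue. exp (- \<delta> * \<bar>x - y\<bar>) ^ 2) = 1 / \<delta>"
    by (simp_all add: has_bochner_integral_iff integrable_completion integral_completion)
qed

end

section \<open>Mapping properties of the Green operator\<close>

lemma integral_Cauchy_Schwarz:
  fixes a b :: "'a \<Rightarrow> real"
  assumes m: "a \<in> borel_measurable M" "b \<in> borel_measurable M"
    and i: "integrable M (\<lambda>x. (a x)\<^sup>2)" "integrable M (\<lambda>x. (b x)\<^sup>2)"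
  shows "integrable M (\<lambda>x. a x * b x)"
    "(LINT x|M. a x * b x) \<le> sqrt (LINT x|M. (a x)\<^sup>2) * sqrt (LINT x|M. (b x)\<^sup>2)"
proof -
  have ab: "integrable M (\<lambda>x. a x * b x)"
  proof (rule Bochner_Integration.integrable_bound)
    show "integrable M (\<lambda>x. (a x)\<^sup>2 + (b x)\<^sup>2)" using i by simp
    show "(\<lambda>x. a x * b x) \<in> borel_measurable M" using m by simp
    show "AE x in M. norm (a x * b x) \<le> norm ((a x)\<^sup>2 + (b x)\<^sup>2)"
    proof (intro AE_I2)
      fix x
      have "2 * \<bar>a x\<bar> * \<bar>b x\<bar> \<le> \<bar>a x\<bar>\<^sup>2 + \<bar>b x\<bar>\<^sup>2" by (rule sum_squares_bound)
      moreover have "0 \<le> \<bar>a x\<bar> * \<bar>b x\<bar>" by simp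
      ultimately have "\<bar>a x\<bar> * \<bar>b x\<bar> \<le> (a x)\<^sup>2 + (b x)\<^sup>2" unfolding power2_abs by linarith
      then show "norm (a x * b x) \<le> norm ((a x)\<^sup>2 + (b x)\<^sup>2)"
        unfolding real_norm_def abs_mult by simp
    qed
  qed
  show "integrable M (\<lambda>x. a x * b x)" by fact
  define A where "A = (LINT x|M. (a x)\<^sup>2)" define B where "B = (LINT x|M. (b x)\<^sup>2)"
  define I where "I = (LINT x|M. a x * b x)"
  have q: "0 \<le> t\<^sup>2 * A - 2 * t * I + B" for t
  proof -
    have "0 \<le> (LINT x|M. (t * a x - b x)\<^sup>2)" by simp
    also have "\<dots> = (LINT x|M. t\<^sup>2 * (a x)\<^sup>2 - (2 * t) * (a x * b x) + (b x)\<^sup>2)"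
      by (simp add: power2_eq_square algebra_simps)
    also have "\<dots> = t\<^sup>2 * A - 2 * t * I + B"
      unfolding A_def B_def I_def using i ab by simp
    finally show ?thesis .
  qed
  have nn: "0 \<le> A" "0 \<le> B" unfolding A_def B_def by simp_all
  have "I\<^sup>2 \<le> A * B"
  proof (cases "A = 0")
    case True
    have "I = 0"
    proof (rule ccontr)
      assume "I \<noteq> 0"
      then show False using q[of "(B + 1) / (2 * I)"] True by (simp add: field_simps)
    qed
    then show ?thesis using True by simp
  next
    case False
    then have A: "A > 0" using nn by simp
    have "(I / A)\<^sup>2 * A - 2 * (I / A) * I + B = B - I\<^sup>2 / A"
      using A by (simp add: field_simps power2_eq_square)
    then have "I\<^sup>2 / A \<le> B" using q[of "I / A"] by simp
    then show ?thesis using A by (simp add: field_simps)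
  qed
  from real_sqrt_le_mono[OF this] have "I \<le> sqrt (A * B)" by simp
  then show "(LINT x|M. a x * b x) \<le> sqrt (LINT x|M. (a x)\<^sup>2) * sqrt (LINT x|M. (b x)\<^sup>2)"
    by (simp add: A_def[symmetric] B_def[symmetric] I_def[symmetric] real_sqrt_mult)
qed

lemma lebesgue_integrable_interval:
  fixes g :: "real \<Rightarrow> real"
  assumes "integrable lebesgue g" "\<And>x. 0 \<le> g x"
  shows "g integrable_on {a..b}" "integral {a..b} g \<le> (LINT x|lebesgue. g x)"
proof -
  have si: "set_integrable lebesgue {a..b} g"
    unfolding set_integrable_def using assms(1) by (intro integrable_mult_indicator) auto
  show "g integrable_on {a..b}" using set_lebesgue_integral_eq_integral(1)[OF si] .
  have "integral {a..b} g = (LINT x:{a..b}|lebesgue. g x)"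
    using set_lebesgue_integral_eq_integral(2)[OF si] by simp
  also have "\<dots> \<le> (LINT x|lebesgue. g x)"
    unfolding set_lebesgue_integral_def
    by (rule integral_mono) (use si assms in \<open>auto simp: set_integrable_def indicator_def\<close>)
  finally show "integral {a..b} g \<le> (LINT x|lebesgue. g x)" .
qed

context green
begin

lemma admissible_source_L1:
  assumes "integrable lebesgue h" shows "admissible_source h"
  unfolding admissible_source_def
proof
  show [measurable]: "h \<in> borel_measurable lebesgue" using assms by auto
  have [measurable]: "(\<lambda>y::real. y) \<in> borel_measurable lebesgue" by (simp add: measurable_completion)
  show "integrable lebesgue (\<lambda>y. exp (- \<delta> * \<bar>y\<bar>) * norm (h y))"
  proof (rule Bochner_Integration.integrable_bound[OF integrable_norm[OF assms]])
    show "AE y in lebesgue. norm (exp (- \<delta> * \<bar>y\<bar>) * norm (h y)) \<le> norm (norm (h y))"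
      using \<delta>(2) by (auto intro!: AE_I2 mult_left_le_one_le)
  qed measurable
qed

lemma G_L1_sup:
  assumes "integrable lebesgue h" shows "norm (G h x) \<le> M * (LINT y|lebesgue. norm (h y))"
proof -
  have "(LINT y|lebesgue. exp (- \<delta> * \<bar>x - y\<bar>) * norm (h y)) \<le> (LINT y|lebesgue. norm (h y))"
    by (rule integral_mono[OF exp_kernel_integrable[OF admissible_source_L1[OF assms]] integrable_norm[OF assms]])
       (use \<delta>(2) in \<open>auto intro!: mult_left_le_one_le\<close>)
  then show ?thesis
    using G_bound[OF admissible_source_L1[OF assms], of x] M by (meson mult_left_mono order.trans zero_le_one)
qed

lemma admissible_source_L2:
  assumes "square_integrable h" shows "admissible_source h"
  unfolding admissible_source_def
proof
  show [measurable]: "h \<in> borel_measurable lebesgue" using assms by (simp add: square_integrable_def)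
  have [measurable]: "(\<lambda>y::real. y) \<in> borel_measurable lebesgue" by (simp add: measurable_completion)
  show "integrable lebesgue (\<lambda>y. exp (- \<delta> * \<bar>y\<bar>) * norm (h y))"
    by (rule integral_Cauchy_Schwarz(1))
       (use exp_square_integral(1)[of 0] assms in \<open>auto simp: square_integrable_def\<close>)
qed

lemma G_L2_sup:
  assumes "square_integrable h"
  shows "norm (G h x) \<le> M / sqrt \<delta> * sqrt (LINT y|lebesgue. (norm (h y))\<^sup>2)"
proof -
  have [measurable]: "h \<in> borel_measurable lebesgue" using assms by (simp add: square_integrable_def)
  have [measurable]: "(\<lambda>y::real. y) \<in> borel_measurable lebesgue" by (simp add: measurable_completion)
  have "(LINT y|lebesgue. exp (- \<delta> * \<bar>x - y\<bar>) * norm (h y))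
      \<le> sqrt (LINT y|lebesgue. exp (- \<delta> * \<bar>x - y\<bar>) ^ 2) * sqrt (LINT y|lebesgue. (norm (h y))\<^sup>2)"
    by (rule integral_Cauchy_Schwarz(2))
       (use exp_square_integral(1)[of x] assms in \<open>auto simp: square_integrable_def\<close>)
  also have "\<dots> = 1 / sqrt \<delta> * sqrt (LINT y|lebesgue. (norm (h y))\<^sup>2)"
    unfolding exp_square_integral(2) by (simp add: real_sqrt_divide)
  finally have "M * (LINT y|lebesgue. exp (- \<delta> * \<bar>x - y\<bar>) * norm (h y))
      \<le> M * (1 / sqrt \<delta> * sqrt (LINT y|lebesgue. (norm (h y))\<^sup>2))"
    using M by (intro mult_left_mono) auto
  then show ?thesis using G_bound[OF admissible_source_L2[OF assms], of x] by simp
qed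

text \<open>One factor \<open>\<bar>G h\<bar>\<close> in the source term of the energy is estimated by its supremum \<open>M \<parallel>h\<parallel>\<^sub>1\<close>. This
is why \<open>M\<close> enters only to the first power.\<close>

lemma G_L1_square_integrable:
  assumes h: "integrable lebesgue h"
  shows "square_integrable (G h)"
    "\<delta> * (LINT x|lebesgue. (norm (G h x))\<^sup>2) \<le> M * (LINT x|lebesgue. norm (h x))\<^sup>2"
proof -
  define S where "S = M * (LINT y|lebesgue. norm (h y))"
  have S: "norm (G h x) \<le> S" for x unfolding S_def by (rule G_L1_sup[OF h])
  have S0: "0 \<le> S" using S[of 0] norm_ge_zero order.trans by blast
  have int: "integrable lebesgue (\<lambda>x. S * norm (h x))" using h by simp
  note * = dirac_sol_square_integrable_bounded[OF G_sol[OF admissible_source_L1[OF h]] _ S, where G = "\<lambda>x. S * norm (h x)"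
      and c = "S * (LINT y|lebesgue. norm (h y))" and r = 0]
  have i: "(\<lambda>x. S * norm (h x)) integrable_on {a..b}"
    "integral {a..b} (\<lambda>x. S * norm (h x)) \<le> S * (LINT y|lebesgue. norm (h y))" for a b
    using lebesgue_integrable_interval[OF int] S0 by auto
  have b: "norm (h x) * norm (G h x) \<le> 0 * (norm (G h x))\<^sup>2 + S * norm (h x)" for x
    using mult_left_mono[OF S[of x] norm_ge_zero[of "h x"]] by (simp add: mult.commute)
  show "square_integrable (G h)"
    by (rule *(1)[OF _ i b]) (use \<delta> in auto)
  have "(\<bar>Im z\<bar> - 1 - 0) * (LINT x|lebesgue. (norm (G h x))\<^sup>2) \<le> S * (LINT y|lebesgue. norm (h y))"
    by (rule *(2)[OF _ i b]) (use \<delta> in auto)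
  then show "\<delta> * (LINT x|lebesgue. (norm (G h x))\<^sup>2) \<le> M * (LINT x|lebesgue. norm (h x))\<^sup>2"
    using \<delta> by (simp add: S_def power2_eq_square)
qed

text \<open>Half of the energy absorbs the source term by Young's inequality. The constant \<open>1 / \<delta>\<close> for the
operator norm is free of \<open>M\<close>: the supremum bound is only used to know that \<open>G h\<close> is bounded.\<close>

lemma G_L2_square_integrable:
  assumes h: "square_integrable h"
  shows "square_integrable (G h)"
    "(LINT x|lebesgue. (norm (G h x))\<^sup>2) \<le> (LINT x|lebesgue. (norm (h x))\<^sup>2) / \<delta>\<^sup>2"
proof -
  have int: "integrable lebesgue (\<lambda>x. (norm (h x))\<^sup>2 / (2 * \<delta>))" using h by (simp add: square_integrable_def)
  note * = dirac_sol_square_integrable_bounded[OF G_sol[OF admissible_source_L2[OF h]] _ G_L2_sup[OF h], where G = "\<lambda>x. (norm (h x))\<^sup>2 / (2 * \<delta>)"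
      and c = "(LINT y|lebesgue. (norm (h y))\<^sup>2) / (2 * \<delta>)" and r = "\<delta> / 2"]
  have i: "(\<lambda>x. (norm (h x))\<^sup>2 / (2 * \<delta>)) integrable_on {a..b}"
    "integral {a..b} (\<lambda>x. (norm (h x))\<^sup>2 / (2 * \<delta>)) \<le> (LINT y|lebesgue. (norm (h y))\<^sup>2) / (2 * \<delta>)" for a b
    using lebesgue_integrable_interval[OF int] \<delta> by auto
  have b: "norm (h x) * norm (G h x) \<le> \<delta> / 2 * (norm (G h x))\<^sup>2 + (norm (h x))\<^sup>2 / (2 * \<delta>)" for x
  proof -
    \<comment> \<open>Young's inequality in the scaling that makes both halves of the energy balance.\<close>
    have "0 \<le> (\<delta> * norm (G h x) - norm (h x))\<^sup>2 / (2 * \<delta>)" using \<delta> by simp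
    also have "\<dots> = \<delta> / 2 * (norm (G h x))\<^sup>2 + (norm (h x))\<^sup>2 / (2 * \<delta>) - norm (h x) * norm (G h x)"
      using \<delta>(2) by (simp add: field_simps power2_eq_square)
    finally show ?thesis by simp
  qed
  show "square_integrable (G h)"
    by (rule *(1)[OF _ i b]) (use \<delta> in auto)
  have "(\<bar>Im z\<bar> - 1 - \<delta> / 2) * (LINT x|lebesgue. (norm (G h x))\<^sup>2) \<le> (LINT y|lebesgue. (norm (h y))\<^sup>2) / (2 * \<delta>)"
    by (rule *(2)[OF _ i b]) (use \<delta> in auto)
  then have "\<delta> / 2 * (LINT x|lebesgue. (norm (G h x))\<^sup>2) \<le> (LINT y|lebesgue. (norm (h y))\<^sup>2) / (2 * \<delta>)"
    unfolding \<delta>(1)[symmetric] by simp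
  then show "(LINT x|lebesgue. (norm (G h x))\<^sup>2) \<le> (LINT x|lebesgue. (norm (h x))\<^sup>2) / \<delta>\<^sup>2"
    using \<delta>(2) by (simp add: pos_le_divide_eq power2_eq_square mult_ac)
qed

lemma solution_unique:
  assumes "dirac_sol m z h u" "dirac_sol m z h v" "square_integrable u" "square_integrable v"
  shows "u = v"
proof
  fix x
  have "dirac_sol m z (\<lambda>_. 0) (\<lambda>x. u x - v x)"
    using dirac_sol_diff[OF assms(1,2)] by simp
  from dirac_sol_homogeneous_zero[OF this _ square_integrable_diff[OF assms(3,4)], of x] \<delta>
  show "u x = v x" by simp
qed

lemma solution_eq_G_add:
  assumes "dirac_sol m z (\<lambda>x. h x + k x) u" "square_integrable u" "integrable lebesgue h" "square_integrable k"
  shows "u = (\<lambda>x. G h x + G k x)"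
  by (rule solution_unique[OF assms(1) dirac_sol_add[OF G_sol G_sol] assms(2) square_integrable_add])
     (use assms in \<open>auto intro: admissible_source_L1 admissible_source_L2 G_L1_square_integrable G_L2_square_integrable\<close>)

lemma solution_eq_G_L1:
  assumes "dirac_sol m z h u" "square_integrable u" "integrable lebesgue h"
  shows "u = G h"
  by (rule solution_unique[OF assms(1) G_sol assms(2)])
     (use assms in \<open>auto intro: admissible_source_L1 G_L1_square_integrable\<close>)

lemma solution_eq_G_L2:
  assumes "dirac_sol m z h u" "square_integrable u" "square_integrable h"
  shows "u = G h"
  by (rule solution_unique[OF assms(1) G_sol assms(2)])
     (use assms in \<open>auto intro: admissible_source_L2 G_L2_square_integrable\<close>)

end

section \<open>Green functions from exponential modes\<close>

text \<open>On a half line the system has constant coefficients with \<open>w = z \<mp> \<i>\<close>, and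
\<open>(1, \<zeta>) exp (k x)\<close> is a solution. The root \<open>k\<close> of \<open>m\<^sup>2 - w\<^sup>2\<close> with positive real
part satisfies \<open>Im w \<le> Re k\<close>, which bounds the rate of decay. The quadrant of \<open>\<zeta>\<close> is the same for all
\<open>w\<close> in the half plane, and this keeps the sum of two such \<open>\<zeta>\<close> away from zero.

With \<open>k = p + \<i> q\<close> and \<open>w = s + \<i> t\<close> the equation \<open>k\<^sup>2 = m\<^sup>2 - w\<^sup>2\<close> reads
\<open>p\<^sup>2 - q\<^sup>2 = m\<^sup>2 - s\<^sup>2 + t\<^sup>2\<close> and \<open>p q = - s t\<close>, and the claims are inequalities between these real numbers.\<close>

lemma characteristic_root_upper:
  assumes w: "0 < Im w" and m: "0 \<le> m"
  shows "\<exists>k \<zeta>. k = \<zeta> * (of_real m + w) \<and> k * \<zeta> = of_real m - w \<and> Im w \<le> Re k \<and> 0 \<le> Re \<zeta> \<and> Im \<zeta> < 0"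
proof -
  define k where "k = csqrt ((of_real m)\<^sup>2 - w\<^sup>2)"
  define p q s t where "p = Re k" and "q = Im k" and "s = Re w" and "t = Im w"
  have k2: "k\<^sup>2 = (of_real m)\<^sup>2 - w\<^sup>2" by (simp add: k_def)
  have "Re (k\<^sup>2) = p\<^sup>2 - q\<^sup>2" "Im (k\<^sup>2) = 2 * (p * q)"
    by (simp_all add: p_def q_def power2_eq_square)
  moreover have "Re (k\<^sup>2) = m\<^sup>2 - s\<^sup>2 + t\<^sup>2" "Im (k\<^sup>2) = - (2 * (s * t))"
    unfolding k2 by (simp_all add: s_def t_def power2_eq_square)
  ultimately have e1: "p\<^sup>2 - q\<^sup>2 = m\<^sup>2 - s\<^sup>2 + t\<^sup>2" and e2: "p * q = - (s * t)" by auto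
  have t: "0 < t" using w by (simp add: t_def)
  have p0: "0 \<le> p"
    unfolding p_def k_def using csqrt_principal[of "(of_real m)\<^sup>2 - w\<^sup>2"] by linarith
  have sq: "p\<^sup>2 * q\<^sup>2 = s\<^sup>2 * t\<^sup>2" using e2 by (metis power2_minus power_mult_distrib)
  have pt2: "t\<^sup>2 \<le> p\<^sup>2"
  proof (rule ccontr)
    assume "\<not> t\<^sup>2 \<le> p\<^sup>2"
    then have lt: "p\<^sup>2 < t\<^sup>2" by simp
    then have qs: "q\<^sup>2 < s\<^sup>2" using e1 zero_le_power2[of m] by linarith
    have "s\<^sup>2 * t\<^sup>2 = p\<^sup>2 * q\<^sup>2" using sq by simp
    also have "\<dots> \<le> t\<^sup>2 * q\<^sup>2" using lt by (intro mult_right_mono) auto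
    also have "\<dots> < t\<^sup>2 * s\<^sup>2" using qs t by (intro mult_strict_left_mono) auto
    finally show False by (simp add: mult.commute)
  qed
  then have pt: "t \<le> p" using p0 t by (simp add: power2_le_iff_abs_le)
  then have p: "0 < p" using t by simp
  have p4: "(p\<^sup>2 - t\<^sup>2) * (p\<^sup>2 + s\<^sup>2) = p\<^sup>2 * m\<^sup>2"
  proof -
    have "(p\<^sup>2 - t\<^sup>2) * (p\<^sup>2 + s\<^sup>2) = p\<^sup>2 * (p\<^sup>2 + s\<^sup>2 - t\<^sup>2) - s\<^sup>2 * t\<^sup>2" by (simp add: algebra_simps)
    also have "\<dots> = p\<^sup>2 * (p\<^sup>2 - q\<^sup>2 + s\<^sup>2 - t\<^sup>2)" unfolding sq[symmetric] by (simp add: algebra_simps)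
    also have "p\<^sup>2 - q\<^sup>2 + s\<^sup>2 - t\<^sup>2 = m\<^sup>2" using e1 by simp
    finally show ?thesis .
  qed
  have pm: "m\<^sup>2 \<le> p\<^sup>2 + s\<^sup>2" using e1 zero_le_power2[of q] zero_le_power2[of t] by linarith
  define \<zeta> where "\<zeta> = k / (of_real m + w)"
  have nz: "of_real m + w \<noteq> 0" using w by (auto simp: complex_eq_iff)
  define N where "N = (m + s)\<^sup>2 + t\<^sup>2"
  have N: "0 < N" using t by (simp add: N_def add_nonneg_pos)
  have z1: "Re \<zeta> = (p * (m + s) + q * t) / N" and z2: "Im \<zeta> = (q * (m + s) - p * t) / N"
    by (simp_all add: \<zeta>_def Re_divide Im_divide p_def q_def s_def t_def N_def)
  have "p * (p * (m + s) + q * t) = p\<^sup>2 * (m + s) + (p * q) * t"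
    by (simp add: power2_eq_square algebra_simps)
  also have "\<dots> = p\<^sup>2 * m + s * (p\<^sup>2 - t\<^sup>2)" unfolding e2 by (simp add: power2_eq_square algebra_simps)
  also have "\<dots> \<ge> 0"
  proof (cases "0 \<le> s")
    case True then show ?thesis using pt2 m by simp
  next
    case False
    have "\<bar>s\<bar> * m \<le> p\<^sup>2 + s\<^sup>2"
    proof -
      have "2 * (\<bar>s\<bar> * m) \<le> s\<^sup>2 + m\<^sup>2" using sum_squares_bound[of "\<bar>s\<bar>" m] by simp
      then show ?thesis using pm zero_le_power2[of p] by linarith
    qed
    then have "p\<^sup>2 * m * (\<bar>s\<bar> * m) \<le> p\<^sup>2 * m * (p\<^sup>2 + s\<^sup>2)" using m by (intro mult_left_mono) auto
    also have "p\<^sup>2 * m * (\<bar>s\<bar> * m) = \<bar>s\<bar> * ((p\<^sup>2 - t\<^sup>2) * (p\<^sup>2 + s\<^sup>2))" unfolding p4 by (simp add: power2_eq_square)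
    finally have "(\<bar>s\<bar> * (p\<^sup>2 - t\<^sup>2)) * (p\<^sup>2 + s\<^sup>2) \<le> (p\<^sup>2 * m) * (p\<^sup>2 + s\<^sup>2)" by (simp add: mult.assoc)
    moreover have "0 < p\<^sup>2 + s\<^sup>2" using p by (simp add: add_pos_nonneg)
    ultimately have "\<bar>s\<bar> * (p\<^sup>2 - t\<^sup>2) \<le> p\<^sup>2 * m" by simp
    then show ?thesis using False by simp
  qed
  finally have "0 \<le> p * (p * (m + s) + q * t)" .
  then have r: "0 \<le> Re \<zeta>" unfolding z1 using p N by (simp add: zero_le_mult_iff)
  have "p * (q * (m + s) - p * t) = (p * q) * (m + s) - p\<^sup>2 * t"
    by (simp add: power2_eq_square algebra_simps)
  also have "\<dots> = - t * (s * (m + s) + p\<^sup>2)" unfolding e2 by (simp add: power2_eq_square algebra_simps)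
  also have "\<dots> < 0"
  proof -
    have "0 < s * (m + s) + p\<^sup>2"
    proof (cases "- m < s")
      case True
      have "s * (m + s) + p\<^sup>2 = m * s + m\<^sup>2 + t\<^sup>2 + q\<^sup>2" using e1 by (simp add: power2_eq_square algebra_simps)
      also have "\<dots> = m * (m + s) + t\<^sup>2 + q\<^sup>2" by (simp add: power2_eq_square algebra_simps)
      also have "\<dots> > 0" using True m t by (intro add_pos_nonneg add_nonneg_pos mult_nonneg_nonneg) auto
      finally show ?thesis .
    next
      case False
      then have "0 \<le> s * (m + s)" using m by (intro mult_nonpos_nonpos) auto
      then show ?thesis using p by (intro add_nonneg_pos) auto
    qed
    then show ?thesis using t by simp
  qed
  finally have "p * (q * (m + s) - p * t) < 0" .
  then have i: "Im \<zeta> < 0" unfolding z2 using p N by (simp add: mult_less_0_iff divide_less_0_iff)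
  have "k * \<zeta> = k\<^sup>2 / (of_real m + w)" by (simp add: \<zeta>_def power2_eq_square)
  also have "\<dots> = of_real m - w"
    unfolding k2 using nz by (simp add: field_simps power2_eq_square)
  finally have kz: "k * \<zeta> = of_real m - w" .
  show ?thesis
    by (rule exI[of _ k], rule exI[of _ \<zeta>]) (use kz r i pt nz in \<open>auto simp: \<zeta>_def p_def t_def\<close>)
qed

text \<open>Complex conjugation exchanges the two half planes.\<close>

lemma characteristic_root:
  assumes w: "Im w \<noteq> 0" and m: "0 \<le> m"
  shows "\<exists>k \<zeta>. k = \<zeta> * (of_real m + w) \<and> k * \<zeta> = of_real m - w \<and> \<bar>Im w\<bar> \<le> Re k \<and> 0 \<le> Re \<zeta> \<and> Im \<zeta> * Im w < 0"
proof (cases "0 < Im w")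
  case True
  then show ?thesis using characteristic_root_upper[OF True m] by (auto simp: mult_less_0_iff)
next
  case False
  then have "0 < Im (cnj w)" using w by simp
  from characteristic_root_upper[OF this m] obtain k \<zeta> where
    *: "k = \<zeta> * (of_real m + cnj w)" "k * \<zeta> = of_real m - cnj w" "Im (cnj w) \<le> Re k" "0 \<le> Re \<zeta>" "Im \<zeta> < 0" by blast
  have "cnj k = cnj \<zeta> * (of_real m + w)" by (subst *(1)) simp
  moreover have "cnj k * cnj \<zeta> = of_real m - w"
    unfolding complex_cnj_mult[symmetric] *(2) by simp
  moreover have "\<bar>Im w\<bar> \<le> Re (cnj k)" "0 \<le> Re (cnj \<zeta>)" using *(3,4) False by auto
  moreover have "Im (cnj \<zeta>) * Im w < 0"
  proof -
    have "0 < Im \<zeta> * Im w" using *(5) False w by (intro mult_neg_neg) auto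
    then show ?thesis by simp
  qed
  ultimately show ?thesis by blast
qed

definition mode :: "complex \<Rightarrow> complex \<Rightarrow> complex \<Rightarrow> complex \<Rightarrow> real \<Rightarrow> complex^2" where
  "mode k \<zeta> a b x = vector [a * exp (x *\<^sub>R k) + b * exp (x *\<^sub>R (- k)),
                            \<zeta> * (a * exp (x *\<^sub>R k) - b * exp (x *\<^sub>R (- k)))]"

lemma primitive_exp: "primitive (\<lambda>x. exp (x *\<^sub>R k)) (\<lambda>x. exp (x *\<^sub>R k) * (k :: complex))"
  by (rule primitive_of_deriv[OF exp_scaleR_has_vector_derivative_right]) (intro continuous_intros)

lemma mode_primitive:
  assumes k: "k = \<zeta> * p" "k * \<zeta> = q"
  shows "primitive (\<lambda>x. mode k \<zeta> a b x $ 1) (\<lambda>x. p * mode k \<zeta> a b x $ 2)"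
    "primitive (\<lambda>x. mode k \<zeta> a b x $ 2) (\<lambda>x. q * mode k \<zeta> a b x $ 1)"
proof -
  note e = primitive_cmult[OF primitive_exp[of k], of a] and f = primitive_cmult[OF primitive_exp[of "- k"], of b]
  show "primitive (\<lambda>x. mode k \<zeta> a b x $ 1) (\<lambda>x. p * mode k \<zeta> a b x $ 2)"
    by (rule primitive_cong[OF primitive_add[OF e f]]) (simp_all add: mode_def k(1) algebra_simps)
  show "primitive (\<lambda>x. mode k \<zeta> a b x $ 2) (\<lambda>x. q * mode k \<zeta> a b x $ 1)"
    by (rule primitive_cong[OF primitive_cmult[OF primitive_diff[OF e f], of \<zeta>]]) (simp_all add: mode_def k(2)[symmetric] algebra_simps)
qed

lemma mode_wronskian:
  "mode k \<zeta> a b x $ 1 * mode k \<zeta> a' b' x $ 2 - mode k \<zeta> a b x $ 2 * mode k \<zeta> a' b' x $ 1 = 2 * \<zeta> * (b * a' - a * b')"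
proof -
  have *: "exp (x *\<^sub>R k) * exp (x *\<^sub>R (- k)) = 1"
    unfolding exp_add_commuting[symmetric, OF mult.commute] by (simp flip: exp_add)
  have "mode k \<zeta> a b x $ 1 * mode k \<zeta> a' b' x $ 2 - mode k \<zeta> a b x $ 2 * mode k \<zeta> a' b' x $ 1
     = 2 * \<zeta> * (b * a' - a * b') * (exp (x *\<^sub>R k) * exp (x *\<^sub>R (- k)))"
    unfolding mode_def vector_2 by (simp add: algebra_simps)
  then show ?thesis unfolding * by simp
qed

lemma mode_norm:
  assumes "1 + (cmod \<zeta>)\<^sup>2 \<le> R"
  shows "norm (mode k \<zeta> a b x) \<le> sqrt R * (cmod a * exp (Re k * x) + cmod b * exp (- Re k * x))"
proof -
  have "mode k \<zeta> a b x = (a * exp (x *\<^sub>R k)) *s vector [1, \<zeta>] + (b * exp (x *\<^sub>R (- k))) *s vector [1, - \<zeta>]"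
    by (simp add: mode_def vec_eq_iff forall_2 algebra_simps)
  also have "norm \<dots> \<le> cmod (a * exp (x *\<^sub>R k)) * norm (vector [1, \<zeta>] :: complex^2) + cmod (b * exp (x *\<^sub>R (- k))) * norm (vector [1, - \<zeta>] :: complex^2)"
    by (rule order.trans[OF norm_triangle_ineq]) (simp add: norm_vector_scalar_mult)
  also have "\<dots> \<le> cmod (a * exp (x *\<^sub>R k)) * sqrt R + cmod (b * exp (x *\<^sub>R (- k))) * sqrt R"
    using assms by (intro add_mono mult_left_mono real_le_rsqrt) (auto simp: norm_vec2_sq)
  also have "\<dots> = sqrt R * (cmod a * exp (Re k * x) + cmod b * exp (- Re k * x))"
    by (simp add: norm_mult algebra_simps)
  finally show ?thesis .
qed

text \<open>The decaying exponential on one half line is continued through the origin by a combination of both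
exponentials of the other half line; \<open>A\<close>, \<open>B\<close>, \<open>A'\<close>, \<open>B'\<close> are the transmission and reflection
coefficients, bounded by \<open>s\<close>. The growing exponential in the continuation is the worst one, and the
exponents of the two factors of the kernel add up to at most \<open>- \<delta> (x - y)\<close>. The Wronskian is
\<open>\<zeta>1 + \<zeta>2\<close>.\<close>

lemma green_from_modes:
  assumes z: "1 < \<bar>Im z\<bar>"
    and k1: "k1 = \<zeta>1 * (of_real m + (z - \<i>))" "k1 * \<zeta>1 = of_real m - (z - \<i>)" "\<bar>Im (z - \<i>)\<bar> \<le> Re k1"
    and k2: "k2 = \<zeta>2 * (of_real m + (z + \<i>))" "k2 * \<zeta>2 = of_real m - (z + \<i>)" "\<bar>Im (z + \<i>)\<bar> \<le> Re k2"
    and nz: "\<zeta>1 \<noteq> 0" "\<zeta>2 \<noteq> 0" "\<zeta>1 + \<zeta>2 \<noteq> 0"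
    and R: "1 + (cmod \<zeta>1)\<^sup>2 \<le> R" "1 + (cmod \<zeta>2)\<^sup>2 \<le> R"
    and s: "1 \<le> s" "cmod ((1 + \<zeta>1 / \<zeta>2) / 2) + cmod ((1 - \<zeta>1 / \<zeta>2) / 2) \<le> s"
      "cmod ((1 + \<zeta>2 / \<zeta>1) / 2) + cmod ((1 - \<zeta>2 / \<zeta>1) / 2) \<le> s"
    and M: "R * s \<le> M * cmod (\<zeta>1 + \<zeta>2)" "1 \<le> M"
  shows "\<exists>up um W. green m z up um W M (\<bar>Im z\<bar> - 1)"
proof -
  \<comment> \<open>Chosen such that the two expressions for \<open>up\<close>, and those for \<open>um\<close>, agree at the origin.\<close>
  define A B A' B' where "A = (1 + \<zeta>1 / \<zeta>2) / 2" and "B = (1 - \<zeta>1 / \<zeta>2) / 2"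
    and "A' = (1 + \<zeta>2 / \<zeta>1) / 2" and "B' = (1 - \<zeta>2 / \<zeta>1) / 2"
  define up where "up x = (if 0 \<le> x then mode k1 \<zeta>1 0 1 x else mode k2 \<zeta>2 B A x)" for x
  define um where "um x = (if 0 \<le> x then mode k1 \<zeta>1 A' B' x else mode k2 \<zeta>2 1 0 x)" for x
  define \<delta> where "\<delta> = \<bar>Im z\<bar> - 1"
  have d: "\<delta> \<le> Re k1" "\<delta> \<le> Re k2" "0 < \<delta>" using k1(3) k2(3) z by (auto simp: \<delta>_def)
  have up0: "up x = mode k2 \<zeta>2 B A x" and um0: "um x = mode k2 \<zeta>2 1 0 x" if "x \<le> 0" for x
    using that nz by (auto simp: up_def um_def mode_def A_def B_def A'_def B'_def vec_eq_iff forall_2 field_simps)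
  have up1: "up x = mode k1 \<zeta>1 0 1 x" and um1: "um x = mode k1 \<zeta>1 A' B' x" if "0 \<le> x" for x
    using that by (auto simp: up_def um_def)
  have solI: "dirac_sol m z (\<lambda>_. 0) u" if u: "\<And>x. 0 \<le> x \<Longrightarrow> u x = mode k1 \<zeta>1 a b x" "\<And>x. x \<le> 0 \<Longrightarrow> u x = mode k2 \<zeta>2 a' b' x" for u a b a' b'
    unfolding dirac_sol_def
  proof
    show "primitive (\<lambda>x. u x $ 1) (\<lambda>x. (of_real m + z - \<i> * of_real (sgn x)) * u x $ 2 + 0 $ 2)"
      by (rule primitive_glue[OF _ _ _ _ mode_primitive(1)[OF k1(1,2), of a b] mode_primitive(1)[OF k2(1,2), of a' b']])
         (use u in \<open>auto simp: algebra_simps\<close>)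
    show "primitive (\<lambda>x. u x $ 2) (\<lambda>x. (of_real m - z + \<i> * of_real (sgn x)) * u x $ 1 - 0 $ 1)"
      by (rule primitive_glue[OF _ _ _ _ mode_primitive(2)[OF k1(1,2), of a b] mode_primitive(2)[OF k2(1,2), of a' b']])
         (use u in \<open>auto simp: algebra_simps\<close>)
  qed
  have n1: "norm (mode k1 \<zeta>1 a b x) \<le> sqrt R * (cmod a * exp (Re k1 * x) + cmod b * exp (- Re k1 * x))" for a b x
    by (rule mode_norm[OF R(1)])
  have n2: "norm (mode k2 \<zeta>2 a b x) \<le> sqrt R * (cmod a * exp (Re k2 * x) + cmod b * exp (- Re k2 * x))" for a b x
    by (rule mode_norm[OF R(2)])
  have R0: "0 \<le> R" using R(1) zero_le_power2[of "cmod \<zeta>1"] by linarith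
  have bup1: "norm (up x) \<le> sqrt R * 1 * exp (- Re k1 * x)" if "0 \<le> x" for x
    using n1[of 0 1 x] up1[OF that] by simp
  have bum0: "norm (um x) \<le> sqrt R * 1 * exp (Re k2 * x)" if "x \<le> 0" for x
    using n2[of 1 0 x] um0[OF that] by simp
  have bup0: "norm (up x) \<le> sqrt R * s * exp (- Re k2 * x)" if "x \<le> 0" for x
  proof -
    have "exp (Re k2 * x) \<le> exp (- Re k2 * x)"
      using mult_nonneg_nonpos[of "Re k2" x] d that by simp
    then have "cmod B * exp (Re k2 * x) + cmod A * exp (- Re k2 * x) \<le> (cmod B + cmod A) * exp (- Re k2 * x)"
      by (simp add: distrib_right mult_left_mono)
    also have "\<dots> \<le> s * exp (- Re k2 * x)"
      using s(2) by (intro mult_right_mono) (auto simp: A_def B_def)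
    finally have "sqrt R * (cmod B * exp (Re k2 * x) + cmod A * exp (- Re k2 * x)) \<le> sqrt R * (s * exp (- Re k2 * x))"
      using R0 by (intro mult_left_mono) auto
    then show ?thesis using n2[of B A x] up0[OF that] by simp
  qed
  have bum1: "norm (um x) \<le> sqrt R * s * exp (Re k1 * x)" if "0 \<le> x" for x
  proof -
    have "exp (- Re k1 * x) \<le> exp (Re k1 * x)"
      using mult_nonneg_nonneg[of "Re k1" x] d that by simp
    then have "cmod A' * exp (Re k1 * x) + cmod B' * exp (- Re k1 * x) \<le> (cmod A' + cmod B') * exp (Re k1 * x)"
      by (simp add: distrib_right mult_left_mono)
    also have "\<dots> \<le> s * exp (Re k1 * x)"
      using s(3) by (intro mult_right_mono) (auto simp: A'_def B'_def)
    finally have "sqrt R * (cmod A' * exp (Re k1 * x) + cmod B' * exp (- Re k1 * x)) \<le> sqrt R * (s * exp (Re k1 * x))"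
      using R0 by (intro mult_left_mono) auto
    then show ?thesis using n1[of A' B' x] um1[OF that] by simp
  qed
  have comb: "norm (up x) * norm (um y) \<le> M * cmod (\<zeta>1 + \<zeta>2) * exp (- \<delta> * (x - y))"
    if "norm (up x) \<le> sqrt R * c * exp e" "norm (um y) \<le> sqrt R * c' * exp e'" "c * c' \<le> s" "0 \<le> c" "0 \<le> c'"
      "e + e' \<le> - \<delta> * (x - y)" for x y c c' e e'
  proof -
    have "norm (up x) * norm (um y) \<le> (sqrt R * c * exp e) * (sqrt R * c' * exp e')"
      using that R0 by (intro mult_mono) auto
    also have "\<dots> = (sqrt R * sqrt R) * ((c * c') * exp (e + e'))"
      by (simp only: exp_add mult_ac)
    also have "\<dots> = R * ((c * c') * exp (e + e'))" using R0 by simp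
    also have "\<dots> \<le> R * (s * exp (- \<delta> * (x - y)))"
      using that R0 s by (intro mult_left_mono mult_mono) auto
    also have "\<dots> = (R * s) * exp (- \<delta> * (x - y))" by simp
    also have "\<dots> \<le> (M * cmod (\<zeta>1 + \<zeta>2)) * exp (- \<delta> * (x - y))"
      using M by (intro mult_right_mono) auto
    finally show ?thesis .
  qed
  have "green m z up um (\<zeta>1 + \<zeta>2) M \<delta>"
  proof
    show "dirac_sol m z (\<lambda>_. 0) up" by (rule solI[OF up1 up0])
    show "dirac_sol m z (\<lambda>_. 0) um" by (rule solI[OF um1 um0])
    show "up x $ 1 * um x $ 2 - up x $ 2 * um x $ 1 = \<zeta>1 + \<zeta>2" for x
    proof (cases "0 \<le> x")
      case True
      then show ?thesis unfolding up1[OF True] um1[OF True] mode_wronskian using nz by (simp add: A'_def B'_def field_simps)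
    next
      case False
      then have x: "x \<le> 0" by simp
      show ?thesis unfolding up0[OF x] um0[OF x] mode_wronskian using nz by (simp add: A_def B_def field_simps)
    qed
    show "norm (up x) * norm (um y) \<le> M * cmod (\<zeta>1 + \<zeta>2) * exp (- \<delta> * (x - y))" if yx: "y \<le> x" for x y
    proof -
      have j: "- Re k * (x - y) \<le> - \<delta> * (x - y)" if "\<delta> \<le> Re k" for k
        using mult_right_mono[OF that, of "x - y"] yx by simp
      consider "0 \<le> y" | "y \<le> 0" "0 \<le> x" | "x \<le> 0" using yx by linarith
      then show ?thesis
      proof cases
        case 1
        show ?thesis
          by (rule comb[OF bup1 bum1]) (use 1 yx s j[OF d(1)] in \<open>auto simp: algebra_simps\<close>)
      next
        case 2
        have "\<delta> * x \<le> Re k1 * x" "Re k2 * y \<le> \<delta> * y"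
          using 2 d by (auto intro: mult_right_mono mult_right_mono_neg)
        then show ?thesis
          by (intro comb[OF bup1 bum0]) (use 2 s in \<open>auto simp: algebra_simps\<close>)
      next
        case 3
        show ?thesis
          by (rule comb[OF bup0 bum0]) (use 3 yx s j[OF d(2)] in \<open>auto simp: algebra_simps\<close>)
      qed
    qed
  qed (use nz d M in \<open>auto simp: \<delta>_def\<close>)
  then show ?thesis unfolding \<delta>_def by blast
qed

text \<open>For \<open>m = 0\<close> both half lines have \<open>\<zeta> = \<mp>\<i>\<close> according to the sign of \<open>Im z\<close>. Hence there
is no reflection, and the bound is \<open>M = 2 / \<bar>2 \<zeta>\<bar> = 1\<close>, the best possible one.\<close>

lemma green_exists_massless:
  assumes z: "1 < \<bar>Im z\<bar>"
  shows "\<exists>up um W. green 0 z up um W 1 (\<bar>Im z\<bar> - 1)"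
proof -
  define \<zeta> where "\<zeta> = - \<i> * of_real (sgn (Im z))"
  have z2: "\<zeta> * \<zeta> = -1" "cmod \<zeta> = 1" "\<zeta> \<noteq> 0" using z by (auto simp: \<zeta>_def sgn_if)
  show ?thesis
  proof (rule green_from_modes[OF z, where R = 2 and s = 1 and ?\<zeta>1.0 = \<zeta> and ?\<zeta>2.0 = \<zeta>])
    show "\<zeta> * (of_real 0 + (z - \<i>)) * \<zeta> = of_real 0 - (z - \<i>)" "\<zeta> * (of_real 0 + (z + \<i>)) * \<zeta> = of_real 0 - (z + \<i>)"
    proof -
      have "\<zeta> * a * \<zeta> = - a" for a
        using arg_cong[OF z2(1), of "\<lambda>c. c * a"] by (simp only: mult_ac) simp
      then show "\<zeta> * (of_real 0 + (z - \<i>)) * \<zeta> = of_real 0 - (z - \<i>)" "\<zeta> * (of_real 0 + (z + \<i>)) * \<zeta> = of_real 0 - (z + \<i>)"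
        by simp_all
    qed
    show "\<bar>Im (z - \<i>)\<bar> \<le> Re (\<zeta> * (of_real 0 + (z - \<i>)))" "\<bar>Im (z + \<i>)\<bar> \<le> Re (\<zeta> * (of_real 0 + (z + \<i>)))"
      using z by (auto simp: \<zeta>_def sgn_if)
    show "2 * 1 \<le> 1 * cmod (\<zeta> + \<zeta>)"
      using z2(2) by (metis mult_1 mult_2 norm_mult norm_numeral order_refl mult.right_neutral)
    show "\<zeta> + \<zeta> \<noteq> 0" using z2(3) by simp
  qed (use z2 in auto)
qed

text \<open>This is where the box enters. The numbers \<open>\<zeta>\<^sup>2 = (m - w) / (m + w)\<close> degenerate only near the
thresholds \<open>w = \<plusminus>m\<close>, and outside the box \<open>w\<close> is at distance at least \<open>1 / 2\<close> or \<open>3 m / 2\<close>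
from them.\<close>

lemma characteristic_ratio_bounds:
  assumes m: "0 < m" and w: "1/2 \<le> \<bar>Im w\<bar> \<or> 5/2 * m \<le> \<bar>Re w\<bar>"
    and K: "K = 7/3 + 4 * m"
  shows "cmod (of_real m - w) \<le> K * cmod (of_real m + w)" "cmod (of_real m + w) \<le> K * cmod (of_real m - w)"
proof -
  have *: "cmod (of_real m - w) \<le> K * cmod (of_real m + w)" if w: "1/2 \<le> \<bar>Im w\<bar> \<or> 5/2 * m \<le> \<bar>Re w\<bar>" for w
  proof -
    have "cmod (of_real m - w) = cmod (of_real (2 * m) - (of_real m + w))" by simp
    also have "\<dots> \<le> cmod (of_real (2 * m)) + cmod (of_real m + w)" by (rule norm_triangle_ineq4)
    also have "cmod (of_real (2 * m)) = 2 * m" using m by (simp add: norm_mult)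
    finally have 1: "cmod (of_real m - w) \<le> 2 * m + cmod (of_real m + w)" .
    have 2: "2 * m \<le> (4 / 3 + 4 * m) * cmod (of_real m + w)"
      using w
    proof
      assume "1/2 \<le> \<bar>Im w\<bar>"
      also have "\<dots> \<le> cmod (of_real m + w)" using abs_Im_le_cmod[of "of_real m + w"] by simp
      finally have "(4 * m) * (1/2) \<le> (4 / 3 + 4 * m) * cmod (of_real m + w)"
        using m by (intro mult_mono) auto
      then show ?thesis by simp
    next
      assume a: "5/2 * m \<le> \<bar>Re w\<bar>"
      have "\<bar>Re w\<bar> - m \<le> \<bar>m + Re w\<bar>" using m by linarith
      also have "\<dots> \<le> cmod (of_real m + w)" using abs_Re_le_cmod[of "of_real m + w"] by simp
      finally have "3/2 * m \<le> cmod (of_real m + w)" using a by simp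
      then have "(4/3) * (3/2 * m) \<le> (4 / 3 + 4 * m) * cmod (of_real m + w)"
        using m by (intro mult_mono) auto
      then show ?thesis by simp
    qed
    show ?thesis using 1 2 unfolding K by (simp add: algebra_simps)
  qed
  show "cmod (of_real m - w) \<le> K * cmod (of_real m + w)" by (rule *[OF w])
  show "cmod (of_real m + w) \<le> K * cmod (of_real m - w)" using *[of "- w"] w by simp
qed

text \<open>All \<open>\<bar>\<zeta>\<bar>\<^sup>2\<close> lie in \<open>[1 / K, K]\<close> with \<open>K = 7 / 3 + 4 m\<close>, and the two \<open>\<zeta>\<close> lie in the same
closed quadrant, so that \<open>1 / K \<le> \<bar>\<zeta>1\<bar> \<le> \<bar>\<zeta>1 + \<zeta>2\<bar>\<close>. With \<open>R = s = 2 K\<close> this gives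
\<open>M = 4 K\<^sup>3\<close>.\<close>

lemma green_exists_massive:
  assumes z: "1 < \<bar>Im z\<bar>" and m: "0 < m" and D: "3/2 \<le> \<bar>Im z\<bar> \<or> 5/2 * m \<le> \<bar>Re z\<bar>"
  shows "\<exists>up um W. green m z up um W (4 * (7/3 + 4 * m) ^ 3) (\<bar>Im z\<bar> - 1)"
proof -
  define K where "K = 7/3 + 4 * m"
  have K: "1 \<le> K" using m by (simp add: K_def)
  have i1: "Im (z - \<i>) \<noteq> 0" and i2: "Im (z + \<i>) \<noteq> 0" using z by auto
  obtain k1 \<zeta>1 where k1: "k1 = \<zeta>1 * (of_real m + (z - \<i>))" "k1 * \<zeta>1 = of_real m - (z - \<i>)" "\<bar>Im (z - \<i>)\<bar> \<le> Re k1"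
      "0 \<le> Re \<zeta>1" "Im \<zeta>1 * Im (z - \<i>) < 0"
    using characteristic_root[OF i1 less_imp_le[OF m]] by blast
  obtain k2 \<zeta>2 where k2: "k2 = \<zeta>2 * (of_real m + (z + \<i>))" "k2 * \<zeta>2 = of_real m - (z + \<i>)" "\<bar>Im (z + \<i>)\<bar> \<le> Re k2"
      "0 \<le> Re \<zeta>2" "Im \<zeta>2 * Im (z + \<i>) < 0"
    using characteristic_root[OF i2 less_imp_le[OF m]] by blast
  have w1: "1/2 \<le> \<bar>Im (z - \<i>)\<bar> \<or> 5/2 * m \<le> \<bar>Re (z - \<i>)\<bar>" and w2: "1/2 \<le> \<bar>Im (z + \<i>)\<bar> \<or> 5/2 * m \<le> \<bar>Re (z + \<i>)\<bar>"
    using D by (auto simp: abs_if split: if_splits)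
  have sq: "(cmod \<zeta>)\<^sup>2 \<le> K \<and> 1 \<le> K * (cmod \<zeta>)\<^sup>2"
    if "k = \<zeta> * (of_real m + w)" "k * \<zeta> = of_real m - w" "1/2 \<le> \<bar>Im w\<bar> \<or> 5/2 * m \<le> \<bar>Re w\<bar>" "Im w \<noteq> 0" for k \<zeta> w
  proof -
    have p: "0 < cmod (of_real m + w)" "0 < cmod (of_real m - w)" using that(4) by (auto simp: complex_eq_iff)
    have "\<zeta>\<^sup>2 * (of_real m + w) = of_real m - w" using that(1,2) by (simp add: power2_eq_square mult_ac)
    then have e: "(cmod \<zeta>)\<^sup>2 * cmod (of_real m + w) = cmod (of_real m - w)" by (metis norm_mult norm_power)
    note b = characteristic_ratio_bounds[OF m that(3) K_def]
    have "(cmod \<zeta>)\<^sup>2 * cmod (of_real m + w) \<le> K * cmod (of_real m + w)" using b(1) e by simp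
    moreover have "1 * cmod (of_real m + w) \<le> (K * (cmod \<zeta>)\<^sup>2) * cmod (of_real m + w)" using b(2) e by (simp add: mult.assoc)
    ultimately show ?thesis using p(1) by (simp only: mult_le_cancel_right_pos)
  qed
  note s1 = sq[OF k1(1,2) w1 i1] and s2 = sq[OF k2(1,2) w2 i2]
  have quot: "cmod (a / b) \<le> K" if "(cmod a)\<^sup>2 \<le> K" "1 \<le> K * (cmod b)\<^sup>2" for a b
  proof -
    have b: "0 < cmod b" using that(2) by auto
    have "(cmod a)\<^sup>2 \<le> K * (K * (cmod b)\<^sup>2)"
      using that K by (metis mult.right_neutral mult_left_mono order.trans zero_le_one)
    then have "(cmod a)\<^sup>2 \<le> (K * cmod b)\<^sup>2" by (simp add: power2_eq_square mult_ac)
    then have "cmod a \<le> K * cmod b" by (rule power2_le_imp_le) (use K in auto)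
    then show ?thesis using b by (simp add: norm_divide pos_divide_le_eq)
  qed
  have half: "cmod ((1 + c) / 2) + cmod ((1 - c) / 2) \<le> 2 * K" if "cmod c \<le> K" for c
    using norm_triangle_ineq[of 1 c] norm_triangle_ineq4[of 1 c] that K by (simp add: norm_divide)
  \<comment> \<open>Two vectors in a common quadrant: the sum is at least as long as either of them.\<close>
  have low: "1 / K \<le> cmod (\<zeta>1 + \<zeta>2)"
  proof -
    have "0 \<le> Im \<zeta>1 * Im \<zeta>2"
      using k1(5) k2(5) z by (auto simp: mult_less_0_iff zero_le_mult_iff)
    then have "(cmod \<zeta>1)\<^sup>2 \<le> (cmod (\<zeta>1 + \<zeta>2))\<^sup>2"
      unfolding cmod_power2 using mult_nonneg_nonneg[OF k1(4) k2(4)]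
      by (simp add: power2_eq_square algebra_simps)
    moreover have "(1 / K)\<^sup>2 \<le> 1 / K" using K by (simp add: power2_eq_square field_simps)
    moreover have "1 / K \<le> (cmod \<zeta>1)\<^sup>2" using s1 K by (simp add: field_simps)
    ultimately have "(1 / K)\<^sup>2 \<le> (cmod (\<zeta>1 + \<zeta>2))\<^sup>2" by linarith
    then show ?thesis by (rule power2_le_imp_le) simp
  qed
  show ?thesis
  proof (rule green_from_modes[OF z k1(1,2,3) k2(1,2,3), where R = "2 * K" and s = "2 * K"])
    show "\<zeta>1 \<noteq> 0" "\<zeta>2 \<noteq> 0" using s1 s2 by auto
    show "\<zeta>1 + \<zeta>2 \<noteq> 0" using low K by auto
    show "1 + (cmod \<zeta>1)\<^sup>2 \<le> 2 * K" "1 + (cmod \<zeta>2)\<^sup>2 \<le> 2 * K" using s1 s2 K by auto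
    show "1 \<le> 2 * K" using K by simp
    show "cmod ((1 + \<zeta>1 / \<zeta>2) / 2) + cmod ((1 - \<zeta>1 / \<zeta>2) / 2) \<le> 2 * K" by (rule half[OF quot]) (use s1 s2 in auto)
    show "cmod ((1 + \<zeta>2 / \<zeta>1) / 2) + cmod ((1 - \<zeta>2 / \<zeta>1) / 2) \<le> 2 * K" by (rule half[OF quot]) (use s1 s2 in auto)
    have "2 * K * (2 * K) = 4 * K ^ 3 * (1 / K)" using K by (simp add: power3_eq_cube)
    also have "\<dots> \<le> 4 * K ^ 3 * cmod (\<zeta>1 + \<zeta>2)" using low K by (intro mult_left_mono) auto
    finally show "2 * K * (2 * K) \<le> 4 * (7/3 + 4 * m) ^ 3 * cmod (\<zeta>1 + \<zeta>2)" by (simp add: K_def)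
    show "1 \<le> 4 * (7/3 + 4 * m) ^ 3" using one_le_power[OF K, of 3] by (simp add: K_def)
  qed
qed

section \<open>The Hilbert space and the free operator\<close>

lemma square_integrable_rep: "square_integrable (rep_l2 f)"
  using Quotient3_rep_reflp[OF Quotient3_l2, of f] by simp

lemma rep_abs_AE: "square_integrable u \<Longrightarrow> AE x in lebesgue. rep_l2 (abs_l2 u) x = u x"
  using Quotient3_rep_abs[OF Quotient3_l2, of u] by simp

lemma abs_rep: "abs_l2 (rep_l2 f) = f"
  by (rule Quotient3_abs_rep[OF Quotient3_l2])

text \<open>All operators below are described on functions instead of on classes; \<open>u\<close> is any representative,
usually the continuous one.\<close>

definition repr :: "l2 \<Rightarrow> (real \<Rightarrow> complex^2) \<Rightarrow> bool" where
  "repr f u \<longleftrightarrow> (AE x in lebesgue. rep_l2 f x = u x)"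

lemma repr_rep: "repr f (rep_l2 f)" by (simp add: repr_def)

lemma repr_abs: "square_integrable u \<Longrightarrow> repr (abs_l2 u) u"
  by (simp add: repr_def rep_abs_AE)

lemma repr_eqI: "repr f u \<Longrightarrow> repr g v \<Longrightarrow> (AE x in lebesgue. u x = v x) \<Longrightarrow> f = g"
proof -
  assume "repr f u" "repr g v" "AE x in lebesgue. u x = v x"
  then have "AE x in lebesgue. rep_l2 f x = rep_l2 g x" unfolding repr_def by eventually_elim simp
  then show "f = g" using Quotient3_rel_rep[OF Quotient3_l2, of f g] square_integrable_rep by simp
qed

lemma repr_unique: "repr f u \<Longrightarrow> repr g u \<Longrightarrow> f = g"
  by (rule repr_eqI) auto

lemma repr_AE_unique: "repr f u \<Longrightarrow> repr f v \<Longrightarrow> AE x in lebesgue. u x = v x"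
  unfolding repr_def by (erule (1) eventually_elim2) simp

lemma repr_cong: "repr f u \<Longrightarrow> (AE x in lebesgue. u x = v x) \<Longrightarrow> repr f v"
  unfolding repr_def by (erule (1) eventually_elim2) simp

lemma repr_square_integrable:
  assumes "repr f u" "u \<in> borel_measurable lebesgue" shows "square_integrable u"
proof -
  have "integrable lebesgue (\<lambda>x. (norm (u x))\<^sup>2)"
  proof (rule integrable_cong_AE_imp)
    show "integrable lebesgue (\<lambda>x. (norm (rep_l2 f x))\<^sup>2)"
      using square_integrable_rep[of f] by (simp add: square_integrable_def)
    show "(\<lambda>x. (norm (u x))\<^sup>2) \<in> borel_measurable lebesgue" using assms(2) by simp
    show "AE x in lebesgue. (norm (rep_l2 f x))\<^sup>2 = (norm (u x))\<^sup>2"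
      using assms(1) unfolding repr_def by eventually_elim simp
  qed
  then show ?thesis using assms(2) by (simp add: square_integrable_def)
qed

lemma continuous_lebesgue_measurable:
  fixes u :: "real \<Rightarrow> 'a::euclidean_space"
  shows "continuous_on UNIV u \<Longrightarrow> u \<in> borel_measurable lebesgue"
  using borel_measurable_continuous_onI[of u] by (simp add: measurable_completion)

lemma repr_rep_plus: "repr (f + g) (\<lambda>x. rep_l2 f x + rep_l2 g x)"
  using repr_abs[OF square_integrable_add[OF square_integrable_rep[of f] square_integrable_rep[of g]]]
    plus_l2.abs_eq[of "rep_l2 f" "rep_l2 g"] by (simp add: square_integrable_rep abs_rep)

lemma repr_rep_minus: "repr (f - g) (\<lambda>x. rep_l2 f x - rep_l2 g x)"
  using repr_abs[OF square_integrable_diff[OF square_integrable_rep[of f] square_integrable_rep[of g]]]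
    minus_l2.abs_eq[of "rep_l2 f" "rep_l2 g"] by (simp add: square_integrable_rep abs_rep)

lemma repr_rep_scaleC: "repr (scaleC c f) (\<lambda>x. c *s rep_l2 f x)"
  using repr_abs[OF square_integrable_scaleC[OF square_integrable_rep[of f], of c]]
    scaleC.abs_eq[of "rep_l2 f" c] by (simp add: square_integrable_rep abs_rep)

lemma repr_rep_scaleR: "repr (c *\<^sub>R f) (\<lambda>x. c *\<^sub>R rep_l2 f x)"
  using repr_abs[OF square_integrable_scaleR[OF square_integrable_rep[of f], of c]]
    scaleR_l2.abs_eq[of "rep_l2 f" c] by (simp add: square_integrable_rep abs_rep)

lemma repr_plus: "repr f u \<Longrightarrow> repr g v \<Longrightarrow> repr (f + g) (\<lambda>x. u x + v x)"
  by (rule repr_cong[OF repr_rep_plus]) (auto simp: repr_def elim!: eventually_elim2)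

lemma repr_minus: "repr f u \<Longrightarrow> repr g v \<Longrightarrow> repr (f - g) (\<lambda>x. u x - v x)"
  by (rule repr_cong[OF repr_rep_minus]) (auto simp: repr_def elim!: eventually_elim2)

lemma repr_scaleC: "repr f u \<Longrightarrow> repr (scaleC c f) (\<lambda>x. c *s u x)"
  by (rule repr_cong[OF repr_rep_scaleC]) (auto simp: repr_def elim!: eventually_mono)

lemma repr_scaleR: "repr f u \<Longrightarrow> repr (c *\<^sub>R f) (\<lambda>x. c *\<^sub>R u x)"
  by (rule repr_cong[OF repr_rep_scaleR]) (auto simp: repr_def elim!: eventually_mono)

lemma scaleR_eq_scaleC: "c *\<^sub>R f = scaleC (complex_of_real c) f"
proof -
  have "c *\<^sub>R v = complex_of_real c *s v" for v :: "complex^2"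
  proof (rule vec_eq_iff[THEN iffD2], rule allI)
    fix i show "(c *\<^sub>R v) $ i = (complex_of_real c *s v) $ i"
      unfolding vector_scaleR_component vector_smult_component by (rule scaleR_conv_of_real)
  qed
  then show ?thesis
    by (intro repr_eqI[OF repr_rep_scaleR repr_rep_scaleC] AE_I2)
qed

lemma repr_zero: "repr 0 (\<lambda>_. 0)"
  using repr_abs[OF square_integrable_zero] by (simp add: zero_l2.abs_eq)

lemma norm_l2_repr:
  assumes "repr f u" "u \<in> borel_measurable lebesgue"
  shows "norm f = sqrt (LINT x|lebesgue. (norm (u x))\<^sup>2)"
proof -
  have "f \<bullet> f = (LINT x|lebesgue. rep_l2 f x \<bullet> rep_l2 f x)"
    using inner_l2.abs_eq[of "rep_l2 f" "rep_l2 f"] by (simp add: square_integrable_rep abs_rep)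
  also have "\<dots> = (LINT x|lebesgue. (norm (u x))\<^sup>2)"
  proof (rule integral_cong_AE)
    show "AE x in lebesgue. rep_l2 f x \<bullet> rep_l2 f x = (norm (u x))\<^sup>2"
      using assms(1) unfolding repr_def by eventually_elim (simp add: power2_norm_eq_inner)
    show "(\<lambda>x. (norm (u x))\<^sup>2) \<in> borel_measurable lebesgue" using assms(2) by simp
    show "(\<lambda>x. rep_l2 f x \<bullet> rep_l2 f x) \<in> borel_measurable lebesgue"
      using square_integrable_inner[OF square_integrable_rep square_integrable_rep] by auto
  qed
  finally show ?thesis by (simp add: norm_eq_sqrt_inner)
qed

lemma norm_l2_rep: "norm f = sqrt (LINT x|lebesgue. (norm (rep_l2 f x))\<^sup>2)"
  using norm_l2_repr[OF repr_rep] square_integrable_rep by (simp add: square_integrable_def)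

lemma norm_scaleC: "norm (scaleC c f) = cmod c * norm f"
proof -
  have "(\<lambda>x. c *s rep_l2 f x) \<in> borel_measurable lebesgue"
    using square_integrable_scaleC[OF square_integrable_rep[of f], of c] by (simp add: square_integrable_def)
  from norm_l2_repr[OF repr_rep_scaleC this] show ?thesis
    by (simp add: norm_vector_scalar_mult power_mult_distrib norm_l2_rep real_sqrt_mult)
qed

lemma scaleC_add: "scaleC c (f + g) = scaleC c f + scaleC c g"
  by (rule repr_unique[OF repr_scaleC[OF repr_plus[OF repr_rep repr_rep]]],
      rule repr_cong[OF repr_plus[OF repr_rep_scaleC repr_rep_scaleC]]) (auto simp: vector_add_ldistrib)

lemma scaleC_scaleR: "scaleC c (r *\<^sub>R f) = r *\<^sub>R scaleC c f"
  by (rule repr_unique[OF repr_scaleC[OF repr_scaleR[OF repr_rep]]],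
      rule repr_cong[OF repr_scaleR[OF repr_rep_scaleC]]) (auto simp: vec_eq_iff)

lemma bounded_linear_scaleC: "bounded_linear (scaleC c)"
  by (rule bounded_linear_intro[of _ "cmod c"]) (simp_all add: scaleC_add scaleC_scaleR norm_scaleC)

lemma square_integrable_absint:
  fixes u :: "real \<Rightarrow> complex^2"
  assumes "square_integrable u" shows "(\<lambda>x. u x $ i) absolutely_integrable_on {a..b}"
proof -
  have m: "(\<lambda>x. u x $ i) \<in> borel_measurable lebesgue"
    using assms exhaust_2[of i] by (auto simp: square_integrable_def vec2_measurable)
  have "set_integrable lebesgue {a..b} (\<lambda>x. 1 + (norm (u x))\<^sup>2)"
  proof (intro set_integral_add)
    show "set_integrable lebesgue {a..b} (\<lambda>x. (norm (u x))\<^sup>2)"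
      unfolding set_integrable_def using assms
      by (intro integrable_mult_indicator) (auto simp: square_integrable_def)
  qed (auto intro: absolutely_integrable_continuous_real)
  then show ?thesis
  proof (rule set_integrable_bound)
    show "set_borel_measurable lebesgue {a..b} (\<lambda>x. u x $ i)"
      unfolding set_borel_measurable_def using m by (intro borel_measurable_scaleR borel_measurable_indicator) auto
    show "AE x in lebesgue. x \<in> {a..b} \<longrightarrow> norm (u x $ i) \<le> norm (1 + (norm (u x))\<^sup>2)"
    proof (intro AE_I2 impI)
      fix x
      have "norm (u x $ i) \<le> norm (u x)" by (rule Finite_Cartesian_Product.norm_nth_le)
      moreover have "2 * norm (u x) \<le> 1 + (norm (u x))\<^sup>2"
        using zero_le_power2[of "norm (u x) - 1"] by (simp add: power2_eq_square algebra_simps)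
      moreover have "0 \<le> norm (u x)" by simp
      ultimately have "norm (u x $ i) \<le> 1 + (norm (u x))\<^sup>2" by linarith
      then show "norm (u x $ i) \<le> norm (1 + (norm (u x))\<^sup>2)" by simp
    qed
  qed
qed

lemma test_function_product_integrable:
  fixes k :: "real \<Rightarrow> complex"
  assumes \<phi>: "test_function \<phi>" and k: "\<And>a b. k absolutely_integrable_on {a..b}"
  shows "integrable lebesgue (\<lambda>x. deriv \<phi> x *\<^sub>R k x)" "integrable lebesgue (\<lambda>x. \<phi> x *\<^sub>R k x)"
proof -
  obtain R where R: "\<And>x. x \<notin> {-R..R} \<Longrightarrow> \<phi> x = 0" "\<And>x. x \<notin> {-R..R} \<Longrightarrow> deriv \<phi> x = 0"
    using test_function_props(3)[OF \<phi>] by blast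
  show "integrable lebesgue (\<lambda>x. deriv \<phi> x *\<^sub>R k x)"
  proof (rule lebesgue_integral_support(1))
    show "(\<lambda>x. deriv \<phi> x *\<^sub>R k x) absolutely_integrable_on {-R..R}"
      unfolding scaleR_conv_of_real
      by (intro absint_mult_continuous k continuous_on_of_real continuous_on_subset[OF test_function_props(2)[OF \<phi>]]) simp
  qed (simp add: R)
  show "integrable lebesgue (\<lambda>x. \<phi> x *\<^sub>R k x)"
  proof (rule lebesgue_integral_support(1))
    show "(\<lambda>x. \<phi> x *\<^sub>R k x) absolutely_integrable_on {-R..R}"
      unfolding scaleR_conv_of_real
      by (intro absint_mult_continuous k continuous_on_of_real primitive_continuous_on[OF test_function_props(1)[OF \<phi>]])
  qed (simp add: R)
qed

lemma vec2_integral: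
  fixes v :: "real \<Rightarrow> complex^2"
  assumes "integrable M (\<lambda>x. v x $ 1)" "integrable M (\<lambda>x. v x $ 2)"
  shows "integrable M v" "(LINT x|M. v x) $ i = (LINT x|M. v x $ i)"
proof -
  have "v = (\<lambda>x. vector [v x $ 1, 0] + vector [0, v x $ 2])"
    by (rule ext) (metis vec2_decomp vec2_eq_vector)
  then show "integrable M v"
    using Bochner_Integration.integrable_add[OF integrable_bounded_linear[OF bounded_linear_vec2(1) assms(1)]
       integrable_bounded_linear[OF bounded_linear_vec2(2) assms(2)]] by simp
  then show "(LINT x|M. v x) $ i = (LINT x|M. v x $ i)"
    by (rule integral_bounded_linear[OF bounded_linear_vec_nth, symmetric])
qed

lemma weak_deriv_iff_components:
  "weak_deriv f f' \<longleftrightarrow> (\<forall>\<phi>. test_function \<phi> \<longrightarrow> (\<forall>i.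
     (LINT x|lebesgue. deriv \<phi> x *\<^sub>R rep_l2 f x $ i) = - (LINT x|lebesgue. \<phi> x *\<^sub>R rep_l2 f' x $ i)))"
proof -
  have "((LINT x|lebesgue. deriv \<phi> x *\<^sub>R rep_l2 f x) = - (LINT x|lebesgue. \<phi> x *\<^sub>R rep_l2 f' x)) \<longleftrightarrow>
    (\<forall>i. (LINT x|lebesgue. deriv \<phi> x *\<^sub>R rep_l2 f x $ i) = - (LINT x|lebesgue. \<phi> x *\<^sub>R rep_l2 f' x $ i))"
    if \<phi>: "test_function \<phi>" for \<phi>
  proof -
    note i = test_function_product_integrable[OF \<phi> square_integrable_absint[OF square_integrable_rep]]
    have "(LINT x|lebesgue. deriv \<phi> x *\<^sub>R rep_l2 f x) $ j = (LINT x|lebesgue. deriv \<phi> x *\<^sub>R rep_l2 f x $ j)"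
      "(LINT x|lebesgue. \<phi> x *\<^sub>R rep_l2 f' x) $ j = (LINT x|lebesgue. \<phi> x *\<^sub>R rep_l2 f' x $ j)" for j
      by (subst vec2_integral(2); simp add: i)+
    then show ?thesis by (simp add: vec_eq_iff)
  qed
  then show ?thesis unfolding weak_deriv_def by blast
qed

text \<open>Membership in the Sobolev space is the existence of a locally absolutely continuous representative.\<close>

lemma weak_deriv_iff_primitive:
  "weak_deriv f f' \<longleftrightarrow> (\<exists>u. repr f u \<and> (\<forall>i. primitive (\<lambda>x. u x $ i) (\<lambda>x. rep_l2 f' x $ i)))"
proof
  assume w: "weak_deriv f f'"
  have "\<exists>F. (AE x in lebesgue. rep_l2 f x $ i = F x) \<and> primitive F (\<lambda>x. rep_l2 f' x $ i)" for i
    by (rule weak_derivative_has_primitive)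
       (use w in \<open>auto simp: weak_deriv_iff_components intro: square_integrable_absint square_integrable_rep\<close>)
  then obtain F where F: "\<And>i. AE x in lebesgue. rep_l2 f x $ i = F i x" "\<And>i. primitive (F i) (\<lambda>x. rep_l2 f' x $ i)"
    by metis
  have "AE x in lebesgue. rep_l2 f x = (\<chi> i. F i x)"
    using F(1)[of 1] F(1)[of 2] by eventually_elim (simp add: vec_eq_iff forall_2)
  then show "\<exists>u. repr f u \<and> (\<forall>i. primitive (\<lambda>x. u x $ i) (\<lambda>x. rep_l2 f' x $ i))"
    using F(2) by (intro exI[of _ "\<lambda>x. \<chi> i. F i x"]) (simp add: repr_def)
next
  assume "\<exists>u. repr f u \<and> (\<forall>i. primitive (\<lambda>x. u x $ i) (\<lambda>x. rep_l2 f' x $ i))"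
  then obtain u where u: "repr f u" "\<And>i. primitive (\<lambda>x. u x $ i) (\<lambda>x. rep_l2 f' x $ i)" by blast
  show "weak_deriv f f'"
    unfolding weak_deriv_iff_components
  proof (intro allI impI)
    fix \<phi> i assume \<phi>: "test_function \<phi>"
    note bp = test_function_by_parts[OF \<phi> u(2)[of i]]
    have "(LINT x|lebesgue. deriv \<phi> x *\<^sub>R rep_l2 f x $ i) = (LINT x|lebesgue. deriv \<phi> x *\<^sub>R u x $ i)"
    proof (rule integral_cong_AE)
      show "AE x in lebesgue. deriv \<phi> x *\<^sub>R rep_l2 f x $ i = deriv \<phi> x *\<^sub>R u x $ i"
        using u(1) unfolding repr_def by eventually_elim simp
    qed (use bp(2) test_function_product_integrable(1)[OF \<phi> square_integrable_absint[OF square_integrable_rep]] in auto)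
    then show "(LINT x|lebesgue. deriv \<phi> x *\<^sub>R rep_l2 f x $ i) = - (LINT x|lebesgue. \<phi> x *\<^sub>R rep_l2 f' x $ i)"
      using bp(1) by simp
  qed
qed

text \<open>The right-hand side contains no derivative in \<open>L\<^sup>2\<close>: the equation itself shows that the derivative of
\<open>u\<close> is square integrable, as \<open>u\<close> and \<open>g\<close> are.\<close>

lemma dirac_iff: "(f, g) \<in> dirac m \<longleftrightarrow> (\<exists>u. repr f u \<and> dirac_sol m 0 (rep_l2 g) u)"
proof
  assume "(f, g) \<in> dirac m"
  then obtain f' where w: "weak_deriv f f'" and g: "AE x in lebesgue. rep_l2 g x =
        vector [of_real m * rep_l2 f x $ 1 - rep_l2 f' x $ 2, rep_l2 f' x $ 1 - of_real m * rep_l2 f x $ 2]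
        + (\<i> * of_real (sgn x)) *s rep_l2 f x" by (auto simp: dirac_def)
  from w obtain u where u: "repr f u" "\<And>i. primitive (\<lambda>x. u x $ i) (\<lambda>x. rep_l2 f' x $ i)"
    unfolding weak_deriv_iff_primitive by blast
  have ae: "AE x in lebesgue. rep_l2 f' x $ 1 = (of_real m + 0 - \<i> * of_real (sgn x)) * u x $ 2 + rep_l2 g x $ 2"
    "AE x in lebesgue. rep_l2 f' x $ 2 = (of_real m - 0 + \<i> * of_real (sgn x)) * u x $ 1 - rep_l2 g x $ 1"
    using g u(1) unfolding repr_def by (eventually_elim, simp add: algebra_simps)+
  have "dirac_sol m 0 (rep_l2 g) u"
    unfolding dirac_sol_def using primitive_cong_AE[OF u(2) ae(1)] primitive_cong_AE[OF u(2) ae(2)] by simp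
  then show "\<exists>u. repr f u \<and> dirac_sol m 0 (rep_l2 g) u" using u(1) by blast
next
  assume "\<exists>u. repr f u \<and> dirac_sol m 0 (rep_l2 g) u"
  then obtain u where u: "repr f u" "dirac_sol m 0 (rep_l2 g) u" by blast
  define v :: "real \<Rightarrow> complex^2" where "v x = vector [(of_real m + 0 - \<i> * of_real (sgn x)) * u x $ 2 + rep_l2 g x $ 2,
      (of_real m - 0 + \<i> * of_real (sgn x)) * u x $ 1 - rep_l2 g x $ 1]" for x
  have um: "u \<in> borel_measurable lebesgue" by (rule continuous_lebesgue_measurable[OF dirac_sol_continuous[OF u(2)]])
  have usq: "square_integrable u" by (rule repr_square_integrable[OF u(1) um])
  have gsq: "square_integrable (rep_l2 g)" by (rule square_integrable_rep)
  have v: "square_integrable v"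
  proof -
    have [measurable]: "(\<lambda>x::real. x) \<in> borel_measurable lebesgue" by (simp add: measurable_completion)
    have [measurable]: "(\<lambda>x. u x $ 1) \<in> borel_measurable lebesgue" "(\<lambda>x. u x $ 2) \<in> borel_measurable lebesgue"
      "(\<lambda>x. rep_l2 g x $ 1) \<in> borel_measurable lebesgue" "(\<lambda>x. rep_l2 g x $ 2) \<in> borel_measurable lebesgue"
      using um gsq by (auto simp: vec2_measurable square_integrable_def)
    have [measurable]: "v \<in> borel_measurable lebesgue"
      unfolding vec2_measurable v_def vector_2 by (intro conjI) measurable
    have "integrable lebesgue (\<lambda>x. (norm (v x))\<^sup>2)"
    proof (rule Bochner_Integration.integrable_bound)
      show "integrable lebesgue (\<lambda>x. 2 * (\<bar>m\<bar> + 1)\<^sup>2 * (norm (u x))\<^sup>2 + 2 * (norm (rep_l2 g x))\<^sup>2)"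
        using usq gsq by (auto simp: square_integrable_def)
      show "AE x in lebesgue. norm ((norm (v x))\<^sup>2) \<le> norm (2 * (\<bar>m\<bar> + 1)\<^sup>2 * (norm (u x))\<^sup>2 + 2 * (norm (rep_l2 g x))\<^sup>2)"
      proof (intro AE_I2)
        fix x
        have b: "(cmod (c * a + d))\<^sup>2 \<le> 2 * (\<bar>m\<bar> + 1)\<^sup>2 * (cmod a)\<^sup>2 + 2 * (cmod d)\<^sup>2" if "cmod c \<le> \<bar>m\<bar> + 1" for a c d
        proof -
          have "cmod (c * a + d) \<le> (\<bar>m\<bar> + 1) * cmod a + cmod d"
            by (rule order.trans[OF norm_triangle_ineq]) (use that in \<open>auto simp: norm_mult mult_right_mono\<close>)
          then have "(cmod (c * a + d))\<^sup>2 \<le> ((\<bar>m\<bar> + 1) * cmod a + cmod d)\<^sup>2" by (intro power_mono) auto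
          also have "\<dots> \<le> 2 * ((\<bar>m\<bar> + 1) * cmod a)\<^sup>2 + 2 * (cmod d)\<^sup>2"
            using sum_squares_bound[of "(\<bar>m\<bar> + 1) * cmod a" "cmod d"] by (simp add: power2_sum)
          finally show ?thesis by (simp add: power_mult_distrib)
        qed
        have c: "cmod (of_real m + 0 - \<i> * of_real (sgn x)) \<le> \<bar>m\<bar> + 1" "cmod (of_real m - 0 + \<i> * of_real (sgn x)) \<le> \<bar>m\<bar> + 1"
          by (rule order.trans[OF norm_triangle_ineq4] order.trans[OF norm_triangle_ineq]; auto simp: norm_mult sgn_if)+
        have "(norm (v x))\<^sup>2 \<le> 2 * (\<bar>m\<bar> + 1)\<^sup>2 * (norm (u x))\<^sup>2 + 2 * (norm (rep_l2 g x))\<^sup>2"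
          unfolding norm_vec2_sq v_def vector_2
          using b[OF c(1), of "u x $ 2" "rep_l2 g x $ 2"] b[OF c(2), of "u x $ 1" "- rep_l2 g x $ 1"]
          by (simp add: algebra_simps)
        then show "norm ((norm (v x))\<^sup>2) \<le> norm (2 * (\<bar>m\<bar> + 1)\<^sup>2 * (norm (u x))\<^sup>2 + 2 * (norm (rep_l2 g x))\<^sup>2)"
          by simp
      qed
    qed measurable
    then show ?thesis by (simp add: square_integrable_def)
  qed
  define f' where "f' = abs_l2 v"
  have f': "AE x in lebesgue. rep_l2 f' x = v x" unfolding f'_def by (rule rep_abs_AE[OF v])
  have "weak_deriv f f'"
    unfolding weak_deriv_iff_primitive
  proof (intro exI[of _ u] conjI u(1) allI)
    fix i :: 2
    have "primitive (\<lambda>x. u x $ i) (\<lambda>x. v x $ i)"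
      using u(2) exhaust_2[of i] by (auto simp: dirac_sol_def v_def)
    moreover have "AE x in lebesgue. v x $ i = rep_l2 f' x $ i" using f' by eventually_elim simp
    ultimately show "primitive (\<lambda>x. u x $ i) (\<lambda>x. rep_l2 f' x $ i)" by (rule primitive_cong_AE)
  qed
  moreover have "AE x in lebesgue. rep_l2 g x =
        vector [of_real m * rep_l2 f x $ 1 - rep_l2 f' x $ 2, rep_l2 f' x $ 1 - of_real m * rep_l2 f x $ 2]
        + (\<i> * of_real (sgn x)) *s rep_l2 f x"
    using f' u(1) unfolding repr_def
    by eventually_elim (simp add: v_def vec_eq_iff forall_2 algebra_simps)
  ultimately show "(f, g) \<in> dirac m" unfolding dirac_def by blast
qed

lemma resolvent_iff: "(g, f) \<in> resolvent T z \<longleftrightarrow> (f, g + scaleC z f) \<in> T"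
proof -
  have "(f, g) \<in> T -\<^sub>o op_scalar z \<longleftrightarrow> (\<exists>g'. g = g' - scaleC z f \<and> (f, g') \<in> T)"
    by (auto simp: op_diff_def op_scalar_def)
  also have "\<dots> \<longleftrightarrow> (f, g + scaleC z f) \<in> T"
    by (metis add_diff_cancel_right' diff_add_cancel)
  finally show ?thesis by (simp add: resolvent_def)
qed

lemma dirac_resolvent_iff: "(g, f) \<in> resolvent (dirac m) z \<longleftrightarrow> (\<exists>u. repr f u \<and> dirac_sol m z (rep_l2 g) u)"
proof -
  have "dirac_sol m 0 (rep_l2 (g + scaleC z f)) u \<longleftrightarrow> dirac_sol m z (rep_l2 g) u" if "repr f u" for u
  proof -
    have ae: "AE x in lebesgue. rep_l2 (g + scaleC z f) x = rep_l2 g x + (z - 0) *s u x"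
      using repr_plus[OF repr_rep[of g] repr_scaleC[OF that, of z]] by (simp add: repr_def)
    then have ae': "AE x in lebesgue. rep_l2 g x + (z - 0) *s u x = rep_l2 (g + scaleC z f) x"
      by eventually_elim simp
    show ?thesis
      unfolding dirac_sol_shift[of m z "rep_l2 g" u 0] using dirac_sol_cong_AE[OF _ ae] dirac_sol_cong_AE[OF _ ae'] by blast
  qed
  then show ?thesis unfolding resolvent_iff dirac_iff by blast
qed

section \<open>Square roots and polar decompositions of two by two matrices\<close>

definition herm :: "real \<Rightarrow> complex \<Rightarrow> real \<Rightarrow> complex^2^2" where
  "herm a b d = vector [vector [of_real a, b], vector [cnj b, of_real d]]"

lemma herm_nth [simp]:
  "herm a b d $ 1 $ 1 = of_real a" "herm a b d $ 1 $ 2 = b"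
  "herm a b d $ 2 $ 1 = cnj b" "herm a b d $ 2 $ 2 = of_real d"
  by (simp_all add: herm_def)

lemma mat2_eq_iff: "(M :: complex^2^2) = N \<longleftrightarrow> M $ 1 $ 1 = N $ 1 $ 1 \<and> M $ 1 $ 2 = N $ 1 $ 2 \<and> M $ 2 $ 1 = N $ 2 $ 1 \<and> M $ 2 $ 2 = N $ 2 $ 2"
  by (auto simp: vec_eq_iff forall_2)

lemma mat2_mult: "((M :: complex^2^2) ** N) $ i $ j = M $ i $ 1 * N $ 1 $ j + M $ i $ 2 * N $ 2 $ j"
  by (simp add: matrix_matrix_mult_def sum_2)

lemma mat2_vec: "((M :: complex^2^2) *v v) $ i = M $ i $ 1 * v $ 1 + M $ i $ 2 * v $ 2"
  by (simp add: matrix_vector_mult_def sum_2)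

definition ip :: "complex^2 \<Rightarrow> complex^2 \<Rightarrow> complex" where
  "ip v w = cnj (v $ 1) * w $ 1 + cnj (v $ 2) * w $ 2"

lemma norm_ip: "cmod (ip v w) \<le> norm v * norm w"
  using sum_prod_le_norms[of v w] norm_triangle_ineq[of "cnj (v $ 1) * w $ 1" "cnj (v $ 2) * w $ 2"]
  by (simp add: ip_def norm_mult)

lemma norm_sq_ip: "(norm v)\<^sup>2 = Re (ip v v)"
  unfolding norm_vec2_sq cmod_power2 by (simp add: ip_def power2_eq_square)

lemma ip_adjoint: "ip (M *v v) w = ip v (matrix_adjoint M *v w)"
  by (simp add: ip_def mat2_vec matrix_adjoint_def algebra_simps)

lemma ip_nonneg_iff: "matrix_nonneg M \<longleftrightarrow> (\<forall>v. ip v (M *v v) \<in> \<real>\<^sub>\<ge>\<^sub>0)"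
  by (simp add: matrix_nonneg_def ip_def sum_2)

lemma matrix_nonneg_iff_herm:
  "matrix_nonneg S \<longleftrightarrow> (\<exists>a b d. S = herm a b d \<and> 0 \<le> a \<and> 0 \<le> d \<and> (cmod b)\<^sup>2 \<le> a * d)"
proof
  assume "matrix_nonneg S"
  then have q: "Im (ip v (S *v v)) = 0" "0 \<le> Re (ip v (S *v v))" for v
    by (auto simp: ip_nonneg_iff complex_nonneg_Reals_iff)
  define a b d where "a = Re (S $ 1 $ 1)" and "b = S $ 1 $ 2" and "d = Re (S $ 2 $ 2)"
  have 1: "S $ 1 $ 1 = of_real a" "0 \<le> a"
    using q[of "vector [1, 0]"] by (auto simp: ip_def mat2_vec a_def complex_eq_iff)
  have 2: "S $ 2 $ 2 = of_real d" "0 \<le> d"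
    using q[of "vector [0, 1]"] by (auto simp: ip_def mat2_vec d_def complex_eq_iff)
  have 3: "S $ 2 $ 1 = cnj b"
    using q(1)[of "vector [1, 1]"] q(1)[of "vector [1, \<i>]"] 1 2
    by (simp add: ip_def mat2_vec b_def complex_eq_iff)
  have S: "S = herm a b d" using 1 2 3 by (simp add: mat2_eq_iff b_def)
  have e: "Re (ip v (S *v v)) = a * (cmod (v $ 1))\<^sup>2 + d * (cmod (v $ 2))\<^sup>2 + 2 * Re (cnj (v $ 1) * b * v $ 2)" for v
    unfolding S cmod_power2 by (simp add: ip_def mat2_vec algebra_simps power2_eq_square)
  have "(cmod b)\<^sup>2 \<le> a * d"
  proof -
    have f1: "0 \<le> a * (a * d - (cmod b)\<^sup>2)"
    proof -
      have "0 \<le> a * (cmod b)\<^sup>2 + d * a\<^sup>2 - 2 * (a * (cmod b)\<^sup>2)"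
        using q(2)[of "vector [- b, of_real a]"] unfolding e cmod_power2
        by (simp add: power2_eq_square algebra_simps)
      then show ?thesis by (simp add: power2_eq_square algebra_simps)
    qed
    have f2: "0 \<le> d * (a * d - (cmod b)\<^sup>2)"
    proof -
      have "0 \<le> a * d\<^sup>2 + d * (cmod b)\<^sup>2 - 2 * (d * (cmod b)\<^sup>2)"
        using q(2)[of "vector [of_real d, - cnj b]"] unfolding e cmod_power2
        by (simp add: power2_eq_square algebra_simps)
      then show ?thesis by (simp add: power2_eq_square algebra_simps)
    qed
    have f3: "0 \<le> a * (cmod b)\<^sup>2 + d - 2 * (cmod b)\<^sup>2"
      using q(2)[of "vector [- b, 1]"] unfolding e cmod_power2
      by (simp add: power2_eq_square algebra_simps)
    consider "0 < a" | "0 < d" | "a = 0" "d = 0" using 1 2 by linarith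
    then show ?thesis
      by cases (use f1 f2 f3 in \<open>auto simp: zero_le_mult_iff\<close>)
  qed
  then show "\<exists>a b d. S = herm a b d \<and> 0 \<le> a \<and> 0 \<le> d \<and> (cmod b)\<^sup>2 \<le> a * d" using S 1 2 by blast
next
  assume "\<exists>a b d. S = herm a b d \<and> 0 \<le> a \<and> 0 \<le> d \<and> (cmod b)\<^sup>2 \<le> a * d"
  then obtain a b d where S: "S = herm a b d" and a: "0 \<le> a" "0 \<le> d" "(cmod b)\<^sup>2 \<le> a * d" by blast
  show "matrix_nonneg S"
    unfolding ip_nonneg_iff complex_nonneg_Reals_iff
  proof (intro allI conjI)
    fix v
    show "Im (ip v (S *v v)) = 0" unfolding S by (simp add: ip_def mat2_vec algebra_simps)
    have e: "Re (ip v (S *v v)) = a * (cmod (v $ 1))\<^sup>2 + d * (cmod (v $ 2))\<^sup>2 + 2 * Re (cnj (v $ 1) * b * v $ 2)"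
      unfolding S cmod_power2 by (simp add: ip_def mat2_vec algebra_simps power2_eq_square)
    have "\<bar>Re (cnj (v $ 1) * b * v $ 2)\<bar> \<le> cmod (v $ 1) * cmod b * cmod (v $ 2)"
      using abs_Re_le_cmod[of "cnj (v $ 1) * b * v $ 2"] by (simp add: norm_mult)
    also have "cmod b \<le> sqrt (a * d)" by (rule real_le_rsqrt[OF a(3)])
    then have "cmod (v $ 1) * cmod b * cmod (v $ 2) \<le> cmod (v $ 1) * sqrt (a * d) * cmod (v $ 2)"
      by (intro mult_right_mono mult_left_mono) auto
    also have "\<dots> = (sqrt a * cmod (v $ 1)) * (sqrt d * cmod (v $ 2))" by (simp add: real_sqrt_mult)
    finally have "2 * \<bar>Re (cnj (v $ 1) * b * v $ 2)\<bar> \<le> (sqrt a * cmod (v $ 1))\<^sup>2 + (sqrt d * cmod (v $ 2))\<^sup>2"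
      using sum_squares_bound[of "sqrt a * cmod (v $ 1)" "sqrt d * cmod (v $ 2)"] by linarith
    then have "2 * \<bar>Re (cnj (v $ 1) * b * v $ 2)\<bar> \<le> a * (cmod (v $ 1))\<^sup>2 + d * (cmod (v $ 2))\<^sup>2"
      using a by (simp only: power_mult_distrib real_sqrt_pow2)
    then show "0 \<le> Re (ip v (S *v v))" unfolding e by linarith
  qed
qed

lemma matrix_nonneg_adjoint: "matrix_nonneg S \<Longrightarrow> matrix_adjoint S = S"
  unfolding matrix_nonneg_iff_herm by (auto simp: mat2_eq_iff matrix_adjoint_def)

text \<open>The square root of a nonnegative matrix \<open>S\<close> of size two is \<open>(S + sqrt (det S)) / sqrt (tr S + 2 sqrt (det S))\<close>.
The denominator is zero only for \<open>S = 0\<close>, for which division by zero returns the correct value. The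
explicit formula gives existence, uniqueness and measurability at once.\<close>

definition herm_sqrt :: "real \<Rightarrow> complex \<Rightarrow> real \<Rightarrow> complex^2^2" where
  "herm_sqrt a b d = (let e = sqrt (a * d - (cmod b)\<^sup>2); t = sqrt (a + d + 2 * e) in
     herm ((a + e) / t) (b / of_real t) ((d + e) / t))"

lemma herm_sqrt_unique:
  assumes S: "S = herm p q r" "0 \<le> p" "0 \<le> r" "(cmod q)\<^sup>2 \<le> p * r" and sq: "S ** S = herm a b d"
  shows "S = herm_sqrt a b d"
proof -
  have "of_real (p * p) + q * cnj q = complex_of_real a" "cnj q * q + of_real (r * r) = complex_of_real d"
    and b: "b = q * of_real (p + r)"
    using sq unfolding S(1) mat2_eq_iff mat2_mult by (auto simp: algebra_simps)
  then have "complex_of_real (p * p + (cmod q)\<^sup>2) = of_real a" "complex_of_real (r * r + (cmod q)\<^sup>2) = of_real d"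
    by (simp_all add: complex_norm_square[symmetric] mult.commute add.commute)
  then have a: "a = p * p + (cmod q)\<^sup>2" and d: "d = r * r + (cmod q)\<^sup>2"
    unfolding of_real_eq_iff by simp_all
  have cb: "(cmod b)\<^sup>2 = (cmod q)\<^sup>2 * (p + r)\<^sup>2"
    unfolding b norm_mult power_mult_distrib norm_of_real power2_abs ..
  have "a * d - (cmod b)\<^sup>2 = (p * r - (cmod q)\<^sup>2)\<^sup>2"
    unfolding a d cb by (simp add: power2_eq_square algebra_simps)
  then have e: "sqrt (a * d - (cmod b)\<^sup>2) = p * r - (cmod q)\<^sup>2" using S(4) by simp
  have "a + d + 2 * (p * r - (cmod q)\<^sup>2) = (p + r)\<^sup>2"
    unfolding a d by (simp add: power2_eq_square algebra_simps)
  then have t: "sqrt (a + d + 2 * (p * r - (cmod q)\<^sup>2)) = p + r" using S by simp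
  show ?thesis
  proof (cases "p + r = 0")
    case True
    then have "p = 0" "r = 0" using S by auto
    moreover from this have "q = 0" using S(4) by simp
    ultimately show ?thesis unfolding S(1) herm_sqrt_def e t Let_def a d b by simp
  next
    case False
    have "p = (a + (p * r - (cmod q)\<^sup>2)) / (p + r)" "r = (d + (p * r - (cmod q)\<^sup>2)) / (p + r)"
      using False unfolding a d by (simp_all add: field_simps)
    moreover have "q = b / of_real (p + r)" using False unfolding b by (simp add: of_real_eq_0_iff del: of_real_add)
    ultimately show ?thesis unfolding S(1) herm_sqrt_def e t Let_def by simp
  qed
qed

lemma herm_sqrt_props:
  assumes a: "0 \<le> a" "0 \<le> d" "(cmod b)\<^sup>2 \<le> a * d"
  shows "matrix_nonneg (herm_sqrt a b d)" "herm_sqrt a b d ** herm_sqrt a b d = herm a b d"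
proof -
  define e t where "e = sqrt (a * d - (cmod b)\<^sup>2)" and "t = sqrt (a + d + 2 * e)"
  have H: "herm_sqrt a b d = herm ((a + e) / t) (b / of_real t) ((d + e) / t)"
    by (simp add: herm_sqrt_def e_def t_def Let_def)
  have e: "0 \<le> e" "e\<^sup>2 = a * d - (cmod b)\<^sup>2" using a by (auto simp: e_def)
  have t: "0 \<le> t" "t\<^sup>2 = a + d + 2 * e" using a e by (auto simp: t_def)
  have "(cmod (b / of_real t))\<^sup>2 \<le> ((a + e) / t) * ((d + e) / t)"
  proof -
    have "(cmod b)\<^sup>2 \<le> (a + e) * (d + e)"
      using a e by (simp add: algebra_simps add_increasing2)
    then show ?thesis by (simp add: norm_divide power_divide power2_eq_square divide_right_mono)
  qed
  then show "matrix_nonneg (herm_sqrt a b d)"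
    unfolding H matrix_nonneg_iff_herm using a e t
    by (intro exI[where x = "(a + e) / t"], intro exI[where x = "b / of_real t"], intro exI[where x = "(d + e) / t"]) auto
  show "herm_sqrt a b d ** herm_sqrt a b d = herm a b d"
  proof (cases "t = 0")
    case True
    then have "a + d + 2 * e = 0" using t by simp
    then have ad: "a = 0" "d = 0" using a e by auto
    then have "b = 0" using a(3) by simp
    then show ?thesis using ad unfolding H True by (simp add: mat2_eq_iff mat2_mult)
  next
    case False
    then have tt: "t * t \<noteq> 0" by simp
    have bb: "b * cnj b = of_real ((cmod b)\<^sup>2)" "cnj b * b = of_real ((cmod b)\<^sup>2)"
      by (simp_all add: complex_norm_square[symmetric] mult.commute)
    have x1: "((a + e) / t) * ((a + e) / t) + (cmod b)\<^sup>2 / (t * t) = a"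
    proof -
      have "(a + e) * (a + e) + (cmod b)\<^sup>2 = a * (t * t)"
        using e(2) t(2) by (simp add: power2_eq_square algebra_simps)
      then show ?thesis using tt by (simp add: add_divide_distrib[symmetric])
    qed
    have x2: "((d + e) / t) * ((d + e) / t) + (cmod b)\<^sup>2 / (t * t) = d"
    proof -
      have "(d + e) * (d + e) + (cmod b)\<^sup>2 = d * (t * t)"
        using e(2) t(2) by (simp add: power2_eq_square algebra_simps)
      then show ?thesis using tt by (simp add: add_divide_distrib[symmetric])
    qed
    have x3: "((a + e) / t + (d + e) / t) / t = 1"
    proof -
      have "(a + e) + (d + e) = t * t" using t(2) by (simp add: power2_eq_square)
      then show ?thesis using False by (simp add: add_divide_distrib[symmetric])
    qed
    have bt: "b / of_real t * cnj (b / of_real t) = complex_of_real ((cmod b)\<^sup>2 / (t * t))"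
      "cnj (b / of_real t) * (b / of_real t) = complex_of_real ((cmod b)\<^sup>2 / (t * t))"
      using bb by simp_all
    show ?thesis
      unfolding H mat2_eq_iff mat2_mult herm_nth
    proof (intro conjI)
      show "complex_of_real ((a + e) / t) * complex_of_real ((a + e) / t) + b / of_real t * cnj (b / of_real t) = of_real a"
        unfolding bt(1) by (simp only: of_real_mult[symmetric] of_real_add[symmetric] x1)
      show "cnj (b / of_real t) * (b / of_real t) + complex_of_real ((d + e) / t) * complex_of_real ((d + e) / t) = of_real d"
        unfolding bt(2) add.commute[of "complex_of_real ((cmod b)\<^sup>2 / (t * t))"]
        by (simp only: of_real_mult[symmetric] of_real_add[symmetric] x2)
      have x3': "complex_of_real ((a + e) / t) / of_real t + of_real ((d + e) / t) / of_real t = 1"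
        using x3 by (simp only: of_real_divide[symmetric] of_real_add[symmetric] add_divide_distrib[symmetric]) simp
      show "complex_of_real ((a + e) / t) * (b / of_real t) + b / of_real t * complex_of_real ((d + e) / t) = b"
        using arg_cong[OF x3', of "\<lambda>c. b * c"] by (simp add: algebra_simps add_divide_distrib)
      show "cnj (b / of_real t) * complex_of_real ((a + e) / t) + complex_of_real ((d + e) / t) * cnj (b / of_real t) = cnj b"
        using arg_cong[OF x3', of "\<lambda>c. cnj b * c"] by (simp add: algebra_simps add_divide_distrib)
    qed
  qed
qed

lemma matrix_sqrt_herm:
  assumes a: "0 \<le> a" "0 \<le> d" "(cmod b)\<^sup>2 \<le> a * d"
  shows "matrix_sqrt (herm a b d) = herm_sqrt a b d"
  unfolding matrix_sqrt_def
proof (rule the_equality)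
  show "matrix_nonneg (herm_sqrt a b d) \<and> herm_sqrt a b d ** herm_sqrt a b d = herm a b d"
    using herm_sqrt_props[OF a] by blast
  fix S assume "matrix_nonneg S \<and> S ** S = herm a b d"
  then show "S = herm_sqrt a b d" unfolding matrix_nonneg_iff_herm using herm_sqrt_unique by blast
qed

lemma matrix_sqrt_props:
  assumes "matrix_nonneg T"
  shows "matrix_nonneg (matrix_sqrt T)" "matrix_sqrt T ** matrix_sqrt T = T"
proof -
  from assms obtain a b d where T: "T = herm a b d" "0 \<le> a" "0 \<le> d" "(cmod b)\<^sup>2 \<le> a * d"
    unfolding matrix_nonneg_iff_herm by blast
  show "matrix_nonneg (matrix_sqrt T)" "matrix_sqrt T ** matrix_sqrt T = T"
    unfolding T(1) matrix_sqrt_herm[OF T(2-4)] using herm_sqrt_props[OF T(2-4)] by blast+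
qed

lemma adjoint_mult_nonneg: "matrix_nonneg (matrix_adjoint V ** V)"
proof -
  have "ip v ((matrix_adjoint V ** V) *v v) = of_real ((norm (V *v v))\<^sup>2)" for v
  proof -
    have "ip v ((matrix_adjoint V ** V) *v v) = ip (V *v v) (V *v v)"
      unfolding ip_adjoint matrix_vector_mul_assoc ..
    also have "\<dots> = of_real ((norm (V *v v))\<^sup>2)"
      unfolding norm_vec2_sq ip_def of_real_add complex_norm_square by (simp add: mult.commute)
    finally show ?thesis .
  qed
  then show ?thesis unfolding ip_nonneg_iff by simp
qed

lemma matrix_abs_props:
  "matrix_nonneg (matrix_abs V)" "matrix_abs V ** matrix_abs V = matrix_adjoint V ** V"
  unfolding matrix_abs_def using matrix_sqrt_props[OF adjoint_mult_nonneg] by blast+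

lemma norm_matrix_abs: "norm (matrix_abs V *v v) = norm (V *v v)"
proof -
  have "(norm (matrix_abs V *v v))\<^sup>2 = (norm (V *v v))\<^sup>2"
    unfolding norm_sq_ip ip_adjoint matrix_nonneg_adjoint[OF matrix_abs_props(1)] matrix_vector_mul_assoc
      matrix_abs_props(2) ..
  then show ?thesis by (metis norm_ge_zero power2_eq_imp_eq)
qed

lemma bounded_linear_matrix: "bounded_linear (\<lambda>v. (M :: complex^2^2) *v v)"
proof -
  have "linear (\<lambda>v. M *v v)"
    by (rule linearI) (auto simp: vec_eq_iff mat2_vec algebra_simps)
  then show ?thesis by (simp add: linear_conv_bounded_linear)
qed

lemma matrix_opnorm_bound: "norm (M *v v) \<le> matrix_opnorm M * norm v"
  unfolding matrix_opnorm_def using onorm[OF bounded_linear_matrix] .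

lemma matrix_opnorm_nonneg: "0 \<le> matrix_opnorm M"
  unfolding matrix_opnorm_def by (rule onorm_pos_le[OF bounded_linear_matrix])

text \<open>With \<open>T = \<bar>V\<bar>\<close> the left-hand side is the quadratic form \<open>\<langle>v, T v\<rangle>\<close>, and \<open>T v\<close> has the norm of
\<open>V v\<close>.\<close>

lemma norm_sqrt_abs_bound:
  "(norm (matrix_sqrt (matrix_abs V) *v v))\<^sup>2 \<le> matrix_opnorm V * (norm v)\<^sup>2"
proof -
  note s = matrix_sqrt_props[OF matrix_abs_props(1), of V]
  have "(norm (matrix_sqrt (matrix_abs V) *v v))\<^sup>2 = Re (ip v (matrix_abs V *v v))"
    unfolding norm_sq_ip ip_adjoint matrix_nonneg_adjoint[OF s(1)] matrix_vector_mul_assoc s(2) ..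
  also have "\<dots> \<le> norm v * norm (matrix_abs V *v v)"
    using complex_Re_le_cmod[of "ip v (matrix_abs V *v v)"] norm_ip[of v "matrix_abs V *v v"] by linarith
  also have "\<dots> \<le> norm v * (matrix_opnorm V * norm v)"
    unfolding norm_matrix_abs by (intro mult_left_mono matrix_opnorm_bound) simp
  finally show ?thesis by (simp add: power2_eq_square mult_ac)
qed

definition det2 :: "complex^2^2 \<Rightarrow> complex" where
  "det2 M = M $ 1 $ 1 * M $ 2 $ 2 - M $ 1 $ 2 * M $ 2 $ 1"

definition adj2 :: "complex^2^2 \<Rightarrow> complex^2^2" where
  "adj2 M = vector [vector [M $ 2 $ 2, - M $ 1 $ 2], vector [- M $ 2 $ 1, M $ 1 $ 1]]"

definition scale2 :: "complex \<Rightarrow> complex^2^2 \<Rightarrow> complex^2^2" where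
  "scale2 c M = (\<chi> i j. c * M $ i $ j)"

lemma adj2_nth [simp]: "adj2 M $ 1 $ 1 = M $ 2 $ 2" "adj2 M $ 1 $ 2 = - M $ 1 $ 2"
  "adj2 M $ 2 $ 1 = - M $ 2 $ 1" "adj2 M $ 2 $ 2 = M $ 1 $ 1" "scale2 c M $ i $ j = c * M $ i $ j"
  by (simp_all add: adj2_def scale2_def)

lemma det2_mult: "det2 (M ** N) = det2 M * det2 N"
  by (simp add: det2_def mat2_mult algebra_simps)

lemma det2_adjoint: "det2 (matrix_adjoint M) = cnj (det2 M)"
  by (simp add: det2_def matrix_adjoint_def mult.commute)

lemma det2_matrix_abs: "det2 (matrix_abs V) \<noteq> 0 \<longleftrightarrow> det2 V \<noteq> 0"
  using arg_cong[OF matrix_abs_props(2)[of V], of det2] by (auto simp: det2_mult det2_adjoint)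

text \<open>For invertible \<open>V\<close> this is \<open>V \<bar>V\<bar>\<^sup>-\<^sup>1\<close>, written with the adjugate. For singular \<open>V\<close> the matrix
\<open>\<bar>V\<bar>\<close> is its trace times a projection, so that \<open>V\<close> itself is the trace times the partial isometry. As for
the square root, measurability can be read off from the formula.\<close>

definition polar :: "complex^2^2 \<Rightarrow> complex^2^2" where
  "polar V = (if det2 V \<noteq> 0 then V ** scale2 (1 / det2 (matrix_abs V)) (adj2 (matrix_abs V))
     else scale2 (1 / (matrix_abs V $ 1 $ 1 + matrix_abs V $ 2 $ 2)) V)"

text \<open>The first claim is the theorem of Cayley and Hamilton for \<open>\<bar>V\<bar>\<close>, whose determinant is zero. It passes
from \<open>\<bar>V\<bar>\<close> to \<open>V\<close> because \<open>V v\<close> and \<open>\<bar>V\<bar> v\<close> have the same norm for every \<open>v\<close>.\<close>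

lemma singular_matrix_abs:
  assumes "det2 V = 0"
  defines "\<tau> \<equiv> matrix_abs V $ 1 $ 1 + matrix_abs V $ 2 $ 2"
  shows "matrix_abs V ** matrix_abs V = scale2 \<tau> (matrix_abs V)" "V ** matrix_abs V = scale2 \<tau> V" "\<tau> = 0 \<Longrightarrow> V = 0"
    "norm (V *v v) \<le> cmod \<tau> * norm v"
proof -
  have d: "det2 (matrix_abs V) = 0" using assms(1) det2_matrix_abs[of V] by blast
  let ?T = "matrix_abs V"
  have T: "?T $ 1 $ 1 * ?T $ 2 $ 2 = ?T $ 1 $ 2 * ?T $ 2 $ 1" using d by (simp add: det2_def)
  show 1: "?T ** ?T = scale2 \<tau> ?T"
    using T unfolding mat2_eq_iff mat2_mult \<tau>_def by (simp add: algebra_simps)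
  obtain a b c where T': "?T = herm a b c" "0 \<le> a" "0 \<le> c" "(cmod b)\<^sup>2 \<le> a * c"
    using matrix_abs_props(1)[of V] unfolding matrix_nonneg_iff_herm by blast
  have \<tau>: "\<tau> = of_real (a + c)" by (simp add: \<tau>_def T')
  have z: "V *v w = 0 \<longleftrightarrow> ?T *v w = 0" for w using norm_matrix_abs[of V w] by (metis norm_eq_zero)
  show 3: "V = 0" if "\<tau> = 0"
  proof -
    have "a + c = 0" using that unfolding \<tau> by (simp only: of_real_eq_0_iff)
    then have "a = 0" "c = 0" using T' by auto
    then have "?T = 0" using T' by (simp add: mat2_eq_iff)
    then have "V *v w = 0" for w using z by simp
    then show ?thesis by (metis matrix_eq matrix_vector_mult_0)
  qed
  show "V ** ?T = scale2 \<tau> V"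
  proof -
    have "V *v (?T *v w) = V *v (\<tau> *s w)" for w
    proof -
      have "?T *v (?T *v w - \<tau> *s w) = (?T ** ?T) *v w - scale2 \<tau> ?T *v w"
        by (simp add: vec_eq_iff mat2_vec mat2_mult algebra_simps)
      then have "?T *v (?T *v w - \<tau> *s w) = 0" using 1 by simp
      then have "V *v (?T *v w - \<tau> *s w) = 0" using z by simp
      then show ?thesis by (simp add: matrix_vector_mult_diff_distrib)
    qed
    then have "(V ** ?T) *v w = scale2 \<tau> V *v w" for w
      by (simp add: matrix_vector_mul_assoc[symmetric]) (simp add: vec_eq_iff mat2_vec algebra_simps)
    then show ?thesis by (simp add: matrix_eq)
  qed
  show "norm (V *v v) \<le> cmod \<tau> * norm v"
  proof (cases "V *v v = 0")
    case False
    have "(norm (?T *v v))\<^sup>2 = Re (ip v (scale2 \<tau> ?T *v v))"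
      unfolding norm_sq_ip ip_adjoint matrix_nonneg_adjoint[OF matrix_abs_props(1)] matrix_vector_mul_assoc 1 ..
    also have "\<dots> \<le> norm v * norm (scale2 \<tau> ?T *v v)"
      using complex_Re_le_cmod norm_ip order.trans by blast
    also have "scale2 \<tau> ?T *v v = \<tau> *s (?T *v v)" by (simp add: vec_eq_iff mat2_vec algebra_simps)
    finally have "norm (?T *v v) * norm (?T *v v) \<le> (cmod \<tau> * norm v) * norm (?T *v v)"
      by (simp add: norm_vector_scalar_mult power2_eq_square mult_ac)
    moreover have "0 < norm (?T *v v)" using False z by simp
    ultimately show ?thesis by (simp only: mult_le_cancel_right_pos norm_matrix_abs)
  qed simp
qed

text \<open>Uniqueness for singular \<open>V\<close>: for each \<open>w\<close> the vector \<open>\<tau> w - \<bar>V\<bar> w\<close> lies in the kernel of \<open>V\<close>,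
on which every candidate vanishes, and on the range of \<open>\<bar>V\<bar>\<close> all candidates agree.\<close>

lemma polar_props:
  "V = polar V ** matrix_abs V" "V *v v = 0 \<Longrightarrow> polar V *v v = 0" "norm (polar V *v v) \<le> norm v"
  "matrix_polar V = polar V"
proof -
  let ?T = "matrix_abs V"
  let ?I = "scale2 (1 / det2 ?T) (adj2 ?T)"
  have inv: "?T ** ?I = mat 1" "?I ** ?T = mat 1" if "det2 V \<noteq> 0"
    using that det2_matrix_abs[of V] unfolding mat2_eq_iff mat2_mult
    by (simp_all add: mat_def field_simps) (simp_all add: det2_def algebra_simps)
  have z: "V *v w = 0 \<longleftrightarrow> ?T *v w = 0" for w using norm_matrix_abs[of V w] by (metis norm_eq_zero)
  define \<tau> where "\<tau> = ?T $ 1 $ 1 + ?T $ 2 $ 2"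
  note sing = singular_matrix_abs[of V, folded \<tau>_def]
  have polar1: "polar V = V ** ?I" if "det2 V \<noteq> 0" using that by (simp add: polar_def)
  have polar0: "polar V = scale2 (1 / \<tau>) V" if "det2 V = 0" using that by (simp add: polar_def \<tau>_def)
  show 1: "V = polar V ** ?T"
  proof (cases "det2 V = 0")
    case False
    then show ?thesis using inv by (simp add: polar1 matrix_mul_assoc[symmetric])
  next
    case True
    have "scale2 (1 / \<tau>) V ** ?T = scale2 (1 / \<tau>) (V ** ?T)" by (simp add: mat2_eq_iff mat2_mult algebra_simps)
    also have "\<dots> = V" unfolding sing(2)[OF True] using sing(3)[OF True] by (cases "\<tau> = 0") (simp_all add: mat2_eq_iff)
    finally show ?thesis using polar0[OF True] by simp
  qed
  have 2: "polar V *v w = 0" if "V *v w = 0" for w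
  proof (cases "det2 V = 0")
    case False
    have "?T *v w = 0" using that z by simp
    then have "(?I ** ?T) *v w = 0" by (simp add: matrix_vector_mul_assoc[symmetric])
    then have "w = 0" unfolding inv(2)[OF False] by simp
    then show ?thesis by simp
  next
    case True
    have "scale2 (1 / \<tau>) V *v w = (1 / \<tau>) *s (V *v w)" by (simp add: vec_eq_iff mat2_vec algebra_simps)
    then show ?thesis using that polar0[OF True] by simp
  qed
  then show "V *v v = 0 \<Longrightarrow> polar V *v v = 0" by blast
  show "norm (polar V *v v) \<le> norm v"
  proof (cases "det2 V = 0")
    case False
    have "norm (polar V *v v) = norm (V *v (?I *v v))" by (simp add: polar1[OF False] matrix_vector_mul_assoc)
    also have "\<dots> = norm (?T *v (?I *v v))" by (rule norm_matrix_abs[symmetric])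
    also have "\<dots> = norm v" by (simp add: matrix_vector_mul_assoc inv(1)[OF False])
    finally show ?thesis by simp
  next
    case True
    have "polar V *v v = (1 / \<tau>) *s (V *v v)" unfolding polar0[OF True] by (simp add: vec_eq_iff mat2_vec algebra_simps)
    then have "norm (polar V *v v) = norm (V *v v) / cmod \<tau>" by (simp add: norm_vector_scalar_mult norm_divide)
    also have "\<dots> \<le> norm v"
      using sing(4)[OF True, of v] by (cases "\<tau> = 0") (simp_all add: pos_divide_le_eq mult.commute)
    finally show ?thesis .
  qed
  show "matrix_polar V = polar V"
    unfolding matrix_polar_def
  proof (rule the_equality)
    show "V = polar V ** ?T \<and> (\<forall>v. V *v v = 0 \<longrightarrow> polar V *v v = 0)" using 1 2 by blast
    fix U assume U: "V = U ** ?T \<and> (\<forall>v. V *v v = 0 \<longrightarrow> U *v v = 0)"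
    show "U = polar V"
    proof (cases "det2 V = 0")
      case False
      have "V ** ?I = U ** (?T ** ?I)" using U by (metis matrix_mul_assoc)
      then show ?thesis by (simp add: polar1[OF False] inv(1)[OF False])
    next
      case True
      have "U *v w = polar V *v w" for w
      proof (cases "\<tau> = 0")
        case t: True
        then have "V = 0" using sing(3)[OF True] by simp
        then show ?thesis using U 2[of w] by simp
      next
        case t: False
        define y where "y = \<tau> *s w - ?T *v w"
        have "?T *v y = scale2 \<tau> ?T *v w - (?T ** ?T) *v w"
          by (simp add: y_def vec_eq_iff mat2_vec mat2_mult algebra_simps)
        then have "V *v y = 0" using sing(1)[OF True] z by simp
        then have y0: "U *v y = 0" "polar V *v y = 0" using U 2 by auto
        have e: "X *v y = \<tau> *s (X *v w) - (X ** ?T) *v w" for X :: "complex^2^2"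
          unfolding y_def vec_eq_iff mat2_vec by (simp add: mat2_vec mat2_mult algebra_simps)
        have "\<tau> *s (U *v w) = V *v w" "\<tau> *s (polar V *v w) = V *v w"
          using y0 unfolding e using U 1 by auto
        then have "\<tau> *s (U *v w) = \<tau> *s (polar V *v w)" by simp
        then show ?thesis using t by (simp add: vec_eq_iff)
      qed
      then show ?thesis by (simp add: matrix_eq)
    qed
  qed
qed

section \<open>Factorised potentials\<close>

definition entries_measurable :: "(real \<Rightarrow> complex^2^2) \<Rightarrow> bool" where
  "entries_measurable M \<longleftrightarrow> (\<forall>i j. (\<lambda>x. M x $ i $ j) \<in> borel_measurable lebesgue)"

lemma entries_measurableD: "entries_measurable M \<Longrightarrow> (\<lambda>x. M x $ i $ j) \<in> borel_measurable lebesgue"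
  by (simp add: entries_measurable_def)

lemma all_index_pairs: "(\<forall>i j. P (i::2) (j::2)) \<longleftrightarrow> P 1 1 \<and> P 1 2 \<and> P 2 1 \<and> P 2 2"
  by (auto simp: forall_2)

lemma entries_measurable_mult:
  assumes "entries_measurable M" "entries_measurable N" shows "entries_measurable (\<lambda>x. M x ** N x)"
proof -
  note [measurable] = entries_measurableD[OF assms(1)] entries_measurableD[OF assms(2)]
  show ?thesis unfolding entries_measurable_def mat2_mult by measurable
qed

lemma entries_measurable_adjoint:
  assumes "entries_measurable M" shows "entries_measurable (\<lambda>x. matrix_adjoint (M x))"
proof -
  have "(\<lambda>x. cnj (M x $ i $ j)) \<in> borel_measurable lebesgue" for i j
    using measurable_compose[OF entries_measurableD[OF assms] borel_measurable_continuous_onI[OF continuous_on_cnj[OF continuous_on_id]]]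
    by simp
  then show ?thesis unfolding entries_measurable_def matrix_adjoint_def by simp
qed

lemma entries_measurable_sqrt:
  assumes T: "entries_measurable T" "\<And>x. matrix_nonneg (T x)"
  shows "entries_measurable (\<lambda>x. matrix_sqrt (T x))"
proof -
  note [measurable] = entries_measurableD[OF T(1)]
  have eq: "matrix_sqrt (T x) = herm_sqrt (Re (T x $ 1 $ 1)) (T x $ 1 $ 2) (Re (T x $ 2 $ 2))" for x
  proof -
    obtain a b d where H: "T x = herm a b d" "0 \<le> a" "0 \<le> d" "(cmod b)\<^sup>2 \<le> a * d"
      using T(2)[of x] unfolding matrix_nonneg_iff_herm by blast
    show ?thesis unfolding H(1) matrix_sqrt_herm[OF H(2-4)] by simp
  qed
  have cnj: "(\<lambda>x. cnj (f x)) \<in> borel_measurable lebesgue" if "f \<in> borel_measurable lebesgue" for f :: "real \<Rightarrow> complex"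
    using measurable_compose[OF that borel_measurable_continuous_onI[OF continuous_on_cnj[OF continuous_on_id]]] by simp
  show ?thesis
    unfolding entries_measurable_def all_index_pairs eq herm_sqrt_def Let_def herm_nth
    by (intro conjI cnj) measurable
qed

lemma entries_measurable_polar:
  assumes "entries_measurable V" shows "entries_measurable (\<lambda>x. polar (V x))"
proof -
  have T: "entries_measurable (\<lambda>x. matrix_abs (V x))"
    unfolding matrix_abs_def by (intro entries_measurable_sqrt entries_measurable_mult entries_measurable_adjoint assms adjoint_mult_nonneg)
  note [measurable] = entries_measurableD[OF assms] entries_measurableD[OF T]
  have e: "polar M $ i $ j = (if det2 M \<noteq> 0 then (M $ i $ 1 * (1 / det2 (matrix_abs M) * adj2 (matrix_abs M) $ 1 $ j) + M $ i $ 2 * (1 / det2 (matrix_abs M) * adj2 (matrix_abs M) $ 2 $ j))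
     else 1 / (matrix_abs M $ 1 $ 1 + matrix_abs M $ 2 $ 2) * M $ i $ j)" for M i j
    by (simp add: polar_def mat2_mult)
  show ?thesis
    unfolding entries_measurable_def all_index_pairs e adj2_nth det2_def by (intro conjI) measurable
qed

lemma entries_measurable_vec:
  assumes "entries_measurable M" "u \<in> borel_measurable lebesgue"
  shows "(\<lambda>x. M x *v u x) \<in> borel_measurable lebesgue"
proof -
  note [measurable] = entries_measurableD[OF assms(1)]
  have [measurable]: "(\<lambda>x. u x $ 1) \<in> borel_measurable lebesgue" "(\<lambda>x. u x $ 2) \<in> borel_measurable lebesgue"
    using assms(2) by (auto simp: vec2_measurable)
  show ?thesis unfolding vec2_measurable mat2_vec by (intro conjI) measurable
qed

lemma matrix_opnorm_le_norm: "matrix_opnorm M \<le> norm M"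
  unfolding matrix_opnorm_def
proof (rule onorm_bound)
  fix v :: "complex^2"
  have nM: "(norm M)\<^sup>2 = (norm (M $ 1))\<^sup>2 + (norm (M $ 2))\<^sup>2"
    by (simp add: norm_vec_def[of M] L2_set_def sum_2)
  have r: "cmod ((M *v v) $ i) \<le> norm (M $ i) * norm v" for i
    using sum_prod_le_norms[of "M $ i" v] norm_triangle_ineq[of "M $ i $ 1 * v $ 1" "M $ i $ 2 * v $ 2"]
    by (simp add: mat2_vec norm_mult)
  have "(norm (M *v v))\<^sup>2 \<le> (norm (M $ 1) * norm v)\<^sup>2 + (norm (M $ 2) * norm v)\<^sup>2"
    unfolding norm_vec2_sq[of "M *v v"] by (intro add_mono power_mono r) auto
  also have "\<dots> = (norm M * norm v)\<^sup>2"
    unfolding power_mult_distrib nM by (simp add: distrib_right)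
  finally show "norm (M *v v) \<le> norm M * norm v" by (rule power2_le_imp_le) simp
qed simp

lemma matrix_opnorm_continuous: "continuous_on UNIV matrix_opnorm"
proof -
  have tri: "matrix_opnorm M \<le> matrix_opnorm N + norm (M - N)" for M N
  proof -
    have "matrix_opnorm M = onorm (\<lambda>v. N *v v + (M - N) *v v)"
      unfolding matrix_opnorm_def by (simp add: matrix_vector_mult_diff_rdistrib)
    also have "\<dots> \<le> matrix_opnorm N + matrix_opnorm (M - N)"
      unfolding matrix_opnorm_def by (rule onorm_triangle[OF bounded_linear_matrix bounded_linear_matrix])
    also have "\<dots> \<le> matrix_opnorm N + norm (M - N)" using matrix_opnorm_le_norm by simp
    finally show ?thesis .
  qed
  show ?thesis
    unfolding continuous_on_iff
  proof (intro ballI allI impI)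
    fix M :: "complex^2^2" and e :: real assume "0 < e"
    have "dist (matrix_opnorm N) (matrix_opnorm M) < e" if "dist N M < e" for N
      using tri[of N M] tri[of M N] that by (simp add: dist_norm norm_minus_commute abs_less_iff)
    then show "\<exists>d>0. \<forall>N\<in>UNIV. dist N M < d \<longrightarrow> dist (matrix_opnorm N) (matrix_opnorm M) < e"
      using \<open>0 < e\<close> by blast
  qed
qed

definition symbol_A :: "(real \<Rightarrow> complex^2^2) \<Rightarrow> real \<Rightarrow> complex^2^2" where
  "symbol_A V x = matrix_sqrt (matrix_abs (V x))"

definition symbol_B :: "(real \<Rightarrow> complex^2^2) \<Rightarrow> real \<Rightarrow> complex^2^2" where
  "symbol_B V x = polar (V x) ** matrix_sqrt (matrix_abs (V x))"

lemma factor_A_iff: "(f, g) \<in> factor_A V \<longleftrightarrow> repr g (\<lambda>x. symbol_A V x *v rep_l2 f x)"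
  by (simp add: factor_A_def mult_operator_def repr_def symbol_A_def)

lemma factor_B_iff: "(f, g) \<in> factor_B V \<longleftrightarrow> repr g (\<lambda>x. symbol_B V x *v rep_l2 f x)"
  by (simp add: factor_B_def mult_operator_def repr_def symbol_B_def polar_props(4))

lemma symbol_B_symbol_A: "symbol_B V x *v (symbol_A V x *v w) = V x *v w"
  unfolding symbol_A_def symbol_B_def matrix_vector_mul_assoc matrix_mul_assoc[symmetric] matrix_sqrt_props(2)[OF matrix_abs_props(1)]
  by (subst polar_props(1)[of "V x", symmetric]) (rule refl)

lemma norm_symbol_A: "norm (symbol_A V x *v w) \<le> sqrt (matrix_opnorm (V x)) * norm w"
proof -
  have "(norm (symbol_A V x *v w))\<^sup>2 \<le> (sqrt (matrix_opnorm (V x)) * norm w)\<^sup>2"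
    using norm_sqrt_abs_bound[of "V x" w] by (simp add: symbol_A_def power_mult_distrib matrix_opnorm_nonneg)
  then show ?thesis by (rule power2_le_imp_le) (simp add: matrix_opnorm_nonneg)
qed

lemma norm_symbol_B: "norm (symbol_B V x *v w) \<le> sqrt (matrix_opnorm (V x)) * norm w"
  unfolding symbol_B_def matrix_vector_mul_assoc[symmetric]
  using order.trans[OF polar_props(3) norm_symbol_A[unfolded symbol_A_def]] .

locale potential =
  fixes V :: "real \<Rightarrow> complex^2^2"
  assumes V: "integrable lebesgue V"
begin

lemma V_entries_measurable: "entries_measurable V"
proof -
  have "(\<lambda>x. V x $ i $ j) \<in> borel_measurable lebesgue" for i j
    by (intro borel_measurable_integrable integrable_bounded_linear[OF bounded_linear_vec_nth] V)
  then show ?thesis by (simp add: entries_measurable_def)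
qed

lemma abs_entries_measurable: "entries_measurable (\<lambda>x. matrix_abs (V x))"
  unfolding matrix_abs_def by (intro entries_measurable_sqrt entries_measurable_mult entries_measurable_adjoint V_entries_measurable adjoint_mult_nonneg)

lemma A_entries_measurable: "entries_measurable (symbol_A V)"
  unfolding symbol_A_def by (intro entries_measurable_sqrt abs_entries_measurable matrix_abs_props)

lemma B_entries_measurable: "entries_measurable (symbol_B V)"
  unfolding symbol_B_def by (intro entries_measurable_mult entries_measurable_polar V_entries_measurable A_entries_measurable[unfolded symbol_A_def])

definition \<rho> :: "real \<Rightarrow> real" where "\<rho> x = matrix_opnorm (V x)"

lemma \<rho>_nonneg: "0 \<le> \<rho> x" by (simp add: \<rho>_def matrix_opnorm_nonneg)

lemma \<rho>_integrable: "integrable lebesgue \<rho>"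
proof (rule Bochner_Integration.integrable_bound[OF integrable_norm[OF V]])
  show "\<rho> \<in> borel_measurable lebesgue"
    unfolding \<rho>_def using measurable_compose[OF borel_measurable_integrable[OF V] borel_measurable_continuous_onI[OF matrix_opnorm_continuous]] .
  show "AE x in lebesgue. norm (\<rho> x) \<le> norm (norm (V x))"
    using matrix_opnorm_le_norm by (auto simp: \<rho>_def matrix_opnorm_nonneg)
qed

lemma \<rho>_meas [measurable]: "\<rho> \<in> borel_measurable lebesgue"
  using \<rho>_integrable by auto

lemma \<rho>_integral: "(LINT x|lebesgue. \<rho> x) = L1_norm V" and L1_nonneg: "0 \<le> L1_norm V"
proof -
  show "(LINT x|lebesgue. \<rho> x) = L1_norm V" by (simp add: \<rho>_def L1_norm_def)
  moreover have "0 \<le> (LINT x|lebesgue. \<rho> x)" by (rule integral_nonneg_AE) (simp add: \<rho>_nonneg)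
  ultimately show "0 \<le> L1_norm V" by simp
qed

text \<open>Both factors of \<open>V\<close> are bounded by \<open>sqrt \<bar>V\<bar>\<close>, a function in \<open>L\<^sup>2\<close>. Thus \<open>A\<close> maps bounded functions
to \<open>L\<^sup>2\<close> and \<open>B\<close> maps \<open>L\<^sup>2\<close> to \<open>L\<^sup>1\<close>, which fits the mapping properties of the Green operator.\<close>

lemma A_mult_L2:
  assumes u: "u \<in> borel_measurable lebesgue" "\<And>x. norm (u x) \<le> S"
  shows "square_integrable (\<lambda>x. symbol_A V x *v u x)"
    "(LINT x|lebesgue. (norm (symbol_A V x *v u x))\<^sup>2) \<le> S\<^sup>2 * L1_norm V"
proof -
  have m: "(\<lambda>x. symbol_A V x *v u x) \<in> borel_measurable lebesgue" by (rule entries_measurable_vec[OF A_entries_measurable u(1)])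
  have b: "(norm (symbol_A V x *v u x))\<^sup>2 \<le> S\<^sup>2 * \<rho> x" for x
  proof -
    have "(norm (symbol_A V x *v u x))\<^sup>2 \<le> (sqrt (\<rho> x) * norm (u x))\<^sup>2"
      using norm_symbol_A[of V x "u x"] by (intro power_mono) (auto simp: \<rho>_def)
    also have "\<dots> = \<rho> x * (norm (u x))\<^sup>2" by (simp add: power_mult_distrib \<rho>_nonneg)
    also have "\<dots> \<le> \<rho> x * S\<^sup>2" using u(2)[of x] by (intro mult_left_mono power_mono \<rho>_nonneg) auto
    finally show ?thesis by (simp add: mult.commute)
  qed
  have i: "integrable lebesgue (\<lambda>x. (norm (symbol_A V x *v u x))\<^sup>2)"
    by (rule Bochner_Integration.integrable_bound[OF integrable_mult_right[OF \<rho>_integrable, of "S\<^sup>2"]])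
       (use m b in \<open>auto simp: abs_mult \<rho>_nonneg\<close>)
  then show "square_integrable (\<lambda>x. symbol_A V x *v u x)" using m by (simp add: square_integrable_def)
  have "(LINT x|lebesgue. (norm (symbol_A V x *v u x))\<^sup>2) \<le> (LINT x|lebesgue. S\<^sup>2 * \<rho> x)"
    by (rule integral_mono[OF i]) (use \<rho>_integrable b in auto)
  then show "(LINT x|lebesgue. (norm (symbol_A V x *v u x))\<^sup>2) \<le> S\<^sup>2 * L1_norm V"
    by (simp add: \<rho>_integral)
qed

lemma B_mult_L1:
  assumes \<phi>: "square_integrable \<phi>"
  shows "integrable lebesgue (\<lambda>x. symbol_B V x *v \<phi> x)"
    "(LINT x|lebesgue. norm (symbol_B V x *v \<phi> x)) \<le> sqrt (L1_norm V) * sqrt (LINT x|lebesgue. (norm (\<phi> x))\<^sup>2)"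
proof -
  have m: "(\<lambda>x. symbol_B V x *v \<phi> x) \<in> borel_measurable lebesgue"
    using \<phi> by (intro entries_measurable_vec[OF B_entries_measurable]) (simp add: square_integrable_def)
  have [measurable]: "\<phi> \<in> borel_measurable lebesgue" using \<phi> by (simp add: square_integrable_def)
  have cs: "integrable lebesgue (\<lambda>x. sqrt (\<rho> x) * norm (\<phi> x))"
    "(LINT x|lebesgue. sqrt (\<rho> x) * norm (\<phi> x)) \<le> sqrt (LINT x|lebesgue. (sqrt (\<rho> x))\<^sup>2) * sqrt (LINT x|lebesgue. (norm (\<phi> x))\<^sup>2)"
    by (rule integral_Cauchy_Schwarz; use \<phi> \<rho>_integrable in \<open>simp add: square_integrable_def \<rho>_nonneg\<close>)+
  show i: "integrable lebesgue (\<lambda>x. symbol_B V x *v \<phi> x)"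
    by (rule Bochner_Integration.integrable_bound[OF cs(1) m])
       (use norm_symbol_B[of V] in \<open>auto simp: \<rho>_def abs_mult matrix_opnorm_nonneg\<close>)
  have "(LINT x|lebesgue. norm (symbol_B V x *v \<phi> x)) \<le> (LINT x|lebesgue. sqrt (\<rho> x) * norm (\<phi> x))"
    by (rule integral_mono[OF integrable_norm[OF i] cs(1)]) (use norm_symbol_B[of V] in \<open>simp add: \<rho>_def\<close>)
  with cs(2) show "(LINT x|lebesgue. norm (symbol_B V x *v \<phi> x)) \<le> sqrt (L1_norm V) * sqrt (LINT x|lebesgue. (norm (\<phi> x))\<^sup>2)"
    by (simp add: \<rho>_nonneg \<rho>_integral)
qed

lemma V_mult_L1:
  assumes u: "u \<in> borel_measurable lebesgue" "\<And>x. norm (u x) \<le> S"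
  shows "integrable lebesgue (\<lambda>x. V x *v u x)"
    "(LINT x|lebesgue. norm (V x *v u x)) \<le> L1_norm V * S"
proof -
  have m: "(\<lambda>x. V x *v u x) \<in> borel_measurable lebesgue" by (rule entries_measurable_vec[OF V_entries_measurable u(1)])
  have b: "norm (V x *v u x) \<le> \<rho> x * S" for x
    using matrix_opnorm_bound[of "V x" "u x"] mult_left_mono[OF u(2)[of x] \<rho>_nonneg[of x]] by (simp add: \<rho>_def)
  show i: "integrable lebesgue (\<lambda>x. V x *v u x)"
    by (rule Bochner_Integration.integrable_bound[OF integrable_mult_left[OF \<rho>_integrable, of S] m])
       (use b in \<open>auto intro: order.trans[OF _ abs_ge_self]\<close>)
  have "(LINT x|lebesgue. norm (V x *v u x)) \<le> (LINT x|lebesgue. \<rho> x * S)"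
    by (rule integral_mono[OF integrable_norm[OF i]]) (use b \<rho>_integrable in auto)
  then show "(LINT x|lebesgue. norm (V x *v u x)) \<le> L1_norm V * S" by (simp add: \<rho>_integral)
qed

text \<open>Truncation to the sets where \<open>\<bar>V\<bar> \<le> n\<close>.\<close>

lemma dom_B_dense: "\<exists>\<phi>'. norm (\<phi>' - \<phi>) < e \<and> \<phi>' \<in> Domain (factor_B V)" if e: "0 < e"
proof -
  let ?r = "rep_l2 \<phi>"
  have r: "square_integrable ?r" by (rule square_integrable_rep)
  have [measurable]: "?r \<in> borel_measurable lebesgue" using r by (simp add: square_integrable_def)
  define t where "t n x = (if \<rho> x \<le> real n then ?r x else 0)" for n x
  have tm [measurable]: "t n \<in> borel_measurable lebesgue" for n unfolding t_def by measurable
  have tsq: "square_integrable (t n)" for n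
    unfolding square_integrable_def
  proof (intro conjI tm)
    show "integrable lebesgue (\<lambda>x. (norm (t n x))\<^sup>2)"
      by (rule Bochner_Integration.integrable_bound[where f = "\<lambda>x. (norm (?r x))\<^sup>2"])
         (use r in \<open>auto simp: square_integrable_def t_def\<close>)
  qed
  have dom: "abs_l2 (t n) \<in> Domain (factor_B V)" for n
  proof -
    have m: "(\<lambda>x. symbol_B V x *v t n x) \<in> borel_measurable lebesgue" by (rule entries_measurable_vec[OF B_entries_measurable tm])
    have b: "(norm (symbol_B V x *v t n x))\<^sup>2 \<le> real n * (norm (?r x))\<^sup>2" for x
    proof (cases "\<rho> x \<le> real n")
      case True
      have "(norm (symbol_B V x *v t n x))\<^sup>2 \<le> (sqrt (\<rho> x) * norm (t n x))\<^sup>2"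
        using norm_symbol_B[of V x "t n x"] by (intro power_mono) (auto simp: \<rho>_def)
      also have "\<dots> = \<rho> x * (norm (?r x))\<^sup>2" using True by (simp add: power_mult_distrib \<rho>_nonneg t_def)
      also have "\<dots> \<le> real n * (norm (?r x))\<^sup>2" using True by (intro mult_right_mono) auto
      finally show ?thesis .
    qed (simp add: t_def)
    have "integrable lebesgue (\<lambda>x. (norm (symbol_B V x *v t n x))\<^sup>2)"
      by (rule Bochner_Integration.integrable_bound[where f = "\<lambda>x. real n * (norm (?r x))\<^sup>2"])
         (use r b m in \<open>auto simp: square_integrable_def abs_mult\<close>)
    then have sq: "square_integrable (\<lambda>x. symbol_B V x *v t n x)" using m by (simp add: square_integrable_def)
    have "(abs_l2 (t n), abs_l2 (\<lambda>x. symbol_B V x *v t n x)) \<in> factor_B V"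
      unfolding factor_B_iff
      by (rule repr_cong[OF repr_abs[OF sq]])
         (use rep_abs_AE[OF tsq[of n]] in \<open>auto elim: eventually_mono\<close>)
    then show ?thesis by blast
  qed
  have "(\<lambda>n. LINT x|lebesgue. (norm (t n x - ?r x))\<^sup>2) \<longlonglongrightarrow> (LINT x|(lebesgue :: real measure). 0)"
  proof (rule integral_dominated_convergence[where w = "\<lambda>x. (norm (?r x))\<^sup>2"])
    show "integrable lebesgue (\<lambda>x. (norm (?r x))\<^sup>2)" using r by (simp add: square_integrable_def)
    show "AE x in lebesgue. (\<lambda>n. (norm (t n x - ?r x))\<^sup>2) \<longlonglongrightarrow> 0"
    proof (intro AE_I2 tendsto_eventually)
      fix x
      obtain N :: nat where "\<rho> x \<le> real N" using real_arch_simple by blast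
      then show "\<forall>\<^sub>F n in sequentially. (norm (t n x - ?r x))\<^sup>2 = 0"
        by (intro eventually_sequentiallyI[of N]) (auto simp: t_def)
    qed
    show "AE x in lebesgue. norm ((norm (t n x - ?r x))\<^sup>2) \<le> (norm (?r x))\<^sup>2" for n
      by (auto simp: t_def)
  qed auto
  then have "(\<lambda>n. sqrt (LINT x|lebesgue. (norm (t n x - ?r x))\<^sup>2)) \<longlonglongrightarrow> sqrt 0"
    by (intro tendsto_real_sqrt) simp
  moreover have "norm (abs_l2 (t n) - \<phi>) = sqrt (LINT x|lebesgue. (norm (t n x - ?r x))\<^sup>2)" for n
    by (rule norm_l2_repr[OF repr_minus[OF repr_abs[OF tsq] repr_rep]]) measurable
  ultimately have "\<forall>\<^sub>F n in sequentially. norm (abs_l2 (t n) - \<phi>) < e"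
    using order_tendstoD(2)[of _ 0 sequentially e] e by simp
  then obtain n where "norm (abs_l2 (t n) - \<phi>) < e" by (auto simp: eventually_sequentially)
  then show ?thesis using dom by blast
qed

end

lemma closure_graph_dense:
  fixes T :: "l2 \<Rightarrow> l2"
  assumes T: "bounded_linear T" and dense: "\<And>\<phi> e. 0 < e \<Longrightarrow> \<exists>\<phi>'. norm (\<phi>' - \<phi>) < e \<and> \<phi>' \<in> D"
  shows "closure {(\<phi>, T \<phi>) | \<phi>. \<phi> \<in> D} = {(\<phi>, T \<phi>) | \<phi>. True}"
proof
  have cont: "continuous_on UNIV T" by (rule linear_continuous_on[OF T])
  have "closed {p. snd p = T (fst p)}"
    by (intro closed_Collect_eq continuous_on_snd continuous_on_id continuous_on_compose2[OF cont] continuous_on_fst) auto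
  moreover have "{p. snd p = T (fst p)} = {(\<phi>, T \<phi>) | \<phi>. True}" by auto
  ultimately show "closure {(\<phi>, T \<phi>) | \<phi>. \<phi> \<in> D} \<subseteq> {(\<phi>, T \<phi>) | \<phi>. True}"
    by (intro closure_minimal) auto
  show "{(\<phi>, T \<phi>) | \<phi>. True} \<subseteq> closure {(\<phi>, T \<phi>) | \<phi>. \<phi> \<in> D}"
  proof clarify
    fix \<phi>
    show "(\<phi>, T \<phi>) \<in> closure {(\<phi>, T \<phi>) | \<phi>. \<phi> \<in> D}"
      unfolding closure_approachable
    proof (intro allI impI)
      fix e :: real assume e: "0 < e"
      obtain K where K: "0 < K" "\<And>x. norm (T x) \<le> norm x * K" using bounded_linear.pos_bounded[OF T] by blast
      obtain \<phi>' where p: "norm (\<phi>' - \<phi>) < e / (1 + K)" "\<phi>' \<in> D" using dense[of "e / (1 + K)" \<phi>] e K by auto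
      have "dist (\<phi>', T \<phi>') (\<phi>, T \<phi>) \<le> norm (\<phi>' - \<phi>) + norm (T (\<phi>' - \<phi>))"
        unfolding dist_Pair_Pair unfolding dist_norm linear_diff[OF bounded_linear.linear[OF T]]
        by (rule sqrt_sum_squares_le_sum) auto
      also have "\<dots> \<le> norm (\<phi>' - \<phi>) * (1 + K)" using K(2)[of "\<phi>' - \<phi>"] by (simp add: algebra_simps)
      also have "\<dots> < e" using p(1) K(1) by (simp add: pos_less_divide_eq)
      finally show "\<exists>y\<in>{(\<phi>, T \<phi>) | \<phi>. \<phi> \<in> D}. dist y (\<phi>, T \<phi>) < e" using p(2) by blast
    qed
  qed
qed

section \<open>The Birman--Schwinger resolvent formula\<close>

text \<open>The differential operator \<open>L\<^sub>m + V\<close>. Its domain consists of bounded functions: for \<open>V\<close> in \<open>L\<^sup>1\<close>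
neither \<open>V u\<close> nor the derivative of \<open>u\<close> need be in \<open>L\<^sup>2\<close>, but boundedness makes \<open>V u\<close> integrable.\<close>

definition dirac_V :: "real \<Rightarrow> (real \<Rightarrow> complex^2^2) \<Rightarrow> operator" where
  "dirac_V m V = {(f, g). \<exists>u. repr f u \<and> (\<exists>S. \<forall>x. norm (u x) \<le> S) \<and> dirac_sol m 0 (\<lambda>x. rep_l2 g x - V x *v u x) u}"

lemma dirac_V_resolvent_iff:
  "(g, f) \<in> resolvent (dirac_V m V) z \<longleftrightarrow>
    (\<exists>u. repr f u \<and> (\<exists>S. \<forall>x. norm (u x) \<le> S) \<and> dirac_sol m z (\<lambda>x. rep_l2 g x - V x *v u x) u)"
proof -
  have "dirac_sol m 0 (\<lambda>x. rep_l2 (g + scaleC z f) x - V x *v u x) u \<longleftrightarrow> dirac_sol m z (\<lambda>x. rep_l2 g x - V x *v u x) u"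
    if "repr f u" for u
  proof -
    have ae: "AE x in lebesgue. rep_l2 (g + scaleC z f) x = rep_l2 g x + z *s u x"
      using repr_plus[OF repr_rep[of g] repr_scaleC[OF that, of z]] by (simp add: repr_def)
    have 1: "AE x in lebesgue. rep_l2 (g + scaleC z f) x - V x *v u x = (rep_l2 g x - V x *v u x) + (z - 0) *s u x"
      using ae by eventually_elim simp
    have 2: "AE x in lebesgue. (rep_l2 g x - V x *v u x) + (z - 0) *s u x = rep_l2 (g + scaleC z f) x - V x *v u x"
      using ae by eventually_elim simp
    show ?thesis
      unfolding dirac_sol_shift[of m z "\<lambda>x. rep_l2 g x - V x *v u x" u 0] using dirac_sol_cong_AE[OF _ 1] dirac_sol_cong_AE[OF _ 2] by blast
  qed
  then show ?thesis unfolding resolvent_iff dirac_V_def by auto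
qed

text \<open>The resolvent formula is needed at every point \<open>z\<close> of the free resolvent set, whether or not a Green
function is at hand there. Only boundedness of the free resolvent \<open>F\<close> at \<open>z\<close> is assumed, and a Green
function at one reference point \<open>z0\<close>; estimates at \<open>z\<close> come from those at \<open>z0\<close> by treating
\<open>(z - z0) u\<close> as part of the source.\<close>

locale birman_schwinger_at = green m z0 up um W M \<delta> + potential V
  for m :: real and z0 :: complex and up um W M \<delta> and V :: "real \<Rightarrow> complex^2^2" +
  fixes z :: complex and F :: "l2 \<Rightarrow> l2"
  assumes F: "bounded_linear F" and R: "resolvent (dirac m) z = {(g, F g) | g. True}"
begin

definition solves :: "(real \<Rightarrow> complex^2) \<Rightarrow> (real \<Rightarrow> complex^2) \<Rightarrow> bool" where
  "solves h u \<longleftrightarrow> dirac_sol m z h u \<and> square_integrable u"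

lemma solves_meas: "solves h u \<Longrightarrow> u \<in> borel_measurable lebesgue"
  by (simp add: solves_def square_integrable_def)

lemma solves_imp_F: "solves (rep_l2 g) u \<Longrightarrow> repr (F g) u"
proof -
  assume s: "solves (rep_l2 g) u"
  then have r: "repr (abs_l2 u) u" by (simp add: solves_def repr_abs)
  then have "(g, abs_l2 u) \<in> resolvent (dirac m) z"
    unfolding dirac_resolvent_iff using s by (auto simp: solves_def)
  then show "repr (F g) u" using r unfolding R by auto
qed

lemma solves_F_exists: "\<exists>u. solves (rep_l2 g) u"
proof -
  have "(g, F g) \<in> resolvent (dirac m) z" unfolding R by blast
  then obtain u where u: "repr (F g) u" "dirac_sol m z (rep_l2 g) u" unfolding dirac_resolvent_iff by blast
  have "square_integrable u"
    by (rule repr_square_integrable[OF u(1) continuous_lebesgue_measurable[OF dirac_sol_continuous[OF u(2)]]])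
  then show ?thesis using u(2) by (auto simp: solves_def)
qed

lemma solves_cong_AE: "solves h u \<Longrightarrow> (AE x in lebesgue. h x = h' x) \<Longrightarrow> solves h' u"
  using dirac_sol_cong_AE by (auto simp: solves_def)

lemma solves_add: "solves h u \<Longrightarrow> solves h' u' \<Longrightarrow> solves (\<lambda>x. h x + h' x) (\<lambda>x. u x + u' x)"
  by (auto simp: solves_def intro: dirac_sol_add square_integrable_add)

lemma solves_diff: "solves h u \<Longrightarrow> solves h' u' \<Longrightarrow> solves (\<lambda>x. h x - h' x) (\<lambda>x. u x - u' x)"
  by (auto simp: solves_def intro: dirac_sol_diff square_integrable_diff)

lemma solves_cmult: "solves h u \<Longrightarrow> solves (\<lambda>x. c *s h x) (\<lambda>x. c *s u x)"
  by (auto simp: solves_def intro: dirac_sol_cmult square_integrable_scaleC)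

text \<open>The difference of two solutions solves the homogeneous equation, whose only square integrable solution
is \<open>F 0 = 0\<close>; continuity turns equality almost everywhere into equality.\<close>

lemma solves_unique:
  assumes "solves h u" "solves h v" shows "u = v"
proof
  fix x
  have d: "solves (\<lambda>_. 0) (\<lambda>x. u x - v x)" using solves_diff[OF assms] by simp
  have "solves (rep_l2 0) (\<lambda>x. u x - v x)"
    by (rule solves_cong_AE[OF d]) (use repr_zero in \<open>auto simp: repr_def elim: eventually_mono\<close>)
  from solves_imp_F[OF this] have "repr 0 (\<lambda>x. u x - v x)"
    using linear_0[OF bounded_linear.linear[OF F]] by simp
  from repr_AE_unique[OF this repr_zero] have "AE x in lebesgue. x \<in> {x. u x - v x = 0}" by simp
  moreover have "closed {x. u x - v x = 0}"
    by (intro closed_Collect_eq continuous_on_const dirac_sol_continuous[of m z "\<lambda>_. 0"]) (use d in \<open>simp add: solves_def\<close>)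
  ultimately show "u x = v x" using mem_closed_if_AE_lebesgue by fastforce
qed

lemma solves_to_reference: "solves h u \<Longrightarrow> dirac_sol m z0 (\<lambda>x. h x + (z - z0) *s u x) u"
  using dirac_sol_shift[of m z h u z0] by (simp add: solves_def)

text \<open>The first resolvent identity \<open>R(z) h = R(z0) h + (z - z0) R(z) R(z0) h\<close>, where the first application
\<open>R(z0) h = G h\<close> already lies in \<open>L\<^sup>2\<close>.\<close>

lemma solves_L1_exists:
  assumes h: "integrable lebesgue h"
  shows "\<exists>u. solves h u \<and> sqrt (LINT x|lebesgue. (norm (u x))\<^sup>2) \<le> (1 + cmod (z - z0) * onorm F) * sqrt (M / \<delta>) * (LINT x|lebesgue. norm (h x))"
proof -
  note sq = G_L1_square_integrable[OF h]
  have Gm: "G h \<in> borel_measurable lebesgue" using sq(1) by (simp add: square_integrable_def)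
  define e where "e = abs_l2 (G h)"
  have e: "repr e (G h)" unfolding e_def by (rule repr_abs[OF sq(1)])
  obtain v where v: "solves (rep_l2 e) v" using solves_F_exists by blast
  \<comment> \<open>Solve at \<open>z0\<close> first and correct the square integrable error at \<open>z\<close>.\<close>
  have s1: "solves (\<lambda>x. h x + (z0 - z) *s G h x) (G h)"
    using dirac_sol_shift[of m z0 h "G h" z] G_sol[OF admissible_source_L1[OF h]] sq(1) by (simp add: solves_def)
  have s2: "solves (\<lambda>x. (z - z0) *s G h x) (\<lambda>x. (z - z0) *s v x)"
    by (rule solves_cong_AE[OF solves_cmult[OF v]]) (use e in \<open>auto simp: repr_def elim: eventually_mono\<close>)
  have "(\<lambda>x. (h x + (z0 - z) *s G h x) + (z - z0) *s G h x) = h"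
    by (simp add: vec_eq_iff algebra_simps fun_eq_iff)
  with solves_add[OF s1 s2] have s: "solves h (\<lambda>x. G h x + (z - z0) *s v x)" by simp
  have r: "repr (e + scaleC (z - z0) (F e)) (\<lambda>x. G h x + (z - z0) *s v x)"
    by (intro repr_plus e repr_scaleC solves_imp_F v)
  have ne: "norm e \<le> sqrt (M / \<delta>) * (LINT x|lebesgue. norm (h x))"
  proof -
    have "(LINT x|lebesgue. (norm (G h x))\<^sup>2) \<le> (M / \<delta>) * (LINT x|lebesgue. norm (h x))\<^sup>2"
      using sq(2) \<delta>(2) by (simp add: pos_le_divide_eq mult.commute)
    from real_sqrt_le_mono[OF this] show ?thesis
      unfolding norm_l2_repr[OF e Gm] by (simp only: real_sqrt_mult real_sqrt_abs) simp
  qed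
  have "sqrt (LINT x|lebesgue. (norm (G h x + (z - z0) *s v x))\<^sup>2) = norm (e + scaleC (z - z0) (F e))"
    by (rule norm_l2_repr[OF r solves_meas[OF s], symmetric])
  also have "\<dots> \<le> norm e + cmod (z - z0) * (onorm F * norm e)"
    by (rule order.trans[OF norm_triangle_ineq]) (simp add: norm_scaleC mult_left_mono onorm[OF F])
  also have "\<dots> = (1 + cmod (z - z0) * onorm F) * norm e" by (simp add: algebra_simps)
  also have "\<dots> \<le> (1 + cmod (z - z0) * onorm F) * (sqrt (M / \<delta>) * (LINT x|lebesgue. norm (h x)))"
    using ne onorm_pos_le[OF F] by (intro mult_left_mono) auto
  finally show ?thesis using s by (auto simp: mult.assoc)
qed

lemma solves_L1_bound:
  "\<exists>c\<ge>0. \<forall>h u. integrable lebesgue h \<longrightarrow> solves h u \<longrightarrow>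
     sqrt (LINT x|lebesgue. (norm (u x))\<^sup>2) \<le> c * (LINT x|lebesgue. norm (h x)) \<and>
     (\<forall>x. norm (u x) \<le> c * (LINT x|lebesgue. norm (h x)))"
proof -
  define c1 where "c1 = (1 + cmod (z - z0) * onorm F) * sqrt (M / \<delta>)"
  define c2 where "c2 = M + M / sqrt \<delta> * (cmod (z - z0) * c1)"
  have c1: "0 \<le> c1" using onorm_pos_le[OF F] M \<delta>(2) by (auto simp: c1_def)
  have c2: "0 \<le> c2" using c1 M \<delta>(2) by (auto simp: c2_def)
  have b1: "sqrt (LINT x|lebesgue. (norm (u x))\<^sup>2) \<le> c1 * (LINT x|lebesgue. norm (h x))"
    if "integrable lebesgue h" "solves h u" for h u
    using solves_L1_exists[OF that(1)] solves_unique[OF that(2)] unfolding c1_def by blast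
  have b2: "norm (u x) \<le> c2 * (LINT x|lebesgue. norm (h x))"
    if h: "integrable lebesgue h" and s: "solves h u" for h u x
  proof -
    have us1: "square_integrable u" using s by (simp add: solves_def)
    note us = us1 square_integrable_scaleC[OF us1, of "z - z0"]
    have "u = (\<lambda>x. G h x + G (\<lambda>x. (z - z0) *s u x) x)"
      by (rule solution_eq_G_add[OF solves_to_reference[OF s] us(1) h us(2)])
    from fun_cong[OF this, of x] have "norm (u x) = norm (G h x + G (\<lambda>x. (z - z0) *s u x) x)"
      by (rule arg_cong)
    also have "\<dots> \<le> norm (G h x) + norm (G (\<lambda>x. (z - z0) *s u x) x)"
      by (rule norm_triangle_ineq)
    also have "\<dots> \<le> M * (LINT x|lebesgue. norm (h x)) + M / sqrt \<delta> * sqrt (LINT y|lebesgue. (norm ((z - z0) *s u y))\<^sup>2)"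
      by (intro add_mono G_L1_sup h G_L2_sup us)
    also have "sqrt (LINT y|lebesgue. (norm ((z - z0) *s u y))\<^sup>2) = cmod (z - z0) * sqrt (LINT y|lebesgue. (norm (u y))\<^sup>2)"
      unfolding norm_vector_scalar_mult power_mult_distrib by (simp add: real_sqrt_mult)
    also have "M * (LINT x|lebesgue. norm (h x)) + M / sqrt \<delta> * (cmod (z - z0) * sqrt (LINT y|lebesgue. (norm (u y))\<^sup>2))
        \<le> M * (LINT x|lebesgue. norm (h x)) + M / sqrt \<delta> * (cmod (z - z0) * (c1 * (LINT x|lebesgue. norm (h x))))"
      using M \<delta>(2) by (intro add_left_mono mult_left_mono b1 that) auto
    finally show ?thesis by (simp add: c2_def algebra_simps)
  qed
  show ?thesis
  proof (intro exI[of _ "c1 + c2"] conjI allI impI)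
    fix h u x assume a: "integrable lebesgue h" "solves h u"
    have n: "0 \<le> (LINT x|lebesgue. norm (h x))" by simp
    have "0 \<le> c1 * (LINT x|lebesgue. norm (h x))" "0 \<le> c2 * (LINT x|lebesgue. norm (h x))"
      using c1 c2 n by (simp_all only: mult_nonneg_nonneg)
    then show "sqrt (LINT x|lebesgue. (norm (u x))\<^sup>2) \<le> (c1 + c2) * (LINT x|lebesgue. norm (h x))"
      "norm (u x) \<le> (c1 + c2) * (LINT x|lebesgue. norm (h x))"
      using b1[OF a] b2[OF a, of x] unfolding distrib_right by linarith+
  qed (use c1 c2 in auto)
qed

lemma solves_L2_bound: "\<exists>c\<ge>0. \<forall>g u x. solves (rep_l2 g) u \<longrightarrow> norm (u x) \<le> c * norm g"
proof (intro exI[of _ "M / sqrt \<delta> * (1 + cmod (z - z0) * onorm F)"] conjI allI impI)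
  show "0 \<le> M / sqrt \<delta> * (1 + cmod (z - z0) * onorm F)"
    using M \<delta>(2) onorm_pos_le[OF F] by (intro mult_nonneg_nonneg) auto
  fix g u x assume s: "solves (rep_l2 g) u"
  let ?h = "\<lambda>x. rep_l2 g x + (z - z0) *s u x"
  have us1: "square_integrable u" using s by (simp add: solves_def)
  note us = us1 square_integrable_add[OF square_integrable_rep[of g] square_integrable_scaleC[OF us1, of "z - z0"]]
  have hm: "?h \<in> borel_measurable lebesgue" using us(2) by (simp add: square_integrable_def)
  have r: "repr (g + scaleC (z - z0) (F g)) ?h"
    by (intro repr_plus repr_rep repr_scaleC solves_imp_F s)
  have "u = G ?h" by (rule solution_eq_G_L2[OF solves_to_reference[OF s] us])
  from fun_cong[OF this, of x] have "norm (u x) = norm (G ?h x)" by (rule arg_cong)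
  also have "\<dots> \<le> M / sqrt \<delta> * sqrt (LINT y|lebesgue. (norm (?h y))\<^sup>2)" by (rule G_L2_sup[OF us(2)])
  also have "sqrt (LINT y|lebesgue. (norm (?h y))\<^sup>2) = norm (g + scaleC (z - z0) (F g))"
    by (rule norm_l2_repr[OF r hm, symmetric])
  also have "M / sqrt \<delta> * norm (g + scaleC (z - z0) (F g)) \<le> M / sqrt \<delta> * (norm g + cmod (z - z0) * (onorm F * norm g))"
    using M \<delta>(2)
    by (intro mult_left_mono order.trans[OF norm_triangle_ineq]) (auto simp: norm_scaleC intro!: mult_left_mono onorm[OF F])
  finally show "norm (u x) \<le> M / sqrt \<delta> * (1 + cmod (z - z0) * onorm F) * norm g" by (simp add: algebra_simps)
qed

definition S :: "(real \<Rightarrow> complex^2) \<Rightarrow> real \<Rightarrow> complex^2" where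
  "S h = (THE u. solves h u)"

lemma S_eq: "solves h u \<Longrightarrow> S h = u"
  unfolding S_def using solves_unique by blast

lemma S_L1: "integrable lebesgue h \<Longrightarrow> solves h (S h)"
  using solves_L1_exists[of h] S_eq by blast

lemma S_L2: "solves (rep_l2 g) (S (rep_l2 g))"
  using solves_F_exists[of g] S_eq by blast

definition B_image :: "l2 \<Rightarrow> real \<Rightarrow> complex^2" where "B_image \<phi> x = symbol_B V x *v rep_l2 \<phi> x"

lemma B_image_L1: "integrable lebesgue (B_image \<phi>)" "(LINT x|lebesgue. norm (B_image \<phi> x)) \<le> sqrt (L1_norm V) * norm \<phi>"
  using B_mult_L1[OF square_integrable_rep[of \<phi>]] unfolding B_image_def[abs_def] norm_l2_rep by auto

lemma B_image_repr: "repr \<phi> v \<Longrightarrow> AE x in lebesgue. B_image \<phi> x = symbol_B V x *v v x"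
  unfolding repr_def B_image_def by (erule eventually_mono) simp

lemma B_image_add: "AE x in lebesgue. B_image (\<phi> + \<psi>) x = B_image \<phi> x + B_image \<psi> x"
  using B_image_repr[OF repr_plus[OF repr_rep[of \<phi>] repr_rep[of \<psi>]]]
  by eventually_elim (simp add: B_image_def matrix_vector_right_distrib)

lemma B_image_scaleR: "AE x in lebesgue. B_image (r *\<^sub>R \<phi>) x = of_real r *s B_image \<phi> x"
  unfolding scaleR_eq_scaleC using B_image_repr[OF repr_scaleC[OF repr_rep[of \<phi>], of "of_real r"]]
  by eventually_elim (simp add: B_image_def vec_eq_iff mat2_vec algebra_simps)

lemma SB_add: "S (B_image (\<phi> + \<psi>)) = (\<lambda>x. S (B_image \<phi>) x + S (B_image \<psi>) x)"
  by (rule S_eq, rule solves_cong_AE[OF solves_add[OF S_L1[OF B_image_L1(1)] S_L1[OF B_image_L1(1)]]])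
     (use B_image_add[of \<phi> \<psi>] in \<open>auto elim: eventually_mono\<close>)

lemma SB_scaleR: "S (B_image (r *\<^sub>R \<phi>)) = (\<lambda>x. of_real r *s S (B_image \<phi>) x)"
  by (rule S_eq, rule solves_cong_AE[OF solves_cmult[OF S_L1[OF B_image_L1(1)]]])
     (use B_image_scaleR[of r \<phi>] in \<open>auto elim: eventually_mono\<close>)

text \<open>On their domains, \<open>T\<close> is \<open>R\<^sub>0(z) B\<close>, \<open>Q\<close> is \<open>A R\<^sub>0(z) B\<close> and \<open>A_res\<close> is \<open>A R\<^sub>0(z)\<close>; the
solution operator \<open>S\<close>, which accepts integrable sources, extends the first two to all of \<open>L\<^sup>2\<close>.\<close>

definition T :: "l2 \<Rightarrow> l2" where "T \<phi> = abs_l2 (S (B_image \<phi>))"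
definition Q :: "l2 \<Rightarrow> l2" where "Q \<phi> = abs_l2 (\<lambda>x. symbol_A V x *v S (B_image \<phi>) x)"
definition A_res :: "l2 \<Rightarrow> l2" where "A_res g = abs_l2 (\<lambda>x. symbol_A V x *v S (rep_l2 g) x)"

lemma SB_sup: "\<exists>c. \<forall>x. norm (S (B_image \<phi>) x) \<le> c"
  using solves_L1_bound S_L1[OF B_image_L1(1)] B_image_L1(1) by blast

lemma T_repr: "repr (T \<phi>) (S (B_image \<phi>))"
  unfolding T_def using S_L1[OF B_image_L1(1)] by (intro repr_abs) (simp add: solves_def)

lemma Q_repr: "repr (Q \<phi>) (\<lambda>x. symbol_A V x *v S (B_image \<phi>) x)"
  unfolding Q_def using SB_sup[of \<phi>] A_mult_L2(1)[OF solves_meas[OF S_L1[OF B_image_L1(1)]]] by (blast intro: repr_abs)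

lemma A_res_repr: "repr (A_res g) (\<lambda>x. symbol_A V x *v S (rep_l2 g) x)"
proof -
  obtain c where c: "0 \<le> c" "\<And>g u x. solves (rep_l2 g) u \<Longrightarrow> norm (u x) \<le> c * norm g" using solves_L2_bound by blast
  show ?thesis unfolding A_res_def
    by (rule repr_abs, rule A_mult_L2(1)[OF solves_meas[OF S_L2] c(2)[OF S_L2]])
qed

lemma F_repr: "repr (F g) (S (rep_l2 g))" by (rule solves_imp_F[OF S_L2])

lemma T_bounded_linear: "bounded_linear T"
proof -
  obtain c where c: "0 \<le> c" "\<And>h u. integrable lebesgue h \<Longrightarrow> solves h u \<Longrightarrow> sqrt (LINT x|lebesgue. (norm (u x))\<^sup>2) \<le> c * (LINT x|lebesgue. norm (h x))"
    using solves_L1_bound by blast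
  show ?thesis
  proof (rule bounded_linear_intro)
    fix \<phi> \<psi> r
    show "T (\<phi> + \<psi>) = T \<phi> + T \<psi>"
      using T_repr[of "\<phi> + \<psi>"] repr_plus[OF T_repr[of \<phi>] T_repr[of \<psi>]] unfolding SB_add by (rule repr_unique)
    show "T (r *\<^sub>R \<phi>) = r *\<^sub>R T \<phi>"
      using T_repr[of "r *\<^sub>R \<phi>"] repr_scaleC[OF T_repr[of \<phi>], of "of_real r"] unfolding SB_scaleR scaleR_eq_scaleC[of r "T \<phi>"] by (rule repr_unique)
    have "norm (T \<phi>) \<le> c * (LINT x|lebesgue. norm (B_image \<phi> x))"
      unfolding norm_l2_repr[OF T_repr solves_meas[OF S_L1[OF B_image_L1(1)]]] by (rule c(2)[OF B_image_L1(1) S_L1[OF B_image_L1(1)]])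
    also have "\<dots> \<le> c * (sqrt (L1_norm V) * norm \<phi>)" using c(1) B_image_L1(2) by (intro mult_left_mono)
    finally show "norm (T \<phi>) \<le> norm \<phi> * (c * sqrt (L1_norm V))" by (simp add: mult_ac)
  qed
qed

lemma Q_bounded_linear: "bounded_linear Q"
proof -
  obtain c where c: "0 \<le> c" "\<And>h u x. integrable lebesgue h \<Longrightarrow> solves h u \<Longrightarrow> norm (u x) \<le> c * (LINT x|lebesgue. norm (h x))"
    using solves_L1_bound by blast
  show ?thesis
  proof (rule bounded_linear_intro)
    fix \<phi> \<psi> r
    show "Q (\<phi> + \<psi>) = Q \<phi> + Q \<psi>"
      using Q_repr[of "\<phi> + \<psi>"] repr_plus[OF Q_repr[of \<phi>] Q_repr[of \<psi>]]
      unfolding SB_add matrix_vector_right_distrib by (rule repr_unique)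
    have sc: "symbol_A V x *v (of_real r *s v) = of_real r *s (symbol_A V x *v v)" for x v
      by (simp add: vec_eq_iff mat2_vec algebra_simps)
    show "Q (r *\<^sub>R \<phi>) = r *\<^sub>R Q \<phi>"
      using Q_repr[of "r *\<^sub>R \<phi>"] repr_scaleC[OF Q_repr[of \<phi>], of "of_real r"]
      unfolding SB_scaleR scaleR_eq_scaleC[of r "Q \<phi>"] sc by (rule repr_unique)
    have sup: "norm (S (B_image \<phi>) x) \<le> c * (sqrt (L1_norm V) * norm \<phi>)" for x
      using c(2)[OF B_image_L1(1) S_L1[OF B_image_L1(1)], of \<phi> x] mult_left_mono[OF B_image_L1(2)[of \<phi>] c(1)] by linarith
    note a = A_mult_L2[OF solves_meas[OF S_L1[OF B_image_L1(1)]] sup]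
    have "norm (Q \<phi>) = sqrt (LINT x|lebesgue. (norm (symbol_A V x *v S (B_image \<phi>) x))\<^sup>2)"
      by (rule norm_l2_repr[OF Q_repr]) (use a(1) in \<open>simp add: square_integrable_def\<close>)
    also have "\<dots> \<le> sqrt ((c * (sqrt (L1_norm V) * norm \<phi>))\<^sup>2 * L1_norm V)" using a(2) by (rule real_sqrt_le_mono)
    also have "\<dots> = norm \<phi> * (c * sqrt (L1_norm V) * sqrt (L1_norm V))"
      using c(1) L1_nonneg unfolding real_sqrt_mult real_sqrt_abs by (simp add: abs_mult)
    finally show "norm (Q \<phi>) \<le> norm \<phi> * (c * sqrt (L1_norm V) * sqrt (L1_norm V))" .
  qed
qed

lemma S_rep_add: "S (rep_l2 (g + h)) = (\<lambda>x. S (rep_l2 g) x + S (rep_l2 h) x)"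
  by (rule S_eq, rule solves_cong_AE[OF solves_add[OF S_L2 S_L2]])
     (use repr_rep_plus[of g h] in \<open>auto simp: repr_def elim: eventually_mono\<close>)

lemma S_rep_scaleC: "S (rep_l2 (scaleC c g)) = (\<lambda>x. c *s S (rep_l2 g) x)"
  by (rule S_eq, rule solves_cong_AE[OF solves_cmult[OF S_L2]])
     (use repr_rep_scaleC[of c g] in \<open>auto simp: repr_def elim: eventually_mono\<close>)

lemma A_res_bounded_linear: "bounded_linear A_res"
proof -
  obtain c where c: "0 \<le> c" "\<And>g u x. solves (rep_l2 g) u \<Longrightarrow> norm (u x) \<le> c * norm g"
    using solves_L2_bound by blast
  show ?thesis
  proof (rule bounded_linear_intro)
    fix g h r
    show "A_res (g + h) = A_res g + A_res h"
      using A_res_repr[of "g + h"] repr_plus[OF A_res_repr[of g] A_res_repr[of h]]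
      unfolding S_rep_add matrix_vector_right_distrib by (rule repr_unique)
    have sc: "symbol_A V x *v (of_real r *s v) = of_real r *s (symbol_A V x *v v)" for x v
      by (simp add: vec_eq_iff mat2_vec algebra_simps)
    show "A_res (r *\<^sub>R g) = r *\<^sub>R A_res g"
      using A_res_repr[of "r *\<^sub>R g"] repr_scaleC[OF A_res_repr[of g], of "of_real r"]
      unfolding scaleR_eq_scaleC S_rep_scaleC sc by (rule repr_unique)
    note a = A_mult_L2[OF solves_meas[OF S_L2] c(2)[OF S_L2]]
    have "norm (A_res g) = sqrt (LINT x|lebesgue. (norm (symbol_A V x *v S (rep_l2 g) x))\<^sup>2)"
      by (rule norm_l2_repr[OF A_res_repr]) (use a(1) in \<open>simp add: square_integrable_def\<close>)
    also have "\<dots> \<le> sqrt ((c * norm g)\<^sup>2 * L1_norm V)" using a(2) by (rule real_sqrt_le_mono)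
    also have "\<dots> = norm g * (c * sqrt (L1_norm V))"
      using c(1) L1_nonneg unfolding real_sqrt_mult real_sqrt_abs by (simp add: abs_mult)
    finally show "norm (A_res g) \<le> norm g * (c * sqrt (L1_norm V))" .
  qed
qed

lemma resolvent_B_eq: "resolvent (dirac m) z \<circ>\<^sub>o factor_B V = {(\<phi>, T \<phi>) | \<phi>. \<phi> \<in> Domain (factor_B V)}"
proof -
  have "F g = T \<phi>" if "(\<phi>, g) \<in> factor_B V" for \<phi> g
  proof -
    have ae: "AE x in lebesgue. rep_l2 g x = B_image \<phi> x"
      using that unfolding factor_B_iff repr_def B_image_def .
    have "S (rep_l2 g) = S (B_image \<phi>)"
      using S_eq[OF solves_cong_AE[OF S_L2 ae]] by simp
    then show ?thesis using F_repr[of g] T_repr[of \<phi>] repr_unique by simp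
  qed
  then show ?thesis unfolding op_comp_def R by auto
qed

lemma closure_resolvent_B: "closure (resolvent (dirac m) z \<circ>\<^sub>o factor_B V) = {(\<phi>, T \<phi>) | \<phi>. True}"
  unfolding resolvent_B_eq by (rule closure_graph_dense[OF T_bounded_linear dom_B_dense])

lemma birman_schwinger_eq: "birman_schwinger m V z = {(\<phi>, Q \<phi>) | \<phi>. True}"
proof -
  have a: "(T \<phi>, f) \<in> factor_A V \<longleftrightarrow> f = Q \<phi>" for \<phi> f
  proof -
    have ae: "AE x in lebesgue. symbol_A V x *v rep_l2 (T \<phi>) x = symbol_A V x *v S (B_image \<phi>) x"
      using T_repr[of \<phi>] unfolding repr_def by eventually_elim simp
    have ae': "AE x in lebesgue. symbol_A V x *v S (B_image \<phi>) x = symbol_A V x *v rep_l2 (T \<phi>) x"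
      using ae by eventually_elim simp
    show ?thesis unfolding factor_A_iff
      using repr_cong[OF _ ae] repr_cong[OF Q_repr ae'] repr_unique[OF _ Q_repr] by blast
  qed
  have "factor_A V \<circ>\<^sub>o resolvent (dirac m) z \<circ>\<^sub>o factor_B V = {(\<phi>, Q \<phi>) | \<phi>. \<phi> \<in> Domain (factor_B V)}"
    unfolding resolvent_B_eq using a by (auto simp: op_comp_def)
  then show ?thesis
    unfolding birman_schwinger_def using closure_graph_dense[OF Q_bounded_linear dom_B_dense] by simp
qed

lemma A_resolvent_eq: "factor_A V \<circ>\<^sub>o resolvent (dirac m) z = {(g, A_res g) | g. True}"
proof -
  have "(F g, f) \<in> factor_A V \<longleftrightarrow> f = A_res g" for g f
  proof -
    have ae: "AE x in lebesgue. symbol_A V x *v rep_l2 (F g) x = symbol_A V x *v S (rep_l2 g) x"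
      using F_repr[of g] unfolding repr_def by eventually_elim simp
    have ae': "AE x in lebesgue. symbol_A V x *v S (rep_l2 g) x = symbol_A V x *v rep_l2 (F g) x"
      using ae by eventually_elim simp
    show ?thesis unfolding factor_A_iff
      using repr_cong[OF _ ae] repr_cong[OF A_res_repr ae'] repr_unique[OF _ A_res_repr] by blast
  qed
  then show ?thesis unfolding op_comp_def R by auto
qed

lemma resolvent_Q_iff: "(\<psi>, \<phi>) \<in> resolvent (birman_schwinger m V z) (-1) \<longleftrightarrow> \<phi> + Q \<phi> = \<psi>"
proof -
  have m1: "scaleC (-1) \<phi> = - \<phi>" using scaleR_eq_scaleC[of "-1" \<phi>] by simp
  have "(\<psi>, \<phi>) \<in> resolvent (birman_schwinger m V z) (-1) \<longleftrightarrow> \<psi> - \<phi> = Q \<phi>"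
    unfolding resolvent_iff birman_schwinger_eq m1 by simp
  then show ?thesis by (auto simp: algebra_simps)
qed

text \<open>If \<open>u\<close> solves the perturbed equation with source \<open>g\<close> and \<open>\<phi> = A u\<close>, then \<open>B \<phi> = V u\<close>, hence
\<open>u = R\<^sub>0 g - T \<phi>\<close>. Applying \<open>A\<close> gives \<open>\<phi> + Q \<phi> = A R\<^sub>0 g\<close>, which determines \<open>\<phi>\<close>. Conversely
the solution \<open>\<phi>\<close> of the last equation defines such a \<open>u\<close>. Boundedness of \<open>u\<close> comes from the supremum
bounds for the solution operator.\<close>

lemma resolvent_formula:
  assumes K: "bounded_linear K" "resolvent (birman_schwinger m V z) (-1) = {(\<psi>, K \<psi>) | \<psi>. True}"
  shows "resolvent (dirac_V m V) z = resolvent (dirac m) z -\<^sub>o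
            closure (resolvent (dirac m) z \<circ>\<^sub>o factor_B V) \<circ>\<^sub>o
            resolvent (birman_schwinger m V z) (-1) \<circ>\<^sub>o factor_A V \<circ>\<^sub>o resolvent (dirac m) z"
    and "resolvent (dirac_V m V) z = {(g, F g - T (K (A_res g))) | g. True}"
    and "bounded_linear (\<lambda>g. F g - T (K (A_res g)))"
proof -
  show "bounded_linear (\<lambda>g. F g - T (K (A_res g)))"
    by (intro bounded_linear_sub F bounded_linear_compose[OF T_bounded_linear]
        bounded_linear_compose[OF K(1)] A_res_bounded_linear)
  have Kiff: "K \<psi> = \<phi> \<longleftrightarrow> \<phi> + Q \<phi> = \<psi>" for \<psi> \<phi>
    using resolvent_Q_iff[of \<psi> \<phi>] unfolding K(2) by auto
  show g: "resolvent (dirac_V m V) z = {(g, F g - T (K (A_res g))) | g. True}"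
  proof -
    have "(g, f) \<in> resolvent (dirac_V m V) z \<longleftrightarrow> f = F g - T (K (A_res g))" for g f
    proof
      assume "(g, f) \<in> resolvent (dirac_V m V) z"
      then obtain u c where u: "repr f u" "\<And>x. norm (u x) \<le> c" "dirac_sol m z (\<lambda>x. rep_l2 g x - V x *v u x) u"
        unfolding dirac_V_resolvent_iff by blast
      have um: "u \<in> borel_measurable lebesgue" by (rule continuous_lebesgue_measurable[OF dirac_sol_continuous[OF u(3)]])
      have su: "solves (\<lambda>x. rep_l2 g x - V x *v u x) u"
        using u(3) repr_square_integrable[OF u(1) um] by (simp add: solves_def)
      define \<phi> where "\<phi> = abs_l2 (\<lambda>x. symbol_A V x *v u x)"
      have \<phi>: "repr \<phi> (\<lambda>x. symbol_A V x *v u x)" unfolding \<phi>_def by (rule repr_abs[OF A_mult_L2(1)[OF um u(2)]])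
      have B: "AE x in lebesgue. B_image \<phi> x = V x *v u x" using B_image_repr[OF \<phi>] unfolding symbol_B_symbol_A .
      have "solves (rep_l2 g) (\<lambda>x. u x + S (B_image \<phi>) x)"
        by (rule solves_cong_AE[OF solves_add[OF su S_L1[OF B_image_L1(1)]]]) (use B in \<open>auto elim: eventually_mono\<close>)
      then have S: "S (rep_l2 g) = (\<lambda>x. u x + S (B_image \<phi>) x)" by (rule S_eq)
      have "\<phi> + Q \<phi> = A_res g"
        by (rule repr_unique[OF repr_plus[OF \<phi> Q_repr]], rule repr_cong[OF A_res_repr])
           (simp add: S matrix_vector_right_distrib)
      then have "K (A_res g) = \<phi>" using Kiff by blast
      moreover have "repr (F g - T \<phi>) u"
        by (rule repr_cong[OF repr_minus[OF F_repr T_repr]]) (simp add: S)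
      ultimately show "f = F g - T (K (A_res g))" using repr_unique[OF u(1)] by simp
    next
      assume f: "f = F g - T (K (A_res g))"
      define \<phi> where "\<phi> = K (A_res g)"
      have e: "\<phi> + Q \<phi> = A_res g" using Kiff \<phi>_def by blast
      define u where "u x = S (rep_l2 g) x - S (B_image \<phi>) x" for x
      have s: "solves (\<lambda>x. rep_l2 g x - B_image \<phi> x) u"
        unfolding u_def by (rule solves_diff[OF S_L2 S_L1[OF B_image_L1(1)]])
      obtain c1 where c1: "\<And>x. norm (S (rep_l2 g) x) \<le> c1"
        using solves_L2_bound S_L2 by blast
      obtain c2 where c2: "\<And>x. norm (S (B_image \<phi>) x) \<le> c2"
        using SB_sup[of \<phi>] by blast
      have bu: "norm (u x) \<le> c1 + c2" for x
        unfolding u_def by (rule order.trans[OF norm_triangle_ineq4 add_mono[OF c1 c2]])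
      have "repr (A_res g - Q \<phi>) (\<lambda>x. symbol_A V x *v u x)"
        by (rule repr_cong[OF repr_minus[OF A_res_repr Q_repr]]) (simp add: u_def matrix_vector_mult_diff_distrib)
      moreover have "A_res g - Q \<phi> = \<phi>" using e by (simp add: eq_diff_eq[symmetric])
      ultimately have "repr \<phi> (\<lambda>x. symbol_A V x *v u x)" by simp
      from B_image_repr[OF this] have B: "AE x in lebesgue. B_image \<phi> x = V x *v u x" unfolding symbol_B_symbol_A .
      have "solves (\<lambda>x. rep_l2 g x - V x *v u x) u"
        by (rule solves_cong_AE[OF s]) (use B in \<open>auto elim: eventually_mono\<close>)
      moreover have "repr f u"
        unfolding f u_def \<phi>_def[symmetric] by (rule repr_minus[OF F_repr T_repr])
      ultimately show "(g, f) \<in> resolvent (dirac_V m V) z"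
        unfolding dirac_V_resolvent_iff using bu by (auto simp: solves_def)
    qed
    then show ?thesis by auto
  qed
  show "resolvent (dirac_V m V) z = resolvent (dirac m) z -\<^sub>o
            closure (resolvent (dirac m) z \<circ>\<^sub>o factor_B V) \<circ>\<^sub>o
            resolvent (birman_schwinger m V z) (-1) \<circ>\<^sub>o factor_A V \<circ>\<^sub>o resolvent (dirac m) z"
    unfolding g closure_resolvent_B K(2) A_resolvent_eq unfolding R op_diff_def op_comp_def by (auto simp: relcomp_unfold)
qed

end

section \<open>Small potentials and the perturbed operator\<close>

lemma test_function_deriv:
  assumes "test_function \<phi>" shows "test_function (deriv \<phi>)"
proof -
  obtain R where R: "\<And>x. x \<notin> {-R..R} \<Longrightarrow> deriv \<phi> x = 0"
    using test_function_props(3)[OF assms] by blast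
  have "{x. deriv \<phi> x \<noteq> 0} \<subseteq> {-R..R}" using R by blast
  then have "compact (closure {x. deriv \<phi> x \<noteq> 0})"
    by (meson bounded_closed_interval bounded_subset compact_closure)
  moreover have "((deriv ^^ k) (deriv \<phi>)) differentiable (at x)" for k x
    using assms unfolding test_function_def by (metis funpow_simps_right(2) o_apply)
  ultimately show ?thesis by (simp add: test_function_def)
qed

text \<open>If \<open>k\<close> has the primitive zero, then partial integration makes \<open>k\<close> orthogonal to all test functions, in
particular to their derivatives.\<close>

lemma primitive_zero_AE:
  fixes k :: "real \<Rightarrow> complex"
  assumes k: "primitive (\<lambda>_. 0) k" shows "AE x in lebesgue. k x = 0"
proof -
  have "\<exists>c. AE x in lebesgue. k x = c"
  proof (rule du_Bois_Reymond)
    show "k absolutely_integrable_on {a..b}" for a b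
      using primitiveD(1)[OF k, of a b] by (cases "a \<le> b") (auto simp: set_integrable_def)
    show "(LINT x|lebesgue. deriv \<phi> x *\<^sub>R k x) = 0" if "test_function \<phi>" for \<phi>
      using test_function_by_parts(1)[OF test_function_deriv[OF that] k] by simp
  qed
  then obtain c where c: "AE x in lebesgue. k x = c" by blast
  have "integral {0..1::real} (\<lambda>_. c) = 0"
    using primitiveD(2)[OF primitive_cong_AE[OF k c], of 0 1] by simp
  then have "c = 0" by simp
  then show ?thesis using c by simp
qed

lemma continuous_AE_eq:
  fixes u v :: "real \<Rightarrow> complex^2"
  assumes "continuous_on UNIV u" "continuous_on UNIV v" "AE x in lebesgue. u x = v x"
  shows "u = v"
proof
  fix x
  have "closed {x. u x = v x}" by (intro closed_Collect_eq assms)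
  moreover have "AE x in lebesgue. x \<in> {x. u x = v x}" using assms(3) by simp
  ultimately show "u x = v x" using mem_closed_if_AE_lebesgue by blast
qed

text \<open>The operator is single valued because a class has at most one continuous representative and this representative determines the
source almost everywhere.\<close>

lemma dirac_V_linear: "linear_operator (dirac_V m V)"
  unfolding linear_operator_def
proof (intro conjI allI impI)
  show "single_valued (dirac_V m V)"
  proof (rule single_valuedI)
    fix f g g' assume "(f, g) \<in> dirac_V m V" "(f, g') \<in> dirac_V m V"
    then obtain u u' where u: "repr f u" "dirac_sol m 0 (\<lambda>x. rep_l2 g x - V x *v u x) u"
      and u': "repr f u'" "dirac_sol m 0 (\<lambda>x. rep_l2 g' x - V x *v u' x) u'"
      unfolding dirac_V_def by blast
    have uu: "u' = u"
      by (rule continuous_AE_eq[OF dirac_sol_continuous[OF u'(2)] dirac_sol_continuous[OF u(2)] repr_AE_unique[OF u'(1) u(1)]])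
    have s: "dirac_sol m 0 (\<lambda>x. (rep_l2 g x - V x *v u x) - (rep_l2 g' x - V x *v u x)) (\<lambda>x. u x - u x)"
      by (rule dirac_sol_diff[OF u(2) u'(2)[unfolded uu]])
    have p1: "primitive (\<lambda>_. 0) (\<lambda>x. rep_l2 g x $ 2 - rep_l2 g' x $ 2)"
      by (rule primitive_cong[OF dirac_solD(1)[OF s]]) auto
    have p2: "primitive (\<lambda>_. 0) (\<lambda>x. rep_l2 g' x $ 1 - rep_l2 g x $ 1)"
      by (rule primitive_cong[OF dirac_solD(2)[OF s]]) auto
    have "AE x in lebesgue. rep_l2 g x = rep_l2 g' x"
      using primitive_zero_AE[OF p1] primitive_zero_AE[OF p2] by eventually_elim (simp add: vec_eq_iff forall_2)
    then show "g = g'" by (rule repr_eqI[OF repr_rep repr_rep])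
  qed
  have add: "(f + f', g + g') \<in> dirac_V m V" if a: "(f, g) \<in> dirac_V m V" "(f', g') \<in> dirac_V m V" for f g f' g'
  proof -
    obtain u c where u: "repr f u" "\<And>x. norm (u x) \<le> c" "dirac_sol m 0 (\<lambda>x. rep_l2 g x - V x *v u x) u"
      using a(1) unfolding dirac_V_def by blast
    obtain u' c' where u': "repr f' u'" "\<And>x. norm (u' x) \<le> c'" "dirac_sol m 0 (\<lambda>x. rep_l2 g' x - V x *v u' x) u'"
      using a(2) unfolding dirac_V_def by blast
    have "dirac_sol m 0 (\<lambda>x. rep_l2 (g + g') x - V x *v (u x + u' x)) (\<lambda>x. u x + u' x)"
      by (rule dirac_sol_cong_AE[OF dirac_sol_add[OF u(3) u'(3)]])
         (use repr_rep_plus[of g g'] in \<open>auto simp: repr_def matrix_vector_right_distrib elim: eventually_mono\<close>)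
    moreover have "\<forall>x. norm (u x + u' x) \<le> c + c'"
      by (intro allI order.trans[OF norm_triangle_ineq add_mono] u u')
    ultimately show ?thesis using repr_plus[OF u(1) u'(1)] unfolding dirac_V_def by auto
  qed
  show sc: "(scaleC a f, scaleC a g) \<in> dirac_V m V" if H: "(f, g) \<in> dirac_V m V" for a f g
  proof -
    obtain u c where u: "repr f u" "\<And>x. norm (u x) \<le> c" "dirac_sol m 0 (\<lambda>x. rep_l2 g x - V x *v u x) u"
      using H unfolding dirac_V_def by blast
    have e: "V x *v (a *s u x) = a *s (V x *v u x)" for x
      by (simp add: vec_eq_iff mat2_vec algebra_simps)
    have "dirac_sol m 0 (\<lambda>x. rep_l2 (scaleC a g) x - V x *v (a *s u x)) (\<lambda>x. a *s u x)"
    proof (rule dirac_sol_cong_AE[OF dirac_sol_cmult[OF u(3)]])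
      have "AE x in lebesgue. rep_l2 (scaleC a g) x = a *s rep_l2 g x"
        using repr_rep_scaleC[of a g] by (simp add: repr_def)
      then show "AE x in lebesgue. a *s (rep_l2 g x - V x *v u x) = rep_l2 (scaleC a g) x - V x *v (a *s u x)"
        by eventually_elim (simp add: e vec_eq_iff algebra_simps)
    qed
    moreover have "\<forall>x. norm (a *s u x) \<le> cmod a * c"
      by (intro allI) (simp add: norm_vector_scalar_mult mult_left_mono u)
    ultimately show ?thesis using repr_scaleC[OF u(1)] unfolding dirac_V_def by blast
  qed
  show "subspace (dirac_V m V)"
  proof (rule subspaceI)
    have "dirac_sol m 0 (\<lambda>_. 0) (\<lambda>_. 0)"
      unfolding dirac_sol_def by (auto intro: primitive_cong[OF primitive_const])
    then have "dirac_sol m 0 (\<lambda>x. rep_l2 0 x - V x *v 0) (\<lambda>_. 0)"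
      by (rule dirac_sol_cong_AE) (use repr_zero in \<open>auto simp: repr_def elim: eventually_mono\<close>)
    then have "((0 :: l2), (0 :: l2)) \<in> dirac_V m V"
      unfolding dirac_V_def using repr_zero by (auto intro!: exI[of _ "\<lambda>_. 0"])
    then show "0 \<in> dirac_V m V" by (simp add: zero_prod_def)
    show "p + q \<in> dirac_V m V" if "p \<in> dirac_V m V" "q \<in> dirac_V m V" for p q
      using add[of "fst p" "snd p" "fst q" "snd q"] that by (simp add: plus_prod_def)
    show "r *\<^sub>R p \<in> dirac_V m V" if "p \<in> dirac_V m V" for r p
      using sc[of "fst p" "snd p" "of_real r"] that by (simp add: scaleR_prod_def scaleR_eq_scaleC)
  qed
qed

lemma resolvent_graph_imp_closed:
  assumes "resolvent L z = {(g, P g) | g. True}" "bounded_linear P"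
  shows "closed L"
proof -
  have iff: "(f, g) \<in> L \<longleftrightarrow> P (g - scaleC z f) = f" for f g
    using resolvent_iff[of "g - scaleC z f" f L z] unfolding assms(1) by auto
  have "L = {p. P (snd p - scaleC z (fst p)) = fst p}" by (auto simp: iff)
  moreover have "closed {p. P (snd p - scaleC z (fst p)) = fst p}"
    by (intro closed_Collect_eq continuous_on_compose2[OF linear_continuous_on[OF assms(2)], of UNIV]
        continuous_on_compose2[OF linear_continuous_on[OF bounded_linear_scaleC], of UNIV]
        continuous_on_diff continuous_on_fst continuous_on_snd continuous_on_id) auto
  ultimately show ?thesis by simp
qed

lemma resolvent_eq_imp_eq:
  assumes "resolvent L z = resolvent L' z" shows "L = L'"
proof -
  have "(f, g) \<in> L \<longleftrightarrow> (f, g) \<in> L'" for f g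
    using resolvent_iff[of "g - scaleC z f" f L z] resolvent_iff[of "g - scaleC z f" f L' z] assms by simp
  then show ?thesis by auto
qed

context green
begin

definition free_res :: "l2 \<Rightarrow> l2" where "free_res g = abs_l2 (G (rep_l2 g))"

lemma free_res_repr: "repr (free_res g) (G (rep_l2 g))"
  unfolding free_res_def by (rule repr_abs[OF G_L2_square_integrable(1)[OF square_integrable_rep]])

lemma resolvent_dirac_eq: "resolvent (dirac m) z = {(g, free_res g) | g. True}"
proof -
  have "(g, f) \<in> resolvent (dirac m) z \<longleftrightarrow> f = free_res g" for g f
  proof
    assume "(g, f) \<in> resolvent (dirac m) z"
    then obtain u where u: "repr f u" "dirac_sol m z (rep_l2 g) u" unfolding dirac_resolvent_iff by blast
    have "square_integrable u"
      by (rule repr_square_integrable[OF u(1) continuous_lebesgue_measurable[OF dirac_sol_continuous[OF u(2)]]])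
    then have "u = G (rep_l2 g)" by (rule solution_eq_G_L2[OF u(2) _ square_integrable_rep])
    then show "f = free_res g" using u(1) free_res_repr repr_unique by blast
  next
    assume "f = free_res g"
    then show "(g, f) \<in> resolvent (dirac m) z"
      unfolding dirac_resolvent_iff using free_res_repr G_sol[OF admissible_source_L2[OF square_integrable_rep]] by blast
  qed
  then show ?thesis by auto
qed

lemma norm_free_res: "norm (free_res g) \<le> norm g / \<delta>"
proof -
  note sq = G_L2_square_integrable[OF square_integrable_rep[of g]]
  have "norm (free_res g) = sqrt (LINT x|lebesgue. (norm (G (rep_l2 g) x))\<^sup>2)"
    by (rule norm_l2_repr[OF free_res_repr]) (use sq(1) in \<open>simp add: square_integrable_def\<close>)
  also have "\<dots> \<le> sqrt ((LINT x|lebesgue. (norm (rep_l2 g x))\<^sup>2) / \<delta>\<^sup>2)" by (rule real_sqrt_le_mono[OF sq(2)])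
  also have "\<dots> = norm g / \<delta>" using \<delta>(2) by (simp add: real_sqrt_divide norm_l2_rep)
  finally show ?thesis .
qed

lemma free_res_bounded_linear: "bounded_linear free_res"
proof (rule bounded_linear_intro)
  fix g h r
  have "(g + h, free_res g + free_res h) \<in> resolvent (dirac m) z"
    unfolding dirac_resolvent_iff
    by (intro exI[of _ "\<lambda>x. G (rep_l2 g) x + G (rep_l2 h) x"] conjI repr_plus free_res_repr
        dirac_sol_cong_AE[OF dirac_sol_add[OF G_sol[OF admissible_source_L2[OF square_integrable_rep]] G_sol[OF admissible_source_L2[OF square_integrable_rep]]]])
       (use repr_rep_plus[of g h] in \<open>auto simp: repr_def elim: eventually_mono\<close>)
  then show "free_res (g + h) = free_res g + free_res h" unfolding resolvent_dirac_eq by auto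
  have "(r *\<^sub>R g, r *\<^sub>R free_res g) \<in> resolvent (dirac m) z"
    unfolding dirac_resolvent_iff scaleR_eq_scaleC
    by (intro exI[of _ "\<lambda>x. of_real r *s G (rep_l2 g) x"] conjI repr_scaleC free_res_repr
        dirac_sol_cong_AE[OF dirac_sol_cmult[OF G_sol[OF admissible_source_L2[OF square_integrable_rep]]]])
       (use repr_rep_scaleC[of "of_real r" g] in \<open>auto simp: repr_def elim: eventually_mono\<close>)
  then show "free_res (r *\<^sub>R g) = r *\<^sub>R free_res g" unfolding resolvent_dirac_eq by auto
  show "norm (free_res g) \<le> norm g * (1 / \<delta>)" using norm_free_res by simp
qed

lemma G_diff:
  assumes "integrable lebesgue h" "integrable lebesgue h'"
  shows "G (\<lambda>x. h x - h' x) = (\<lambda>x. G h x - G h' x)"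
  by (rule solution_eq_G_L1[symmetric, OF dirac_sol_diff[OF G_sol G_sol] square_integrable_diff])
     (use assms in \<open>auto intro: admissible_source_L1 G_L1_square_integrable\<close>)

end

text \<open>The supremum \<open>s\<close> is finite by the a priori bound \<open>B\<close>, and so \<open>s \<le> a + q s\<close> can be solved
for \<open>s\<close>.\<close>

lemma sup_bound_contraction:
  fixes u :: "real \<Rightarrow> 'a::real_normed_vector"
  assumes b: "\<And>x. norm (u x) \<le> B" and q: "0 \<le> q" "q < 1"
    and step: "\<And>S. (\<And>x. norm (u x) \<le> S) \<Longrightarrow> (\<And>x. norm (u x) \<le> a + q * S)"
  shows "norm (u x) \<le> a / (1 - q)"
proof -
  define s where "s = (SUP x. norm (u x))"
  have bdd: "bdd_above (range (\<lambda>x. norm (u x)))" by (rule bdd_aboveI2) (rule b)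
  have up: "norm (u x) \<le> s" for x unfolding s_def by (rule cSUP_upper[OF _ bdd]) simp
  have "s \<le> a + q * s" unfolding s_def by (rule cSUP_least) (use step[OF up] in \<open>auto simp: s_def\<close>)
  then have "s \<le> a / (1 - q)" using q by (simp add: pos_le_divide_eq algebra_simps)
  then show ?thesis using up[of x] by linarith
qed

locale small_potential = green m z up um W M \<delta> + potential V
  for m :: real and z :: complex and up um W M \<delta> and V :: "real \<Rightarrow> complex^2^2" +
  assumes small: "M * L1_norm V < 1"
begin

sublocale birman_schwinger_at m z up um W M \<delta> V z free_res
  by (intro birman_schwinger_at.intro birman_schwinger_at_axioms.intro green_axioms potential_axioms free_res_bounded_linear resolvent_dirac_eq)

lemma Mv_nonneg: "0 \<le> M * L1_norm V" using M L1_nonneg by auto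

lemma S_eq_G: "integrable lebesgue h \<Longrightarrow> S h = G h"
  by (rule S_eq) (simp add: solves_def G_sol admissible_source_L1 G_L1_square_integrable)

text \<open>Banach's fixed point theorem on bounded continuous functions: \<open>G\<close> maps \<open>L\<^sup>1\<close> to bounded functions
with norm \<open>M\<close>, and multiplication by \<open>V\<close> maps bounded functions to \<open>L\<^sup>1\<close> with norm \<open>v\<close>.\<close>

lemma fixed_point_exists:
  "\<exists>u. continuous_on UNIV u \<and> bounded (range u) \<and> u = G (\<lambda>x. B_image \<psi> x - V x *v u x)"
proof -
  define \<Phi> where "\<Phi> u = Bcontfun (G (\<lambda>x. B_image \<psi> x - V x *v apply_bcontfun u x))" for u
  have meas: "apply_bcontfun u \<in> borel_measurable lebesgue" for u :: "(real, complex^2) bcontfun"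
    by (rule continuous_lebesgue_measurable) (rule continuous_on_apply_bcontfun)
  have int: "integrable lebesgue (\<lambda>x. B_image \<psi> x - V x *v apply_bcontfun u x)" for u
    by (intro Bochner_Integration.integrable_diff B_image_L1 V_mult_L1(1)[OF meas norm_bounded])
  have ap: "apply_bcontfun (\<Phi> u) = G (\<lambda>x. B_image \<psi> x - V x *v apply_bcontfun u x)" for u
    unfolding \<Phi>_def
  proof (rule Bcontfun_inverse, rule bcontfun_normI)
    show "continuous_on UNIV (G (\<lambda>x. B_image \<psi> x - V x *v apply_bcontfun u x))"
      by (rule dirac_sol_continuous[OF G_sol[OF admissible_source_L1[OF int]]])
    show "norm (G (\<lambda>x. B_image \<psi> x - V x *v apply_bcontfun u x) x) \<le> M * (LINT y|lebesgue. norm (B_image \<psi> y - V y *v apply_bcontfun u y))" for x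
      by (rule G_L1_sup[OF int])
  qed
  have "\<exists>!u. \<Phi> u = u"
  proof (rule banach_fix_type[of "M * L1_norm V"])
    show "\<forall>u v. dist (\<Phi> u) (\<Phi> v) \<le> M * L1_norm V * dist u v"
    proof (intro allI dist_bound)
      fix u v x
      have e: "(\<lambda>x. (B_image \<psi> x - V x *v apply_bcontfun u x) - (B_image \<psi> x - V x *v apply_bcontfun v x))
          = (\<lambda>x. V x *v (apply_bcontfun v x - apply_bcontfun u x))"
        by (simp add: matrix_vector_mult_diff_distrib)
      have m: "(\<lambda>x. apply_bcontfun v x - apply_bcontfun u x) \<in> borel_measurable lebesgue"
        by (intro borel_measurable_diff meas)
      have b: "norm (apply_bcontfun v x - apply_bcontfun u x) \<le> dist u v" for x
        using dist_bounded[of v x u] unfolding dist_norm[symmetric] dist_commute[of u v] .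
      have "dist (apply_bcontfun (\<Phi> u) x) (apply_bcontfun (\<Phi> v) x)
          = norm (G (\<lambda>x. V x *v (apply_bcontfun v x - apply_bcontfun u x)) x)"
        unfolding ap dist_norm e[symmetric] G_diff[OF int int] ..
      also have "\<dots> \<le> M * (LINT y|lebesgue. norm (V y *v (apply_bcontfun v y - apply_bcontfun u y)))"
        by (rule G_L1_sup[OF V_mult_L1(1)[OF m b]])
      also have "\<dots> \<le> M * (L1_norm V * dist u v)"
        using M by (intro mult_left_mono V_mult_L1(2)[OF m b]) auto
      finally show "dist (apply_bcontfun (\<Phi> u) x) (apply_bcontfun (\<Phi> v) x) \<le> M * L1_norm V * dist u v" by simp
    qed
  qed (use small Mv_nonneg in auto)
  then obtain u where "\<Phi> u = u" by blast
  then have "apply_bcontfun u = G (\<lambda>x. B_image \<psi> x - V x *v apply_bcontfun u x)" using ap[of u] by simp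
  moreover have "bounded (range (apply_bcontfun u))" using bounded_apply_bcontfun by blast
  ultimately show ?thesis using continuous_on_apply_bcontfun by blast
qed

text \<open>If \<open>u = G (B \<psi> - V u)\<close>, then \<open>\<phi> = \<psi> - A u\<close> has \<open>B \<phi> = B \<psi> - V u\<close>, and hence
\<open>Q \<phi> = A u\<close>. In this way the equation in \<open>L\<^sup>2\<close> is solved in the space of bounded functions, where the
smallness condition is linear in \<open>\<parallel>V\<parallel>\<^sub>1\<close>.\<close>

lemma one_plus_Q_surj:
  "\<exists>\<phi>. \<phi> + Q \<phi> = \<psi> \<and> norm \<phi> \<le> norm \<psi> * (1 + M * sqrt (L1_norm V) / (1 - M * L1_norm V) * sqrt (L1_norm V))"
proof -
  obtain u where u: "continuous_on UNIV u" "bounded (range u)" "u = G (\<lambda>x. B_image \<psi> x - V x *v u x)"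
    using fixed_point_exists by blast
  obtain B where B: "\<And>x. norm (u x) \<le> B" using u(2) by (auto simp: bounded_iff)
  have um: "u \<in> borel_measurable lebesgue" by (rule continuous_lebesgue_measurable[OF u(1)])
  have int: "integrable lebesgue (\<lambda>x. B_image \<psi> x - V x *v u x)"
    by (intro Bochner_Integration.integrable_diff B_image_L1 V_mult_L1(1)[OF um B])
  define c where "c = M * (sqrt (L1_norm V) * norm \<psi>) / (1 - M * L1_norm V)"
  have sup: "norm (u x) \<le> c" for x
    unfolding c_def
  proof (rule sup_bound_contraction[OF B Mv_nonneg small])
    fix s x assume s: "\<And>x. norm (u x) \<le> s"
    have "norm (u x) = norm (G (\<lambda>x. B_image \<psi> x - V x *v u x) x)" using fun_cong[OF u(3), of x] by (rule arg_cong)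
    also have "\<dots> \<le> M * (LINT y|lebesgue. norm (B_image \<psi> y - V y *v u y))" by (rule G_L1_sup[OF int])
    also have "\<dots> \<le> M * (LINT y|lebesgue. norm (B_image \<psi> y) + norm (V y *v u y))"
      using M int B_image_L1(1)[of \<psi>] V_mult_L1(1)[OF um B]
      by (intro mult_left_mono integral_mono) (auto intro: norm_triangle_ineq4)
    also have "\<dots> = M * ((LINT y|lebesgue. norm (B_image \<psi> y)) + (LINT y|lebesgue. norm (V y *v u y)))"
      using B_image_L1(1)[of \<psi>] V_mult_L1(1)[OF um B] by simp
    also have "\<dots> \<le> M * (sqrt (L1_norm V) * norm \<psi> + L1_norm V * s)"
      using M by (intro mult_left_mono add_mono B_image_L1(2) V_mult_L1(2)[OF um s]) auto
    finally show "norm (u x) \<le> M * (sqrt (L1_norm V) * norm \<psi>) + M * L1_norm V * s" by (simp add: algebra_simps)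
  qed
  have c0: "0 \<le> c" using sup[of 0] norm_ge_zero order.trans by blast
  note a = A_mult_L2[OF um sup]
  define a0 where "a0 = abs_l2 (\<lambda>x. symbol_A V x *v u x)"
  have a0: "repr a0 (\<lambda>x. symbol_A V x *v u x)" unfolding a0_def by (rule repr_abs[OF a(1)])
  define \<phi> where "\<phi> = \<psi> - a0"
  have r: "repr \<phi> (\<lambda>x. rep_l2 \<psi> x - symbol_A V x *v u x)" unfolding \<phi>_def by (intro repr_minus repr_rep a0)
  have B: "AE x in lebesgue. B_image \<phi> x = B_image \<psi> x - V x *v u x"
    using B_image_repr[OF r] unfolding matrix_vector_mult_diff_distrib symbol_B_symbol_A by (simp add: B_image_def)
  have "S (B_image \<phi>) = S (\<lambda>x. B_image \<psi> x - V x *v u x)"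
    by (rule S_eq, rule solves_cong_AE[OF S_L1[OF int]]) (use B in \<open>auto elim: eventually_mono\<close>)
  also have "\<dots> = u" using S_eq_G[OF int] u(3) by simp
  finally have "Q \<phi> = a0" unfolding Q_def a0_def by simp
  then have "\<phi> + Q \<phi> = \<psi>" by (simp add: \<phi>_def)
  moreover have "norm \<phi> \<le> norm \<psi> * (1 + M * sqrt (L1_norm V) / (1 - M * L1_norm V) * sqrt (L1_norm V))"
  proof -
    have "norm a0 = sqrt (LINT x|lebesgue. (norm (symbol_A V x *v u x))\<^sup>2)"
      by (rule norm_l2_repr[OF a0]) (use a(1) in \<open>simp add: square_integrable_def\<close>)
    also have "\<dots> \<le> sqrt (c\<^sup>2 * L1_norm V)" by (rule real_sqrt_le_mono[OF a(2)])
    also have "\<dots> = c * sqrt (L1_norm V)" using c0 by (simp add: real_sqrt_mult)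
    finally show ?thesis
      using norm_triangle_ineq4[of \<psi> a0] by (simp add: \<phi>_def c_def algebra_simps)
  qed
  ultimately show ?thesis by blast
qed

lemma one_plus_Q_inj:
  assumes e: "\<phi> + Q \<phi> = 0" shows "\<phi> = 0"
proof -
  let ?u = "S (B_image \<phi>)"
  note s = S_L1[OF B_image_L1(1)[of \<phi>]]
  have um: "?u \<in> borel_measurable lebesgue" by (rule solves_meas[OF s])
  obtain b where b: "\<And>x. norm (?u x) \<le> b" using SB_sup[of \<phi>] by blast
  have "repr (0 - Q \<phi>) (\<lambda>x. 0 - symbol_A V x *v ?u x)" by (intro repr_minus repr_zero Q_repr)
  moreover have "0 - Q \<phi> = \<phi>"
    unfolding diff_0 using e by (rule minus_unique[OF trans[OF add.commute]])
  ultimately have r: "repr \<phi> (\<lambda>x. 0 - symbol_A V x *v ?u x)" by simp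
  have B: "AE x in lebesgue. B_image \<phi> x = - (V x *v ?u x)"
    using B_image_repr[OF r] unfolding matrix_vector_mult_diff_distrib symbol_B_symbol_A by simp
  have "norm (?u x) \<le> 0 / (1 - M * L1_norm V)" for x
  proof (rule sup_bound_contraction[OF b Mv_nonneg small])
    fix c x assume c: "\<And>x. norm (?u x) \<le> c"
    have "norm (?u x) \<le> M * (LINT y|lebesgue. norm (B_image \<phi> y))"
      unfolding S_eq_G[OF B_image_L1(1)] by (rule G_L1_sup[OF B_image_L1(1)])
    also have "(LINT y|lebesgue. norm (B_image \<phi> y)) = (LINT y|lebesgue. norm (V y *v ?u y))"
    proof (rule integral_cong_AE)
      show "AE y in lebesgue. norm (B_image \<phi> y) = norm (V y *v ?u y)" using B by eventually_elim simp
    qed (use B_image_L1(1)[of \<phi>] V_mult_L1(1)[OF um b] in auto)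
    also have "M * \<dots> \<le> M * (L1_norm V * c)"
      using M by (intro mult_left_mono V_mult_L1(2)[OF um c]) auto
    finally show "norm (?u x) \<le> 0 + M * L1_norm V * c" by simp
  qed
  then have "?u x = 0" for x by simp
  then have "repr \<phi> (\<lambda>_. 0)" using r by simp
  then show ?thesis using repr_zero repr_unique by blast
qed

lemma one_plus_Q_invertible:
  "\<exists>K. bounded_linear K \<and> resolvent (birman_schwinger m V z) (-1) = {(\<psi>, K \<psi>) | \<psi>. True}"
proof -
  have uniq: "\<phi> = \<phi>'" if "\<phi> + Q \<phi> = \<phi>' + Q \<phi>'" for \<phi> \<phi>'
  proof -
    have "(\<phi> - \<phi>') + Q (\<phi> - \<phi>') = 0"
      using that unfolding linear_diff[OF bounded_linear.linear[OF Q_bounded_linear]] by (simp add: algebra_simps)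
    from one_plus_Q_inj[OF this] show ?thesis by simp
  qed
  define c where "c = 1 + M * sqrt (L1_norm V) / (1 - M * L1_norm V) * sqrt (L1_norm V)"
  obtain K where K: "\<And>\<psi>. K \<psi> + Q (K \<psi>) = \<psi>" "\<And>\<psi>. norm (K \<psi>) \<le> norm \<psi> * c"
    using one_plus_Q_surj unfolding c_def[symmetric] by metis
  have "bounded_linear K"
  proof (rule bounded_linear_intro[OF _ _ K(2)])
    note lin = bounded_linear.linear[OF Q_bounded_linear]
    show "K (x + y) = K x + K y" for x y
    proof (rule uniq)
      have "K x + K y + Q (K x + K y) = (K x + Q (K x)) + (K y + Q (K y))"
        unfolding linear_add[OF lin] by (simp only: add_ac)
      then show "K (x + y) + Q (K (x + y)) = K x + K y + Q (K x + K y)" by (simp only: K(1))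
    qed
    show "K (r *\<^sub>R x) = r *\<^sub>R K x" for r x
      by (rule uniq) (simp only: K(1) linear_scale[OF lin] scaleR_add_right[symmetric])
  qed
  moreover have "resolvent (birman_schwinger m V z) (-1) = {(\<psi>, K \<psi>) | \<psi>. True}"
  proof -
    have "(\<psi>, \<phi>) \<in> resolvent (birman_schwinger m V z) (-1) \<longleftrightarrow> \<phi> = K \<psi>" for \<psi> \<phi>
      unfolding resolvent_Q_iff using K(1) uniq by metis
    then show ?thesis by auto
  qed
  ultimately show ?thesis by blast
qed

lemma dirac_V_resolvent_graph:
  "\<exists>P. bounded_linear P \<and> resolvent (dirac_V m V) z = {(g, P g) | g. True}"
proof -
  obtain K where "bounded_linear K" "resolvent (birman_schwinger m V z) (-1) = {(\<psi>, K \<psi>) | \<psi>. True}"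
    using one_plus_Q_invertible by blast
  from resolvent_formula(2,3)[OF this] show ?thesis by blast
qed

lemma admissible:
  "z \<in> resolvent_set (dirac m)" "-1 \<in> resolvent_set (birman_schwinger m V z)"
  unfolding resolvent_set_def everywhere_bounded_def
  using resolvent_dirac_eq free_res_bounded_linear one_plus_Q_invertible by blast+

text \<open>The definition prescribes the resolvent at all admissible points, and \<open>z\<close> is one of them. The differential
operator has the prescribed resolvents, and any other candidate shares its resolvent at \<open>z\<close>.\<close>

lemma perturbed_dirac_eq: "perturbed_dirac m V = dirac_V m V"
  unfolding perturbed_dirac_def
proof (rule the_equality)
  let ?formula = "\<lambda>z. resolvent (dirac m) z -\<^sub>o closure (resolvent (dirac m) z \<circ>\<^sub>o factor_B V) \<circ>\<^sub>o
        resolvent (birman_schwinger m V z) (-1) \<circ>\<^sub>o factor_A V \<circ>\<^sub>o resolvent (dirac m) z"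
  have formula: "\<zeta> \<in> resolvent_set (dirac_V m V) \<and> resolvent (dirac_V m V) \<zeta> = ?formula \<zeta>"
    if a: "\<zeta> \<in> resolvent_set (dirac m)" "-1 \<in> resolvent_set (birman_schwinger m V \<zeta>)" for \<zeta>
  proof -
    obtain F where F: "bounded_linear F" "resolvent (dirac m) \<zeta> = {(g, F g) | g. True}"
      using a(1) by (auto simp: resolvent_set_def everywhere_bounded_def)
    obtain K where K: "bounded_linear K" "resolvent (birman_schwinger m V \<zeta>) (-1) = {(g, K g) | g. True}"
      using a(2) by (auto simp: resolvent_set_def everywhere_bounded_def)
    interpret b: birman_schwinger_at m z up um W M \<delta> V \<zeta> F 
      by (intro birman_schwinger_at.intro birman_schwinger_at_axioms.intro green_axioms potential_axioms F)
    show ?thesis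
      using b.resolvent_formula[OF K] unfolding resolvent_set_def everywhere_bounded_def by blast
  qed
  obtain P where P: "bounded_linear P" "resolvent (dirac_V m V) z = {(g, P g) | g. True}"
    using dirac_V_resolvent_graph by blast
  have "closed_operator (dirac_V m V)"
    unfolding closed_operator_def using dirac_V_linear resolvent_graph_imp_closed[OF P(2,1)] by blast
  then show "closed_operator (dirac_V m V) \<and> (\<forall>z \<in> resolvent_set (dirac m). -1 \<in> resolvent_set (birman_schwinger m V z) \<longrightarrow>
        z \<in> resolvent_set (dirac_V m V) \<and> resolvent (dirac_V m V) z = ?formula z)"
    using formula by blast
  fix L assume "closed_operator L \<and> (\<forall>z \<in> resolvent_set (dirac m). -1 \<in> resolvent_set (birman_schwinger m V z) \<longrightarrow>
        z \<in> resolvent_set L \<and> resolvent L z = ?formula z)"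
  then have "resolvent L z = ?formula z" using admissible by blast
  then have "resolvent L z = resolvent (dirac_V m V) z" using formula[OF admissible] by simp
  then show "L = dirac_V m V" by (rule resolvent_eq_imp_eq)
qed

text \<open>Duhamel's formula \<open>u = G g - G (V u)\<close>. The first term has norm at most \<open>1 / \<delta>\<close> by the energy estimate; only
the second one pays for the factor \<open>M\<close>.\<close>

lemma resolvent_norm_bound:
  assumes "(g, f) \<in> resolvent (dirac_V m V) z"
  shows "norm f \<le> (1 + M * sqrt M * L1_norm V / (1 - M * L1_norm V)) / \<delta> * norm g"
proof -
  obtain u b where u: "repr f u" "\<And>x. norm (u x) \<le> b" "dirac_sol m z (\<lambda>x. rep_l2 g x - V x *v u x) u"
    using assms unfolding dirac_V_resolvent_iff by blast
  have um: "u \<in> borel_measurable lebesgue" by (rule continuous_lebesgue_measurable[OF dirac_sol_continuous[OF u(3)]])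
  have usq: "square_integrable u" by (rule repr_square_integrable[OF u(1) um])
  let ?h = "\<lambda>x. - (V x *v u x)"
  have h: "integrable lebesgue ?h" using V_mult_L1(1)[OF um u(2)] by simp
  have hb: "(LINT x|lebesgue. norm (?h x)) \<le> L1_norm V * s" if "\<And>x. norm (u x) \<le> s" for s
    using V_mult_L1(2)[OF um that] by simp
  have eq: "u = (\<lambda>x. G ?h x + G (rep_l2 g) x)"
    by (rule solution_eq_G_add[OF _ usq h square_integrable_rep]) (use u(3) in \<open>simp add: algebra_simps\<close>)
  define c where "c = M / sqrt \<delta> * norm g / (1 - M * L1_norm V)"
  have sup: "norm (u x) \<le> c" for x
    unfolding c_def
  proof (rule sup_bound_contraction[OF u(2) Mv_nonneg small])
    fix s x assume s: "\<And>x. norm (u x) \<le> s"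
    have "norm (u x) = norm (G ?h x + G (rep_l2 g) x)" using fun_cong[OF eq, of x] by (rule arg_cong)
    also have "\<dots> \<le> M * (LINT x|lebesgue. norm (?h x)) + M / sqrt \<delta> * sqrt (LINT x|lebesgue. (norm (rep_l2 g x))\<^sup>2)"
      by (intro order.trans[OF norm_triangle_ineq] add_mono G_L1_sup[OF h] G_L2_sup[OF square_integrable_rep])
    also have "\<dots> \<le> M * (L1_norm V * s) + M / sqrt \<delta> * norm g"
      unfolding norm_l2_rep using M by (intro add_mono mult_left_mono hb s order_refl) auto
    finally show "norm (u x) \<le> M / sqrt \<delta> * norm g + M * L1_norm V * s" by (simp add: algebra_simps)
  qed
  have c0: "0 \<le> c" using sup[of 0] norm_ge_zero order.trans by blast
  define e where "e = abs_l2 (G ?h)"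
  note sq = G_L1_square_integrable[OF h]
  have e: "repr e (G ?h)" unfolding e_def by (rule repr_abs[OF sq(1)])
  have "repr (e + free_res g) u" by (rule repr_cong[OF repr_plus[OF e free_res_repr]]) (simp add: fun_cong[OF eq, symmetric])
  then have f: "f = e + free_res g" using repr_unique u(1) by blast
  have "norm e = sqrt (LINT x|lebesgue. (norm (G ?h x))\<^sup>2)"
    by (rule norm_l2_repr[OF e]) (use sq(1) in \<open>simp add: square_integrable_def\<close>)
  also have "\<dots> \<le> sqrt (M / \<delta> * (L1_norm V * c)\<^sup>2)"
  proof (rule real_sqrt_le_mono)
    have "(LINT x|lebesgue. (norm (G ?h x))\<^sup>2) \<le> M / \<delta> * (LINT x|lebesgue. norm (?h x))\<^sup>2"
      using sq(2) \<delta>(2) by (simp add: pos_le_divide_eq mult.commute)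
    also have "\<dots> \<le> M / \<delta> * (L1_norm V * c)\<^sup>2"
      using M \<delta>(2) hb[OF sup] by (intro mult_left_mono power_mono) auto
    finally show "(LINT x|lebesgue. (norm (G ?h x))\<^sup>2) \<le> M / \<delta> * (L1_norm V * c)\<^sup>2" .
  qed
  also have "\<dots> = sqrt M / sqrt \<delta> * (L1_norm V * c)"
    using c0 L1_nonneg by (simp add: real_sqrt_mult real_sqrt_divide abs_mult)
  also have "\<dots> = M * sqrt M * L1_norm V / (1 - M * L1_norm V) / (sqrt \<delta> * sqrt \<delta>) * norm g"
  proof -
    have "r / s * (v * (a / s * n / k)) = a * r * v / k / (s * s) * n" for r s v a n k :: real
      by (simp add: mult_ac)
    then show ?thesis unfolding c_def .
  qed
  also have "sqrt \<delta> * sqrt \<delta> = \<delta>" using \<delta>(2) by simp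
  finally have "norm f \<le> M * sqrt M * L1_norm V / (1 - M * L1_norm V) / \<delta> * norm g + norm g / \<delta>"
    unfolding f using norm_free_res[of g] norm_triangle_ineq[of e "free_res g"] by linarith
  then show ?thesis by (simp add: add_divide_distrib distrib_right add.commute)
qed

end

section \<open>A weighted energy estimate for zero mass\<close>

lemma primitive_cmod_sq:
  assumes "primitive p q" shows "primitive (\<lambda>x. (cmod (p x))\<^sup>2) (\<lambda>x. 2 * Re (cnj (p x) * q x))"
  unfolding cmod_power2
  by (rule primitive_cong[OF primitive_linear[OF bounded_linear_Re primitive_mult[OF primitive_linear[OF bounded_linear_cnj assms] assms]]])
     (simp_all add: power2_eq_square)

text \<open>For \<open>m = 0\<close> the matrix of the system is diagonal in the components \<open>u\<^sub>1 \<plusminus> \<i> u\<^sub>2\<close>: off the strip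
one of them grows and the other one decays at rate at least \<open>\<delta>\<close>.\<close>

lemma rotated_components:
  assumes "dirac_sol 0 z h u"
  shows "primitive (\<lambda>x. (cmod (u x $ 1 + \<i> * u x $ 2))\<^sup>2)
      (\<lambda>x. 2 * (Im z - sgn x) * (cmod (u x $ 1 + \<i> * u x $ 2))\<^sup>2
        + 2 * Im (cnj (u x $ 1 + \<i> * u x $ 2) * (h x $ 1 + \<i> * h x $ 2)))"
    "primitive (\<lambda>x. (cmod (u x $ 1 - \<i> * u x $ 2))\<^sup>2)
      (\<lambda>x. - 2 * (Im z - sgn x) * (cmod (u x $ 1 - \<i> * u x $ 2))\<^sup>2
        - 2 * Im (cnj (u x $ 1 - \<i> * u x $ 2) * (h x $ 1 - \<i> * h x $ 2)))"
proof -
  note P = dirac_solD[OF assms]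
  show "primitive (\<lambda>x. (cmod (u x $ 1 + \<i> * u x $ 2))\<^sup>2)
      (\<lambda>x. 2 * (Im z - sgn x) * (cmod (u x $ 1 + \<i> * u x $ 2))\<^sup>2
        + 2 * Im (cnj (u x $ 1 + \<i> * u x $ 2) * (h x $ 1 + \<i> * h x $ 2)))"
    by (rule primitive_cong[OF primitive_cmod_sq[OF primitive_add[OF P(1) primitive_cmult[OF P(2), of \<i>]]] refl], unfold cmod_power2)
       (simp add: power2_eq_square algebra_simps)
  show "primitive (\<lambda>x. (cmod (u x $ 1 - \<i> * u x $ 2))\<^sup>2)
      (\<lambda>x. - 2 * (Im z - sgn x) * (cmod (u x $ 1 - \<i> * u x $ 2))\<^sup>2
        - 2 * Im (cnj (u x $ 1 - \<i> * u x $ 2) * (h x $ 1 - \<i> * h x $ 2)))"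
    by (rule primitive_cong[OF primitive_cmod_sq[OF primitive_diff[OF P(1) primitive_cmult[OF P(2), of \<i>]]] refl], unfold cmod_power2)
       (simp add: power2_eq_square algebra_simps)
qed

lemma rotated_norm:
  "(cmod (v $ 1 + \<i> * v $ 2))\<^sup>2 + (cmod (v $ 1 - \<i> * v $ 2))\<^sup>2 = 2 * (norm (v :: complex^2))\<^sup>2"
  unfolding norm_vec2_sq cmod_power2 by (simp add: power2_eq_square algebra_simps)

text \<open>The Cauchy-Schwarz inequality in the plane.\<close>

lemma rotated_pairing:
  fixes v h :: "complex^2" and w1 w2 :: real
  assumes w: "0 \<le> w1" "0 \<le> w2"
  shows "w1 * (cmod (v $ 1 + \<i> * v $ 2) * cmod (h $ 1 + \<i> * h $ 2)) + w2 * (cmod (v $ 1 - \<i> * v $ 2) * cmod (h $ 1 - \<i> * h $ 2))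
    \<le> sqrt (w1\<^sup>2 * (cmod (v $ 1 + \<i> * v $ 2))\<^sup>2 + w2\<^sup>2 * (cmod (v $ 1 - \<i> * v $ 2))\<^sup>2) * (sqrt 2 * norm h)"
proof -
  let ?a = "cmod (v $ 1 + \<i> * v $ 2)" and ?b = "cmod (v $ 1 - \<i> * v $ 2)"
  let ?c = "cmod (h $ 1 + \<i> * h $ 2)" and ?d = "cmod (h $ 1 - \<i> * h $ 2)"
  have "(w1 * (?a * ?c) + w2 * (?b * ?d))\<^sup>2 \<le> (w1\<^sup>2 * ?a\<^sup>2 + w2\<^sup>2 * ?b\<^sup>2) * (?c\<^sup>2 + ?d\<^sup>2)"
    using zero_le_power2[of "w1 * ?a * ?d - w2 * ?b * ?c"] by (simp add: power2_eq_square algebra_simps)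
  also have "\<dots> = (sqrt (w1\<^sup>2 * ?a\<^sup>2 + w2\<^sup>2 * ?b\<^sup>2) * (sqrt 2 * norm h))\<^sup>2"
    unfolding rotated_norm power_mult_distrib by simp
  finally show ?thesis by (rule power2_le_imp_le) simp
qed

text \<open>The derivative of \<open>w1 X\<^sup>2 - w2 Y\<^sup>2\<close>, up to the sign \<open>\<sigma>\<close>, dominates \<open>\<bar>u\<bar>\<^sup>2\<close> for every
perturbation \<open>f\<close> with \<open>\<bar>f\<bar> \<le> \<rho> \<bar>u\<bar>\<close>. The derivatives of the weights are exactly what is needed to
absorb the contribution of \<open>f\<close>. The remaining loss is the oscillation of the weights, and it is optimised as in
Kantorovich's inequality: \<open>w\<^sup>2 + 1 \<le> (\<kappa> + 1 / \<kappa>) w\<close> on \<open>[\<kappa>, 1 / \<kappa>]\<close>.\<close>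

lemma weighted_energy_pointwise:
  fixes u g f :: "complex^2" and w1 w2 d1 d2 \<kappa> \<rho> \<delta> t \<sigma> :: real
  defines "X \<equiv> cmod (u $ 1 + \<i> * u $ 2)" and "Y \<equiv> cmod (u $ 1 - \<i> * u $ 2)"
    and "s \<equiv> \<kappa> + 1 / \<kappa>" and "h \<equiv> g - f"
  assumes \<kappa>: "0 < \<kappa>" and w: "\<kappa> \<le> w1" "w1 \<le> 1 / \<kappa>" "\<kappa> \<le> w2" "w2 \<le> 1 / \<kappa>"
    and d: "\<rho> * (1 + w1\<^sup>2) \<le> \<sigma> * d1" "\<rho> * (1 + w2\<^sup>2) \<le> - (\<sigma> * d2)"
    and f: "norm f \<le> \<rho> * norm u" and \<delta>: "0 < \<delta>" "\<delta> \<le> \<sigma> * t" and \<sigma>: "\<bar>\<sigma>\<bar> = 1" and \<rho>: "0 \<le> \<rho>"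
  shows "4 * \<delta> / s * (norm u)\<^sup>2 \<le> \<sigma> * ((d1 * X\<^sup>2 + w1 * (2 * t * X\<^sup>2 + 2 * Im (cnj (u $ 1 + \<i> * u $ 2) * (h $ 1 + \<i> * h $ 2))))
        - (d2 * Y\<^sup>2 + w2 * (- 2 * t * Y\<^sup>2 - 2 * Im (cnj (u $ 1 - \<i> * u $ 2) * (h $ 1 - \<i> * h $ 2)))))
      + s / \<delta> * (norm g)\<^sup>2"
proof -
  define q where "q = sqrt (w1\<^sup>2 * X\<^sup>2 + w2\<^sup>2 * Y\<^sup>2)"
  have q2: "q\<^sup>2 = w1\<^sup>2 * X\<^sup>2 + w2\<^sup>2 * Y\<^sup>2" "0 \<le> q" by (simp_all add: q_def)
  have XY: "X\<^sup>2 + Y\<^sup>2 = 2 * (norm u)\<^sup>2" unfolding X_def Y_def by (rule rotated_norm)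
  have wp: "0 < w1" "0 < w2" using w \<kappa> by auto
  have s: "0 < s" using \<kappa> by (simp add: s_def add_pos_pos)
  define D where "D = w1 * X\<^sup>2 + w2 * Y\<^sup>2"
  define I1 I2 where "I1 = Im (cnj (u $ 1 + \<i> * u $ 2) * (h $ 1 + \<i> * h $ 2))" and "I2 = Im (cnj (u $ 1 - \<i> * u $ 2) * (h $ 1 - \<i> * h $ 2))"
  have I: "\<bar>I1\<bar> \<le> X * cmod (h $ 1 + \<i> * h $ 2)" "\<bar>I2\<bar> \<le> Y * cmod (h $ 1 - \<i> * h $ 2)"
    using abs_Im_le_cmod[of "cnj (u $ 1 + \<i> * u $ 2) * (h $ 1 + \<i> * h $ 2)"]
      abs_Im_le_cmod[of "cnj (u $ 1 - \<i> * u $ 2) * (h $ 1 - \<i> * h $ 2)"]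
    unfolding I1_def I2_def X_def Y_def norm_mult complex_mod_cnj by blast+
  have "w1 * \<bar>I1\<bar> + w2 * \<bar>I2\<bar> \<le> w1 * (X * cmod (h $ 1 + \<i> * h $ 2)) + w2 * (Y * cmod (h $ 1 - \<i> * h $ 2))"
    using I wp by (intro add_mono mult_left_mono) auto
  also have "\<dots> \<le> q * (sqrt 2 * norm h)"
    unfolding q_def X_def Y_def by (rule rotated_pairing) (use wp in auto)
  also have "\<dots> \<le> q * (sqrt 2 * (norm g + \<rho> * norm u))"
    using f norm_triangle_ineq4[of g f] q2(2) by (intro mult_left_mono) (auto simp: h_def)
  finally have cross: "w1 * \<bar>I1\<bar> + w2 * \<bar>I2\<bar> \<le> q * (sqrt 2 * norm g) + \<rho> * (q * (sqrt 2 * norm u))"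
    by (simp add: algebra_simps)
  \<comment> \<open>The potential term is turned into the sum of \<open>(1 + w\<^sup>2)\<close>-multiples that the weights absorb.\<close>
  have "2 * (q * (sqrt 2 * norm u)) \<le> q\<^sup>2 + (sqrt 2 * norm u)\<^sup>2"
    using sum_squares_bound[of q "sqrt 2 * norm u"] by (simp add: mult.assoc)
  also have "\<dots> = (1 + w1\<^sup>2) * X\<^sup>2 + (1 + w2\<^sup>2) * Y\<^sup>2"
    using XY q2 by (simp add: power_mult_distrib algebra_simps)
  finally have "2 * (\<rho> * (q * (sqrt 2 * norm u))) \<le> \<rho> * ((1 + w1\<^sup>2) * X\<^sup>2 + (1 + w2\<^sup>2) * Y\<^sup>2)"
    using \<rho> by (metis mult.left_commute mult_left_mono)
  also have "\<dots> = \<rho> * (1 + w1\<^sup>2) * X\<^sup>2 + \<rho> * (1 + w2\<^sup>2) * Y\<^sup>2" by (simp add: algebra_simps)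
  also have "\<dots> \<le> \<sigma> * d1 * X\<^sup>2 + - (\<sigma> * d2) * Y\<^sup>2" by (intro add_mono mult_right_mono d) auto
  finally have absorb: "2 * (\<rho> * (q * (sqrt 2 * norm u))) \<le> \<sigma> * d1 * X\<^sup>2 - \<sigma> * d2 * Y\<^sup>2" by simp
  \<comment> \<open>The factor \<open>2 \<delta> / s\<close> is the share of \<open>q\<^sup>2\<close> that Kantorovich's inequality \<open>kant\<close> leaves over.\<close>
  have young: "2 * (q * (sqrt 2 * norm g)) \<le> 2 * \<delta> / s * q\<^sup>2 + s / \<delta> * (norm g)\<^sup>2"
  proof -
    have "0 \<le> 2 * \<delta> / s * (q - s / (2 * \<delta>) * (sqrt 2 * norm g))\<^sup>2" using \<delta> s by (intro mult_nonneg_nonneg) auto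
    also have "\<dots> = 2 * \<delta> / s * q\<^sup>2 - 2 * (q * (sqrt 2 * norm g)) + s / (2 * \<delta>) * (sqrt 2 * norm g)\<^sup>2"
      using \<delta>(1) s by (simp add: field_simps power2_eq_square)
    also have "s / (2 * \<delta>) * (sqrt 2 * norm g)\<^sup>2 = s / \<delta> * (norm g)\<^sup>2" by (simp add: power_mult_distrib)
    finally show ?thesis by linarith
  qed
  have kant: "q\<^sup>2 + (X\<^sup>2 + Y\<^sup>2) \<le> s * D"
  proof -
    have k: "w\<^sup>2 + 1 \<le> s * w" if "\<kappa> \<le> w" "w \<le> 1 / \<kappa>" for w
    proof -
      have "0 \<le> (w - \<kappa>) * (1 / \<kappa> - w)" using that by (intro mult_nonneg_nonneg) auto
      also have "\<dots> = s * w - (w\<^sup>2 + 1)" using \<kappa> by (simp add: s_def field_simps power2_eq_square)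
      finally show ?thesis by simp
    qed
    have "(w1\<^sup>2 + 1) * X\<^sup>2 + (w2\<^sup>2 + 1) * Y\<^sup>2 \<le> s * w1 * X\<^sup>2 + s * w2 * Y\<^sup>2"
      by (intro add_mono mult_right_mono k w) auto
    then show ?thesis unfolding q2(1) D_def by (simp add: algebra_simps)
  qed
  have "2 * \<delta> / s * (2 * (norm u)\<^sup>2) \<le> 2 * \<delta> / s * (s * D - q\<^sup>2)"
    using kant XY \<delta>(1) s by (intro mult_left_mono) auto
  also have "\<dots> = 2 * \<delta> * D - 2 * \<delta> / s * q\<^sup>2" using s by (simp add: field_simps)
  finally have A: "4 * \<delta> / s * (norm u)\<^sup>2 \<le> 2 * \<delta> * D - 2 * \<delta> / s * q\<^sup>2" by simp
  have B: "2 * \<delta> * D \<le> 2 * (\<sigma> * t) * D"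
    using \<delta> wp by (intro mult_right_mono) (auto simp: D_def)
  have C: "- (w1 * \<bar>I1\<bar> + w2 * \<bar>I2\<bar>) \<le> \<sigma> * (w1 * I1 + w2 * I2)"
  proof -
    have "\<bar>\<sigma> * (w1 * I1 + w2 * I2)\<bar> = \<bar>w1 * I1 + w2 * I2\<bar>" using \<sigma> by (simp add: abs_mult)
    also have "\<dots> \<le> w1 * \<bar>I1\<bar> + w2 * \<bar>I2\<bar>"
      by (rule order.trans[OF abs_triangle_ineq]) (use wp in \<open>simp add: abs_mult\<close>)
    finally show ?thesis by linarith
  qed
  have E: "\<sigma> * ((d1 * X\<^sup>2 + w1 * (2 * t * X\<^sup>2 + 2 * I1)) - (d2 * Y\<^sup>2 + w2 * (- 2 * t * Y\<^sup>2 - 2 * I2)))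
      = (\<sigma> * d1 * X\<^sup>2 - \<sigma> * d2 * Y\<^sup>2) + 2 * (\<sigma> * t) * D + 2 * (\<sigma> * (w1 * I1 + w2 * I2))"
    by (simp add: D_def algebra_simps)
  show ?thesis
    unfolding I1_def[symmetric] I2_def[symmetric] E using A B C cross absorb young by linarith
qed

text \<open>The equation \<open>a' = \<rho> (1 + a\<^sup>2)\<close> is solved by tangents of \<open>\<mu>\<close>. The Moebius function
\<open>a = (\<kappa> + l) / (1 - l)\<close>, where \<open>l\<close> is the multiple \<open>c \<mu>\<close> of \<open>\<mu>\<close>, is an elementary
supersolution; it runs through \<open>[\<kappa>, 1 / \<kappa>]\<close> while \<open>l\<close> grows from \<open>0\<close> to \<open>1 - \<kappa>\<close>. The constant
\<open>c\<close> is the smallest one for which the differential inequality holds, with equality at both ends, and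
\<open>\<kappa>\<close> is chosen such that \<open>c v = 1 - \<kappa>\<close>. The second weight is \<open>b = 1 / a\<close>.\<close>

lemma weighted_energy_weights:
  assumes \<mu>: "primitive \<mu> \<rho>" "\<And>x. 0 \<le> \<mu> x" "\<And>x. \<mu> x \<le> v" and \<rho>: "\<And>x. 0 \<le> \<rho> x" and v: "0 \<le> v" "v < 1"
  defines "\<kappa> \<equiv> sqrt ((1 - v) / (1 + v))"
  shows "\<exists>a a' b b'. primitive a a' \<and> primitive b b' \<and> (\<forall>x. \<kappa> \<le> a x \<and> a x \<le> 1 / \<kappa> \<and> \<kappa> \<le> b x \<and> b x \<le> 1 / \<kappa>
      \<and> \<rho> x * (1 + (a x)\<^sup>2) \<le> a' x \<and> \<rho> x * (1 + (b x)\<^sup>2) \<le> - b' x)"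
proof -
  have k2: "\<kappa>\<^sup>2 = (1 - v) / (1 + v)" using v by (simp add: \<kappa>_def)
  have k: "0 < \<kappa>" "\<kappa> \<le> 1" using v by (auto simp: \<kappa>_def)
  define c where "c = 2 / ((1 + v) * (1 + \<kappa>))"
  have c0: "0 \<le> c" using v k by (simp add: c_def)
  have c1: "(1 + \<kappa>) * c = 1 + \<kappa>\<^sup>2"
  proof -
    have "e * (2 / (d * e)) = 2 / d" if "e \<noteq> 0" for d e :: real using that by simp
    from this[of "1 + \<kappa>" "1 + v"] have "(1 + \<kappa>) * c = 2 / (1 + v)" using k by (simp add: c_def)
    also have "\<dots> = 1 + \<kappa>\<^sup>2" unfolding k2 using v by (simp add: field_simps)
    finally show ?thesis .
  qed
  have c2: "c * v = 1 - \<kappa>"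
  proof -
    have "(1 + \<kappa>) * (c * v) = (1 + \<kappa>\<^sup>2) * v" using c1 by (simp add: mult.assoc[symmetric])
    also have "\<dots> = 1 - \<kappa>\<^sup>2" unfolding k2 using v by (simp add: field_simps)
    also have "\<dots> = (1 + \<kappa>) * (1 - \<kappa>)" by (simp add: power2_eq_square algebra_simps)
    finally show ?thesis using k by simp
  qed
  define l where "l x = c * \<mu> x" for x
  have l: "0 \<le> l x" "l x \<le> 1 - \<kappa>" for x
    using mult_left_mono[OF \<mu>(3)[of x] c0] \<mu>(2)[of x] c0 c2 by (auto simp: l_def)
  have pl: "primitive l (\<lambda>x. c * \<rho> x)" unfolding l_def by (rule primitive_cmult[OF \<mu>(1)])
  have p1: "primitive (\<lambda>x. 1 - l x) (\<lambda>x. - (c * \<rho> x))"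
    by (rule primitive_cong[OF primitive_diff[OF primitive_const[of 1] pl]]) auto
  have p2: "primitive (\<lambda>x. \<kappa> + l x) (\<lambda>x. c * \<rho> x)"
    by (rule primitive_cong[OF primitive_add[OF primitive_const[of \<kappa>] pl]]) auto
  have i1: "primitive (\<lambda>x. 1 / (1 - l x)) (\<lambda>x. - (- (c * \<rho> x)) / (1 - l x)\<^sup>2)"
    by (rule primitive_inverse[OF p1 k(1), where R = 1]) (use l in \<open>auto simp: algebra_simps\<close>)
  have i2: "primitive (\<lambda>x. 1 / (\<kappa> + l x)) (\<lambda>x. - (c * \<rho> x) / (\<kappa> + l x)\<^sup>2)"
    by (rule primitive_inverse[OF p2 k(1), where R = 1]) (use l in \<open>auto simp: algebra_simps\<close>)
  define a b where "a x = (\<kappa> + l x) / (1 - l x)" and "b x = (1 - l x) / (\<kappa> + l x)" for x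
  have pos: "0 < 1 - l x" "0 < \<kappa> + l x" for x using l[of x] k by auto
  have pa: "primitive a (\<lambda>x. (1 + \<kappa>) * (c * \<rho> x / (1 - l x)\<^sup>2))"
    by (rule primitive_cong[OF primitive_add[OF primitive_const[of "-1"] primitive_cmult[OF i1, of "1 + \<kappa>"]]])
       (use pos(1) in \<open>auto simp: a_def field_simps less_imp_neq[THEN not_sym]\<close>)
  have pb: "primitive b (\<lambda>x. (1 + \<kappa>) * (- (c * \<rho> x) / (\<kappa> + l x)\<^sup>2))"
    by (rule primitive_cong[OF primitive_add[OF primitive_const[of "-1"] primitive_cmult[OF i2, of "1 + \<kappa>"]]])
       (use pos(2) in \<open>auto simp: b_def field_simps less_imp_neq[THEN not_sym]\<close>)
  \<comment> \<open>A convex function of \<open>l\<close>, with equality at the end points \<open>0\<close> and \<open>1 - \<kappa>\<close>.\<close>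
  have key: "(1 - l x)\<^sup>2 + (\<kappa> + l x)\<^sup>2 \<le> (1 + \<kappa>) * c" for x
  proof -
    have "0 \<le> 2 * (l x * (1 - \<kappa> - l x))" using l[of x] by simp
    also have "\<dots> = (1 + \<kappa>\<^sup>2) - ((1 - l x)\<^sup>2 + (\<kappa> + l x)\<^sup>2)" by (simp add: power2_eq_square algebra_simps)
    finally show ?thesis unfolding c1 by simp
  qed
  have ea: "1 + (a x)\<^sup>2 = ((1 - l x)\<^sup>2 + (\<kappa> + l x)\<^sup>2) / (1 - l x)\<^sup>2"
    and eb: "1 + (b x)\<^sup>2 = ((1 - l x)\<^sup>2 + (\<kappa> + l x)\<^sup>2) / (\<kappa> + l x)\<^sup>2" for x
    unfolding a_def b_def power_divide using pos[of x] by (simp_all add: add_divide_distrib)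
  have ba: "\<kappa> \<le> a x" "a x \<le> 1 / \<kappa>" "\<kappa> \<le> b x" "b x \<le> 1 / \<kappa>" for x
  proof -
    have m1: "\<kappa> * (1 - l x) \<le> \<kappa> + l x" using l(1)[of x] k by (simp add: algebra_simps add_increasing)
    have "\<kappa> * (\<kappa> + l x) \<le> \<kappa> * 1" using l[of x] k by (intro mult_left_mono) auto
    then have m2: "\<kappa> * (\<kappa> + l x) \<le> 1 - l x" using l[of x] by simp
    show "\<kappa> \<le> a x" "a x \<le> 1 / \<kappa>" "\<kappa> \<le> b x" "b x \<le> 1 / \<kappa>"
      using m1 m2 pos[of x] k(1) by (simp_all add: a_def b_def pos_le_divide_eq pos_divide_le_eq mult.commute)
  qed
  have da: "\<rho> x * (1 + (a x)\<^sup>2) \<le> (1 + \<kappa>) * (c * \<rho> x / (1 - l x)\<^sup>2)" for x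
  proof -
    have "\<rho> x * (1 + (a x)\<^sup>2) \<le> \<rho> x * (((1 + \<kappa>) * c) / (1 - l x)\<^sup>2)"
      unfolding ea using \<rho> by (intro mult_left_mono divide_right_mono key) auto
    then show ?thesis by (simp add: mult_ac)
  qed
  have db: "\<rho> x * (1 + (b x)\<^sup>2) \<le> - ((1 + \<kappa>) * (- (c * \<rho> x) / (\<kappa> + l x)\<^sup>2))" for x
  proof -
    have "\<rho> x * (1 + (b x)\<^sup>2) \<le> \<rho> x * (((1 + \<kappa>) * c) / (\<kappa> + l x)\<^sup>2)"
      unfolding eb using \<rho> by (intro mult_left_mono divide_right_mono key) auto
    then show ?thesis by (simp add: mult_ac)
  qed
  show ?thesis
    by (rule exI[of _ a], rule exI[of _ "\<lambda>x. (1 + \<kappa>) * (c * \<rho> x / (1 - l x)\<^sup>2)"],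
        rule exI[of _ b], rule exI[of _ "\<lambda>x. (1 + \<kappa>) * (- (c * \<rho> x) / (\<kappa> + l x)\<^sup>2)"])
       (intro conjI allI pa pb ba da db)
qed

text \<open>Integrating the weighted energy gives the constant \<open>(\<kappa> + 1 / \<kappa>) / 2\<close> with
\<open>\<kappa>\<^sup>2 = (1 - v) / (1 + v)\<close>, which is \<open>1 / sqrt (1 - v\<^sup>2)\<close>.\<close>

lemma (in potential) massless_resolvent_bound:
  assumes f: "(g, f) \<in> resolvent (dirac_V 0 V) z" and z: "1 < \<bar>Im z\<bar>" and v: "L1_norm V < 1"
  shows "norm f \<le> 1 / sqrt (1 - (L1_norm V)\<^sup>2) / (\<bar>Im z\<bar> - 1) * norm g"
proof -
  define v \<delta> \<sigma> where "v = L1_norm V" and "\<delta> = \<bar>Im z\<bar> - 1" and "\<sigma> = sgn (Im z)"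
  define \<kappa> where "\<kappa> = sqrt ((1 - v) / (1 + v))"
  define s where "s = \<kappa> + 1 / \<kappa>"
  have v01: "0 \<le> v" "v < 1" using v L1_nonneg by (auto simp: v_def)
  have \<kappa>: "0 < \<kappa>" using v01 by (simp add: \<kappa>_def)
  have s: "0 < s" using \<kappa> by (simp add: s_def add_pos_pos)
  have \<delta>: "0 < \<delta>" using z by (simp add: \<delta>_def)
  have \<sigma>: "\<sigma> = 1 \<or> \<sigma> = - 1" using z by (auto simp: \<sigma>_def sgn_if)
  obtain u B where u: "repr f u" "\<And>x. norm (u x) \<le> B" "dirac_sol 0 z (\<lambda>x. rep_l2 g x - V x *v u x) u"
    using f unfolding dirac_V_resolvent_iff by blast
  have um: "u \<in> borel_measurable lebesgue" by (rule continuous_lebesgue_measurable[OF dirac_sol_continuous[OF u(3)]])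
  have usq: "square_integrable u" by (rule repr_square_integrable[OF u(1) um])
  define \<mu> where "\<mu> x = integral {..x} \<rho>" for x
  have ai: "\<rho> absolutely_integrable_on {..x}" for x
    unfolding set_integrable_def using \<rho>_integrable by (intro integrable_mult_indicator) auto
  have \<mu>: "primitive \<mu> \<rho>" unfolding \<mu>_def by (rule primitive_integral_left[OF ai])
  have \<mu>0: "0 \<le> \<mu> x" "\<mu> x \<le> v" for x
  proof -
    have e: "\<mu> x = (LINT y:{..x}|lebesgue. \<rho> y)"
      unfolding \<mu>_def using set_lebesgue_integral_eq_integral(2)[OF ai[of x]] by simp
    show "0 \<le> \<mu> x" unfolding e set_lebesgue_integral_def by (rule integral_nonneg_AE) (auto simp: \<rho>_nonneg)
    have "(LINT y:{..x}|lebesgue. \<rho> y) \<le> (LINT y|lebesgue. \<rho> y)"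
      unfolding set_lebesgue_integral_def
      by (rule integral_mono) (use ai[of x] \<rho>_integrable \<rho>_nonneg in \<open>auto simp: set_integrable_def indicator_def\<close>)
    then show "\<mu> x \<le> v" unfolding e \<rho>_integral v_def .
  qed
  obtain a a' b b' where w: "primitive a a'" "primitive b b'" "\<And>x. \<kappa> \<le> a x" "\<And>x. a x \<le> 1 / \<kappa>" "\<And>x. \<kappa> \<le> b x" "\<And>x. b x \<le> 1 / \<kappa>"
    "\<And>x. \<rho> x * (1 + (a x)\<^sup>2) \<le> a' x" "\<And>x. \<rho> x * (1 + (b x)\<^sup>2) \<le> - b' x"
    using weighted_energy_weights[OF \<mu> \<mu>0 \<rho>_nonneg v01] unfolding \<kappa>_def[symmetric] by blast
  \<comment> \<open>For \<open>Im z < 0\<close> the two components exchange their roles, and so do the weights.\<close>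
  obtain w1 d1 w2 d2 where w: "primitive w1 d1" "primitive w2 d2" "\<And>x. \<kappa> \<le> w1 x" "\<And>x. w1 x \<le> 1 / \<kappa>" "\<And>x. \<kappa> \<le> w2 x" "\<And>x. w2 x \<le> 1 / \<kappa>"
    "\<And>x. \<rho> x * (1 + (w1 x)\<^sup>2) \<le> \<sigma> * d1 x" "\<And>x. \<rho> x * (1 + (w2 x)\<^sup>2) \<le> - (\<sigma> * d2 x)"
    using \<sigma>
  proof
    assume s1: "\<sigma> = 1"
    show thesis by (rule that[OF w(1,2,3,4,5,6)]) (use w(7,8) s1 in auto)
  next
    assume s1: "\<sigma> = - 1"
    show thesis by (rule that[OF w(2,1,5,6,3,4)]) (use w(7,8) s1 in auto)
  qed
  let ?h = "\<lambda>x. rep_l2 g x - V x *v u x"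
  let ?X = "\<lambda>x. cmod (u x $ 1 + \<i> * u x $ 2)" and ?Y = "\<lambda>x. cmod (u x $ 1 - \<i> * u x $ 2)"
  note rc = rotated_components[OF u(3)]
  let ?E = "\<lambda>x. w1 x * (?X x)\<^sup>2 - w2 x * (?Y x)\<^sup>2"
  let ?e = "\<lambda>x. (d1 x * (?X x)\<^sup>2 + w1 x * (2 * (Im z - sgn x) * (?X x)\<^sup>2 + 2 * Im (cnj (u x $ 1 + \<i> * u x $ 2) * (?h x $ 1 + \<i> * ?h x $ 2))))
     - (d2 x * (?Y x)\<^sup>2 + w2 x * (- 2 * (Im z - sgn x) * (?Y x)\<^sup>2 - 2 * Im (cnj (u x $ 1 - \<i> * u x $ 2) * (?h x $ 1 - \<i> * ?h x $ 2))))"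
  have E: "primitive ?E ?e"
    by (rule primitive_diff[OF primitive_mult[OF w(1) rc(1)] primitive_mult[OF w(2) rc(2)]])
  have pw: "4 * \<delta> / s * (norm (u x))\<^sup>2 \<le> \<sigma> * ?e x + s / \<delta> * (norm (rep_l2 g x))\<^sup>2" for x
  proof -
    have "norm (V x *v u x) \<le> \<rho> x * norm (u x)" unfolding \<rho>_def by (rule matrix_opnorm_bound)
    moreover have "\<delta> \<le> \<sigma> * (Im z - sgn x)" using z by (auto simp: \<delta>_def \<sigma>_def sgn_if)
    moreover have "\<bar>\<sigma>\<bar> = 1" using \<sigma> by auto
    ultimately show ?thesis
      unfolding s_def by (rule weighted_energy_pointwise[OF \<kappa> w(3,4,5,6,7,8) _ \<delta> _ _ \<rho>_nonneg])
  qed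
  have gi: "integrable lebesgue (\<lambda>x. s / \<delta> * (norm (rep_l2 g x))\<^sup>2)"
    using square_integrable_rep[of g] by (simp add: square_integrable_def)
  note gh = lebesgue_integrable_interval[OF gi]
  have cu: "continuous_on UNIV u" by (rule dirac_sol_continuous[OF u(3)])
  have cphi: "continuous_on UNIV (\<lambda>x. (norm (u x))\<^sup>2)" by (intro continuous_intros cu)
  have Eb: "\<bar>?E x\<bar> \<le> 2 / \<kappa> * (norm (u x))\<^sup>2" for x
  proof -
    have "0 \<le> w1 x" "0 \<le> w2 x" using w(3,5)[of x] \<kappa> by auto
    then have "\<bar>?E x\<bar> \<le> w1 x * (?X x)\<^sup>2 + w2 x * (?Y x)\<^sup>2"
      using abs_triangle_ineq4[of "w1 x * (?X x)\<^sup>2" "w2 x * (?Y x)\<^sup>2"] by (simp add: abs_mult)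
    also have "\<dots> \<le> 1 / \<kappa> * (?X x)\<^sup>2 + 1 / \<kappa> * (?Y x)\<^sup>2"
      by (intro add_mono mult_right_mono w) auto
    also have "\<dots> = 1 / \<kappa> * ((?X x)\<^sup>2 + (?Y x)\<^sup>2)" by (simp add: algebra_simps)
    finally show ?thesis unfolding rotated_norm by simp
  qed
  define c where "c = (LINT x|lebesgue. s / \<delta> * (norm (rep_l2 g x))\<^sup>2)"
  have "4 * \<delta> / s * (LINT x|lebesgue. (norm (u x))\<^sup>2) \<le> c"
  proof (rule integral_bound_if_energy[OF cphi])
    show "integrable lebesgue (\<lambda>x. (norm (u x))\<^sup>2)" using usq by (simp add: square_integrable_def)
    show "4 * \<delta> / s * integral {l..r} (\<lambda>x. (norm (u x))\<^sup>2) \<le> c + 2 / \<kappa> * ((norm (u l))\<^sup>2 + (norm (u r))\<^sup>2)"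
      if lr: "l \<le> r" for l r
    proof -
      note P = primitiveD[OF E lr]
      have "4 * \<delta> / s * integral {l..r} (\<lambda>x. (norm (u x))\<^sup>2) = integral {l..r} (\<lambda>x. 4 * \<delta> / s * (norm (u x))\<^sup>2)"
        by simp
      also have "\<dots> \<le> integral {l..r} (\<lambda>x. \<sigma> * ?e x + s / \<delta> * (norm (rep_l2 g x))\<^sup>2)"
      proof (rule integral_le)
        show "(\<lambda>x. 4 * \<delta> / s * (norm (u x))\<^sup>2) integrable_on {l..r}"
          by (intro integrable_continuous_real continuous_intros continuous_on_subset[OF cu]) auto
        show "(\<lambda>x. \<sigma> * ?e x + s / \<delta> * (norm (rep_l2 g x))\<^sup>2) integrable_on {l..r}"
          by (intro integrable_add integrable_on_mult_right P(3) gh(1)) (use s \<delta> in auto)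
      qed (rule pw)
      also have "\<dots> = \<sigma> * (?E r - ?E l) + integral {l..r} (\<lambda>x. s / \<delta> * (norm (rep_l2 g x))\<^sup>2)"
        unfolding P(2) integral_mult_right[symmetric]
        by (rule Henstock_Kurzweil_Integration.integral_add[OF integrable_on_mult_right[OF P(3)] gh(1)]) (use s \<delta> in auto)
      also have "integral {l..r} (\<lambda>x. s / \<delta> * (norm (rep_l2 g x))\<^sup>2) \<le> c"
        unfolding c_def by (rule gh(2)) (use s \<delta> in auto)
      also have "\<sigma> * (?E r - ?E l) \<le> \<bar>?E r\<bar> + \<bar>?E l\<bar>"
        using \<sigma> by (elim disjE) (simp_all only: mult_1 mult_minus1)
      also have "\<dots> \<le> 2 / \<kappa> * ((norm (u l))\<^sup>2 + (norm (u r))\<^sup>2)"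
        using Eb[of l] Eb[of r] unfolding distrib_left by linarith
      finally show ?thesis by simp
    qed
  qed (use s \<delta> \<kappa> in auto)
  moreover have "c = s / \<delta> * (norm g)\<^sup>2"
    unfolding c_def norm_l2_rep by simp
  moreover have "(LINT x|lebesgue. (norm (u x))\<^sup>2) = (norm f)\<^sup>2"
    unfolding norm_l2_repr[OF u(1) um] by simp
  ultimately have "4 * \<delta> / s * (norm f)\<^sup>2 \<le> s / \<delta> * (norm g)\<^sup>2" by simp
  then have "(norm f)\<^sup>2 \<le> (s / 2 / \<delta> * norm g)\<^sup>2"
    using s \<delta> by (simp add: field_simps power2_eq_square)
  then have n: "norm f \<le> s / 2 / \<delta> * norm g"
    by (rule power2_le_imp_le) (use s \<delta> in auto)
  have "s / 2 = 1 / sqrt (1 - v\<^sup>2)"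
  proof -
    have k2: "\<kappa>\<^sup>2 = (1 - v) / (1 + v)" using v01 by (simp add: \<kappa>_def)
    have "s / 2 = (\<kappa>\<^sup>2 + 1) / (2 * \<kappa>)" using \<kappa> by (simp add: s_def field_simps power2_eq_square)
    also have "\<kappa>\<^sup>2 + 1 = 2 / (1 + v)" unfolding k2 using v01 by (simp add: field_simps)
    also have "2 / (1 + v) / (2 * \<kappa>) = 1 / ((1 + v) * \<kappa>)" by simp
    also have "(1 + v) * \<kappa> = sqrt (1 - v\<^sup>2)"
    proof -
      have "((1 + v) * \<kappa>)\<^sup>2 = 1 - v\<^sup>2" unfolding power_mult_distrib k2 using v01
        by (simp add: power2_eq_square field_simps)
      then show ?thesis using v01 \<kappa> by (metis real_sqrt_unique mult_nonneg_nonneg add_nonneg_nonneg zero_le_one less_imp_le)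
    qed
    finally show ?thesis .
  qed
  then show ?thesis using n by (simp add: v_def \<delta>_def)
qed

section \<open>The pseudospectral enclosure\<close>

lemma pseudospectrum_subset_of_resolvent_bound:
  assumes \<epsilon>: "0 \<le> \<epsilon>" and K: "1 \<le> K"
    and res: "\<And>z. z \<notin> D \<Longrightarrow> 1 < \<bar>Im z\<bar> \<Longrightarrow> \<exists>P. bounded_linear P \<and> resolvent L z = {(g, P g) | g. True}
      \<and> (\<forall>g. norm (P g) \<le> K / (\<bar>Im z\<bar> - 1) * norm g)"
  shows "pseudospectrum \<epsilon> L \<subseteq> D \<union> {z. \<bar>Im z\<bar> \<le> 1 + \<epsilon> * K}"
proof
  fix z assume z: "z \<in> pseudospectrum \<epsilon> L"
  show "z \<in> D \<union> {z. \<bar>Im z\<bar> \<le> 1 + \<epsilon> * K}"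
  proof (rule ccontr)
    assume n: "z \<notin> D \<union> {z. \<bar>Im z\<bar> \<le> 1 + \<epsilon> * K}"
    then have D: "z \<notin> D" and i: "1 + \<epsilon> * K < \<bar>Im z\<bar>" by auto
    have i1: "1 < \<bar>Im z\<bar>" using i mult_nonneg_nonneg[OF \<epsilon>, of K] K by linarith
    obtain P where P: "bounded_linear P" "resolvent L z = {(g, P g) | g. True}"
      "\<And>g. norm (P g) \<le> K / (\<bar>Im z\<bar> - 1) * norm g" using res[OF D i1] by blast
    have "z \<in> resolvent_set L" using P by (auto simp: resolvent_set_def everywhere_bounded_def)
    then have e: "\<epsilon> \<noteq> 0" "inverse \<epsilon> < op_norm (resolvent L z)"
      using z by (auto simp: pseudospectrum_def spectrum_def split: if_splits)
    have "op_apply (resolvent L z) = P" unfolding P(2) op_apply_def by (rule ext) auto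
    then have "op_norm (resolvent L z) \<le> K / (\<bar>Im z\<bar> - 1)"
      unfolding op_norm_def using P(3) K i1 by (simp add: onorm_bound)
    with e have "1 / \<epsilon> < K / (\<bar>Im z\<bar> - 1)" by (simp add: inverse_eq_divide)
    then have "\<bar>Im z\<bar> - 1 < \<epsilon> * K" using e(1) \<epsilon> i1 by (simp add: field_simps)
    then show False using i by simp
  qed
qed

text \<open>After squaring and cancelling \<open>v (1 - v)\<close>, this is the positivity of \<open>8 - 15 v + 9 v\<^sup>2\<close>, a
quadratic polynomial of negative discriminant.\<close>

lemma massless_constant_bound:
  assumes v: "0 \<le> v" "v < (1::real)"
  shows "1 / sqrt (1 - v\<^sup>2) \<le> 1 + v / (4 * (1 - v))"
proof -
  define r where "r = 1 + v / (4 * (1 - v))"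
  have r: "r = (4 - 3 * v) / (4 * (1 - v))" "0 < r" using v by (simp_all add: r_def field_simps add_pos_nonneg)
  have v2: "0 < 1 - v\<^sup>2" using v by (simp add: power_less_one_iff abs_square_less_1)
  have q: "0 \<le> v * (8 - 15 * v + 9 * v\<^sup>2)"
  proof -
    have "8 - 15 * v + 9 * v\<^sup>2 = (3 * v - 5/2)\<^sup>2 + 7/4" by (simp add: power2_eq_square algebra_simps)
    then have "0 \<le> 8 - 15 * v + 9 * v\<^sup>2" by simp
    then show ?thesis using v by simp
  qed
  have "16 * (1 - v)\<^sup>2 \<le> (1 - v\<^sup>2) * (4 - 3 * v)\<^sup>2"
  proof -
    have "(1 - v\<^sup>2) * (4 - 3 * v)\<^sup>2 - 16 * (1 - v)\<^sup>2 = (1 - v) * (v * (8 - 15 * v + 9 * v\<^sup>2))"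
      by (simp add: power2_eq_square algebra_simps)
    then show ?thesis using q v by (metis diff_ge_0_iff_ge less_imp_le mult_nonneg_nonneg)
  qed
  moreover have "(4 * (1 - v))\<^sup>2 = 16 * (1 - v)\<^sup>2" by (simp only: power_mult_distrib) simp
  moreover have "0 < 16 * (1 - v)\<^sup>2" using v by simp
  ultimately have "1 \<le> (1 - v\<^sup>2) * r\<^sup>2"
    unfolding r(1) power_divide times_divide_eq_right by (simp only: pos_le_divide_eq mult_1)
  then have "1 \<le> sqrt ((1 - v\<^sup>2) * r\<^sup>2)" by simp
  also have "\<dots> = sqrt (1 - v\<^sup>2) * r" using r(2) by (simp add: real_sqrt_mult)
  finally show ?thesis using v2 unfolding r_def[symmetric] by (simp add: pos_divide_le_eq mult.commute)
qed

text \<open>For \<open>C = 1 / (2 M)\<close> the right-hand side is \<open>1 + M\<^sup>2 v / (1 - 2 M v)\<close>; the choice of \<open>C\<close> leaves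
room in both numerator and denominator.\<close>

lemma massive_constant_bound:
  assumes M: "1 \<le> (M::real)" and v: "0 \<le> v" "v < 1 / (2 * M)"
  shows "1 + M * sqrt M * v / (1 - M * v) \<le> 1 + v / (4 * (1 / (2 * M)) * (1 / (2 * M) - v))"
proof -
  have Mv: "M * v < 1 / 2" "0 \<le> M * v" using M v by (simp_all add: field_simps)
  have "sqrt M \<le> M" using M by (simp add: real_le_lsqrt power2_eq_square)
  then have "M * sqrt M * v \<le> M * M * v" using M v by (intro mult_right_mono mult_left_mono) auto
  then have "M * sqrt M * v / (1 - M * v) \<le> M * M * v / (1 - 2 * (M * v))"
    using Mv M v by (intro frac_le) auto
  also have "\<dots> = v / (4 * (1 / (2 * M)) * (1 / (2 * M) - v))"
    using M Mv by (simp add: field_simps)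
  finally show ?thesis by simp
qed

text \<open>For \<open>m = 0\<close> the box is empty. The perturbed operator is identified with the differential operator at the point
\<open>z = 2 \<i>\<close>, which lies outside the box for every \<open>m\<close>.\<close>

theorem theorem2p4:
  shows "\<exists>C :: real \<Rightarrow> real. C 0 = 1 \<and>
    (\<forall>m\<ge>0. 0 < C m \<and> C m \<le> 1 \<and>
      (\<forall>V :: real \<Rightarrow> complex^2^2. integrable lebesgue V \<and> L1_norm V < C m \<longrightarrow>
        (\<forall>\<epsilon>\<ge>0. pseudospectrum \<epsilon> (perturbed_dirac m V) \<subseteq>
           closure {z. \<bar>Im z\<bar> < 3/2 \<and> \<bar>Re z\<bar> < 5/2 * m} \<union>
           {z. \<bar>Im z\<bar> \<le> 1 + \<epsilon> * (1 + L1_norm V / (4 * C m * (C m - L1_norm V)))})))"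
proof -
  define M :: "real \<Rightarrow> real" where "M m = 4 * (7/3 + 4 * m) ^ 3" for m
  define C :: "real \<Rightarrow> real" where "C m = (if m = 0 then 1 else 1 / (2 * M m))" for m
  have M1: "1 \<le> M m" if "0 \<le> m" for m
  proof -
    have "1 \<le> 7/3 + 4 * m" using that by simp
    from one_le_power[OF this, of 3] show ?thesis by (simp add: M_def)
  qed
  have C: "0 < C m" "C m \<le> 1" if "0 \<le> m" for m using M1[OF that] by (auto simp: C_def)
  have main: "pseudospectrum \<epsilon> (perturbed_dirac m V) \<subseteq> closure {z. \<bar>Im z\<bar> < 3/2 \<and> \<bar>Re z\<bar> < 5/2 * m} \<union>
           {z. \<bar>Im z\<bar> \<le> 1 + \<epsilon> * (1 + L1_norm V / (4 * C m * (C m - L1_norm V)))}"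
    if m: "0 \<le> m" and V: "integrable lebesgue V" and v: "L1_norm V < C m" and \<epsilon>: "0 \<le> \<epsilon>" for m V \<epsilon>
  proof -
    interpret potential V by unfold_locales (rule V)
    define N where "N = (if m = 0 then 1 else M m)"
    have small: "N * L1_norm V < 1"
    proof (cases "m = 0")
      case False
      then show ?thesis using v M1[OF m] by (simp add: N_def C_def field_simps)
    qed (use v in \<open>simp add: N_def C_def\<close>)
    let ?D = "closure {z. \<bar>Im z\<bar> < 3/2 \<and> \<bar>Re z\<bar> < 5/2 * m}"
    have green_ex: "\<exists>up um W. green m z up um W N (\<bar>Im z\<bar> - 1)" if z: "z \<notin> ?D" "1 < \<bar>Im z\<bar>" for z
    proof (cases "m = 0")
      case True
      then show ?thesis using green_exists_massless[OF z(2)] by (simp add: N_def)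
    next
      case False
      have "z \<notin> {z. \<bar>Im z\<bar> < 3/2 \<and> \<bar>Re z\<bar> < 5/2 * m}" by (rule contra_subsetD[OF closure_subset z(1)])
      then have "3/2 \<le> \<bar>Im z\<bar> \<or> 5/2 * m \<le> \<bar>Re z\<bar>" by auto
      then show ?thesis using green_exists_massive[OF z(2)] False m by (simp add: N_def M_def)
    qed
    have K: "1 \<le> 1 + L1_norm V / (4 * C m * (C m - L1_norm V))"
      using C[OF m] v L1_nonneg by simp
    have eq: "perturbed_dirac m V = dirac_V m V"
    proof -
      have "\<exists>up um W. green m (2 * \<i>) up um W N (\<bar>Im (2 * \<i>)\<bar> - 1)"
        using green_exists_massless[of "2 * \<i>"] green_exists_massive[of "2 * \<i>" m] m by (cases "m = 0") (simp_all add: N_def M_def)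
      then obtain up um W where "green m (2 * \<i>) up um W N (\<bar>Im (2 * \<i>)\<bar> - 1)" by blast
      then interpret s: small_potential m "2 * \<i>" up um W N "\<bar>Im (2 * \<i>)\<bar> - 1" V
        by (intro small_potential.intro small_potential_axioms.intro potential_axioms small)
      show ?thesis by (rule s.perturbed_dirac_eq)
    qed
    show ?thesis
      unfolding eq
    proof (rule pseudospectrum_subset_of_resolvent_bound[OF \<epsilon> K])
      fix z assume z: "z \<notin> ?D" "1 < \<bar>Im z\<bar>"
      obtain up um W where "green m z up um W N (\<bar>Im z\<bar> - 1)" using green_ex[OF z] by blast
      then interpret s: small_potential m z up um W N "\<bar>Im z\<bar> - 1" V
        by (intro small_potential.intro small_potential_axioms.intro potential_axioms small)
      obtain P where P: "bounded_linear P" "resolvent (dirac_V m V) z = {(g, P g) | g. True}"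
        using s.dirac_V_resolvent_graph by blast
      let ?K = "1 + L1_norm V / (4 * C m * (C m - L1_norm V))"
      have "norm (P g) \<le> ?K / (\<bar>Im z\<bar> - 1) * norm g" for g
      proof -
        have g: "(g, P g) \<in> resolvent (dirac_V m V) z" unfolding P(2) by blast
        have "\<exists>k\<le>?K. norm (P g) \<le> k / (\<bar>Im z\<bar> - 1) * norm g"
        proof (cases "m = 0")
          case True
          have v1: "L1_norm V < 1" using v True by (simp add: C_def)
          have "1 / sqrt (1 - (L1_norm V)\<^sup>2) \<le> ?K"
            using massless_constant_bound[OF L1_nonneg v1] True by (simp add: C_def)
          then show ?thesis using massless_resolvent_bound[OF g[unfolded True] z(2) v1] by blast
        next
          case False
          then have N: "N = M m" by (simp add: N_def)
          have "1 + M m * sqrt (M m) * L1_norm V / (1 - M m * L1_norm V) \<le> ?K"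
            using massive_constant_bound[OF M1[OF m] L1_nonneg] v False by (simp add: C_def)
          then show ?thesis using s.resolvent_norm_bound[OF g] unfolding N by blast
        qed
        then obtain k where k: "k \<le> ?K" "norm (P g) \<le> k / (\<bar>Im z\<bar> - 1) * norm g" by blast
        have "k / (\<bar>Im z\<bar> - 1) * norm g \<le> ?K / (\<bar>Im z\<bar> - 1) * norm g"
          using k(1) z(2) by (intro mult_right_mono divide_right_mono) auto
        then show ?thesis using k(2) by linarith
      qed
      then show "\<exists>P. bounded_linear P \<and> resolvent (dirac_V m V) z = {(g, P g) | g. True}
          \<and> (\<forall>g. norm (P g) \<le> ?K / (\<bar>Im z\<bar> - 1) * norm g)"
        using P by blast
    qed
  qed
  show ?thesis
  proof (intro exI[of _ C] conjI allI impI)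
    show "C 0 = 1" by (simp add: C_def)
  qed (use C main in auto)
qed

end
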